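(* The problem of deciding whether a commuting stoquastic ($k$-local, $k$ constant) Hamiltonian $H$ is frustration-free is in $\mathrm{NP}$.
   Context: Let $\Sigma$ be a fixed finite alphabet and $k$ a constant. The input consists of Hermitian terms $H_1,\dots,H_m$, each acting on at most $k$ out of $n$ qudits with local space $\mathbb C^\Sigma$, given by their matrix elements, each specified with $\mathrm{poly}(m)$ bits; $H$ is the (normalized) sum of the operators $\tilde H_i=H_i\otimes I$. Each $H_i$ is positive semidefinite. $H$ is stoquastic if all off-diagonal entries of each $H_i$ in the computational basis are non-positive. It is commuting if the $\tilde H_i$ mutually commute exactly. It is frustration-free if there is a state lying in the groundspace (minimal eigenspace) of all the local terms $\tilde H_i$ simultaneously. No promise gap is assumed. *)

theory Defs
  imports
    "HOL-Computational_Algebra.Polynomial"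
    "Jordan_Normal_Form.Spectral_Radius"
    "Jordan_Normal_Form.Schur_Decomposition"
begin

section \<open>Deterministic multi-tape Turing machines and NP\<close>

datatype direction = Left | Stay | Right

type_synonym command = "nat list \<Rightarrow> nat \<times> (nat \<times> direction) list"

text \<open>
  A machine is the list of the commands of its states: in state \<open>q < length M\<close> the command
  \<open>M ! q\<close> maps the scanned symbols to the next state and, for every tape, the symbol to write
  and the head movement.  State 0 is initial; \<open>length M\<close> is the halting state.
  Symbols are numbers, 0 being the blank; the tapes are infinite in both directions.
\<close>
type_synonym machine = "command list"
type_synonym tape = "int \<times> (int \<Rightarrow> nat)"
type_synonym configuration = "nat \<times> tape list"

definition turing_machine :: "nat \<Rightarrow> nat \<Rightarrow> machine \<Rightarrow> bool" where
  "turing_machine K G M \<longleftrightarrow> K \<ge> 1 \<and> G \<ge> 4 \<and>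
     (\<forall>q < length M. \<forall>ss. length ss = K \<and> set ss \<subseteq> {..<G} \<longrightarrow>
        (case (M ! q) ss of (q', as) \<Rightarrow>
           q' \<le> length M \<and> length as = K \<and> fst ` set as \<subseteq> {..<G}))"

fun shift :: "direction \<Rightarrow> int \<Rightarrow> int" where
  "shift Left p = p - 1"
| "shift Stay p = p"
| "shift Right p = p + 1"

fun scanned :: "tape \<Rightarrow> nat" where
  "scanned (p, c) = c p"

fun act :: "nat \<times> direction \<Rightarrow> tape \<Rightarrow> tape" where
  "act (s, dir) (p, c) = (shift dir p, c(p := s))"

fun step :: "machine \<Rightarrow> configuration \<Rightarrow> configuration" where
  "step M (q, ts) =
     (if q < length M
      then (case (M ! q) (map scanned ts) of (q', as) \<Rightarrow> (q', map2 act as ts))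
      else (q, ts))"

definition initial :: "nat \<Rightarrow> nat list \<Rightarrow> configuration" where
  "initial K w =
     (0, (0, \<lambda>i. if 0 \<le> i \<and> nat i < length w then w ! nat i else 0)
         # replicate (K - 1) (0, \<lambda>i. 0))"

definition config_at :: "nat \<Rightarrow> machine \<Rightarrow> nat list \<Rightarrow> nat \<Rightarrow> configuration" where
  "config_at K M w t = (step M ^^ t) (initial K w)"

definition halts_within :: "nat \<Rightarrow> machine \<Rightarrow> nat list \<Rightarrow> nat \<Rightarrow> bool" where
  "halts_within K M w t \<longleftrightarrow> fst (config_at K M w t) = length M"

text \<open>Acceptance means halting with the symbol 2, i.e. the bit 1, under the head of the first tape.\<close>
definition accepts :: "nat \<Rightarrow> machine \<Rightarrow> nat list \<Rightarrow> bool" where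
  "accepts K M w \<longleftrightarrow>
     (\<exists>t. halts_within K M w t \<and> scanned (hd (snd (config_at K M w t))) = 2)"

definition bit_symbol :: "bool \<Rightarrow> nat" where
  "bit_symbol b = (if b then 2 else 1)"

definition input_pair :: "bool list \<Rightarrow> bool list \<Rightarrow> nat list" where
  "input_pair x y = map bit_symbol x @ 3 # map bit_symbol y"

text \<open>
  A problem is a pair of the set of yes-instances and the set of no-instances.  Languages \<open>L\<close> are
  the special case \<open>(L, - L)\<close>.  The time bound holds on all inputs, instances or not.
\<close>
definition in_NP :: "bool list set \<times> bool list set \<Rightarrow> bool" where
  "in_NP A \<longleftrightarrow>
     (\<exists>K G M (p :: nat poly) (r :: nat poly).
        turing_machine K G M \<and>
        (\<forall>x y. halts_within K M (input_pair x y) (poly r (length x + length y))) \<and>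
        (\<forall>x \<in> fst A. \<exists>y. length y \<le> poly p (length x) \<and> accepts K M (input_pair x y)) \<and>
        (\<forall>x \<in> snd A. \<forall>y. length y \<le> poly p (length x) \<longrightarrow> \<not> accepts K M (input_pair x y)))"


section \<open>Local Hamiltonians\<close>

text \<open>
  The alphabet is \<open>{..<d}\<close>.  The basis string \<open>x\<^sub>0 \<dots> x\<^sub>n\<^sub>-\<^sub>1\<close> has index \<open>\<Sum>j<n. x\<^sub>j * d ^ j\<close>, so that
  operators on \<open>n\<close> qudits are matrices of dimension \<open>d ^ n\<close>.
\<close>

text \<open>
  A term lists the qudits it acts on and, row by row, the entries of its matrix, each given by its
  real and its imaginary part.  The first qudit listed is the least significant digit of a local index.
\<close>
record local_term =
  acts_on :: "nat list"
  entries :: "(rat \<times> rat) list"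

record hamiltonian =
  num_qudits :: nat
  local_terms :: "local_term list"

definition local_dim :: "nat \<Rightarrow> local_term \<Rightarrow> nat" where
  "local_dim d T = d ^ length (acts_on T)"

definition local_matrix :: "nat \<Rightarrow> local_term \<Rightarrow> complex mat" where
  "local_matrix d T = mat (local_dim d T) (local_dim d T)
     (\<lambda>(a, b). case entries T ! (a * local_dim d T + b) of
        (re, im) \<Rightarrow> Complex (of_rat re) (of_rat im))"

definition digit :: "nat \<Rightarrow> nat \<Rightarrow> nat \<Rightarrow> nat" where
  "digit d x j = x div d ^ j mod d"

definition restrict_index :: "nat \<Rightarrow> nat list \<Rightarrow> nat \<Rightarrow> nat" where
  "restrict_index d S x = (\<Sum>t < length S. digit d x (S ! t) * d ^ t)"

text \<open>The operator \<open>H\<^sub>i \<otimes> I\<close> on all \<open>n\<close> qudits.\<close>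
definition global_matrix :: "nat \<Rightarrow> nat \<Rightarrow> local_term \<Rightarrow> complex mat" where
  "global_matrix d n T = mat (d ^ n) (d ^ n)
     (\<lambda>(x, y). if \<forall>j < n. j \<notin> set (acts_on T) \<longrightarrow> digit d x j = digit d y j
               then local_matrix d T $$ (restrict_index d (acts_on T) x, restrict_index d (acts_on T) y)
               else 0)"

definition hermitian_mat :: "complex mat \<Rightarrow> bool" where
  "hermitian_mat A \<longleftrightarrow> square_mat A \<and> mat_adjoint A = A"

text \<open>In the order on the complex numbers, \<open>0 \<le> z\<close> and \<open>z \<le> 0\<close> include that \<open>z\<close> is real.\<close>

definition positive_semidefinite :: "complex mat \<Rightarrow> bool" where
  "positive_semidefinite A \<longleftrightarrow> hermitian_mat A \<and>
     (\<forall>v \<in> carrier_vec (dim_row A). 0 \<le> (A *\<^sub>v v) \<bullet>c v)"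

definition stoquastic_mat :: "complex mat \<Rightarrow> bool" where
  "stoquastic_mat A \<longleftrightarrow>
     (\<forall>i < dim_row A. \<forall>j < dim_col A. i \<noteq> j \<longrightarrow> A $$ (i, j) \<le> 0)"

definition stoquastic :: "nat \<Rightarrow> hamiltonian \<Rightarrow> bool" where
  "stoquastic d H \<longleftrightarrow> (\<forall>T \<in> set (local_terms H). stoquastic_mat (local_matrix d T))"

definition commuting :: "nat \<Rightarrow> hamiltonian \<Rightarrow> bool" where
  "commuting d H \<longleftrightarrow>
     (\<forall>S \<in> set (local_terms H). \<forall>T \<in> set (local_terms H).
        global_matrix d (num_qudits H) S * global_matrix d (num_qudits H) T =
        global_matrix d (num_qudits H) T * global_matrix d (num_qudits H) S)"

definition ground_energy :: "complex mat \<Rightarrow> real" where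
  "ground_energy A = Min (Re ` spectrum A)"

definition groundspace :: "complex mat \<Rightarrow> complex vec set" where
  "groundspace A = {v \<in> carrier_vec (dim_row A). A *\<^sub>v v = complex_of_real (ground_energy A) \<cdot>\<^sub>v v}"

definition frustration_free :: "nat \<Rightarrow> hamiltonian \<Rightarrow> bool" where
  "frustration_free d H \<longleftrightarrow>
     (\<exists>\<psi> \<in> carrier_vec (d ^ num_qudits H). \<psi> \<bullet>c \<psi> = 1 \<and>
        (\<forall>T \<in> set (local_terms H). \<psi> \<in> groundspace (global_matrix d (num_qudits H) T)))"


section \<open>Binary encoding\<close>

text \<open>
  Self-delimiting codes: binary numbers start with the least significant digit, every digit and every
  list element is preceded by the bit 1, and the end is marked by the bit 0.
\<close>

fun enc_nat :: "nat \<Rightarrow> bool list" where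
  "enc_nat n = (if n = 0 then [False] else True # odd n # enc_nat (n div 2))"

declare enc_nat.simps [simp del]

definition enc_rat :: "rat \<Rightarrow> bool list" where
  "enc_rat x = (case quotient_of x of (a, b) \<Rightarrow> (a < 0) # enc_nat (nat \<bar>a\<bar>) @ enc_nat (nat b))"

definition enc_entry :: "rat \<times> rat \<Rightarrow> bool list" where
  "enc_entry z = enc_rat (fst z) @ enc_rat (snd z)"

definition enc_list :: "('a \<Rightarrow> bool list) \<Rightarrow> 'a list \<Rightarrow> bool list" where
  "enc_list f xs = concat (map (\<lambda>x. True # f x) xs) @ [False]"

definition enc_term :: "local_term \<Rightarrow> bool list" where
  "enc_term T = enc_list enc_nat (acts_on T) @ enc_list enc_entry (entries T)"

definition enc_hamiltonian :: "hamiltonian \<Rightarrow> bool list" where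
  "enc_hamiltonian H = enc_nat (num_qudits H) @ enc_list enc_term (local_terms H)"


section \<open>The decision problem\<close>

text \<open>
  The polynomial \<open>b\<close> bounds the number of bits of every matrix entry in terms of the number of
  local terms.
\<close>

definition valid_term :: "nat \<Rightarrow> nat \<Rightarrow> nat \<Rightarrow> local_term \<Rightarrow> bool" where
  "valid_term d k n T \<longleftrightarrow>
     distinct (acts_on T) \<and> set (acts_on T) \<subseteq> {..<n} \<and> length (acts_on T) \<le> k \<and>
     length (entries T) = local_dim d T * local_dim d T \<and>
     positive_semidefinite (local_matrix d T)"

definition local_hamiltonian :: "nat \<Rightarrow> nat \<Rightarrow> nat poly \<Rightarrow> hamiltonian \<Rightarrow> bool" where
  "local_hamiltonian d k b H \<longleftrightarrow>
     (\<forall>T \<in> set (local_terms H). valid_term d k (num_qudits H) T \<and>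
        (\<forall>z \<in> set (entries T). length (enc_entry z) \<le> poly b (length (local_terms H))))"

definition commuting_stoquastic_frustration_free ::
    "nat \<Rightarrow> nat \<Rightarrow> nat poly \<Rightarrow> bool list set \<times> bool list set" where
  "commuting_stoquastic_frustration_free d k b =
     (enc_hamiltonian ` {H. local_hamiltonian d k b H \<and> commuting d H \<and> stoquastic d H \<and>
                            frustration_free d H},
      enc_hamiltonian ` {H. local_hamiltonian d k b H \<and> commuting d H \<and> stoquastic d H \<and>
                            \<not> frustration_free d H})"

end

theory Submission
  imports Defs
begin

text \<open>
  The ground projectors of commuting stoquastic terms commute and have non-negative entries, since
  each is a limit of powers of a matrix with non-negative entries.  The diagonal entry at \<open>x\<close> of
  their product is therefore at least the product of their diagonal entries at \<open>x\<close>.  Hence there is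
  a common ground state if and only if there is a basis string \<open>x\<close> such that every term has, on its
  own qudits, a ground vector that does not vanish at the restriction of \<open>x\<close>.

  The certificate consists of such an \<open>x\<close> and one number for every term.  After the denominators are
  cleared, the local condition on the matrix \<open>A\<close> at the local string \<open>a\<close> says that for large \<open>S\<close>
  the least eigenvalue of \<open>S * A\<close> minus the projector on \<open>a\<close> is less than that of \<open>S * A\<close>.  As these
  are integer matrices of constant size, distinct eigenvalues are separated by a rational number with
  polynomially many digits, and comparing it with the two spectra amounts to the signs of the
  coefficients of the characteristic polynomials, because these have only real roots.  For every value
  of the local string this is a fixed formula of polynomial inequalities in the entries.

  The verifier is written as a program on finitely many stacks whose loops all run as often as the
  input is long, and such a program is compiled to a multi-tape Turing machine.
\<close>

section \<open>Machine model: programs with bounded loops and their translation to Turing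
  machines\<close>

section \<open>Stack programs\<close>

text \<open>The perturbation turns the question about ground vectors into a strict inequality
  between two least eigenvalues, and strictness leaves room for a rational witness that can be
  guessed and then tested exactly. All lower bounds on gaps, and with them the length of the
  witness, come from one fact: a non-zero integer has absolute value at least 1. The verifier relies
  on the promise that the terms commute and are stoquastic, but it must halt in polynomial time on
  every input and reject every certificate of a no-instance. Hence parsing is total, and certified
  digits are truncated to legal ones, so that each certificate describes some string. As the
  alphabet and the locality are constant, the digits at the qudits of a term can be kept in the
  finite control.\<close>

datatype prog =
    Skip
  | Push nat nat
  | Pop nat
  | Seq prog prog (infixr ";;" 60)
  | Case nat prog prog prog prog
  | Loop prog

type_synonym store = "nat \<Rightarrow> nat list"

text \<open>The value 0 of the empty stack is the blank that the head finds there, so one four-way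
  case distinction tests for emptiness and for the symbols.\<close>

definition top_of :: "nat list \<Rightarrow> nat" where
  "top_of xs = (case xs of [] \<Rightarrow> 0 | x # _ \<Rightarrow> x)"

lemma top_of_simps [simp]: "top_of [] = 0" "top_of (x # xs) = x"
  by (simp_all add: top_of_def)

text \<open>
  \<open>L\<close> is the number of iterations of every loop; it will be the length of the input, which makes
  all programs run in polynomial time.
\<close>
primrec run :: "nat \<Rightarrow> prog \<Rightarrow> store \<Rightarrow> store" where
  "run L Skip \<sigma> = \<sigma>"
| "run L (Push i s) \<sigma> = \<sigma>(i := s # \<sigma> i)"
| "run L (Pop i) \<sigma> = \<sigma>(i := tl (\<sigma> i))"
| "run L (Seq p q) \<sigma> = run L q (run L p \<sigma>)"
| "run L (Case i p0 p1 p2 p3) \<sigma> =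
     (if top_of (\<sigma> i) = 0 then run L p0 \<sigma> else if top_of (\<sigma> i) = 1 then run L p1 \<sigma>
      else if top_of (\<sigma> i) = 2 then run L p2 \<sigma> else run L p3 \<sigma>)"
| "run L (Loop p) \<sigma> = (run L p ^^ L) \<sigma>"

text \<open>Pushing 0 is excluded: on the tape it would be a blank and look like the end of the
  stack.\<close>

primrec wf_prog :: "prog \<Rightarrow> bool" where
  "wf_prog Skip \<longleftrightarrow> True"
| "wf_prog (Push i s) \<longleftrightarrow> 1 \<le> s \<and> s \<le> 3"
| "wf_prog (Pop i) \<longleftrightarrow> True"
| "wf_prog (Seq p q) \<longleftrightarrow> wf_prog p \<and> wf_prog q"
| "wf_prog (Case i p0 p1 p2 p3) \<longleftrightarrow> wf_prog p0 \<and> wf_prog p1 \<and> wf_prog p2 \<and> wf_prog p3"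
| "wf_prog (Loop p) \<longleftrightarrow> wf_prog p"

primrec stacks :: "prog \<Rightarrow> nat" where
  "stacks Skip = 0"
| "stacks (Push i s) = Suc i"
| "stacks (Pop i) = Suc i"
| "stacks (Seq p q) = max (stacks p) (stacks q)"
| "stacks (Case i p0 p1 p2 p3) =
     max (Suc i) (max (max (stacks p0) (stacks p1)) (max (stacks p2) (stacks p3)))"
| "stacks (Loop p) = stacks p"

text \<open>Nested loops need different counters, loops in sequence can share one; the nesting depth
  is therefore the number of counter tapes.\<close>

primrec depth :: "prog \<Rightarrow> nat" where
  "depth Skip = 0"
| "depth (Push i s) = 0"
| "depth (Pop i) = 0"
| "depth (Seq p q) = max (depth p) (depth q)"
| "depth (Case i p0 p1 p2 p3) = max (max (depth p0) (depth p1)) (max (depth p2) (depth p3))"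
| "depth (Loop p) = Suc (depth p)"

definition valid_store :: "store \<Rightarrow> bool" where
  "valid_store \<sigma> \<longleftrightarrow> (\<forall>i. set (\<sigma> i) \<subseteq> {1..3})"

lemma valid_store_run: "wf_prog p \<Longrightarrow> valid_store \<sigma> \<Longrightarrow> valid_store (run L p \<sigma>)"
proof (induction p arbitrary: \<sigma>)
  case (Push i s)
  then show ?case by (auto simp: valid_store_def)
next
  case (Pop i)
  have "set (tl (\<sigma> i)) \<subseteq> set (\<sigma> i)" by (cases "\<sigma> i") auto
  with Pop show ?case by (auto simp: valid_store_def)
next
  case (Loop p)
  have "valid_store ((run L p ^^ n) \<sigma>)" for n
    by (induction n) (use Loop in auto)
  then show ?case by simp
qed auto


section \<open>Compilation to Turing machines\<close>

definition cmd :: "nat \<Rightarrow> nat \<Rightarrow> (nat \<Rightarrow> nat \<times> nat \<times> direction) \<Rightarrow> command" where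
  "cmd K j f = (\<lambda>ss. (fst (f (ss ! j)),
     map (\<lambda>i. if i = j then snd (f (ss ! j)) else (ss ! i, Stay)) [0..<K]))"

primrec code_length :: "prog \<Rightarrow> nat" where
  "code_length Skip = 1"
| "code_length (Push i s) = 2"
| "code_length (Pop i) = 1"
| "code_length (Seq p q) = code_length p + code_length q"
| "code_length (Case i p0 p1 p2 p3) =
     Suc (code_length p0 + code_length p1 + code_length p2 + code_length p3)"
| "code_length (Loop p) = code_length p + 3"

text \<open>
  There are \<open>K\<close> tapes, of which those from \<open>C\<close> on are the loop counters.  The code of a program is
  placed at state \<open>a\<close> and leaves to state \<open>e\<close>; a loop of nesting depth \<open>j\<close> uses counter \<open>C + j\<close>.
\<close>
primrec code :: "nat \<Rightarrow> nat \<Rightarrow> prog \<Rightarrow> nat \<Rightarrow> nat \<Rightarrow> command list" where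
  "code K C Skip a e = [cmd K 0 (\<lambda>s. (e, s, Stay))]"
| "code K C (Push i x) a e =
     [cmd K i (\<lambda>s. (Suc a, s, Left)), cmd K i (\<lambda>s. (e, x, Stay))]"
| "code K C (Pop i) a e = [cmd K i (\<lambda>s. (e, 0, if s = 0 then Stay else Right))]"
| "code K C (Seq p q) a e =
     code K C p a (a + code_length p) @ code K C q (a + code_length p) e"
| "code K C (Case i p0 p1 p2 p3) a e =
     (let a0 = Suc a; a1 = a0 + code_length p0; a2 = a1 + code_length p1; a3 = a2 + code_length p2
      in cmd K i (\<lambda>s. (if s = 0 then a0 else if s = 1 then a1 else if s = 2 then a2 else a3, s, Stay))
         # code K C p0 a0 e @ code K C p1 a1 e @ code K C p2 a2 e @ code K C p3 a3 e)"
| "code K C (Loop p) a e =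
     (let r = Suc a + code_length p
      in cmd K (C + depth p) (\<lambda>s. if s = 0 then (Suc r, s, Left) else (Suc a, s, Stay))
         # code K C p (Suc a) r
         @ [cmd K (C + depth p) (\<lambda>s. (a, s, Right)),
            cmd K (C + depth p) (\<lambda>s. if s = 0 then (e, s, Right) else (Suc r, s, Left))])"

lemma length_code [simp]: "length (code K C p a e) = code_length p"
  by (induction p arbitrary: a e) (auto simp: Let_def)

text \<open>An upper bound that depends on the loop length alone: a case distinction is charged for
  all its branches. A round costs the body, the test and the move of the counter; leaving the loop
  costs the failed test and \<open>L + 1\<close> steps of rewinding.\<close>

primrec run_time :: "nat \<Rightarrow> prog \<Rightarrow> nat" where
  "run_time L Skip = 1"
| "run_time L (Push i s) = 2"
| "run_time L (Pop i) = 1"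
| "run_time L (Seq p q) = run_time L p + run_time L q"
| "run_time L (Case i p0 p1 p2 p3) =
     Suc (run_time L p0 + run_time L p1 + run_time L p2 + run_time L p3)"
| "run_time L (Loop p) = L * (run_time L p + 2) + L + 2"

lemma run_time_poly: "\<exists>r :: nat poly. \<forall>L. run_time L p \<le> poly r L"
proof (induction p)
  case Skip
  show ?case by (rule exI[of _ 1]) simp
next
  case (Push i s)
  show ?case by (rule exI[of _ 2]) simp
next
  case (Pop i)
  show ?case by (rule exI[of _ 1]) simp
next
  case (Seq p q)
  then obtain r s where "\<forall>L. run_time L p \<le> poly r L" "\<forall>L. run_time L q \<le> poly s L" by blast
  then show ?case by (intro exI[of _ "r + s"]) (simp add: add_mono)
next
  case (Case i p0 p1 p2 p3)
  then obtain r0 r1 r2 r3 where "\<forall>L. run_time L p0 \<le> poly r0 L" "\<forall>L. run_time L p1 \<le> poly r1 L"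
    "\<forall>L. run_time L p2 \<le> poly r2 L" "\<forall>L. run_time L p3 \<le> poly r3 L" by blast
  then show ?case by (intro exI[of _ "1 + r0 + r1 + r2 + r3"]) (simp add: add_mono)
next
  case (Loop p)
  then obtain r where "\<forall>L. run_time L p \<le> poly r L" by blast
  then show ?case by (intro exI[of _ "[:0, 1:] * (r + 2) + [:0, 1:] + 2"]) (simp add: add_mono)
qed

text \<open>The head is on the top and the stack extends to the right, with blanks everywhere else.
  The two-sided tape lets the stack grow to the left, so that nothing is ever shifted.\<close>

definition holds_stack :: "tape \<Rightarrow> nat list \<Rightarrow> bool" where
  "holds_stack t xs \<longleftrightarrow> (case t of (p, c) \<Rightarrow>
     \<forall>j. c (p + j) = (if 0 \<le> j \<and> nat j < length xs then xs ! nat j else 0))"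

lemma scanned_holds_stack: "holds_stack t xs \<Longrightarrow> scanned t = top_of xs"
  by (cases t; cases xs) (auto simp: holds_stack_def dest: spec[of _ 0])

lemma holds_stack_act_same: "act (scanned t, Stay) t = t"
  by (cases t) auto

lemma holds_stack_push:
  assumes "holds_stack t xs" "scanned t = y"
  shows "holds_stack (act (x, Stay) (act (y, Left) t)) (x # xs)"
proof (cases t)
  case (Pair p c)
  have c: "c (p + j) = (if 0 \<le> j \<and> nat j < length xs then xs ! nat j else 0)" for j
    using assms(1) Pair by (auto simp: holds_stack_def)
  have "(c(p := y, p - 1 := x)) (p - 1 + j) =
        (if 0 \<le> j \<and> nat j < length (x # xs) then (x # xs) ! nat j else 0)" for j
  proof -
    have "c p = y" using assms(2) Pair by simp
    then have "(c(p := y, p - 1 := x)) (p - 1 + j) = (if j = 0 then x else c (p + (j - 1)))"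
      by (auto simp: algebra_simps)
    also have "\<dots> = (if 0 \<le> j \<and> nat j < length (x # xs) then (x # xs) ! nat j else 0)"
      unfolding c by (auto simp: nth_Cons' nat_diff_distrib)
    finally show ?thesis .
  qed
  then show ?thesis unfolding Pair holds_stack_def by simp
qed

text \<open>Since no symbol of a stack is 0, a scanned blank means that the stack is empty; the head
  then stays, which makes popping an empty stack harmless.\<close>

lemma holds_stack_pop:
  assumes "holds_stack t xs" "set xs \<subseteq> {1..3}"
  shows "holds_stack (act (0, if scanned t = 0 then Stay else Right) t) (tl xs)"
proof (cases t)
  case (Pair p c)
  have c: "c (p + j) = (if 0 \<le> j \<and> nat j < length xs then xs ! nat j else 0)" for j
    using assms(1) Pair by (auto simp: holds_stack_def)
  show ?thesis
  proof (cases xs)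
    case Nil
    with c have "c = (\<lambda>_. 0)" by (metis add_diff_cancel_left' diff_add_cancel length_0_conv not_less_zero ext)
    then show ?thesis using Pair Nil by (simp add: holds_stack_def)
  next
    case (Cons x xs')
    with assms(2) have "x \<noteq> 0" by auto
    moreover have "c p = x" using c[of 0] Cons by simp
    moreover have "(c(p := 0)) (p + 1 + j) =
        (if 0 \<le> j \<and> nat j < length xs' then xs' ! nat j else 0)" for j
    proof -
      have "(c(p := 0)) (p + 1 + j) = (if j = -1 then 0 else c (p + (1 + j)))"
        by (auto simp: add.assoc)
      also have "\<dots> = (if 0 \<le> j \<and> nat j < length xs' then xs' ! nat j else 0)"
        unfolding c Cons by (auto simp: nth_Cons' nat_add_distrib)
      finally show ?thesis .
    qed
    ultimately show ?thesis using Pair Cons by (simp add: holds_stack_def)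
  qed
qed

lemma step_cmd:
  assumes "q < length M" "M ! q = cmd K j f" "length ts = K" "j < K"
  shows "step M (q, ts) = (fst (f (scanned (ts ! j))), ts[j := act (snd (f (scanned (ts ! j)))) (ts ! j)])"
proof -
  have "map2 act (map (\<lambda>i. if i = j then snd (f (map scanned ts ! j)) else (map scanned ts ! i, Stay)) [0..<K]) ts
     = ts[j := act (snd (f (scanned (ts ! j)))) (ts ! j)]"
    using assms(3,4) by (intro nth_equalityI) (auto simp: holds_stack_act_same nth_list_update)
  then show ?thesis using assms by (simp add: cmd_def)
qed

text \<open>A unary clock: the contents, \<open>L\<close> ones, never change, and the position of
  the head is the number of completed rounds. The loop ends on the first blank, after which only the
  head has to return.\<close>

definition counter :: "nat \<Rightarrow> nat \<Rightarrow> tape" where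
  "counter L p = (int p, \<lambda>j. if 0 \<le> j \<and> nat j < L then 1 else 0)"

text \<open>Only the tapes below \<open>C\<close> are described; the counters move during a loop and
  are tracked separately in \<open>code_correct\<close>.\<close>

definition simulates :: "nat \<Rightarrow> nat \<Rightarrow> store \<Rightarrow> tape list \<Rightarrow> bool" where
  "simulates K C \<sigma> ts \<longleftrightarrow> length ts = K \<and> C \<le> K \<and> (\<forall>i < C. holds_stack (ts ! i) (\<sigma> i))"

lemma simulates_update_counter:
  "simulates K C \<sigma> ts \<Longrightarrow> C \<le> j \<Longrightarrow> simulates K C \<sigma> (ts[j := t])"
  by (auto simp: simulates_def)

lemma simulates_update_stack:
  "simulates K C \<sigma> ts \<Longrightarrow> i < C \<Longrightarrow> holds_stack t xs \<Longrightarrow> simulates K C (\<sigma>(i := xs)) (ts[i := t])"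
  by (auto simp: simulates_def nth_list_update)

definition code_at :: "machine \<Rightarrow> nat \<Rightarrow> command list \<Rightarrow> bool" where
  "code_at M a cs \<longleftrightarrow> a + length cs \<le> length M \<and> (\<forall>i < length cs. M ! (a + i) = cs ! i)"

lemma code_at_Cons: "code_at M a (c # cs) \<longleftrightarrow> a < length M \<and> M ! a = c \<and> code_at M (Suc a) cs"
  by (auto simp: code_at_def less_Suc_eq_0_disj)

lemma code_at_append:
  "code_at M a (cs @ cs') \<longleftrightarrow> code_at M a cs \<and> code_at M (a + length cs) cs'"
proof -
  have "(\<forall>i < length cs + length cs'. M ! (a + i) = (cs @ cs') ! i) \<longleftrightarrow>
    (\<forall>i < length cs. M ! (a + i) = cs ! i) \<and> (\<forall>i < length cs'. M ! (a + length cs + i) = cs' ! i)"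
    (is "?L \<longleftrightarrow> ?R")
  proof
    assume ?L
    then show ?R by (auto simp: nth_append) (metis add.assoc add_diff_cancel_left' nat_add_left_cancel_less not_add_less1)
  next
    assume R: ?R
    show ?L
    proof (intro allI impI)
      fix i assume "i < length cs + length cs'"
      then show "M ! (a + i) = (cs @ cs') ! i"
        using R by (cases "i < length cs") (auto simp: nth_append dest!: spec[of _ "i - length cs"])
    qed
  qed
  then show ?thesis by (auto simp: code_at_def)
qed

lemma counter_scanned: "scanned (counter L p) = (if p < L then 1 else 0)"
  by (simp add: counter_def)

lemma counter_right: "act (scanned (counter L p), Right) (counter L p) = counter L (Suc p)"
  by (auto simp: counter_def)

lemma steps_trans:
  assumes "(step M ^^ n) c = c'" "(step M ^^ m) c' = c''"
  shows "(step M ^^ (n + m)) c = c''"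
  using assms by (simp add: add.commute[of n] funpow_add)

text \<open>The failed test of the loop has moved the head to \<open>p - 1\<close>; from there
  \<open>p\<close> ones are crossed to the left, and one step leads back from the blank at
  -1.\<close>

lemma counter_rewind:
  assumes M: "r < length M" "M ! r = cmd K j (\<lambda>s. if s = 0 then (e, s, Right) else (r, s, Left))"
    and "j < K" "length ts = K" "p \<le> L"
  shows "ts ! j = (let t = counter L p in (fst t - 1, snd t)) \<Longrightarrow>
         (step M ^^ (Suc p)) (r, ts) = (e, ts[j := counter L 0])"
  using assms(3-5)
proof (induction p arbitrary: ts)
  case 0
  then have "scanned (ts ! j) = 0" by (simp add: counter_def)
  moreover have "act (0, Right) (ts ! j) = counter L 0"
    using 0 by (auto simp: counter_def)
  ultimately show ?case using step_cmd[OF M \<open>length ts = K\<close> \<open>j < K\<close>] by simp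
next
  case (Suc p)
  then have s: "scanned (ts ! j) = 1" by (simp add: counter_def)
  moreover have "act (1, Left) (ts ! j) = (let t = counter L p in (fst t - 1, snd t))"
    using Suc by (auto simp: counter_def Let_def)
  ultimately have st: "step M (r, ts) = (r, ts[j := (let t = counter L p in (fst t - 1, snd t))])"
    using step_cmd[OF M \<open>length ts = K\<close> \<open>j < K\<close>] by simp
  have "(step M ^^ Suc p) (r, ts[j := (let t = counter L p in (fst t - 1, snd t))]) =
      (e, ts[j := (let t = counter L p in (fst t - 1, snd t)), j := counter L 0])"
    using Suc.prems by (intro Suc.IH) auto
  then show ?case
    unfolding funpow_Suc_right[of "Suc p"] comp_apply st by simp
qed

text \<open>The counters available to the program start rewound, and every counter is returned as it
  was. This allows the body of a loop to be started again, and it protects the counter of the loop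
  itself, which lies above those of the body.\<close>

lemma code_correct:
  assumes "code_at M a (code K C p a e)" "stacks p \<le> C" "0 < C" "C + depth p \<le> K" "wf_prog p"
    "valid_store \<sigma>" "simulates K C \<sigma> ts" "\<forall>j < depth p. ts ! (C + j) = counter L 0"
  shows "\<exists>n \<le> run_time L p. \<exists>ts'. (step M ^^ n) (a, ts) = (e, ts') \<and>
     simulates K C (run L p \<sigma>) ts' \<and> (\<forall>j \<ge> C. ts' ! j = ts ! j)"
  using assms
proof (induction p arbitrary: a e \<sigma> ts)
  case Skip
  have "step M (a, ts) = (e, ts)"
    using Skip step_cmd[of a M K 0 "\<lambda>s. (e, s, Stay)" ts]
    by (auto simp: code_at_Cons simulates_def holds_stack_act_same)
  with Skip show ?case by (intro exI[of _ 1] conjI exI[of _ ts]) auto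
next
  case (Push i x)
  let ?y = "scanned (ts ! i)"
  let ?t1 = "act (?y, Left) (ts ! i)"
  have len: "length ts = K" and i: "i < K" "i < C" using Push by (auto simp: simulates_def)
  have "step M (a, ts) = (Suc a, ts[i := ?t1])"
    using Push step_cmd[OF _ _ len i(1), of a M "\<lambda>s. (Suc a, s, Left)"] by (auto simp: code_at_Cons)
  moreover have "step M (Suc a, ts[i := ?t1]) = (e, ts[i := act (x, Stay) ?t1])"
    using Push len i step_cmd[of "Suc a" M K i "\<lambda>s. (e, x, Stay)" "ts[i := ?t1]"]
    by (auto simp: code_at_Cons)
  ultimately have "(step M ^^ 2) (a, ts) = (e, ts[i := act (x, Stay) ?t1])"
    by (simp add: numeral_2_eq_2)
  moreover have "holds_stack (act (x, Stay) ?t1) (x # \<sigma> i)"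
    using Push i by (intro holds_stack_push) (auto simp: simulates_def)
  ultimately show ?case using Push i simulates_update_stack[of K C \<sigma> ts i]
    by (intro exI[of _ 2] conjI exI[of _ "ts[i := act (x, Stay) ?t1]"]) (auto simp del: fun_upd_apply)
next
  case (Pop i)
  let ?t1 = "act (0, if scanned (ts ! i) = 0 then Stay else Right) (ts ! i)"
  have len: "length ts = K" and i: "i < K" "i < C" using Pop by (auto simp: simulates_def)
  have "step M (a, ts) = (e, ts[i := ?t1])"
    using Pop step_cmd[OF _ _ len i(1), of a M "\<lambda>s. (e, 0, if s = 0 then Stay else Right)"]
    by (auto simp: code_at_Cons)
  moreover have "holds_stack ?t1 (tl (\<sigma> i))"
    using Pop i by (intro holds_stack_pop) (auto simp: simulates_def valid_store_def)
  ultimately show ?case using Pop i simulates_update_stack[of K C \<sigma> ts i]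
    by (intro exI[of _ 1] conjI exI[of _ "ts[i := ?t1]"]) (auto simp del: fun_upd_apply step.simps)
next
  case (Seq p q)
  have "\<exists>n \<le> run_time L p. \<exists>ts'. (step M ^^ n) (a, ts) = (a + code_length p, ts') \<and>
     simulates K C (run L p \<sigma>) ts' \<and> (\<forall>j \<ge> C. ts' ! j = ts ! j)"
    using Seq.prems by (intro Seq.IH(1)) (auto simp: code_at_append)
  then obtain n ts1 where 1: "n \<le> run_time L p" "(step M ^^ n) (a, ts) = (a + code_length p, ts1)"
     "simulates K C (run L p \<sigma>) ts1" "\<forall>j \<ge> C. ts1 ! j = ts ! j" by blast
  have "\<exists>n \<le> run_time L q. \<exists>ts'. (step M ^^ n) (a + code_length p, ts1) = (e, ts') \<and>
     simulates K C (run L q (run L p \<sigma>)) ts' \<and> (\<forall>j \<ge> C. ts' ! j = ts1 ! j)"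
    using Seq.prems 1 by (intro Seq.IH(2)) (auto simp: code_at_append valid_store_run)
  then obtain m ts2 where 2: "m \<le> run_time L q" "(step M ^^ m) (a + code_length p, ts1) = (e, ts2)"
     "simulates K C (run L q (run L p \<sigma>)) ts2" "\<forall>j \<ge> C. ts2 ! j = ts1 ! j" by blast
  show ?case using 1 2 steps_trans[OF 1(2) 2(2)]
    by (intro exI[of _ "n + m"] conjI exI[of _ ts2]) auto
next
  case (Case i p0 p1 p2 p3)
  have len: "length ts = K" and i: "i < K" "i < C" using Case.prems by (auto simp: simulates_def)
  let ?a0 = "Suc a" and ?s = "top_of (\<sigma> i)"
  let ?a1 = "?a0 + code_length p0"
  let ?a2 = "?a1 + code_length p1"
  let ?a3 = "?a2 + code_length p2"
  let ?b = "if ?s = 0 then ?a0 else if ?s = 1 then ?a1 else if ?s = 2 then ?a2 else ?a3"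
  have s: "scanned (ts ! i) = ?s"
    using Case.prems i by (auto simp: simulates_def intro: scanned_holds_stack)
  have "M ! a = cmd K i (\<lambda>s. (if s = 0 then ?a0 else if s = 1 then ?a1 else if s = 2 then ?a2 else ?a3, s, Stay))"
    and a: "a < length M" using Case.prems by (auto simp: code_at_Cons Let_def)
  from step_cmd[OF a this(1) len i(1)] have st: "step M (a, ts) = (?b, ts)"
    by (auto simp: s[symmetric] holds_stack_act_same)
  have "\<exists>n \<le> run_time L (Case i p0 p1 p2 p3) - 1. \<exists>ts'. (step M ^^ n) (?b, ts) = (e, ts') \<and>
     simulates K C (run L (Case i p0 p1 p2 p3) \<sigma>) ts' \<and> (\<forall>j \<ge> C. ts' ! j = ts ! j)"
  proof -
    have w: "\<exists>n \<le> t'. P n" if "\<exists>n \<le> t. P n" "t \<le> t'" for P :: "nat \<Rightarrow> bool" and t t'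
      using that by (meson le_trans)
    consider "?s = 0" | "?s = 1" | "?s = 2" | "?s \<noteq> 0" "?s \<noteq> 1" "?s \<noteq> 2" by blast
    then show ?thesis
    proof cases
      case 1
      have "\<exists>n \<le> run_time L p0. \<exists>ts'. (step M ^^ n) (?a0, ts) = (e, ts') \<and>
        simulates K C (run L p0 \<sigma>) ts' \<and> (\<forall>j \<ge> C. ts' ! j = ts ! j)"
        using Case.prems by (intro Case.IH) (auto simp: code_at_append code_at_Cons Let_def)
      from w[OF this, of "run_time L (Case i p0 p1 p2 p3) - 1"] 1 show ?thesis by simp
    next
      case 2
      have "\<exists>n \<le> run_time L p1. \<exists>ts'. (step M ^^ n) (?a1, ts) = (e, ts') \<and>
        simulates K C (run L p1 \<sigma>) ts' \<and> (\<forall>j \<ge> C. ts' ! j = ts ! j)"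
        using Case.prems by (intro Case.IH) (auto simp: code_at_append code_at_Cons Let_def)
      from w[OF this, of "run_time L (Case i p0 p1 p2 p3) - 1"] 2 show ?thesis by simp
    next
      case 3
      have "\<exists>n \<le> run_time L p2. \<exists>ts'. (step M ^^ n) (?a2, ts) = (e, ts') \<and>
        simulates K C (run L p2 \<sigma>) ts' \<and> (\<forall>j \<ge> C. ts' ! j = ts ! j)"
        using Case.prems by (intro Case.IH) (auto simp: code_at_append code_at_Cons Let_def)
      from w[OF this, of "run_time L (Case i p0 p1 p2 p3) - 1"] 3 show ?thesis by simp
    next
      case 4
      have "\<exists>n \<le> run_time L p3. \<exists>ts'. (step M ^^ n) (?a3, ts) = (e, ts') \<and>
        simulates K C (run L p3 \<sigma>) ts' \<and> (\<forall>j \<ge> C. ts' ! j = ts ! j)"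
        using Case.prems by (intro Case.IH) (auto simp: code_at_append code_at_Cons Let_def)
      from w[OF this, of "run_time L (Case i p0 p1 p2 p3) - 1"] 4 show ?thesis by simp
    qed
  qed
  then obtain n ts' where n: "n \<le> run_time L (Case i p0 p1 p2 p3) - 1" "(step M ^^ n) (?b, ts) = (e, ts')"
     "simulates K C (run L (Case i p0 p1 p2 p3) \<sigma>) ts'" "\<forall>j \<ge> C. ts' ! j = ts ! j" by blast
  have "(step M ^^ Suc n) (a, ts) = (e, ts')" by (subst funpow_Suc_right) (simp only: comp_apply st n(2))
  with n show ?case by (intro exI[of _ "Suc n"] conjI exI[of _ ts']) auto
next
  case (Loop p)
  let ?j = "C + depth p"
  let ?r = "Suc a + code_length p"
  have len: "length ts = K" and j: "?j < K" using Loop.prems by (auto simp: simulates_def)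
  have at: "a < length M" "M ! a = cmd K ?j (\<lambda>s. if s = 0 then (Suc ?r, s, Left) else (Suc a, s, Stay))"
    "code_at M (Suc a) (code K C p (Suc a) ?r)"
    "?r < length M" "M ! ?r = cmd K ?j (\<lambda>s. (a, s, Right))"
    "Suc ?r < length M" "M ! Suc ?r = cmd K ?j (\<lambda>s. if s = 0 then (e, s, Right) else (Suc ?r, s, Left))"
    using Loop.prems(1) by (simp_all add: Let_def code_at_Cons code_at_append cong: if_cong)
  have valid: "valid_store ((run L p ^^ q) \<sigma>)" for q
    by (induction q) (use Loop.prems in \<open>auto simp: valid_store_run\<close>)
  \<comment> \<open>Induction on the completed rounds: the counter \<open>C + depth p\<close> stands
    at \<open>q\<close>, while the counters used inside the body are rewound again.\<close>
  have main: "\<exists>n \<le> q * (run_time L p + 2). \<exists>ts'. (step M ^^ n) (a, ts) = (a, ts') \<and>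
     simulates K C ((run L p ^^ q) \<sigma>) ts' \<and> ts' ! ?j = counter L q \<and>
     (\<forall>j \<ge> C. j \<noteq> ?j \<longrightarrow> ts' ! j = ts ! j)" if "q \<le> L" for q
    using that
  proof (induction q)
    case 0
    show ?case using Loop.prems by (intro exI[of _ 0] conjI exI[of _ ts]) auto
  next
    case (Suc q)
    then obtain n ts1 where 1: "n \<le> q * (run_time L p + 2)" "(step M ^^ n) (a, ts) = (a, ts1)"
      "simulates K C ((run L p ^^ q) \<sigma>) ts1" "ts1 ! ?j = counter L q"
      "\<forall>j \<ge> C. j \<noteq> ?j \<longrightarrow> ts1 ! j = ts ! j" by auto
    have len1: "length ts1 = K" using 1 by (simp add: simulates_def)
    have s1: "step M (a, ts1) = (Suc a, ts1)"
      using step_cmd[OF at(1,2) len1 j] 1(4) Suc.prems holds_stack_act_same[of "ts1 ! ?j"]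
        list_update_id[of ts1 ?j]
      by (simp del: step.simps list_update_id add: counter_scanned)
    have "\<exists>n \<le> run_time L p. \<exists>ts'. (step M ^^ n) (Suc a, ts1) = (?r, ts') \<and>
     simulates K C (run L p ((run L p ^^ q) \<sigma>)) ts' \<and> (\<forall>j \<ge> C. ts' ! j = ts1 ! j)"
      using Loop.prems at 1 valid by (intro Loop.IH) auto
    then obtain m ts2 where 2: "m \<le> run_time L p" "(step M ^^ m) (Suc a, ts1) = (?r, ts2)"
      "simulates K C (run L p ((run L p ^^ q) \<sigma>)) ts2" "\<forall>j \<ge> C. ts2 ! j = ts1 ! j" by blast
    have len2: "length ts2 = K" using 2 by (simp add: simulates_def)
    have s2: "step M (?r, ts2) = (a, ts2[?j := counter L (Suc q)])"
      using step_cmd[OF at(4,5) len2 j] 1(4) 2(4) counter_right[of L q] by auto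
    have "(step M ^^ (n + (1 + (m + 1)))) (a, ts) = (a, ts2[?j := counter L (Suc q)])"
      by (intro steps_trans[OF 1(2)] steps_trans[OF _ steps_trans[OF 2(2)]]) (use s1 s2 in auto)
    moreover have "simulates K C ((run L p ^^ Suc q) \<sigma>) (ts2[?j := counter L (Suc q)])"
      using 2 by (auto intro: simulates_update_counter)
    ultimately show ?case using 1 2 len2 j
      by (intro exI[of _ "n + (1 + (m + 1))"] conjI exI[of _ "ts2[?j := counter L (Suc q)]"]) auto
  qed
  obtain n ts1 where 1: "n \<le> L * (run_time L p + 2)" "(step M ^^ n) (a, ts) = (a, ts1)"
      "simulates K C ((run L p ^^ L) \<sigma>) ts1" "ts1 ! ?j = counter L L"
      "\<forall>j \<ge> C. j \<noteq> ?j \<longrightarrow> ts1 ! j = ts ! j" using main[OF le_refl] by blast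
  have len1: "length ts1 = K" using 1 by (simp add: simulates_def)
  let ?ts2 = "ts1[?j := (let t = counter L L in (fst t - 1, snd t))]"
  have "step M (a, ts1) = (Suc ?r, ts1[?j := act (0, Left) (counter L L)])"
    using step_cmd[OF at(1,2) len1 j] 1(4) by (simp add: counter_scanned)
  also have "act (0, Left) (counter L L) = (let t = counter L L in (fst t - 1, snd t))"
    by (auto simp: counter_def)
  finally have s1: "step M (a, ts1) = (Suc ?r, ?ts2)" .
  have s2: "(step M ^^ Suc L) (Suc ?r, ?ts2) = (e, ?ts2[?j := counter L 0])"
    by (rule counter_rewind[OF at(6,7)]) (use j len1 in auto)
  have "(step M ^^ (n + (1 + Suc L))) (a, ts) = (e, ts1[?j := counter L 0])"
    by (rule steps_trans[OF 1(2)], rule steps_trans[OF _ s2[simplified list_update_overwrite]])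
       (use s1 in simp)
  moreover have "simulates K C (run L (Loop p) \<sigma>) (ts1[?j := counter L 0])"
    using 1 by (auto intro: simulates_update_counter)
  moreover have "\<forall>i \<ge> C. ts1[?j := counter L 0] ! i = ts ! i"
    using 1(5) Loop.prems(8) len1 j by (auto simp: nth_list_update)
  ultimately show ?case using 1(1)
    by (intro exI[of _ "n + (1 + Suc L)"] conjI exI[of _ "ts1[?j := counter L 0]"]) auto
qed


text \<open>The loop length is written in unary before the program starts: while state 0 crosses the
  input, every counter tape receives a one per symbol; state 1 brings the heads back. Input symbols
  are non-zero, so the first blank marks the end.\<close>

definition preparation :: "nat \<Rightarrow> nat \<Rightarrow> command list" where
  "preparation C K =
     [\<lambda>ss. if ss ! 0 \<noteq> 0
           then (0, map (\<lambda>i. if i = 0 then (ss ! 0, Right)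
                             else if i < C then (ss ! i, Stay) else (1, Right)) [0..<K])
           else (1, map (\<lambda>i. if i = 0 \<or> C \<le> i then (ss ! i, Left) else (ss ! i, Stay)) [0..<K]),
      \<lambda>ss. if ss ! 0 \<noteq> 0
           then (1, map (\<lambda>i. if i = 0 \<or> C \<le> i then (ss ! i, Left) else (ss ! i, Stay)) [0..<K])
           else (2, map (\<lambda>i. if i = 0 \<or> C \<le> i then (ss ! i, Right) else (ss ! i, Stay)) [0..<K])]"

definition prep_tapes :: "nat \<Rightarrow> nat \<Rightarrow> nat list \<Rightarrow> nat \<Rightarrow> int \<Rightarrow> tape list" where
  "prep_tapes C K w q p = map (\<lambda>i. if i = 0 then (p, \<lambda>i. if 0 \<le> i \<and> nat i < length w then w ! nat i else 0)
       else if i < C then (0, \<lambda>_. 0) else (p, \<lambda>i. if 0 \<le> i \<and> nat i < q then 1 else 0)) [0..<K]"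

definition compile :: "nat \<Rightarrow> nat \<Rightarrow> prog \<Rightarrow> machine" where
  "compile C K p = preparation C K @ code K C p 2 (2 + code_length p)"

lemma length_compile: "length (compile C K p) = 2 + code_length p"
  by (simp add: compile_def preparation_def)

lemma code_at_compile: "code_at (compile C K p) 2 (code K C p 2 (2 + code_length p))"
  by (auto simp: code_at_def compile_def preparation_def nth_append)

lemma compile_nth: "compile C K p ! 0 = preparation C K ! 0" "compile C K p ! 1 = preparation C K ! 1"
  by (auto simp: compile_def preparation_def)

text \<open>The count consists of \<open>length w\<close> steps out, \<open>length w\<close> steps
  back, and one step for each of the two turns.\<close>

lemma prep_steps:
  assumes "1 \<le> C" "C \<le> K" "0 \<notin> set w"
  shows "(step (compile C K p) ^^ (2 * length w + 2)) (0, prep_tapes C K w 0 0) =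
         (2, prep_tapes C K w (length w) 0)"
proof -
  let ?M = "compile C K p"
  have scan: "scanned (prep_tapes C K w q x ! 0) = (if 0 \<le> x \<and> nat x < length w then w ! nat x else 0)" for q x
    using assms by (simp add: prep_tapes_def)
  have w: "w ! i \<noteq> 0" if "i < length w" for i using assms(3) that by (metis nth_mem)
  have len: "length (prep_tapes C K w q x) = K" for q x by (simp add: prep_tapes_def)
  have K: "0 < K" using assms by simp
  have fwd: "(step ?M ^^ q) (0, prep_tapes C K w 0 0) = (0, prep_tapes C K w q q)" if "q \<le> length w" for q
    using that
  proof (induction q)
    case (Suc q)
    have "step ?M (0, prep_tapes C K w q q) = (0, prep_tapes C K w (Suc q) (Suc q))"
      using Suc.prems w[of q] K assms(1)
      by (auto simp: length_compile compile_nth preparation_def len scan prep_tapes_def fun_eq_iff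
          intro!: nth_equalityI)
    with Suc show ?case by simp
  qed auto
  have mid: "step ?M (0, prep_tapes C K w (length w) (length w)) =
      (1, prep_tapes C K w (length w) (int (length w) - 1))"
    using K assms(1)
    by (auto simp: length_compile compile_nth preparation_def len scan prep_tapes_def fun_eq_iff
        intro!: nth_equalityI)
  have bwd: "(step ?M ^^ q) (1, prep_tapes C K w (length w) (int (length w) - 1)) =
      (1, prep_tapes C K w (length w) (int (length w) - 1 - int q))" if "q \<le> length w" for q
    using that
  proof (induction q)
    case (Suc q)
    have "w ! nat (int (length w) - 1 - int q) \<noteq> 0" using Suc.prems by (intro w) auto
    then have "step ?M (1, prep_tapes C K w (length w) (int (length w) - 1 - int q)) =
       (1, prep_tapes C K w (length w) (int (length w) - 1 - int (Suc q)))"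
      using Suc.prems K assms(1) compile_nth(2)[of C K p, unfolded One_nat_def]
      by (auto simp: length_compile preparation_def len scan prep_tapes_def fun_eq_iff intro!: nth_equalityI)
    with Suc show ?case by simp
  qed auto
  have last: "step ?M (1, prep_tapes C K w (length w) (-1)) = (2, prep_tapes C K w (length w) 0)"
    using K assms(1) compile_nth(2)[of C K p, unfolded One_nat_def]
    by (auto simp: length_compile preparation_def len scan prep_tapes_def fun_eq_iff intro!: nth_equalityI)
  have "(step ?M ^^ (length w + (1 + (length w + 1)))) (0, prep_tapes C K w 0 0) =
         (2, prep_tapes C K w (length w) 0)"
    by (intro steps_trans[OF fwd[OF le_refl]] steps_trans[OF _ steps_trans[OF bwd[OF le_refl]]])
       (use mid last in simp_all)
  then show ?thesis by (simp add: mult_2)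
qed

lemma prep_tapes_initial:
  assumes "1 \<le> C" "C \<le> K"
  shows "initial K w = (0, prep_tapes C K w 0 0)"
  unfolding initial_def prep_tapes_def
  using assms by (auto intro!: nth_equalityI simp: nth_Cons')

definition input_store :: "nat list \<Rightarrow> store" where
  "input_store w = (\<lambda>_. [])(0 := w)"

lemma turing_machine_compile:
  assumes "wf_prog p" "stacks p \<le> C" "1 \<le> C" "C + depth p \<le> K"
  shows "turing_machine K 4 (compile C K p)"
proof -
  \<comment> \<open>The claim is made for arbitrary addresses and exit states up to a bound
    \<open>l\<close>, because the induction places subprograms at different addresses.\<close>
  have *: "q' \<le> l \<and> length as = K \<and> fst ` set as \<subseteq> {..<4}"
    if "c \<in> set (code K C p a e)" "length ss = K" "set ss \<subseteq> {..<4}" "c ss = (q', as)"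
       "a + code_length p \<le> l" "e \<le> l" "wf_prog p" "stacks p \<le> C" "C + depth p \<le> K"
    for c ss q' as a e l and p :: prog
  proof -
    have nth: "ss ! i < 4" if "i < K" for i
      using that \<open>set ss \<subseteq> {..<4}\<close> \<open>length ss = K\<close> nth_mem by blast
    have cmd: "q' \<le> l \<and> length as = K \<and> fst ` set as \<subseteq> {..<4}"
      if "cmd K j f ss = (q', as)" "\<And>s. fst (f s) \<le> l" "\<And>s. s < 4 \<Longrightarrow> fst (snd (f s)) < 4" "j < K" for j f q' as
    proof -
      have "fst (snd (f (ss ! j))) < 4" "fst (f (ss ! j)) \<le> l" using that nth by auto
      then show ?thesis using that(1) nth by (auto simp: cmd_def image_iff) (metis fst_conv)
    qed
    show ?thesis using that(1,4-)
    proof (induction p arbitrary: a e)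
      case (Skip a e)
      then have "cmd K 0 (\<lambda>s. (e, s, Stay)) ss = (q', as)" by simp
      from cmd[OF this] show ?case using Skip assms(3) by simp
    next
      case (Push i x a e)
      then consider "cmd K i (\<lambda>s. (Suc a, s, Left)) ss = (q', as)"
        | "cmd K i (\<lambda>s. (e, x, Stay)) ss = (q', as)" by auto
      then show ?case
      proof cases
        case 1
        from cmd[OF this] show ?thesis using Push by simp
      next
        case 2
        from cmd[OF this] show ?thesis using Push by simp
      qed
    next
      case (Pop i a e)
      then have "cmd K i (\<lambda>s. (e, 0, if s = 0 then Stay else Right)) ss = (q', as)" by simp
      from cmd[OF this] show ?case using Pop by simp
    next
      case (Seq p1 p2 a e)
      then consider "c \<in> set (code K C p1 a (a + code_length p1))"
        | "c \<in> set (code K C p2 (a + code_length p1) e)" by auto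
      then show ?case
      proof cases
        case 1
        from Seq.IH(1)[OF this] show ?thesis using Seq.prems by simp
      next
        case 2
        from Seq.IH(2)[OF this] show ?thesis using Seq.prems by simp
      qed
    next
      case (Case i p0 p1 p2 p3 a e)
      then consider "c = cmd K i (\<lambda>s. (if s = 0 then Suc a else if s = 1 then Suc a + code_length p0
          else if s = 2 then Suc a + code_length p0 + code_length p1
          else Suc a + code_length p0 + code_length p1 + code_length p2, s, Stay))"
        | "c \<in> set (code K C p0 (Suc a) e)" | "c \<in> set (code K C p1 (Suc a + code_length p0) e)"
        | "c \<in> set (code K C p2 (Suc a + code_length p0 + code_length p1) e)"
        | "c \<in> set (code K C p3 (Suc a + code_length p0 + code_length p1 + code_length p2) e)"
        by (auto simp: Let_def)
      then show ?case
      proof cases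
        case 1
        with Case.prems(2) have "cmd K i (\<lambda>s. (if s = 0 then Suc a else if s = 1 then Suc a + code_length p0
          else if s = 2 then Suc a + code_length p0 + code_length p1
          else Suc a + code_length p0 + code_length p1 + code_length p2, s, Stay)) ss = (q', as)" by simp
        then show ?thesis using Case.prems by (elim cmd) auto
      next
        case 2
        from Case.IH(1)[OF this] show ?thesis using Case.prems by simp
      next
        case 3
        from Case.IH(2)[OF this] show ?thesis using Case.prems by simp
      next
        case 4
        from Case.IH(3)[OF this] show ?thesis using Case.prems by simp
      next
        case 5
        from Case.IH(4)[OF this] show ?thesis using Case.prems by simp
      qed
    next
      case (Loop p a e)
      let ?r = "Suc a + code_length p" and ?j = "C + depth p"
      from Loop.prems consider "c = cmd K ?j (\<lambda>s. if s = 0 then (Suc ?r, s, Left) else (Suc a, s, Stay))"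
        | "c \<in> set (code K C p (Suc a) ?r)" | "c = cmd K ?j (\<lambda>s. (a, s, Right))"
        | "c = cmd K ?j (\<lambda>s. if s = 0 then (e, s, Right) else (Suc ?r, s, Left))"
        by (auto simp: Let_def cong: if_cong)
      then show ?case
      proof cases
        case 1
        show ?thesis by (rule cmd[OF Loop.prems(2)[unfolded 1]]) (use Loop.prems in auto)
      next
        case 2
        from Loop.IH[OF this] show ?thesis using Loop.prems by simp
      next
        case 3
        show ?thesis by (rule cmd[OF Loop.prems(2)[unfolded 3]]) (use Loop.prems in auto)
      next
        case 4
        show ?thesis by (rule cmd[OF Loop.prems(2)[unfolded 4]]) (use Loop.prems in auto)
      qed
    qed
  qed
  show ?thesis
    unfolding turing_machine_def
  proof (intro conjI allI impI)
    show "1 \<le> K" using assms by simp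
    fix q and ss :: "nat list" assume q: "q < length (compile C K p)" and ss: "length ss = K \<and> set ss \<subseteq> {..<4}"
    have nth: "ss ! i < 4" if "i < K" for i using that ss nth_mem by blast
    obtain q' as where qa: "(compile C K p ! q) ss = (q', as)" by fastforce
    have "q' \<le> length (compile C K p) \<and> length as = K \<and> fst ` set as \<subseteq> {..<4}"
    proof (cases "q < 2")
      case True
      then have "q = 0 \<or> q = 1" by auto
      then show ?thesis using qa compile_nth(2)[of C K p, unfolded One_nat_def] nth
        by (auto simp: compile_nth preparation_def length_compile split: if_splits)
    next
      case False
      then have "compile C K p ! q \<in> set (code K C p 2 (2 + code_length p))"
        using q by (auto simp: compile_def nth_append length_compile preparation_def)
      from *[OF this _ _ qa] ss assms show ?thesis by (auto simp: length_compile)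
    qed
    then show "case (compile C K p ! q) ss of (q', as) \<Rightarrow>
        q' \<le> length (compile C K p) \<and> length as = K \<and> fst ` set as \<subseteq> {..<4}"
      by (simp add: qa)
  qed simp
qed

lemma compile_correct:
  assumes "wf_prog p" "stacks p \<le> C" "1 \<le> C" "C + depth p = K" "set w \<subseteq> {1..3}"
  shows "\<exists>n \<le> 2 * length w + 2 + run_time (length w) p. \<exists>ts.
     config_at K (compile C K p) w n = (length (compile C K p), ts) \<and>
     scanned (hd ts) = top_of (run (length w) p (input_store w) 0)"
proof -
  let ?M = "compile C K p" and ?L = "length w"
  have "simulates K C (input_store w) (prep_tapes C K w ?L 0)"
    using assms by (auto simp: simulates_def prep_tapes_def input_store_def holds_stack_def)
  moreover have "\<forall>j < depth p. prep_tapes C K w ?L 0 ! (C + j) = counter ?L 0"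
    using assms by (auto simp: prep_tapes_def counter_def)
  moreover have "valid_store (input_store w)" using assms by (auto simp: valid_store_def input_store_def)
  ultimately obtain n ts where n: "n \<le> run_time ?L p"
    "(step ?M ^^ n) (2, prep_tapes C K w ?L 0) = (2 + code_length p, ts)"
    "simulates K C (run ?L p (input_store w)) ts"
    using code_correct[OF code_at_compile assms(2) _ _ assms(1), of K "input_store w" "prep_tapes C K w ?L 0" ?L]
      assms by auto
  have "0 \<notin> set w" using assms by auto
  then have "(step ?M ^^ (2 * ?L + 2 + n)) (initial K w) = (2 + code_length p, ts)"
    using assms prep_tapes_initial[of C K w]
    by (intro steps_trans[OF _ n(2)]) (simp only: prep_steps[OF assms(3) _ \<open>0 \<notin> set w\<close>] le_add1 assms(4)[symmetric])
  moreover have "scanned (hd ts) = top_of (run ?L p (input_store w) 0)"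
    using n(3) assms by (cases ts) (auto simp: simulates_def intro!: scanned_holds_stack dest: spec[of _ 0])
  ultimately show ?thesis using n(1)
    by (intro exI[of _ "2 * ?L + 2 + n"]) (auto simp: config_at_def length_compile)
qed

lemma step_halted: "(step M ^^ n) (length M, ts) = (length M, ts)"
  by (induction n) auto

text \<open>The condition on no-instances is imposed for certificates of any length, which is
  stronger than what \<open>in_NP\<close> asks. The time bound is automatic, since every program
  halts on every input.\<close>

theorem in_NP_progI:
  assumes wf_prog: "wf_prog p"
    and yes: "\<And>x. x \<in> fst A \<Longrightarrow> \<exists>y. length y \<le> poly r (length x) \<and>
        top_of (run (length (input_pair x y)) p (input_store (input_pair x y)) 0) = 2"
    and no: "\<And>x y. x \<in> snd A \<Longrightarrow>
        top_of (run (length (input_pair x y)) p (input_store (input_pair x y)) 0) \<noteq> 2"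
  shows "in_NP A"
proof -
  define C where "C = max 1 (stacks p)"
  define K where "K = C + depth p"
  let ?M = "compile C K p"
  have C: "stacks p \<le> C" "1 \<le> C" by (auto simp: C_def)
  obtain t where t: "run_time L p \<le> poly t L" for L using run_time_poly by blast
  \<comment> \<open>The separator makes the input one symbol longer than \<open>x\<close> and
    \<open>y\<close> together, hence the composition with \<open>[:1, 1:]\<close>.\<close>
  define u where "u = pcompose (2 * [:0, 1:] + 2 + t) [:1, 1:]"
  have set_input: "set (input_pair x y) \<subseteq> {1..3}" for x y
    by (auto simp: input_pair_def bit_symbol_def)
  have len: "length (input_pair x y) = Suc (length x + length y)" for x y by (simp add: input_pair_def)
  have *: "\<exists>ts. (\<forall>n \<ge> poly u (length x + length y). config_at K ?M (input_pair x y) n = (length ?M, ts)) \<and>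
      scanned (hd ts) = top_of (run (length (input_pair x y)) p (input_store (input_pair x y)) 0)" for x y
  proof -
    let ?w = "input_pair x y"
    obtain n ts where n: "n \<le> 2 * length ?w + 2 + run_time (length ?w) p"
      "config_at K ?M ?w n = (length ?M, ts)" "scanned (hd ts) = top_of (run (length ?w) p (input_store ?w) 0)"
      using compile_correct[OF wf_prog C _ set_input] K_def by metis
    have "n \<le> poly u (length x + length y)"
      using n(1) t[of "length ?w"] by (simp add: u_def poly_pcompose len)
    moreover have "config_at K ?M ?w m = (length ?M, ts)" if "n \<le> m" for m
    proof -
      have "(step ?M ^^ (n + (m - n))) (initial K ?w) = (length ?M, ts)"
        by (rule steps_trans[OF n(2)[unfolded config_at_def] step_halted])
      with that show ?thesis by (simp add: config_at_def)
    qed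
    ultimately show ?thesis using n(3) by auto
  qed
  have acc: "accepts K ?M (input_pair x y) \<longleftrightarrow>
      top_of (run (length (input_pair x y)) p (input_store (input_pair x y)) 0) = 2" for x y
  proof -
    let ?w = "input_pair x y"
    obtain ts where ts: "\<And>n. n \<ge> poly u (length x + length y) \<Longrightarrow> config_at K ?M ?w n = (length ?M, ts)"
      "scanned (hd ts) = top_of (run (length ?w) p (input_store ?w) 0)" using * by blast
    \<comment> \<open>A halted machine does not move, so the final tapes do not depend on the time
      at which it is found halted.\<close>
    have "snd (config_at K ?M ?w n) = ts" if h: "halts_within K ?M ?w n" for n
    proof -
      obtain ts' where n: "(step ?M ^^ n) (initial K ?w) = (length ?M, ts')"
        using h by (cases "config_at K ?M ?w n") (auto simp: halts_within_def config_at_def)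
      from steps_trans[OF n step_halted] have "config_at K ?M ?w (n + poly u (length x + length y)) = (length ?M, ts')"
        by (simp add: config_at_def)
      with ts(1) have "ts' = ts" by simp
      with n show ?thesis by (simp add: config_at_def)
    qed
    moreover have "halts_within K ?M ?w (poly u (length x + length y))"
      using ts(1) by (simp add: halts_within_def)
    ultimately show ?thesis using ts(2) unfolding accepts_def by metis
  qed
  have halts: "halts_within K ?M (input_pair x y) (poly u (length x + length y))" for x y
    using *[of x y] by (auto simp: halts_within_def)
  show ?thesis unfolding in_NP_def
    using turing_machine_compile[OF wf_prog C, of K] yes no halts acc
    by (intro exI[of _ K] exI[of _ 4] exI[of _ ?M] exI[of _ r] exI[of _ u]) (auto simp: K_def)
qed

section \<open>Polynomial-time routines: lists, binary arithmetic, evaluation of polynomial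
  inequalities\<close>

section \<open>Basic stack routines\<close>

primrec repeat :: "nat \<Rightarrow> prog \<Rightarrow> prog" where
  "repeat 0 p = Skip"
| "repeat (Suc n) p = p ;; repeat n p"

text \<open>\<open>Loop\<close> makes \<open>L\<close> rounds; intermediate numbers may be longer
  than the input by a constant factor, which is paid for by \<open>f\<close> consecutive copies of
  the loop.\<close>

definition loops :: "nat \<Rightarrow> prog \<Rightarrow> prog" where
  "loops f p = repeat f (Loop p)"

lemma run_loops [simp]: "run L (loops f p) \<sigma> = (run L p ^^ (f * L)) \<sigma>"
proof -
  have "run L (repeat f (Loop p)) \<sigma> = (run L p ^^ (f * L)) \<sigma>"
    by (induction f arbitrary: \<sigma>) (auto simp: funpow_add add.commute[of L])
  then show ?thesis by (simp add: loops_def)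
qed

lemma wf_loops [simp]: "wf_prog (loops f p) \<longleftrightarrow> f = 0 \<or> wf_prog p"
proof -
  have "wf_prog (repeat f (Loop p)) \<longleftrightarrow> f = 0 \<or> wf_prog p" by (induction f) auto
  then show ?thesis by (simp add: loops_def)
qed

text \<open>Loops run longer than their work takes. It is enough that the body does nothing once the
  work is done: the surplus rounds are idle.\<close>

lemma loop_fixed:
  assumes "(run L p ^^ m) \<sigma> = \<tau>" "run L p \<tau> = \<tau>" "m \<le> n"
  shows "(run L p ^^ n) \<sigma> = \<tau>"
proof -
  have "(run L p ^^ k) \<tau> = \<tau>" for k by (induction k) (auto simp: assms(2))
  moreover have "(run L p ^^ n) \<sigma> = (run L p ^^ (n - m)) ((run L p ^^ m) \<sigma>)"
    using assms(3) by (metis comp_apply funpow_add le_add_diff_inverse2)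
  ultimately show ?thesis using assms(1) by simp
qed

lemma loop_step: "run L p \<sigma> = \<tau> \<Longrightarrow> (run L p ^^ n) \<tau> = \<rho> \<Longrightarrow> (run L p ^^ Suc n) \<sigma> = \<rho>"
  by (simp add: funpow_Suc_right del: funpow.simps)

lemma loop_idle: "run L p \<sigma> = \<sigma> \<Longrightarrow> (run L p ^^ n) \<sigma> = \<sigma>"
  by (induction n) auto

definition clear :: "nat \<Rightarrow> nat \<Rightarrow> prog" where
  "clear f i = loops f (Pop i)"

lemma run_clear:
  assumes "length (\<sigma> i) \<le> f * L"
  shows "run L (clear f i) \<sigma> = \<sigma>(i := [])"
proof -
  have "(run L (Pop i) ^^ n) \<sigma> = \<sigma>(i := drop n (\<sigma> i))" for n
    by (induction n) (auto simp: drop_Suc tl_drop)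
  with assms show ?thesis by (simp add: clear_def)
qed

lemma wf_clear [simp]: "wf_prog (clear f i)" by (simp add: clear_def)

definition symbols :: "nat list \<Rightarrow> bool" where
  "symbols xs \<longleftrightarrow> set xs \<subseteq> {1..3}"

lemma symbols_simps [simp]:
  "symbols []" "symbols (x # xs) \<longleftrightarrow> (x = 1 \<or> x = 2 \<or> x = 3) \<and> symbols xs"
  "symbols (xs @ ys) \<longleftrightarrow> symbols xs \<and> symbols ys" "symbols (rev xs) \<longleftrightarrow> symbols xs"
  by (auto simp: symbols_def)

lemma symbols_tl: "symbols xs \<Longrightarrow> symbols (tl xs)" by (cases xs) auto

definition move :: "nat \<Rightarrow> nat \<Rightarrow> nat \<Rightarrow> prog" where
  "move f i j = loops f (Case i Skip (Pop i ;; Push j 1) (Pop i ;; Push j 2) (Pop i ;; Push j 3))"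

lemma run_move:
  assumes "i \<noteq> j" "symbols (\<sigma> i)" "length (\<sigma> i) \<le> f * L"
  shows "run L (move f i j) \<sigma> = \<sigma>(i := [], j := rev (\<sigma> i) @ \<sigma> j)"
proof -
  let ?b = "Case i Skip (Pop i ;; Push j 1) (Pop i ;; Push j 2) (Pop i ;; Push j 3)"
  have "(run L ?b ^^ length xs) (\<sigma>(i := xs, j := ys)) = \<sigma>(i := [], j := rev xs @ ys)"
    if "symbols xs" for xs ys
    using that
  proof (induction xs arbitrary: ys)
    case (Cons x xs)
    have "run L ?b (\<sigma>(i := x # xs, j := ys)) = \<sigma>(i := xs, j := x # ys)"
      using Cons.prems assms(1) by (auto simp: fun_eq_iff)
    from loop_step[OF this Cons.IH] Cons.prems show ?case
      by (simp only: length_Cons rev.simps append_assoc append_Cons append_Nil symbols_simps)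
  qed simp
  from this[OF assms(2), of "\<sigma> j"] show ?thesis
    unfolding move_def run_loops fun_upd_triv by (rule loop_fixed) (use assms in auto)
qed

lemma wf_move [simp]: "wf_prog (move f i j)" by (simp add: move_def)

text \<open>Moving reverses a stack; passing through \<open>t\<close> and back to both targets
  reverses it twice.\<close>

definition copy :: "nat \<Rightarrow> nat \<Rightarrow> nat \<Rightarrow> nat \<Rightarrow> prog" where
  "copy f i j t = move f i t ;;
     loops f (Case t Skip (Pop t ;; Push i 1 ;; Push j 1) (Pop t ;; Push i 2 ;; Push j 2)
                          (Pop t ;; Push i 3 ;; Push j 3))"

lemma run_copy:
  assumes "i \<noteq> j" "i \<noteq> t" "j \<noteq> t" "symbols (\<sigma> i)" "length (\<sigma> i) \<le> f * L" "\<sigma> t = []"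
  shows "run L (copy f i j t) \<sigma> = \<sigma>(j := \<sigma> i @ \<sigma> j)"
proof -
  let ?b = "Case t Skip (Pop t ;; Push i 1 ;; Push j 1) (Pop t ;; Push i 2 ;; Push j 2)
                          (Pop t ;; Push i 3 ;; Push j 3)"
  have *: "(run L ?b ^^ length xs) (\<sigma>(t := xs, i := ys, j := zs)) =
      \<sigma>(t := [], i := rev xs @ ys, j := rev xs @ zs)"
    if "symbols xs" for xs ys zs
    using that
  proof (induction xs arbitrary: ys zs)
    case (Cons x xs)
    have "run L ?b (\<sigma>(t := x # xs, i := ys, j := zs)) = \<sigma>(t := xs, i := x # ys, j := x # zs)"
      using Cons.prems assms(1-3) by (auto simp: fun_eq_iff)
    from loop_step[OF this Cons.IH] Cons.prems show ?case
      by (simp only: length_Cons rev.simps append_assoc append_Cons append_Nil symbols_simps)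
  qed simp
  have 1: "run L (move f i t) \<sigma> = \<sigma>(t := rev (\<sigma> i), i := [], j := \<sigma> j)"
    using assms by (subst run_move) auto
  have 2: "(run L ?b ^^ (f * L)) (\<sigma>(t := rev (\<sigma> i), i := [], j := \<sigma> j)) = \<sigma>(t := [], i := \<sigma> i, j := \<sigma> i @ \<sigma> j)"
    by (rule loop_fixed[OF *[of "rev (\<sigma> i)" "[]" "\<sigma> j", simplified rev_rev_ident append_Nil2]])
       (use assms in auto)
  show ?thesis
    unfolding copy_def run.simps(4) 1 run_loops 2 using assms by auto
qed

lemma wf_copy [simp]: "wf_prog (copy f i j t)" by (simp add: copy_def)

text \<open>A flag is the empty stack or \<open>[1]\<close>. Raising it again changes nothing, so
  failures can be recorded any number of times.\<close>

definition raise :: "nat \<Rightarrow> prog" where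
  "raise i = Case i (Push i 1) Skip Skip Skip"

lemma run_raise: "symbols (\<sigma> i) \<Longrightarrow> run L (raise i) \<sigma> = (if \<sigma> i = [] then \<sigma>(i := [1]) else \<sigma>)"
  by (cases "\<sigma> i") (auto simp: raise_def)

lemma wf_raise [simp]: "wf_prog (raise i)" by (simp add: raise_def)

text \<open>Both arguments are consumed, and any difference raises the flag \<open>k\<close>. A
  missing symbol counts as a difference, and popping the shorter stack beyond its end does no
  harm.\<close>

definition equal :: "nat \<Rightarrow> nat \<Rightarrow> nat \<Rightarrow> nat \<Rightarrow> prog" where
  "equal f i j k =
     (let eq = Pop i ;; Pop j; neq = Pop i ;; Pop j ;; raise k
      in loops f (Case i (Case j Skip neq neq neq) (Case j neq eq neq neq)
                         (Case j neq neq eq neq) (Case j neq neq neq eq)))"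

lemma run_equal:
  assumes "i \<noteq> j" "i \<noteq> k" "j \<noteq> k" "symbols (\<sigma> i)" "symbols (\<sigma> j)"
    "length (\<sigma> i) \<le> f * L" "length (\<sigma> j) \<le> f * L" "\<sigma> k = []"
  shows "run L (equal f i j k) \<sigma> = \<sigma>(i := [], j := [], k := (if \<sigma> i = \<sigma> j then [] else [1]))"
proof -
  let ?neq = "Pop i ;; Pop j ;; raise k"
  let ?b = "Case i (Case j Skip ?neq ?neq ?neq) (Case j ?neq (Pop i ;; Pop j) ?neq ?neq)
        (Case j ?neq ?neq (Pop i ;; Pop j) ?neq) (Case j ?neq ?neq ?neq (Pop i ;; Pop j))"
  have neq: "run L ?neq (\<sigma>(i := xs, j := ys, k := zs)) = \<sigma>(i := tl xs, j := tl ys, k := [1])"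
    if "zs = [] \<or> zs = [1]" for xs ys zs
    using that assms(1-3) by (auto simp: raise_def fun_eq_iff)
  have eq: "run L (Pop i ;; Pop j) (\<sigma>(i := xs, j := ys, k := zs)) = \<sigma>(i := tl xs, j := tl ys, k := zs)"
    for xs ys zs
    using assms(1-3) by (auto simp: fun_eq_iff)
  have *: "(run L ?b ^^ n) (\<sigma>(i := xs, j := ys, k := zs)) =
      \<sigma>(i := [], j := [], k := (if xs = ys then zs else [1]))"
    if "symbols xs" "symbols ys" "n = max (length xs) (length ys)" "zs = [] \<or> zs = [1]" for xs ys zs n
    using that
  proof (induction n arbitrary: xs ys zs)
    case 0
    then show ?case by simp
  next
    case (Suc n)
    let ?zs = "if top_of xs = top_of ys then zs else [1]"
    have tops: "top_of xs \<le> 3" "top_of ys \<le> 3" "top_of xs \<noteq> 0 \<or> top_of ys \<noteq> 0"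
      using Suc.prems by (cases xs; cases ys; auto)+
    have "run L ?b (\<sigma>(i := xs, j := ys, k := zs)) =
        (if top_of xs = top_of ys then run L (Pop i ;; Pop j) (\<sigma>(i := xs, j := ys, k := zs))
         else run L ?neq (\<sigma>(i := xs, j := ys, k := zs)))"
    proof -
      define S where "S = \<sigma>(i := xs, j := ys, k := zs)"
      have "S i = xs" "S j = ys" using assms(1-3) by (auto simp: S_def)
      with tops show ?thesis unfolding S_def[symmetric] by (auto simp del: run.simps(3,4))
    qed
    also have "\<dots> = \<sigma>(i := tl xs, j := tl ys, k := ?zs)"
      using neq[OF Suc.prems(4)] eq by presburger
    finally have st: "run L ?b (\<sigma>(i := xs, j := ys, k := zs)) = \<sigma>(i := tl xs, j := tl ys, k := ?zs)" .
    have rest: "(run L ?b ^^ n) (\<sigma>(i := tl xs, j := tl ys, k := ?zs)) =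
        \<sigma>(i := [], j := [], k := (if tl xs = tl ys then ?zs else [1]))"
      by (rule Suc.IH) (use Suc.prems symbols_tl in auto)
    have "(if tl xs = tl ys then ?zs else [1]) = (if xs = ys then zs else [1])"
      using Suc.prems by (cases xs; cases ys) auto
    with loop_step[OF st rest] show ?case by (simp only:)
  qed
  have "(run L ?b ^^ max (length (\<sigma> i)) (length (\<sigma> j))) \<sigma> =
      \<sigma>(i := [], j := [], k := (if \<sigma> i = \<sigma> j then [] else [1]))"
  proof -
    have eq: "\<sigma>(i := \<sigma> i, j := \<sigma> j, k := []) = \<sigma>"
      using assms(8) by (metis fun_upd_triv)
    show ?thesis by (rule *[OF assms(4,5) refl disjI1[OF refl], unfolded eq])
  qed
  then show ?thesis
    unfolding equal_def Let_def run_loops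
    by (rule loop_fixed) (use assms in auto)
qed

lemma wf_equal [simp]: "wf_prog (equal f i j k)" by (simp add: equal_def Let_def)

text \<open>The parser for the self-delimiting codes: 2 announces a digit, any other symbol ends the
  field and is consumed with it. A truncated field is cut off, so that reading is total on malformed
  input.\<close>

fun read_field :: "nat list \<Rightarrow> nat list \<times> nat list" where
  "read_field [] = ([], [])"
| "read_field [s] = ([], [])"
| "read_field (s # b # r) =
     (if s = 2 then (b # fst (read_field r), snd (read_field r)) else ([], b # r))"

lemma symbols_read_field:
  "symbols xs \<Longrightarrow> symbols (fst (read_field xs)) \<and> symbols (snd (read_field xs))"
  by (induction xs rule: read_field.induct) auto

lemma length_read_field: "length (fst (read_field xs)) + length (snd (read_field xs)) \<le> length xs"
  by (induction xs rule: read_field.induct) auto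

definition read :: "nat \<Rightarrow> nat \<Rightarrow> nat \<Rightarrow> prog" where
  "read i t j =
     Loop (Case i Skip Skip
       (Pop i ;; Case i Skip (Pop i ;; Push t 1) (Pop i ;; Push t 2) (Pop i ;; Push t 3)) Skip) ;;
     Pop i ;; move 1 t j"

lemma run_read:
  assumes "i \<noteq> t" "i \<noteq> j" "t \<noteq> j" "symbols (\<sigma> i)" "length (\<sigma> i) \<le> L" "\<sigma> t = []"
  shows "run L (read i t j) \<sigma> = \<sigma>(i := snd (read_field (\<sigma> i)), j := fst (read_field (\<sigma> i)) @ \<sigma> j)"
proof -
  let ?b = "Case i Skip Skip
       (Pop i ;; Case i Skip (Pop i ;; Push t 1) (Pop i ;; Push t 2) (Pop i ;; Push t 3)) Skip"
  have fixed: "run L ?b S = S" if "top_of (S i) \<noteq> 2" for S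
    using that by simp
  \<comment> \<open>The loop stops in front of the end marker and idles there. The marker is popped
    only afterwards, since otherwise the surplus rounds would go on into the next field.\<close>
  have loop: "\<exists>r. tl r = snd (read_field xs) \<and> top_of r \<noteq> 2 \<and>
     (run L ?b ^^ length xs) (\<sigma>(i := xs, t := ys)) = \<sigma>(i := r, t := rev (fst (read_field xs)) @ ys)"
    if "symbols xs" for xs ys
    using that
  proof (induction xs arbitrary: ys rule: read_field.induct)
    case 1
    show ?case by (intro exI[of _ "[]"]) simp
  next
    case (2 s)
    show ?case
    proof (cases "s = 2")
      case True
      then show ?thesis using assms(1) by (intro exI[of _ "[]"]) (auto simp: fun_eq_iff)
    next
      case False
      then show ?thesis using assms(1) by (intro exI[of _ "[s]"]) (auto simp: fun_eq_iff)
    qed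
  next
    case (3 s b r)
    show ?case
    proof (cases "s = 2")
      case True
      then obtain r' where r': "tl r' = snd (read_field r)" "top_of r' \<noteq> 2"
        "(run L ?b ^^ length r) (\<sigma>(i := r, t := b # ys)) = \<sigma>(i := r', t := rev (fst (read_field r)) @ b # ys)"
        using 3 by fastforce
      have st: "run L ?b (\<sigma>(i := s # b # r, t := ys)) = \<sigma>(i := r, t := b # ys)"
        using True "3.prems" assms(1) by (auto simp: fun_eq_iff)
      \<comment> \<open>A round consumes two symbols while the induction counts one round per
        symbol; one idle round makes up the difference.\<close>
      have "(run L ?b ^^ (length r + 1)) (\<sigma>(i := r, t := b # ys)) =
            \<sigma>(i := r', t := rev (fst (read_field r)) @ b # ys)"
        by (rule loop_fixed[OF r'(3)]) (use r'(2) assms(1) in auto)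
      note main = loop_step[OF st this[unfolded Suc_eq_plus1[symmetric]]]
      have field: "fst (read_field (s # b # r)) = b # fst (read_field r)"
        "snd (read_field (s # b # r)) = snd (read_field r)" using True by simp_all
      show ?thesis
        unfolding field length_Cons rev.simps append_assoc append_Cons append_Nil
        using main r'(1,2) by blast
    next
      case False
      then have st: "run L ?b (\<sigma>(i := s # b # r, t := ys)) = \<sigma>(i := s # b # r, t := ys)"
        using assms(1) by (intro fixed) simp
      have field: "fst (read_field (s # b # r)) = []" "snd (read_field (s # b # r)) = b # r"
        using False by simp_all
      have "tl (s # b # r) = b # r" "top_of (s # b # r) \<noteq> 2" using False by simp_all
      then show ?thesis unfolding field rev.simps append_Nil using loop_idle[OF st] by blast
    qed
  qed
  then obtain r where r: "tl r = snd (read_field (\<sigma> i))" "top_of r \<noteq> 2"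
    "(run L ?b ^^ length (\<sigma> i)) (\<sigma>(i := \<sigma> i, t := [])) = \<sigma>(i := r, t := rev (fst (read_field (\<sigma> i))) @ [])"
    using assms(4) by blast
  have "(run L ?b ^^ L) \<sigma> = \<sigma>(i := r, t := rev (fst (read_field (\<sigma> i))))"
  proof -
    have eq: "\<sigma>(i := \<sigma> i, t := []) = \<sigma>" using assms(6) by (metis fun_upd_triv)
    have "(run L ?b ^^ length (\<sigma> i)) \<sigma> = \<sigma>(i := r, t := rev (fst (read_field (\<sigma> i))))"
      using r(3) unfolding eq by simp
    then show ?thesis by (rule loop_fixed) (use r assms in auto)
  qed
  then have 1: "run L (Loop ?b ;; Pop i) \<sigma> =
      \<sigma>(i := snd (read_field (\<sigma> i)), t := rev (fst (read_field (\<sigma> i))))"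
    using r(1) assms(1) by auto
  have "run L (read i t j) \<sigma> = run L (move 1 t j) (run L (Loop ?b ;; Pop i) \<sigma>)"
    by (simp add: read_def)
  also have "\<dots> = \<sigma>(i := snd (read_field (\<sigma> i)), j := fst (read_field (\<sigma> i)) @ \<sigma> j)"
    unfolding 1 using assms symbols_read_field[OF assms(4)] length_read_field[of "\<sigma> i"]
    by (subst run_move) auto
  finally show ?thesis .
qed

lemma wf_read [simp]: "wf_prog (read i t j)" by (simp add: read_def)



section \<open>Binary arithmetic on stacks\<close>

text \<open>Everything but 2 counts as the digit 0. In particular the value 0 of an exhausted stack
  does, which pads the shorter of two numbers.\<close>

definition bit_value :: "nat \<Rightarrow> nat" where
  "bit_value s = (if s = 2 then 1 else 0)"

text \<open>The least significant digit is on top of the stack; the symbol 2 is the digit 1.\<close>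
primrec num :: "nat list \<Rightarrow> nat" where
  "num [] = 0"
| "num (s # xs) = bit_value s + 2 * num xs"

lemma num_tl: "num xs = bit_value (top_of xs) + 2 * num (tl xs)"
  by (cases xs) (auto simp: bit_value_def)

lemma bit_value_le: "bit_value s \<le> 1" by (simp add: bit_value_def)

function plus_list :: "nat list \<Rightarrow> nat list \<Rightarrow> bool \<Rightarrow> nat list" where
  "plus_list xs ys c =
     (if xs = [] \<and> ys = [] \<and> \<not> c then []
      else let s = bit_value (top_of xs) + bit_value (top_of ys) + of_bool c
           in (1 + s mod 2) # plus_list (tl xs) (tl ys) (s \<ge> 2))"
  by auto
termination
\<comment> \<open>Once both lists are exhausted the digit sum is the carry alone, so the next carry
  is 0 and the measure still drops.\<close>
proof (relation "measure (\<lambda>(xs, ys, c). length xs + length ys + of_bool c)", goal_cases)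
  case (2 xs ys c x)
  then show ?case by (cases xs; cases ys; cases c) (auto simp: bit_value_def)
qed simp

declare plus_list.simps [simp del]

lemma plus_list_Nil: "plus_list [] [] False = []"
  by (simp add: plus_list.simps)

lemma plus_list_step:
  assumes "s = bit_value (top_of xs) + bit_value (top_of ys) + of_bool c" "xs \<noteq> [] \<or> ys \<noteq> [] \<or> c"
  shows "plus_list xs ys c = (1 + s mod 2) # plus_list (tl xs) (tl ys) (s \<ge> 2)"
proof -
  have "\<not> (xs = [] \<and> ys = [] \<and> \<not> c)" using assms(2) by blast
  then show ?thesis by (subst plus_list.simps) (simp only: if_False Let_def assms(1))
qed

lemma plus_list_cases:
  obtains "xs = []" "ys = []" "\<not> c" "plus_list xs ys c = []"
  | s where "s = bit_value (top_of xs) + bit_value (top_of ys) + of_bool c" "xs \<noteq> [] \<or> ys \<noteq> [] \<or> c"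
      "plus_list xs ys c = (1 + s mod 2) # plus_list (tl xs) (tl ys) (s \<ge> 2)"
proof (cases "xs = [] \<and> ys = [] \<and> \<not> c")
  case True
  then show ?thesis using plus_list_Nil that(1) by simp
next
  case False
  then have "xs \<noteq> [] \<or> ys \<noteq> [] \<or> c" by blast
  from that(2)[OF refl this plus_list_step[OF refl this]] show ?thesis .
qed

lemma bit_value_digit: "bit_value (1 + n mod 2) = n mod 2"
  by (simp add: bit_value_def)

lemma num_plus_list: "num (plus_list xs ys c) = num xs + num ys + of_bool c"
proof (induction xs ys c rule: plus_list.induct)
  case (1 xs ys c)
  show ?case
  proof (cases xs ys c rule: plus_list_cases)
    case 1
    then show ?thesis by simp
  next
    case (2 s)
    then have "\<not> (xs = [] \<and> ys = [] \<and> \<not> c)" by blast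
    from 1[OF this 2(1)]
    have "num (plus_list xs ys c) = s mod 2 + 2 * (num (tl xs) + num (tl ys) + of_bool (s \<ge> 2))"
      unfolding 2(3) num.simps bit_value_digit by simp
    moreover have "s mod 2 + 2 * of_bool (s \<ge> 2) = s"
    proof -
      have "s \<le> 3" using 2(1) bit_value_le[of "top_of xs"] bit_value_le[of "top_of ys"] by (cases c) simp_all
      then have "s \<in> {0, 1, 2, 3}" by auto
      then show ?thesis by auto
    qed
    ultimately show ?thesis using 2(1) num_tl[of xs] num_tl[of ys] by simp
  qed
qed

lemma length_plus_list: "length (plus_list xs ys c) \<le> Suc (max (length xs) (length ys))"
proof (induction xs ys c rule: plus_list.induct)
  case (1 xs ys c)
  show ?case
  proof (cases xs ys c rule: plus_list_cases)
    case 1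
    then show ?thesis by simp
  next
    case (2 s)
    then have "\<not> (xs = [] \<and> ys = [] \<and> \<not> c)" by blast
    from 1[OF this 2(1)] have *: "length (plus_list xs ys c) \<le> Suc (Suc (max (length (tl xs)) (length (tl ys))))"
      unfolding 2(3) by simp
    show ?thesis
    proof (cases "xs = [] \<and> ys = []")
      case True
      then have "s \<le> 1" using 2(1) by (cases c) (auto simp: bit_value_def)
      then have "\<not> s \<ge> 2" by simp
      then show ?thesis unfolding 2(3) using True by (simp add: plus_list_Nil)
    next
      case False
      then have "Suc (max (length (tl xs)) (length (tl ys))) = max (length xs) (length ys)"
        by (cases xs; cases ys) auto
      with * show ?thesis by simp
    qed
  qed
qed

lemma digit_cases: "1 + n mod 2 = 1 \<or> 1 + n mod 2 = (2::nat)"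
  by presburger

lemma symbols_plus_list: "symbols (plus_list xs ys c)"
proof (induction xs ys c rule: plus_list.induct)
  case (1 xs ys c)
  show ?case
  proof (cases xs ys c rule: plus_list_cases)
    case 1
    then show ?thesis by simp
  next
    case (2 s)
    then have "\<not> (xs = [] \<and> ys = [] \<and> \<not> c)" by blast
    from 1[OF this 2(1)] digit_cases show ?thesis
      unfolding 2(3) symbols_simps by blast
  qed
qed

text \<open>The carry is kept on stack \<open>i + 3\<close>, the sum is first built in reverse on stack \<open>i + 2\<close>.\<close>
definition plus_act :: "nat \<Rightarrow> nat \<Rightarrow> nat \<Rightarrow> nat \<Rightarrow> prog" where
  "plus_act i x y c =
     (if x = 0 \<and> y = 0 \<and> c = 0 then Skip
      else let s = bit_value x + bit_value y + bit_value c
           in Pop i ;; Pop (i + 1) ;; Pop (i + 3) ;; Push (i + 2) (1 + s mod 2) ;;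
              (if s \<ge> 2 then Push (i + 3) 2 else Skip))"

text \<open>A program can branch only on the top of a stack; the three nested distinctions tabulate
  the digit sum over the two digits and the carry.\<close>

definition plus :: "nat \<Rightarrow> nat \<Rightarrow> prog" where
  "plus f i =
     (let third = (\<lambda>x y. Case (i + 3) (plus_act i x y 0) (plus_act i x y 1) (plus_act i x y 2) (plus_act i x y 3));
          second = (\<lambda>x. Case (i + 1) (third x 0) (third x 1) (third x 2) (third x 3))
      in loops f (Case i (second 0) (second 1) (second 2) (second 3)) ;; move f (i + 2) i)"

lemma wf_plus [simp]: "wf_prog (plus f i)"
proof -
  have "1 + n mod 2 \<le> (3::nat)" for n by presburger
  then have "wf_prog (plus_act i x y c)" for x y c
    by (simp add: plus_act_def Let_def)
  then show ?thesis by (simp add: plus_def Let_def)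
qed

lemma run_Case4:
  assumes "top_of (\<sigma> i) \<le> 3"
  shows "run L (Case i (p 0) (p 1) (p 2) (p 3)) \<sigma> = run L (p (top_of (\<sigma> i))) \<sigma>"
proof -
  have "top_of (\<sigma> i) \<in> {0, 1, 2, 3}" using assms by auto
  then show ?thesis by auto
qed

lemma top_of_symbols: "symbols xs \<Longrightarrow> top_of xs \<le> 3"
  by (cases xs) auto

text \<open>The strict bound leaves a round in which a last carry becomes a digit of its
  own.\<close>

lemma run_plus:
  assumes "symbols (\<sigma> i)" "symbols (\<sigma> (i + 1))" "\<sigma> (i + 2) = []" "\<sigma> (i + 3) = []"
    "max (length (\<sigma> i)) (length (\<sigma> (i + 1))) < f * L"
  shows "run L (plus f i) \<sigma> = \<sigma>(i := plus_list (\<sigma> i) (\<sigma> (i + 1)) False, i + 1 := [])"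
proof -
  let ?third = "\<lambda>x y. Case (i + 3) (plus_act i x y 0) (plus_act i x y 1) (plus_act i x y 2) (plus_act i x y 3)"
  let ?second = "\<lambda>x. Case (i + 1) (?third x 0) (?third x 1) (?third x 2) (?third x 3)"
  let ?b = "Case i (?second 0) (?second 1) (?second 2) (?second 3)"
  let ?S = "\<lambda>xs ys zs c. \<sigma>(i := xs, i + 1 := ys, i + 2 := zs, i + 3 := (if c then [2] else []))"
  have step: "run L ?b (?S xs ys zs c) = run L (plus_act i (top_of xs) (top_of ys) (if c then 2 else 0)) (?S xs ys zs c)"
    if "symbols xs" "symbols ys" for xs ys zs c
    by (subst run_Case4[where p = ?second], use that top_of_symbols in simp,
        subst run_Case4[where p = "?third _"], use that top_of_symbols in simp,
        subst run_Case4[where p = "plus_act i _ _"]) (use that top_of_symbols in auto)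
  have act: "run L (plus_act i (top_of xs) (top_of ys) (if c then 2 else 0)) (?S xs ys zs c) =
      ?S (tl xs) (tl ys) ((1 + s mod 2) # zs) (s \<ge> 2)"
    if "s = bit_value (top_of xs) + bit_value (top_of ys) + of_bool c" "xs \<noteq> [] \<or> ys \<noteq> [] \<or> c"
      "symbols xs" "symbols ys" for xs ys zs c s
  proof -
    have "bit_value (if c then 2 else 0) = of_bool c" by (simp add: bit_value_def)
    moreover have "\<not> (top_of xs = 0 \<and> top_of ys = 0 \<and> (if c then 2 else 0) = (0::nat))"
      using that by (cases xs; cases ys) auto
    ultimately have "plus_act i (top_of xs) (top_of ys) (if c then 2 else 0) =
        Pop i ;; Pop (i + 1) ;; Pop (i + 3) ;; Push (i + 2) (1 + s mod 2) ;;
              (if s \<ge> 2 then Push (i + 3) 2 else Skip)"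
      unfolding plus_act_def Let_def by (simp only: that(1) if_False)
    then show ?thesis by (cases "s \<ge> 2") (auto simp: fun_eq_iff)
  qed
  have *: "(run L ?b ^^ length (plus_list xs ys c)) (?S xs ys zs c) = ?S [] [] (rev (plus_list xs ys c) @ zs) False"
    if "symbols xs" "symbols ys" for xs ys zs c
    using that
  proof (induction xs ys c arbitrary: zs rule: plus_list.induct)
    case (1 xs ys c)
    show ?case
    proof (cases xs ys c rule: plus_list_cases)
      case 1
      then show ?thesis by simp
    next
      case (2 s)
      then have "\<not> (xs = [] \<and> ys = [] \<and> \<not> c)" by blast
      note IH = 1(1)[OF this 2(1) symbols_tl[OF 1(2)] symbols_tl[OF 1(3)]]
      show ?thesis
        unfolding 2(3) length_Cons rev.simps append_assoc append_Cons append_Nil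
        by (rule loop_step[OF _ IH]) (simp only: step[OF 1(2,3)] act[OF 2(1,2) 1(2,3)])
    qed
  qed
  let ?r = "plus_list (\<sigma> i) (\<sigma> (i + 1)) False"
  have len: "length ?r \<le> f * L" using length_plus_list assms(5) by (meson Suc_leI order_trans)
  have init: "?S (\<sigma> i) (\<sigma> (i + 1)) [] False = \<sigma>" using assms(3,4) by (auto simp: fun_eq_iff)
  have "(run L ?b ^^ (f * L)) \<sigma> = ?S [] [] (rev ?r) False"
  proof (rule loop_fixed[OF _ _ len])
    show "(run L ?b ^^ length ?r) \<sigma> = ?S [] [] (rev ?r) False"
      using *[OF assms(1,2), of False "[]"] unfolding init by simp
    show "run L ?b (?S [] [] (rev ?r) False) = ?S [] [] (rev ?r) False"
      using step[of "[]" "[]" "rev ?r" False] by (simp add: plus_act_def del: run.simps(5))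
  qed
  then have "run L (plus f i) \<sigma> = run L (move f (i + 2) i) (?S [] [] (rev ?r) False)"
    by (simp add: plus_def Let_def del: run.simps(5))
  also have "\<dots> = (?S [] [] (rev ?r) False)(i + 2 := [], i := rev (?S [] [] (rev ?r) False (i + 2)) @ [])"
    by (subst run_move) (use len symbols_plus_list in auto)
  also have "\<dots> = \<sigma>(i := ?r, i + 1 := [])" using assms(3,4) by (auto simp: fun_eq_iff)
  finally show ?thesis .
qed

primrec times_list :: "nat list \<Rightarrow> nat list \<Rightarrow> nat list" where
  "times_list [] ys = []"
| "times_list (x # xs) ys =
     (if x = 2 then plus_list (1 # times_list xs ys) ys False else 1 # times_list xs ys)"

lemma num_times_list: "num (times_list xs ys) = num xs * num ys"
  by (induction xs) (auto simp: num_plus_list bit_value_def algebra_simps)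

lemma symbols_times_list: "symbols (times_list xs ys)"
  by (induction xs) (auto simp: symbols_plus_list)

text \<open>Each digit of the multiplier adds at most two places, one for the doubling and one for
  the carry of the addition.\<close>

lemma length_times_list: "length (times_list xs ys) \<le> length ys + 2 * length xs"
proof (induction xs)
  case (Cons x xs)
  then show ?case using length_plus_list[of "1 # times_list xs ys" ys False] by auto
qed simp

text \<open>Horner's scheme: pushing the digit 0 doubles the accumulator on stack \<open>i + 3\<close>.\<close>
definition times :: "nat \<Rightarrow> nat \<Rightarrow> prog" where
  "times f i = move f i (i + 2) ;;
     loops f (Case (i + 2) Skip
       (Pop (i + 2) ;; Push (i + 3) 1)
       (Pop (i + 2) ;; Push (i + 3) 1 ;; copy f (i + 1) (i + 4) (i + 5) ;; plus f (i + 3))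
       (Pop (i + 2) ;; Push (i + 3) 1)) ;;
     clear f (i + 1) ;; move f (i + 3) (i + 2) ;; move f (i + 2) i"

lemma wf_times [simp]: "wf_prog (times f i)" by (simp add: times_def)

lemma run_times:
  assumes "symbols (\<sigma> i)" "symbols (\<sigma> (i + 1))" "\<forall>j \<ge> i + 2. \<sigma> j = []"
    "length (\<sigma> (i + 1)) + 2 * length (\<sigma> i) < f * L"
  shows "run L (times f i) \<sigma> = \<sigma>(i := times_list (\<sigma> i) (\<sigma> (i + 1)), i + 1 := [])"
proof -
  let ?ys = "\<sigma> (i + 1)"
  let ?zero = "Pop (i + 2) ;; Push (i + 3) 1"
  let ?one = "Pop (i + 2) ;; Push (i + 3) 1 ;; copy f (i + 1) (i + 4) (i + 5) ;; plus f (i + 3)"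
  let ?b = "Case (i + 2) Skip ?zero ?one ?zero"
  let ?S = "\<lambda>rs acc. \<sigma>(i := [], i + 2 := rs, i + 3 := acc)"
  have tops: "\<sigma> j = []" if "j \<ge> i + 2" for j using assms(3) that by blast
  have zero: "run L ?zero (?S (r # rs) acc) = ?S rs (1 # acc)" for r rs acc
    by (auto simp: fun_eq_iff)
  have one: "run L ?one (?S (r # rs) acc) = ?S rs (plus_list (1 # acc) ?ys False)"
    if "symbols acc" "Suc (length acc) < f * L" for r rs acc
  proof -
    have 1: "run L (copy f (i + 1) (i + 4) (i + 5)) (?S rs (1 # acc)) = (?S rs (1 # acc))(i + 4 := ?ys)"
      by (subst run_copy) (use assms(2,4) tops in \<open>auto simp: fun_eq_iff\<close>)
    have 2: "run L (plus f (i + 3)) ((?S rs (1 # acc))(i + 4 := ?ys)) =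
      ((?S rs (1 # acc))(i + 4 := ?ys))(i + 3 := plus_list (1 # acc) ?ys False, i + 4 := [])"
      by (subst run_plus) (use assms(2,4) tops that in \<open>auto simp: eval_nat_numeral\<close>)
    have "run L ?one (?S (r # rs) acc) = ((?S rs (1 # acc))(i + 4 := ?ys))(i + 3 := plus_list (1 # acc) ?ys False, i + 4 := [])"
      using zero 1 2 by (simp only: run.simps(4))
    also have "\<dots> = ?S rs (plus_list (1 # acc) ?ys False)"
      using tops[of "i + 4"] by (auto simp: fun_eq_iff)
    finally show ?thesis .
  qed
  have loop: "(run L ?b ^^ length rs) (?S rs (times_list zs ?ys)) = ?S [] (times_list (rev rs @ zs) ?ys)"
    if "symbols rs" "length ?ys + 2 * (length rs + length zs) < f * L" for rs zs
    using that
  proof (induction rs arbitrary: zs)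
    case Nil
    then show ?case by simp
  next
    case (Cons r rs)
    have len: "Suc (length (times_list zs ?ys)) < f * L"
      using Cons.prems length_times_list[of zs ?ys] by simp
    have "run L ?b (?S (r # rs) (times_list zs ?ys)) =
        (if r = 2 then run L ?one (?S (r # rs) (times_list zs ?ys))
         else run L ?zero (?S (r # rs) (times_list zs ?ys)))"
      using Cons.prems(1) by (auto simp del: run.simps(1,2,3,4,6) fun_upd_apply simp: fun_upd_same fun_upd_other)
    also have "\<dots> = ?S rs (times_list (r # zs) ?ys)"
      unfolding zero one[OF symbols_times_list len] by simp
    finally have st: "run L ?b (?S (r # rs) (times_list zs ?ys)) = ?S rs (times_list (r # zs) ?ys)" .
    have "(run L ?b ^^ length rs) (?S rs (times_list (r # zs) ?ys)) = ?S [] (times_list (rev rs @ r # zs) ?ys)"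
      by (rule Cons.IH) (use Cons.prems in auto)
    from loop_step[OF st this] show ?case
      by (simp only: length_Cons rev.simps append_assoc append_Cons append_Nil)
  qed
  let ?r = "times_list (\<sigma> i) ?ys"
  have len: "length ?r \<le> f * L" using length_times_list[of "\<sigma> i" ?ys] assms(4) by simp
  have 1: "run L (move f i (i + 2)) \<sigma> = ?S (rev (\<sigma> i)) (times_list [] ?ys)"
    by (subst run_move) (use assms tops in \<open>auto simp: fun_eq_iff\<close>)
  have 2: "(run L ?b ^^ (f * L)) (?S (rev (\<sigma> i)) (times_list [] ?ys)) = ?S [] ?r"
  proof (rule loop_fixed)
    show "(run L ?b ^^ length (rev (\<sigma> i))) (?S (rev (\<sigma> i)) (times_list [] ?ys)) = ?S [] ?r"
      using loop[of "rev (\<sigma> i)" "[]"] assms(1,4) by (simp del: run.simps)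
  qed (use assms(4) in auto)
  have 3: "run L (clear f (i + 1)) (?S [] ?r) = (?S [] ?r)(i + 1 := [])"
    by (subst run_clear) (use assms(4) in auto)
  have 4: "run L (move f (i + 3) (i + 2)) ((?S [] ?r)(i + 1 := [])) =
      \<sigma>(i := [], i + 1 := [], i + 3 := [], i + 2 := rev ?r)"
    by (subst run_move) (use len symbols_times_list in \<open>auto simp: fun_eq_iff\<close>)
  have 5: "run L (move f (i + 2) i) (\<sigma>(i := [], i + 1 := [], i + 3 := [], i + 2 := rev ?r)) =
      \<sigma>(i := ?r, i + 1 := [])"
    by (subst run_move) (use len symbols_times_list tops[of "i + 2"] tops[of "i + 3"] in \<open>auto simp: fun_eq_iff\<close>)
  show ?thesis unfolding times_def run.simps(4) 1 run_loops 2 3 4 5 ..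
qed

text \<open>The least significant digits arrive first: \<open>r\<close> is the verdict on the lower
  digits, and a difference in a higher digit overrules it.\<close>

function less_list :: "nat list \<Rightarrow> nat list \<Rightarrow> bool \<Rightarrow> bool" where
  "less_list xs ys r =
     (if xs = [] \<and> ys = [] then r
      else less_list (tl xs) (tl ys)
        (if bit_value (top_of xs) = bit_value (top_of ys) then r
         else bit_value (top_of xs) < bit_value (top_of ys)))"
  by auto
termination
proof (relation "measure (\<lambda>(xs, ys, c). length xs + length ys)", goal_cases)
  case (2 xs ys r)
  then show ?case by (cases xs; cases ys) auto
qed simp

declare less_list.simps [simp del]

lemma less_digit:
  fixes a b p q :: nat
  assumes "a \<le> 1" "b \<le> 1"
  shows "(p < q \<or> p = q \<and> (if a = b then r else a < b)) \<longleftrightarrow> (a + 2 * p < b + 2 * q \<or> a + 2 * p = b + 2 * q \<and> r)"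
proof (cases "a = b")
  case False
  with assms have "a < b \<and> a + 1 = b \<or> b < a \<and> b + 1 = a" by linarith
  then show ?thesis using False by (elim disjE) (auto | (simp; presburger) | presburger)+
qed simp

lemma less_list_correct: "less_list xs ys r \<longleftrightarrow> num xs < num ys \<or> num xs = num ys \<and> r"
proof (induction xs ys r rule: less_list.induct)
  case (1 xs ys r)
  show ?case
  proof (cases "xs = [] \<and> ys = []")
    case True
    then show ?thesis by (simp add: less_list.simps)
  next
    case False
    have "less_list xs ys r \<longleftrightarrow> less_list (tl xs) (tl ys)
        (if bit_value (top_of xs) = bit_value (top_of ys) then r
         else bit_value (top_of xs) < bit_value (top_of ys))"
      by (subst less_list.simps) (simp only: False if_False)
    also have "\<dots> \<longleftrightarrow> num (tl xs) < num (tl ys) \<or> num (tl xs) = num (tl ys) \<and>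
        (if bit_value (top_of xs) = bit_value (top_of ys) then r
         else bit_value (top_of xs) < bit_value (top_of ys))"
      by (rule 1[OF False])
    also have "\<dots> \<longleftrightarrow> num xs < num ys \<or> num xs = num ys \<and> r"
      unfolding num_tl[of xs] num_tl[of ys] by (rule less_digit[OF bit_value_le bit_value_le])
    finally show ?thesis .
  qed
qed

definition less_act :: "nat \<Rightarrow> nat \<Rightarrow> nat \<Rightarrow> prog" where
  "less_act i x y =
     (if x = 0 \<and> y = 0 then Skip
      else Pop i ;; Pop (i + 1) ;;
        (if bit_value x = bit_value y then Skip
         else Pop (i + 2) ;; Push (i + 2) (if bit_value x < bit_value y then 2 else 1)))"

definition less :: "nat \<Rightarrow> nat \<Rightarrow> prog" where
  "less f i =
     (let second = (\<lambda>x. Case (i + 1) (less_act i x 0) (less_act i x 1) (less_act i x 2) (less_act i x 3))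
      in Push (i + 2) 1 ;; loops f (Case i (second 0) (second 1) (second 2) (second 3)) ;; move f (i + 2) i)"

lemma wf_less [simp]: "wf_prog (less f i)"
proof -
  have "wf_prog (less_act i x y)" for x y by (simp add: less_act_def)
  then show ?thesis by (simp add: less_def Let_def)
qed

definition truth :: "bool \<Rightarrow> nat list" where
  "truth b = [if b then 2 else 1]"

lemma symbols_truth [simp]: "symbols (truth b)" "length (truth b) = 1"
  by (auto simp: truth_def)

lemma run_less:
  assumes "symbols (\<sigma> i)" "symbols (\<sigma> (i + 1))" "\<sigma> (i + 2) = []"
    "max (length (\<sigma> i)) (length (\<sigma> (i + 1))) < f * L"
  shows "run L (less f i) \<sigma> = \<sigma>(i := truth (num (\<sigma> i) < num (\<sigma> (i + 1))), i + 1 := [])"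
proof -
  let ?second = "\<lambda>x. Case (i + 1) (less_act i x 0) (less_act i x 1) (less_act i x 2) (less_act i x 3)"
  let ?b = "Case i (?second 0) (?second 1) (?second 2) (?second 3)"
  let ?S = "\<lambda>xs ys r. \<sigma>(i := xs, i + 1 := ys, i + 2 := truth r)"
  have step: "run L ?b (?S xs ys r) = run L (less_act i (top_of xs) (top_of ys)) (?S xs ys r)"
    if "symbols xs" "symbols ys" for xs ys r
    by (subst run_Case4[where p = ?second], use that top_of_symbols in simp,
        subst run_Case4[where p = "less_act i _"]) (use that top_of_symbols in auto)
  have act: "run L (less_act i (top_of xs) (top_of ys)) (?S xs ys r) =
      ?S (tl xs) (tl ys) (if bit_value (top_of xs) = bit_value (top_of ys) then r
         else bit_value (top_of xs) < bit_value (top_of ys))"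
    if "\<not> (xs = [] \<and> ys = [])" "symbols xs" "symbols ys" for xs ys r
  proof -
    have "\<not> (top_of xs = 0 \<and> top_of ys = 0)"
      using that by (cases xs; cases ys) auto
    then show ?thesis unfolding less_act_def by (auto simp: fun_eq_iff truth_def)
  qed
  have *: "(run L ?b ^^ max (length xs) (length ys)) (?S xs ys r) = ?S [] [] (less_list xs ys r)"
    if "symbols xs" "symbols ys" for xs ys r
    using that
  proof (induction xs ys r rule: less_list.induct)
    case (1 xs ys r)
    show ?case
    proof (cases "xs = [] \<and> ys = []")
      case True
      then show ?thesis by (simp add: less_list.simps)
    next
      case False
      note IH = 1(1)[OF False symbols_tl[OF 1(2)] symbols_tl[OF 1(3)]]
      have len: "max (length xs) (length ys) = Suc (max (length (tl xs)) (length (tl ys)))"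
        using False by (cases xs; cases ys) auto
      have fold: "less_list xs ys r \<longleftrightarrow> less_list (tl xs) (tl ys)
        (if bit_value (top_of xs) = bit_value (top_of ys) then r
         else bit_value (top_of xs) < bit_value (top_of ys))"
        by (subst less_list.simps) (simp only: False if_False)
      show ?thesis
        unfolding len fold
        by (rule loop_step[OF _ IH]) (simp only: step[OF 1(2,3)] act[OF False 1(2,3)])
    qed
  qed
  let ?r = "less_list (\<sigma> i) (\<sigma> (i + 1)) False"
  have init: "run L (Push (i + 2) 1) \<sigma> = ?S (\<sigma> i) (\<sigma> (i + 1)) False"
    using assms(3) by (auto simp: fun_eq_iff truth_def)
  have loop: "(run L ?b ^^ (f * L)) (?S (\<sigma> i) (\<sigma> (i + 1)) False) = ?S [] [] ?r"
  proof (rule loop_fixed[OF *[OF assms(1,2)]])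
    show "run L ?b (?S [] [] ?r) = ?S [] [] ?r"
      using step[of "[]" "[]" ?r] by (simp add: less_act_def del: run.simps(5))
  qed (use assms(4) in auto)
  have fin: "run L (move f (i + 2) i) (?S [] [] ?r) = \<sigma>(i := truth ?r, i + 1 := [])"
  proof -
    have "1 \<le> f * L" using assms(4) by linarith
    then show ?thesis
      by (subst run_move) (use assms(3,4) in \<open>auto simp: fun_eq_iff truth_def\<close>)
  qed
  show ?thesis
    unfolding less_def Let_def run.simps(4) init run_loops loop fin
    by (simp add: less_list_correct)
qed


section \<open>Polynomial inequalities on stacks\<close>

text \<open>Values are natural numbers and there is no subtraction; integers will be represented as
  differences of two expressions.\<close>

datatype expr = Var nat | Zero | One | Add expr expr | Mul expr expr

primrec eval_expr :: "(nat \<Rightarrow> nat) \<Rightarrow> expr \<Rightarrow> nat" where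
  "eval_expr \<rho> (Var j) = \<rho> j"
| "eval_expr \<rho> Zero = 0"
| "eval_expr \<rho> One = 1"
| "eval_expr \<rho> (Add a b) = eval_expr \<rho> a + eval_expr \<rho> b"
| "eval_expr \<rho> (Mul a b) = eval_expr \<rho> a * eval_expr \<rho> b"

primrec expr_vars :: "expr \<Rightarrow> nat" where
  "expr_vars (Var j) = Suc j"
| "expr_vars Zero = 0"
| "expr_vars One = 0"
| "expr_vars (Add a b) = max (expr_vars a) (expr_vars b)"
| "expr_vars (Mul a b) = max (expr_vars a) (expr_vars b)"

text \<open>The value of an expression has at most \<open>expr_size e * l\<close> digits if all variables have at most \<open>l\<close>.\<close>
primrec expr_size :: "expr \<Rightarrow> nat" where
  "expr_size (Var j) = 1"
| "expr_size Zero = 1"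
| "expr_size One = 1"
| "expr_size (Add a b) = expr_size a + expr_size b + 1"
| "expr_size (Mul a b) = 2 * expr_size a + expr_size b"

primrec expr_list :: "(nat \<Rightarrow> nat list) \<Rightarrow> expr \<Rightarrow> nat list" where
  "expr_list \<rho> (Var j) = \<rho> j"
| "expr_list \<rho> Zero = []"
| "expr_list \<rho> One = [2]"
| "expr_list \<rho> (Add a b) = plus_list (expr_list \<rho> a) (expr_list \<rho> b) False"
| "expr_list \<rho> (Mul a b) = times_list (expr_list \<rho> a) (expr_list \<rho> b)"

lemma num_expr_list: "num (expr_list \<rho> e) = eval_expr (\<lambda>j. num (\<rho> j)) e"
  by (induction e) (auto simp: num_plus_list num_times_list bit_value_def)

lemma length_expr_list:
  assumes "1 \<le> l" "\<And>j. j < expr_vars e \<Longrightarrow> length (\<rho> j) \<le> l"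
  shows "length (expr_list \<rho> e) \<le> expr_size e * l"
  using assms(2)
proof (induction e)
  case (Add a b)
  have "length (expr_list \<rho> a) \<le> expr_size a * l" "length (expr_list \<rho> b) \<le> expr_size b * l"
    using Add by auto
  then show ?case using length_plus_list[of "expr_list \<rho> a" "expr_list \<rho> b" False] assms(1)
    by (auto simp: algebra_simps)
next
  case (Mul a b)
  have "length (expr_list \<rho> a) \<le> expr_size a * l" "length (expr_list \<rho> b) \<le> expr_size b * l"
    using Mul by auto
  then show ?case using length_times_list[of "expr_list \<rho> a" "expr_list \<rho> b"]
    by (auto simp: algebra_simps)
qed (use assms(1) in auto)

lemma symbols_expr_list:
  "(\<And>j. j < expr_vars e \<Longrightarrow> symbols (\<rho> j)) \<Longrightarrow> symbols (expr_list \<rho> e)"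
  by (induction e) (auto simp: symbols_plus_list symbols_times_list)

lemma expr_list_cong:
  "(\<And>j. j < expr_vars e \<Longrightarrow> \<rho> j = \<rho>' j) \<Longrightarrow> expr_list \<rho> e = expr_list \<rho>' e"
  by (induction e) auto

text \<open>An evaluation stack: the variables lie from stack \<open>v\<close> on, the value ends on
  stack \<open>i\<close>, and the stacks above \<open>i\<close> are empty before and after.\<close>

primrec expr_prog :: "nat \<Rightarrow> nat \<Rightarrow> expr \<Rightarrow> nat \<Rightarrow> prog" where
  "expr_prog f v (Var j) i = copy f (v + j) i (i + 1)"
| "expr_prog f v Zero i = Skip"
| "expr_prog f v One i = Push i 2"
| "expr_prog f v (Add a b) i = expr_prog f v a i ;; expr_prog f v b (i + 1) ;; plus f i"
| "expr_prog f v (Mul a b) i = expr_prog f v a i ;; expr_prog f v b (i + 1) ;; times f i"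

lemma wf_expr_prog [simp]: "wf_prog (expr_prog f v e i)"
  by (induction e arbitrary: i) auto

lemma run_expr_prog:
  assumes "\<forall>j \<ge> i. \<sigma> j = []" "v + expr_vars e \<le> i" "1 \<le> l"
    "\<forall>j < expr_vars e. symbols (\<sigma> (v + j)) \<and> length (\<sigma> (v + j)) \<le> l" "expr_size e * l < f * L"
  shows "run L (expr_prog f v e i) \<sigma> = \<sigma>(i := expr_list (\<lambda>j. \<sigma> (v + j)) e)"
  using assms
proof (induction e arbitrary: i \<sigma>)
  case (Var j)
  then show ?case by (subst expr_prog.simps, subst run_copy) auto
next
  case Zero
  then show ?case by (auto simp: fun_eq_iff)
next
  case One
  then show ?case by (auto simp: fun_eq_iff)
next
  case (Add a b)
  let ?\<rho> = "\<lambda>j. \<sigma> (v + j)"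
  let ?x = "expr_list ?\<rho> a" and ?y = "expr_list ?\<rho> b"
  have size: "expr_size a * l + expr_size b * l + l < f * L"
    using Add.prems(5) by (simp add: algebra_simps)
  have size': "expr_size a * l < f * L" "expr_size b * l < f * L" using size by linarith+
  have 1: "run L (expr_prog f v a i) \<sigma> = \<sigma>(i := ?x)"
    using size' Add.prems by (intro Add.IH(1)) auto
  have len: "length ?x \<le> expr_size a * l" "length ?y \<le> expr_size b * l"
    using Add.prems by (auto intro!: length_expr_list)
  have "run L (expr_prog f v b (i + 1)) (\<sigma>(i := ?x)) =
      (\<sigma>(i := ?x))(i + 1 := expr_list (\<lambda>j. (\<sigma>(i := ?x)) (v + j)) b)"
    using size' Add.prems by (intro Add.IH(2)) auto
  also have "expr_list (\<lambda>j. (\<sigma>(i := ?x)) (v + j)) b = ?y"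
    using Add.prems(2) by (intro expr_list_cong) auto
  finally have 2: "run L (expr_prog f v b (i + 1)) (\<sigma>(i := ?x)) = \<sigma>(i := ?x, i + 1 := ?y)" .
  have "run L (plus f i) (\<sigma>(i := ?x, i + 1 := ?y)) = \<sigma>(i := plus_list ?x ?y False)"
  proof (subst run_plus)
    show "max (length ((\<sigma>(i := ?x, i + 1 := ?y)) i)) (length ((\<sigma>(i := ?x, i + 1 := ?y)) (i + 1))) < f * L"
      using len size' by simp
  qed (use Add.prems in \<open>auto simp: symbols_expr_list fun_eq_iff\<close>)
  with 1 2 show ?case by simp
next
  case (Mul a b)
  let ?\<rho> = "\<lambda>j. \<sigma> (v + j)"
  let ?x = "expr_list ?\<rho> a" and ?y = "expr_list ?\<rho> b"
  have size: "2 * (expr_size a * l) + expr_size b * l < f * L"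
    using Mul.prems(5) by (simp add: algebra_simps)
  have size': "expr_size a * l < f * L" "expr_size b * l < f * L" using size by linarith+
  have 1: "run L (expr_prog f v a i) \<sigma> = \<sigma>(i := ?x)"
    using size' Mul.prems by (intro Mul.IH(1)) auto
  have len: "length ?x \<le> expr_size a * l" "length ?y \<le> expr_size b * l"
    using Mul.prems by (auto intro!: length_expr_list)
  have "run L (expr_prog f v b (i + 1)) (\<sigma>(i := ?x)) =
      (\<sigma>(i := ?x))(i + 1 := expr_list (\<lambda>j. (\<sigma>(i := ?x)) (v + j)) b)"
    using size' Mul.prems by (intro Mul.IH(2)) auto
  also have "expr_list (\<lambda>j. (\<sigma>(i := ?x)) (v + j)) b = ?y"
    using Mul.prems(2) by (intro expr_list_cong) auto
  finally have 2: "run L (expr_prog f v b (i + 1)) (\<sigma>(i := ?x)) = \<sigma>(i := ?x, i + 1 := ?y)" .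
  have "run L (times f i) (\<sigma>(i := ?x, i + 1 := ?y)) = \<sigma>(i := times_list ?x ?y)"
  proof (subst run_times)
    show "length ((\<sigma>(i := ?x, i + 1 := ?y)) (i + 1)) + 2 * length ((\<sigma>(i := ?x, i + 1 := ?y)) i) < f * L"
      using len size by simp
  qed (use Mul.prems in \<open>auto simp: symbols_expr_list fun_eq_iff\<close>)
  with 1 2 show ?case by simp
qed

datatype form = Less expr expr | Conj form form | Disj form form

primrec eval_form :: "(nat \<Rightarrow> nat) \<Rightarrow> form \<Rightarrow> bool" where
  "eval_form \<rho> (Less a b) \<longleftrightarrow> eval_expr \<rho> a < eval_expr \<rho> b"
| "eval_form \<rho> (Conj p q) \<longleftrightarrow> eval_form \<rho> p \<and> eval_form \<rho> q"
| "eval_form \<rho> (Disj p q) \<longleftrightarrow> eval_form \<rho> p \<or> eval_form \<rho> q"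

primrec form_vars :: "form \<Rightarrow> nat" where
  "form_vars (Less a b) = max (expr_vars a) (expr_vars b)"
| "form_vars (Conj p q) = max (form_vars p) (form_vars q)"
| "form_vars (Disj p q) = max (form_vars p) (form_vars q)"

primrec form_size :: "form \<Rightarrow> nat" where
  "form_size (Less a b) = max (expr_size a) (expr_size b)"
| "form_size (Conj p q) = max (form_size p) (form_size q)"
| "form_size (Disj p q) = max (form_size p) (form_size q)"

primrec form_prog :: "nat \<Rightarrow> nat \<Rightarrow> form \<Rightarrow> nat \<Rightarrow> prog" where
  "form_prog f v (Less a b) i = expr_prog f v a i ;; expr_prog f v b (i + 1) ;; less f i"
| "form_prog f v (Conj p q) i = form_prog f v p i ;; form_prog f v q (i + 1) ;;
     Case i Skip (Pop (i + 1)) (Pop i ;; move f (i + 1) i) Skip"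
| "form_prog f v (Disj p q) i = form_prog f v p i ;; form_prog f v q (i + 1) ;;
     Case i Skip (Pop i ;; move f (i + 1) i) (Pop (i + 1)) Skip"

lemma wf_form_prog [simp]: "wf_prog (form_prog f v p i)"
  by (induction p arbitrary: i) auto

lemma eval_expr_cong: "(\<And>j. j < expr_vars e \<Longrightarrow> \<rho> j = \<rho>' j) \<Longrightarrow> eval_expr \<rho> e = eval_expr \<rho>' e"
  by (induction e) auto

lemma eval_form_cong: "(\<And>j. j < form_vars p \<Longrightarrow> \<rho> j = \<rho>' j) \<Longrightarrow> eval_form \<rho> p = eval_form \<rho>' p"
  by (induction p) (auto cong: eval_expr_cong)

lemma run_form_prog:
  assumes "\<forall>j \<ge> i. \<sigma> j = []" "v + form_vars p \<le> i" "1 \<le> l"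
    "\<forall>j < form_vars p. symbols (\<sigma> (v + j)) \<and> length (\<sigma> (v + j)) \<le> l" "form_size p * l < f * L"
  shows "run L (form_prog f v p i) \<sigma> = \<sigma>(i := truth (eval_form (\<lambda>j. num (\<sigma> (v + j))) p))"
proof -
  have fL: "1 \<le> f * L" using assms(5) by linarith
  \<comment> \<open>The truth values are the symbols 1 and 2, so the top of stack \<open>i\<close>
    decides which of the two verdicts is dropped.\<close>
  have combine: "run L (Case i Skip (Pop (i + 1)) (Pop i ;; move f (i + 1) i) Skip)
        (\<sigma>(i := truth x, i + 1 := truth y)) = \<sigma>(i := truth (x \<and> y))"
      "run L (Case i Skip (Pop i ;; move f (i + 1) i) (Pop (i + 1)) Skip)
        (\<sigma>(i := truth x, i + 1 := truth y)) = \<sigma>(i := truth (x \<or> y))"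
    if "\<forall>j \<ge> i. \<sigma> j = []" for x y i and \<sigma> :: store
  proof -
    have 1: "run L (Pop i ;; move f (i + 1) i) (\<sigma>(i := truth x, i + 1 := truth y)) = \<sigma>(i := truth y)" for x y
      by (simp only: run.simps, subst run_move) (use fL that in \<open>auto simp: fun_eq_iff truth_def\<close>)
    have 2: "run L (Pop (i + 1)) (\<sigma>(i := truth x, i + 1 := truth y)) = \<sigma>(i := truth x)" for x y
      using that by (auto simp: fun_eq_iff truth_def)
    have 3: "run L (Case i Skip p q Skip) (\<sigma>(i := truth x, i + 1 := truth y)) =
        (if x then run L q (\<sigma>(i := truth x, i + 1 := truth y)) else run L p (\<sigma>(i := truth x, i + 1 := truth y)))"
      for p q
      by (simp add: truth_def)
    show "run L (Case i Skip (Pop (i + 1)) (Pop i ;; move f (i + 1) i) Skip)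
        (\<sigma>(i := truth x, i + 1 := truth y)) = \<sigma>(i := truth (x \<and> y))"
      unfolding 1 2 3 by (cases x) simp_all
    show "run L (Case i Skip (Pop i ;; move f (i + 1) i) (Pop (i + 1)) Skip)
        (\<sigma>(i := truth x, i + 1 := truth y)) = \<sigma>(i := truth (x \<or> y))"
      unfolding 1 2 3 by (cases x) simp_all
  qed
  show ?thesis using assms(1,2,4,5)
  proof (induction p arbitrary: i \<sigma>)
    case (Less a b)
    let ?\<rho> = "\<lambda>j. \<sigma> (v + j)"
    let ?x = "expr_list ?\<rho> a" and ?y = "expr_list ?\<rho> b"
    have size: "expr_size a * l < f * L" "expr_size b * l < f * L"
      using Less.prems(4) by (auto simp: nat_mult_max_left)
    have len: "length ?x \<le> expr_size a * l" "length ?y \<le> expr_size b * l"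
      using Less.prems assms(3) by (auto intro!: length_expr_list)
    have 1: "run L (expr_prog f v a i) \<sigma> = \<sigma>(i := ?x)"
      using Less.prems size assms(3) by (intro run_expr_prog) auto
    have "run L (expr_prog f v b (i + 1)) (\<sigma>(i := ?x)) =
        (\<sigma>(i := ?x))(i + 1 := expr_list (\<lambda>j. (\<sigma>(i := ?x)) (v + j)) b)"
      using Less.prems size assms(3) by (intro run_expr_prog) auto
    then have 2: "run L (expr_prog f v b (i + 1)) (\<sigma>(i := ?x)) =
        \<sigma>(i := ?x, i + 1 := expr_list (\<lambda>j. (\<sigma>(i := ?x)) (v + j)) b)" by simp
    have y: "expr_list (\<lambda>j. (\<sigma>(i := ?x)) (v + j)) b = ?y"
      using Less.prems(2) by (intro expr_list_cong) auto
    have "run L (less f i) (\<sigma>(i := ?x, i + 1 := ?y)) = \<sigma>(i := truth (num ?x < num ?y))"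
      using Less.prems len size by (subst run_less) (auto simp: symbols_expr_list fun_eq_iff)
    with 1 2 show ?case unfolding y by (simp add: num_expr_list)
  next
    case (Conj p q)
    let ?x = "eval_form (\<lambda>j. num (\<sigma> (v + j))) p" and ?y = "eval_form (\<lambda>j. num (\<sigma> (v + j))) q"
    have 1: "run L (form_prog f v p i) \<sigma> = \<sigma>(i := truth ?x)"
      using Conj.prems by (intro Conj.IH(1)) (auto simp: nat_mult_max_left)
    have "run L (form_prog f v q (i + 1)) (\<sigma>(i := truth ?x)) =
        (\<sigma>(i := truth ?x))(i + 1 := truth (eval_form (\<lambda>j. num ((\<sigma>(i := truth ?x)) (v + j))) q))"
      using Conj.prems by (intro Conj.IH(2)) (auto simp: nat_mult_max_left)
    also have "eval_form (\<lambda>j. num ((\<sigma>(i := truth ?x)) (v + j))) q = ?y"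
      using Conj.prems(2) by (intro eval_form_cong) auto
    finally have 2: "run L (form_prog f v q (i + 1)) (\<sigma>(i := truth ?x)) = \<sigma>(i := truth ?x, i + 1 := truth ?y)" .
    show ?case unfolding form_prog.simps run.simps(4) 1 2 eval_form.simps by (rule combine(1)[OF Conj.prems(1)])
  next
    case (Disj p q)
    let ?x = "eval_form (\<lambda>j. num (\<sigma> (v + j))) p" and ?y = "eval_form (\<lambda>j. num (\<sigma> (v + j))) q"
    have 1: "run L (form_prog f v p i) \<sigma> = \<sigma>(i := truth ?x)"
      using Disj.prems by (intro Disj.IH(1)) (auto simp: nat_mult_max_left)
    have "run L (form_prog f v q (i + 1)) (\<sigma>(i := truth ?x)) =
        (\<sigma>(i := truth ?x))(i + 1 := truth (eval_form (\<lambda>j. num ((\<sigma>(i := truth ?x)) (v + j))) q))"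
      using Disj.prems by (intro Disj.IH(2)) (auto simp: nat_mult_max_left)
    also have "eval_form (\<lambda>j. num ((\<sigma>(i := truth ?x)) (v + j))) q = ?y"
      using Disj.prems(2) by (intro eval_form_cong) auto
    finally have 2: "run L (form_prog f v q (i + 1)) (\<sigma>(i := truth ?x)) = \<sigma>(i := truth ?x, i + 1 := truth ?y)" .
    show ?case unfolding form_prog.simps run.simps(4) 1 2 eval_form.simps by (rule combine(2)[OF Disj.prems(1)])
  qed
qed

section \<open>The verifier as a stack program and its exact acceptance condition\<close>

section \<open>The verifier\<close>

fun nat_field :: "nat \<Rightarrow> nat list" where
  "nat_field n = (if n = 0 then [] else (if odd n then 2 else 1) # nat_field (n div 2))"

declare nat_field.simps [simp del]

lemma num_nat_field: "num (nat_field n) = n"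
proof (induction n rule: nat_field.induct)
  case (1 n)
  show ?case
  proof (cases "n = 0")
    case True
    then show ?thesis by (simp add: nat_field.simps)
  next
    case False
    have "num (nat_field n) = (if odd n then 1 else 0) + 2 * num (nat_field (n div 2))"
      using False by (subst nat_field.simps) (auto simp: bit_value_def)
    also have "\<dots> = n" unfolding 1[OF False] by presburger
    finally show ?thesis .
  qed
qed

lemma nat_field_inject: "nat_field m = nat_field n \<longleftrightarrow> m = n"
  by (metis num_nat_field)

definition bit_symbols :: "bool list \<Rightarrow> nat list" where
  "bit_symbols = map bit_symbol"

lemma bit_symbols_simps [simp]:
  "bit_symbols [] = []" "bit_symbols (True # bs) = 2 # bit_symbols bs" "bit_symbols (False # bs) = 1 # bit_symbols bs"
  "bit_symbols (bs @ cs) = bit_symbols bs @ bit_symbols cs" "length (bit_symbols bs) = length bs"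
  by (auto simp: bit_symbols_def bit_symbol_def)

lemma bit_symbols_Cons: "bit_symbols (b # bs) = bit_symbol b # bit_symbols bs"
  by (simp add: bit_symbols_def)

lemma symbols_bit_symbols [simp]: "symbols (bit_symbols bs)"
  by (auto simp: symbols_def bit_symbols_def bit_symbol_def)

lemma read_field_enc_nat: "read_field (bit_symbols (enc_nat n) @ rest) = (nat_field n, rest)"
proof (induction n rule: enc_nat.induct)
  case (1 n)
  show ?case
  proof (cases "n = 0")
    case True
    then show ?thesis by (cases rest) (simp_all add: nat_field.simps enc_nat.simps)
  next
    case False
    show ?thesis using False
      by (subst enc_nat.simps, subst nat_field.simps) (simp add: 1[OF False] bit_symbols_Cons bit_symbol_def)
  qed
qed

text \<open>
  The second component of the result is the unary digit of the last record whose name is \<open>nm\<close>.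
\<close>
definition lookup_step :: "nat list \<Rightarrow> nat list \<times> nat list \<Rightarrow> nat list \<times> nat list" where
  "lookup_step nm p =
     (if top_of (fst p) = 2
      then (let n = read_field (tl (fst p)); g = read_field (snd n)
            in (snd g, if fst n = nm then rev (fst g) else snd p))
      else p)"

text \<open>The search starts with the empty list, which is the digit 0, for a qudit without a
  record.\<close>

definition lookup_list :: "nat \<Rightarrow> nat list \<Rightarrow> nat list \<Rightarrow> nat list" where
  "lookup_list L zs nm = snd ((lookup_step nm ^^ L) (zs, []))"

definition record_bounded :: "nat \<Rightarrow> nat list \<times> nat list \<Rightarrow> bool" where
  "record_bounded L p \<longleftrightarrow> symbols (fst p) \<and> length (fst p) \<le> L \<and> symbols (snd p) \<and> length (snd p) \<le> L"

lemma record_bounded_step: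
  assumes "record_bounded L p"
  shows "record_bounded L (lookup_step nm p)"
proof -
  let ?n = "read_field (tl (fst p))"
  let ?g = "read_field (snd ?n)"
  have "symbols (tl (fst p))" "length (tl (fst p)) \<le> L"
    using assms by (auto simp: record_bounded_def symbols_tl)
  then have "symbols (fst ?g)" "symbols (snd ?g)" "length (fst ?g) \<le> L" "length (snd ?g) \<le> L"
    using symbols_read_field length_read_field[of "tl (fst p)"] length_read_field[of "snd ?n"] by auto
  with assms show ?thesis by (auto simp: record_bounded_def lookup_step_def Let_def)
qed

text \<open>Stack 11 holds the unread part of a copy of the certificate, 6 and 8 the name and the
  digit of the current record, 4 and 5 the wanted name and its copy for the comparison, 9 the
  outcome, and 7 the digit of the latest match.\<close>

definition lookup_body :: prog where
  "lookup_body = Case 11 Skip Skip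
     (Pop 11 ;; read 11 1 6 ;; read 11 1 8 ;; copy 1 4 5 1 ;; equal 1 5 6 9 ;;
      Case 9 (clear 1 7 ;; move 1 8 7) (Pop 9 ;; clear 1 8) Skip Skip)
     Skip"

definition lookup :: prog where
  "lookup = copy 1 0 11 1 ;; Loop lookup_body ;; clear 1 11 ;; clear 1 4"

lemma wf_lookup [simp]: "wf_prog lookup"
  by (simp add: lookup_def lookup_body_def)

lemma run_lookup_body:
  assumes "\<sigma> 1 = []" "\<sigma> 5 = []" "\<sigma> 6 = []" "\<sigma> 8 = []" "\<sigma> 9 = []"
    "symbols (\<sigma> 4)" "length (\<sigma> 4) \<le> L" "record_bounded L p"
  shows "run L lookup_body (\<sigma>(11 := fst p, 7 := snd p)) =
    \<sigma>(11 := fst (lookup_step (\<sigma> 4) p), 7 := snd (lookup_step (\<sigma> 4) p))"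
proof (cases "top_of (fst p) = 2")
  case False
  then show ?thesis by (simp add: lookup_body_def lookup_step_def)
next
  case True
  obtain ws where ws: "fst p = 2 # ws" using True by (cases "fst p") auto
  let ?n = "read_field ws"
  let ?g = "read_field (snd ?n)"
  have sy: "symbols ws" "length ws \<le> L" "symbols (snd p)" "length (snd p) \<le> L"
    using assms(8) ws by (auto simp: record_bounded_def)
  have sn: "symbols (fst ?n)" "symbols (snd ?n)" "length (fst ?n) \<le> L" "length (snd ?n) \<le> L"
    using symbols_read_field[OF sy(1)] length_read_field[of ws] sy(2) by auto
  have sg: "symbols (fst ?g)" "symbols (snd ?g)" "length (fst ?g) \<le> L" "length (snd ?g) \<le> L"
    using symbols_read_field[OF sn(2)] length_read_field[of "snd ?n"] sn(4) by auto
  define \<sigma>0 where "\<sigma>0 = \<sigma>(11 := ws, 7 := snd p)"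
  define \<sigma>1 where "\<sigma>1 = \<sigma>(11 := snd ?n, 7 := snd p, 6 := fst ?n)"
  define \<sigma>2 where "\<sigma>2 = \<sigma>(11 := snd ?g, 7 := snd p, 6 := fst ?n, 8 := fst ?g)"
  define \<sigma>3 where "\<sigma>3 = \<sigma>(11 := snd ?g, 7 := snd p, 6 := fst ?n, 8 := fst ?g, 5 := \<sigma> 4)"
  define \<sigma>4 where "\<sigma>4 = \<sigma>(11 := snd ?g, 7 := snd p, 8 := fst ?g, 9 := (if fst ?n = \<sigma> 4 then [] else [1]))"
  have 0: "run L (Pop 11) (\<sigma>(11 := fst p, 7 := snd p)) = \<sigma>0"
    by (auto simp: \<sigma>0_def ws fun_eq_iff)
  have 1: "run L (read 11 1 6) \<sigma>0 = \<sigma>1"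
    by (subst run_read) (use assms sy in \<open>auto simp: \<sigma>0_def \<sigma>1_def fun_eq_iff\<close>)
  have 2: "run L (read 11 1 8) \<sigma>1 = \<sigma>2"
    by (subst run_read) (use assms sn in \<open>auto simp: \<sigma>1_def \<sigma>2_def fun_eq_iff\<close>)
  have 3: "run L (copy 1 4 5 1) \<sigma>2 = \<sigma>3"
    by (subst run_copy) (use assms in \<open>auto simp: \<sigma>2_def \<sigma>3_def fun_eq_iff\<close>)
  have 4: "run L (equal 1 5 6 9) \<sigma>3 = \<sigma>4"
    by (subst run_equal) (use assms sn in \<open>auto simp: \<sigma>3_def \<sigma>4_def fun_eq_iff\<close>)
  have 5: "run L (Case 9 (clear 1 7 ;; move 1 8 7) (Pop 9 ;; clear 1 8) Skip Skip) \<sigma>4 =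
      \<sigma>(11 := snd ?g, 7 := if fst ?n = \<sigma> 4 then rev (fst ?g) else snd p)"
  proof (cases "fst ?n = \<sigma> 4")
    case True
    have "run L (clear 1 7) \<sigma>4 = \<sigma>(11 := snd ?g, 7 := [], 8 := fst ?g)"
      by (subst run_clear) (use assms sy True in \<open>auto simp: \<sigma>4_def fun_eq_iff\<close>)
    moreover have "run L (move 1 8 7) (\<sigma>(11 := snd ?g, 7 := [], 8 := fst ?g)) = \<sigma>(11 := snd ?g, 7 := rev (fst ?g))"
      by (subst run_move) (use assms sg in \<open>auto simp: fun_eq_iff\<close>)
    moreover have "\<sigma>4 9 = []" using True by (simp add: \<sigma>4_def)
    ultimately show ?thesis using True by simp
  next
    case False
    have "run L (Pop 9) \<sigma>4 = \<sigma>(11 := snd ?g, 7 := snd p, 8 := fst ?g)"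
      using assms False by (auto simp: \<sigma>4_def fun_eq_iff)
    moreover have "run L (clear 1 8) (\<sigma>(11 := snd ?g, 7 := snd p, 8 := fst ?g)) = \<sigma>(11 := snd ?g, 7 := snd p)"
      by (subst run_clear) (use assms sg in \<open>auto simp: fun_eq_iff\<close>)
    moreover have "\<sigma>4 9 = [1]" using False by (simp add: \<sigma>4_def)
    ultimately show ?thesis using False by simp
  qed
  have "run L lookup_body (\<sigma>(11 := fst p, 7 := snd p)) =
      run L (Pop 11 ;; read 11 1 6 ;; read 11 1 8 ;; copy 1 4 5 1 ;; equal 1 5 6 9 ;;
      Case 9 (clear 1 7 ;; move 1 8 7) (Pop 9 ;; clear 1 8) Skip Skip) (\<sigma>(11 := fst p, 7 := snd p))"
    using True by (simp add: lookup_body_def del: run.simps(3,4))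
  also have "\<dots> = \<sigma>(11 := snd ?g, 7 := if fst ?n = \<sigma> 4 then rev (fst ?g) else snd p)"
    unfolding run.simps(4) 0 1 2 3 4 5 ..
  finally show ?thesis by (simp add: lookup_step_def ws Let_def)
qed

lemma run_lookup:
  assumes "\<sigma> 1 = []" "\<sigma> 5 = []" "\<sigma> 6 = []" "\<sigma> 7 = []" "\<sigma> 8 = []" "\<sigma> 9 = []" "\<sigma> 11 = []"
    "symbols (\<sigma> 4)" "length (\<sigma> 4) \<le> L" "symbols (\<sigma> 0)" "length (\<sigma> 0) \<le> L"
  shows "run L lookup \<sigma> = \<sigma>(4 := [], 7 := lookup_list L (\<sigma> 0) (\<sigma> 4))"
    and "length (lookup_list L (\<sigma> 0) (\<sigma> 4)) \<le> L" "symbols (lookup_list L (\<sigma> 0) (\<sigma> 4))"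
proof -
  let ?p = "\<lambda>n. (lookup_step (\<sigma> 4) ^^ n) (\<sigma> 0, [])"
  have bounded: "record_bounded L (?p n)" for n
  proof (induction n)
    case 0
    then show ?case using assms by (simp add: record_bounded_def)
  next
    case (Suc n)
    then show ?case by (simp add: record_bounded_step)
  qed
  then show "length (lookup_list L (\<sigma> 0) (\<sigma> 4)) \<le> L" "symbols (lookup_list L (\<sigma> 0) (\<sigma> 4))"
    by (auto simp: record_bounded_def lookup_list_def)
  have loop: "(run L lookup_body ^^ n) (\<sigma>(11 := \<sigma> 0)) = \<sigma>(11 := fst (?p n), 7 := snd (?p n))" for n
  proof (induction n)
    case 0
    then show ?case using assms(4) by (auto simp: fun_eq_iff)
  next
    case (Suc n)
    have "(run L lookup_body ^^ Suc n) (\<sigma>(11 := \<sigma> 0)) =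
        run L lookup_body (\<sigma>(11 := fst (?p n), 7 := snd (?p n)))" by (simp only: funpow.simps comp_apply Suc)
    also have "\<dots> = \<sigma>(11 := fst (?p (Suc n)), 7 := snd (?p (Suc n)))"
      using run_lookup_body[OF assms(1-3,5,6,8,9) bounded[of n]] by simp
    finally show ?case .
  qed
  have 1: "run L (copy 1 0 11 1) \<sigma> = \<sigma>(11 := \<sigma> 0)"
    by (subst run_copy) (use assms in auto)
  have 2: "run L (clear 1 11) (\<sigma>(11 := fst (?p L), 7 := snd (?p L))) = \<sigma>(7 := snd (?p L))"
    by (subst run_clear) (use assms bounded[of L] in \<open>auto simp: record_bounded_def fun_eq_iff\<close>)
  have 3: "run L (clear 1 4) (\<sigma>(7 := snd (?p L))) = \<sigma>(4 := [], 7 := lookup_list L (\<sigma> 0) (\<sigma> 4))"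
    by (subst run_clear) (use assms in \<open>auto simp: lookup_list_def fun_eq_iff\<close>)
  show "run L lookup \<sigma> = \<sigma>(4 := [], 7 := lookup_list L (\<sigma> 0) (\<sigma> 4))"
    unfolding lookup_def run.simps(4,6) 1 loop 2 3 ..
qed

text \<open>Moves a unary number from stack 7 into the control: it is counted down into the choice
  of a program. Everything beyond \<open>c + m\<close> is discarded, which keeps the digit
  legal.\<close>

primrec digit_chain :: "nat \<Rightarrow> nat \<Rightarrow> (nat \<Rightarrow> prog) \<Rightarrow> prog" where
  "digit_chain 0 c p = clear 1 7 ;; p c"
| "digit_chain (Suc m) c p =
     (let q = Pop 7 ;; digit_chain m (Suc c) p in Case 7 (p c) q q q)"

lemma wf_digit_chain: "(\<And>c. c \<le> c0 + m \<Longrightarrow> wf_prog (p c)) \<Longrightarrow> wf_prog (digit_chain m c0 p)"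
  by (induction m arbitrary: c0) (auto simp: Let_def)

lemma run_digit_chain:
  assumes "symbols (\<sigma> 7)" "length (\<sigma> 7) \<le> L"
  shows "run L (digit_chain m c p) \<sigma> = run L (p (c + min (length (\<sigma> 7)) m)) (\<sigma>(7 := []))"
  using assms
proof (induction m arbitrary: c \<sigma>)
  case 0
  then have "run L (clear 1 7) \<sigma> = \<sigma>(7 := [])" by (intro run_clear) simp
  then show ?case by (simp only: digit_chain.simps run.simps(4) min_0R add_0_right)
next
  case (Suc m)
  show ?case
  proof (cases "\<sigma> 7")
    case Nil
    then have "\<sigma>(7 := []) = \<sigma>" by (metis fun_upd_triv)
    with Nil show ?thesis by (simp add: Let_def)
  next
    case (Cons x xs)
    have "run L (digit_chain (Suc m) c p) \<sigma> = run L (digit_chain m (Suc c) p) (\<sigma>(7 := xs))"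
      using Cons Suc.prems by (auto simp: Let_def)
    also have "\<dots> = run L (p (Suc c + min (length xs) m)) (\<sigma>(7 := []))"
    proof -
      have "run L (digit_chain m (Suc c) p) (\<sigma>(7 := xs)) =
          run L (p (Suc c + min (length ((\<sigma>(7 := xs)) 7)) m)) ((\<sigma>(7 := xs))(7 := []))"
        by (rule Suc.IH) (use Suc.prems Cons in auto)
      then show ?thesis by (simp only: fun_upd_same fun_upd_upd)
    qed
    also have "Suc c + min (length xs) m = c + min (length (\<sigma> 7)) (Suc m)" using Cons by simp
    finally show ?thesis .
  qed
qed

text \<open>
  The certificate stays on stack 0; stack 2 holds the rest of the instance, stack 3 the records that
  have not been used for a term, and stack 10 is non-empty as soon as a check has failed.
\<close>
definition frame :: "nat list \<Rightarrow> nat list \<Rightarrow> nat list \<Rightarrow> bool \<Rightarrow> store" where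
  "frame zs xs vs fail =
     (\<lambda>_. [])(0 := zs, 2 := xs, 3 := vs, 10 := (if fail then [1] else []))"

definition bounded :: "nat \<Rightarrow> nat list \<Rightarrow> bool" where
  "bounded L xs \<longleftrightarrow> symbols xs \<and> length xs \<le> L"

text \<open>The certified digits at the qudits of the current term are collected in the parameter
  \<open>ds\<close> of the program rather than on a stack, so that the formula at the leaf can
  depend on them. This is possible because a term has at most \<open>k\<close> qudits.\<close>

primrec names :: "nat \<Rightarrow> (nat list \<Rightarrow> prog) \<Rightarrow> nat \<Rightarrow> nat list \<Rightarrow> prog" where
  "names d p 0 ds = Pop 2 ;; p ds"
| "names d p (Suc k) ds =
     Case 2 Skip (Pop 2 ;; p ds)
       (Pop 2 ;; read 2 1 4 ;; lookup ;; digit_chain (d - 1) 0 (\<lambda>c. names d p k (ds @ [c])))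
       Skip"

lemma wf_names:
  assumes "\<And>ds. wf_prog (p ds)"
  shows "wf_prog (names d p k ds)"
  by (induction k arbitrary: ds) (auto intro!: wf_digit_chain assms)

text \<open>The minimum is the truncation made by \<open>digit_chain\<close>; for positive
  \<open>d\<close>, every list \<open>zs\<close> thus determines a legal digit for every
  qudit.\<close>

definition cert_digit :: "nat \<Rightarrow> nat \<Rightarrow> nat list \<Rightarrow> nat \<Rightarrow> nat" where
  "cert_digit d L zs j = min (length (lookup_list L zs (nat_field j))) (d - 1)"

lemma run_names:
  assumes "bounded L zs" "length S \<le> k" "bounded L (bit_symbols (enc_list enc_nat S) @ rest)"
  shows "run L (names d p k ds) (frame zs (bit_symbols (enc_list enc_nat S) @ rest) vs fail) =
    run L (p (ds @ map (cert_digit d L zs) S)) (frame zs rest vs fail)"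
  using assms(2,3)
proof (induction S arbitrary: k ds)
  case Nil
  have "run L (Pop 2) (frame zs (1 # rest) vs fail) = frame zs rest vs fail"
    by (auto simp: frame_def fun_eq_iff)
  moreover have "bit_symbols (enc_list enc_nat []) @ rest = 1 # rest" by (simp add: enc_list_def)
  moreover have "top_of (frame zs (1 # rest) vs fail 2) = 1" by (simp add: frame_def)
  ultimately show ?case by (cases k) (simp_all del: run.simps(3))
next
  case (Cons j S)
  then obtain k' where k: "k = Suc k'" by (cases k) auto
  let ?xs = "bit_symbols (enc_list enc_nat S) @ rest"
  have enc: "bit_symbols (enc_list enc_nat (j # S)) @ rest = 2 # (bit_symbols (enc_nat j) @ ?xs)"
    by (simp add: enc_list_def)
  have b: "bounded L (bit_symbols (enc_nat j) @ ?xs)" "bounded L ?xs"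
    using Cons.prems(2) unfolding enc by (auto simp: bounded_def)
  have nf: "symbols (nat_field j)" "length (nat_field j) \<le> L"
    using symbols_read_field[of "bit_symbols (enc_nat j) @ ?xs"] length_read_field[of "bit_symbols (enc_nat j) @ ?xs"] b(1)
    unfolding read_field_enc_nat by (auto simp: bounded_def)
  let ?F = "frame zs (bit_symbols (enc_nat j) @ ?xs) vs fail"
  have 1: "run L (read 2 1 4) ?F = (frame zs ?xs vs fail)(4 := nat_field j)"
    by (subst run_read)
      (use b in \<open>auto simp: frame_def bounded_def read_field_enc_nat fun_eq_iff\<close>)
  have 2: "run L lookup ((frame zs ?xs vs fail)(4 := nat_field j)) =
     (frame zs ?xs vs fail)(7 := lookup_list L zs (nat_field j))"
    by (subst run_lookup(1)) (use assms(1) nf in \<open>auto simp: frame_def bounded_def fun_eq_iff\<close>)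
  have lk: "length (lookup_list L zs (nat_field j)) \<le> L" "symbols (lookup_list L zs (nat_field j))"
    using run_lookup(2,3)[of "(frame zs ?xs vs fail)(4 := nat_field j)" L] assms(1) nf
    by (simp_all add: frame_def bounded_def)
  have 3: "run L (digit_chain (d - 1) 0 q) ((frame zs ?xs vs fail)(7 := lookup_list L zs (nat_field j))) =
      run L (q (cert_digit d L zs j)) (frame zs ?xs vs fail)" for q
  proof -
    have "(frame zs ?xs vs fail)(7 := []) = frame zs ?xs vs fail" by (auto simp: frame_def fun_eq_iff)
    then show ?thesis by (subst run_digit_chain) (use lk in \<open>simp_all add: cert_digit_def\<close>)
  qed
  have 0: "run L (Pop 2) (frame zs (2 # (bit_symbols (enc_nat j) @ ?xs)) vs fail) = ?F"
    by (auto simp: frame_def fun_eq_iff)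
  have "run L (names d p k ds) (frame zs (bit_symbols (enc_list enc_nat (j # S)) @ rest) vs fail) =
     run L (Pop 2 ;; read 2 1 4 ;; lookup ;; digit_chain (d - 1) 0 (\<lambda>c. names d p k' (ds @ [c])))
      (frame zs (2 # (bit_symbols (enc_nat j) @ ?xs)) vs fail)"
    unfolding enc k names.simps run.simps(5) by (simp add: frame_def del: run.simps)
  also have "\<dots> = run L (names d p k' (ds @ [cert_digit d L zs j])) (frame zs ?xs vs fail)"
    unfolding run.simps(4) 0 1 2 3 ..
  also have "\<dots> = run L (p ((ds @ [cert_digit d L zs j]) @ map (cert_digit d L zs) S)) (frame zs rest vs fail)"
    using Cons.prems b k by (intro Cons.IH) auto
  finally show ?case by simp
qed


text \<open>Numbers on stacks have no sign, so the sign bit selects the stack of the positive or of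
  the negative part of the numerator. The imaginary part is parsed and erased: Hermitian stoquastic
  matrices are real.\<close>

definition entry_prog :: "nat \<Rightarrow> prog" where
  "entry_prog v =
     Pop 2 ;; Case 2 Skip (Pop 2 ;; read 2 1 v) (Pop 2 ;; read 2 1 (v + 1)) Skip ;; read 2 1 (v + 2) ;;
     Pop 2 ;; read 2 1 12 ;; clear 1 12 ;; read 2 1 12 ;; clear 1 12"

text \<open>Positive part of the numerator, negative part of the numerator, denominator of the real part.\<close>
definition entry_fields :: "rat \<times> rat \<Rightarrow> nat list \<times> nat list \<times> nat list" where
  "entry_fields z = (case quotient_of (fst z) of (a, b) \<Rightarrow>
     (nat_field (nat a), nat_field (nat (- a)), nat_field (nat b)))"

lemma nat_field_0 [simp]: "nat_field 0 = []"
  by (simp add: nat_field.simps)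

lemma run_read_nat:
  assumes "\<sigma> i = bit_symbols (enc_nat n) @ rest" "bounded L (\<sigma> i)" "\<sigma> t = []" "\<sigma> j = []" "i \<noteq> t" "i \<noteq> j" "t \<noteq> j"
  shows "run L (read i t j) \<sigma> = \<sigma>(i := rest, j := nat_field n)"
    and "bounded L rest" "bounded L (nat_field n)"
proof -
  show "run L (read i t j) \<sigma> = \<sigma>(i := rest, j := nat_field n)"
    by (subst run_read) (use assms in \<open>auto simp: bounded_def read_field_enc_nat\<close>)
  show "bounded L rest" "bounded L (nat_field n)"
    using symbols_read_field[of "\<sigma> i"] length_read_field[of "\<sigma> i"] assms(2)
    unfolding assms(1) read_field_enc_nat bounded_def by auto
qed

lemma run_entry_prog:
  assumes "\<sigma> 2 = 2 # bit_symbols (enc_entry z) @ rest" "bounded L (\<sigma> 2)" "\<sigma> 1 = []" "\<sigma> 12 = []" "13 \<le> v"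
    "\<sigma> v = []" "\<sigma> (v + 1) = []" "\<sigma> (v + 2) = []"
  shows "run L (entry_prog v) \<sigma> = \<sigma>(2 := rest, v := fst (entry_fields z),
      v + 1 := fst (snd (entry_fields z)), v + 2 := snd (snd (entry_fields z)))"
    and "bounded L rest" "bounded L (fst (entry_fields z))"
      "bounded L (fst (snd (entry_fields z)))" "bounded L (snd (snd (entry_fields z)))"
proof -
  obtain a b where ab: "quotient_of (fst z) = (a, b)" by fastforce
  obtain a' b' where ab': "quotient_of (snd z) = (a', b')" by fastforce
  let ?r4 = "rest"
  let ?r3 = "bit_symbols (enc_nat (nat b')) @ ?r4"
  let ?r2 = "bit_symbol (a' < 0) # bit_symbols (enc_nat (nat \<bar>a'\<bar>)) @ ?r3"
  let ?r1 = "bit_symbols (enc_nat (nat b)) @ ?r2"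
  let ?r0 = "bit_symbols (enc_nat (nat \<bar>a\<bar>)) @ ?r1"
  have xs: "\<sigma> 2 = 2 # bit_symbol (a < 0) # ?r0"
    using assms(1) by (simp add: enc_entry_def enc_rat_def ab ab' bit_symbols_Cons)
  have b0: "bounded L ?r0" using assms(2) unfolding xs by (simp add: bounded_def)
  let ?p = "nat_field (nat a)" and ?m = "nat_field (nat (- a))"
  have 1: "run L (Pop 2) \<sigma> = \<sigma>(2 := bit_symbol (a < 0) # ?r0)" by (simp add: xs)
  have 2: "run L (Case 2 Skip (Pop 2 ;; read 2 1 v) (Pop 2 ;; read 2 1 (v + 1)) Skip)
      (\<sigma>(2 := bit_symbol (a < 0) # ?r0)) = \<sigma>(2 := ?r1, v := ?p, v + 1 := ?m)"
  proof (cases "a < 0")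
    case True
    then have "nat \<bar>a\<bar> = nat (- a)" "nat a = 0" by auto
    moreover have "run L (read 2 1 (v + 1)) (\<sigma>(2 := ?r0)) = (\<sigma>(2 := ?r0))(2 := ?r1, v + 1 := nat_field (nat \<bar>a\<bar>))"
      by (rule run_read_nat) (use assms b0 in auto)
    ultimately show ?thesis using True assms(5,6) by (simp add: bit_symbol_def fun_eq_iff)
  next
    case False
    then have "nat \<bar>a\<bar> = nat a" "nat (- a) = 0" by auto
    moreover have "run L (read 2 1 v) (\<sigma>(2 := ?r0)) = (\<sigma>(2 := ?r0))(2 := ?r1, v := nat_field (nat \<bar>a\<bar>))"
      by (rule run_read_nat) (use assms b0 in auto)
    ultimately show ?thesis using False assms(5,7) by (simp add: bit_symbol_def fun_eq_iff)
  qed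
  have "bounded L ?r1" "bounded L (nat_field (nat \<bar>a\<bar>))"
    using run_read_nat(2,3)[of "(\<lambda>_. [])(2 := ?r0)" 2 "nat \<bar>a\<bar>" ?r1 L 0 1] b0 by auto
  then have b1: "bounded L ?r1" "bounded L ?p" "bounded L ?m"
    by (auto simp: abs_if bounded_def split: if_splits)
  define \<sigma>1 where "\<sigma>1 = \<sigma>(2 := ?r1, v := ?p, v + 1 := ?m)"
  define \<sigma>2 where "\<sigma>2 = \<sigma>(2 := ?r2, v := ?p, v + 1 := ?m, v + 2 := nat_field (nat b))"
  define \<sigma>3 where "\<sigma>3 = \<sigma>2(2 := bit_symbols (enc_nat (nat \<bar>a'\<bar>)) @ ?r3)"
  define \<sigma>4 where "\<sigma>4 = \<sigma>2(2 := ?r3)"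
  define \<sigma>5 where "\<sigma>5 = \<sigma>2(2 := rest)"
  have 3: "run L (read 2 1 (v + 2)) \<sigma>1 = \<sigma>2" and b2: "bounded L ?r2" "bounded L (nat_field (nat b))"
    using run_read_nat[of \<sigma>1 2 "nat b" ?r2 L 1 "v + 2"] assms b1
    by (auto simp: \<sigma>1_def \<sigma>2_def fun_eq_iff)
  have 4: "run L (Pop 2) \<sigma>2 = \<sigma>3"
    using assms(5) by (auto simp: \<sigma>2_def \<sigma>3_def fun_eq_iff)
  have b3: "bounded L (bit_symbols (enc_nat (nat \<bar>a'\<bar>)) @ ?r3)" using b2 by (simp add: bounded_def)
  have 5: "run L (read 2 1 12) \<sigma>3 = \<sigma>4(12 := nat_field (nat \<bar>a'\<bar>))" and b4: "bounded L ?r3" "bounded L (nat_field (nat \<bar>a'\<bar>))"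
    using run_read_nat[of \<sigma>3 2 "nat \<bar>a'\<bar>" ?r3 L 1 12] assms b3
    by (auto simp: \<sigma>2_def \<sigma>3_def \<sigma>4_def fun_eq_iff)
  have v: "\<sigma>2 12 = []" using assms by (simp add: \<sigma>2_def)
  have 6: "run L (clear 1 12) (\<sigma>4(12 := nat_field (nat \<bar>a'\<bar>))) = \<sigma>4"
    by (subst run_clear) (use b4 v in \<open>auto simp: bounded_def \<sigma>4_def fun_eq_iff\<close>)
  have 7: "run L (read 2 1 12) \<sigma>4 = \<sigma>5(12 := nat_field (nat b'))" and b5: "bounded L rest" "bounded L (nat_field (nat b'))"
    using run_read_nat[of \<sigma>4 2 "nat b'" rest L 1 12] assms b4
    by (auto simp: \<sigma>2_def \<sigma>4_def \<sigma>5_def fun_eq_iff)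
  have 8: "run L (clear 1 12) (\<sigma>5(12 := nat_field (nat b'))) = \<sigma>5"
    by (subst run_clear) (use b5 v in \<open>auto simp: bounded_def \<sigma>5_def fun_eq_iff\<close>)
  have "run L (entry_prog v) \<sigma> = \<sigma>5"
    unfolding entry_prog_def run.simps(4) 1 2 \<sigma>1_def[symmetric] 3 4 5 6 7 8 ..
  then show "run L (entry_prog v) \<sigma> = \<sigma>(2 := rest, v := fst (entry_fields z),
      v + 1 := fst (snd (entry_fields z)), v + 2 := snd (snd (entry_fields z)))"
    using assms(5) by (auto simp: \<sigma>5_def \<sigma>2_def entry_fields_def ab fun_eq_iff)
  show "bounded L rest" "bounded L (fst (entry_fields z))"
      "bounded L (fst (snd (entry_fields z)))" "bounded L (snd (snd (entry_fields z)))"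
    using b1 b2 b5 by (auto simp: entry_fields_def ab)
qed

primrec entries_prog :: "nat \<Rightarrow> nat \<Rightarrow> prog" where
  "entries_prog 0 v = Skip"
| "entries_prog (Suc n) v = entry_prog v ;; entries_prog n (v + 3)"

primrec set_entries :: "(rat \<times> rat) list \<Rightarrow> nat \<Rightarrow> store \<Rightarrow> store" where
  "set_entries [] v \<sigma> = \<sigma>"
| "set_entries (z # zs) v \<sigma> = set_entries zs (v + 3) (\<sigma>(v := fst (entry_fields z),
      v + 1 := fst (snd (entry_fields z)), v + 2 := snd (snd (entry_fields z))))"

lemma set_entries_other: "j < v \<or> v + 3 * length zs \<le> j \<Longrightarrow> set_entries zs v \<sigma> j = \<sigma> j"
  by (induction zs arbitrary: v \<sigma>) auto

definition entry_var :: "(rat \<times> rat) list \<Rightarrow> nat \<Rightarrow> nat list" where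
  "entry_var zs j = (case entry_fields (zs ! (j div 3)) of (p, m, q) \<Rightarrow>
     if j mod 3 = 0 then p else if j mod 3 = 1 then m else q)"

lemma entry_var_shift: "entry_var (z # zs) (i + 3) = entry_var zs i"
proof -
  have "(i + 3) div 3 = Suc (i div 3)" "(i + 3) mod 3 = i mod 3" by simp_all
  then show ?thesis unfolding entry_var_def by (simp only: nth_Cons_Suc)
qed

lemma set_entries_var: "j < 3 * length zs \<Longrightarrow> set_entries zs v \<sigma> (v + j) = entry_var zs j"
proof (induction zs arbitrary: v \<sigma> j)
  case (Cons z zs)
  show ?case
  proof (cases "j < 3")
    case True
    then consider "j = 0" | "j = 1" | "j = 2" by linarith
    then show ?thesis
      by cases (auto simp: set_entries_other entry_var_def split: prod.splits)
  next
    case False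
    then obtain i where i: "j = i + 3" by (metis add.commute le_Suc_ex not_less)
    have "set_entries (z # zs) v \<sigma> (v + j) = entry_var zs i"
      using Cons.prems i Cons.IH[of i "v + 3"] by (simp add: algebra_simps)
    also have "\<dots> = entry_var (z # zs) j" by (simp only: entry_var_shift i)
    finally show ?thesis .
  qed
qed simp

lemma set_entries_update: "j < v \<Longrightarrow> (set_entries zs v \<sigma>)(j := x) = set_entries zs v (\<sigma>(j := x))"
  by (induction zs arbitrary: v \<sigma>) (auto simp: fun_upd_twist)

lemma run_entries_prog:
  assumes "\<sigma> 2 = bit_symbols (concat (map (\<lambda>z. True # enc_entry z) zs)) @ rest" "bounded L (\<sigma> 2)" "\<sigma> 1 = []" "\<sigma> 12 = []" "13 \<le> v"
    "\<forall>j \<ge> v. \<sigma> j = []"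
  shows "run L (entries_prog (length zs) v) \<sigma> = set_entries zs v (\<sigma>(2 := rest)) \<and> bounded L rest \<and>
     (\<forall>j < 3 * length zs. bounded L (entry_var zs j))"
  using assms
proof (induction zs arbitrary: v \<sigma>)
  case Nil
  then have "\<sigma>(2 := rest) = \<sigma>" by (metis append_Nil concat.simps(1) fun_upd_triv list.simps(8) bit_symbols_simps(1))
  with Nil show ?case by simp
next
  case (Cons z zs)
  let ?rest = "bit_symbols (concat (map (\<lambda>z. True # enc_entry z) zs)) @ rest"
  let ?\<tau> = "\<sigma>(2 := ?rest, v := fst (entry_fields z),
      v + 1 := fst (snd (entry_fields z)), v + 2 := snd (snd (entry_fields z)))"
  have e: "\<sigma> 2 = 2 # bit_symbols (enc_entry z) @ ?rest" using Cons.prems by simp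
  note entry = run_entry_prog[OF e Cons.prems(2-5)]
  have 1: "run L (entry_prog v) \<sigma> = ?\<tau>" by (rule entry) (use Cons.prems in auto)
  have b: "bounded L ?rest" "bounded L (fst (entry_fields z))"
      "bounded L (fst (snd (entry_fields z)))" "bounded L (snd (snd (entry_fields z)))"
    using entry(2-5) Cons.prems(6) by auto
  have IH: "run L (entries_prog (length zs) (v + 3)) ?\<tau> = set_entries zs (v + 3) (?\<tau>(2 := rest)) \<and> bounded L rest \<and>
     (\<forall>j < 3 * length zs. bounded L (entry_var zs j))"
    by (rule Cons.IH) (use Cons.prems b in auto)
  have "?\<tau>(2 := rest) = (\<sigma>(2 := rest))(v := fst (entry_fields z),
      v + 1 := fst (snd (entry_fields z)), v + 2 := snd (snd (entry_fields z)))"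
    using Cons.prems(5) by (auto simp: fun_eq_iff)
  then have 2: "run L (entries_prog (length zs) (v + 3)) ?\<tau> = set_entries (z # zs) v (\<sigma>(2 := rest))"
    using IH by simp
  have "bounded L (entry_var (z # zs) j)" if "j < 3 * length (z # zs)" for j
  proof (cases "j < 3")
    case True
    then consider "j = 0" | "j = 1" | "j = 2" by linarith
    then show ?thesis using b by cases (auto simp: entry_var_def split: prod.splits)
  next
    case False
    then obtain i where i: "j = i + 3" by (metis add.commute le_Suc_ex not_less)
    have "entry_var (z # zs) j = entry_var zs i" by (simp only: entry_var_shift i)
    with IH that i show ?thesis by simp
  qed
  then show ?case using IH unfolding list.size add_0_right add_Suc_right entries_prog.simps run.simps(4) 1 2
    by blast
qed

lemma wf_entries_prog [simp]: "wf_prog (entries_prog n v)"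
  by (induction n arbitrary: v) (auto simp: entry_prog_def)

primrec clear_range :: "nat \<Rightarrow> nat \<Rightarrow> prog" where
  "clear_range 0 v = Skip"
| "clear_range (Suc n) v = clear 1 v ;; clear_range n (Suc v)"

lemma wf_clear_range [simp]: "wf_prog (clear_range n v)"
  by (induction n arbitrary: v) auto

lemma run_clear_range:
  assumes "\<forall>j < n. length (\<sigma> (v + j)) \<le> L"
  shows "run L (clear_range n v) \<sigma> = (\<lambda>j. if v \<le> j \<and> j < v + n then [] else \<sigma> j)"
  using assms
proof (induction n arbitrary: v \<sigma>)
  case 0
  then show ?case by (auto simp: fun_eq_iff)
next
  case (Suc n)
  have 1: "run L (clear 1 v) \<sigma> = \<sigma>(v := [])"
    by (rule run_clear) (use Suc.prems in \<open>auto dest: spec[of _ 0]\<close>)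
  have 2: "run L (clear_range n (Suc v)) (\<sigma>(v := [])) =
      (\<lambda>j. if Suc v \<le> j \<and> j < Suc v + n then [] else (\<sigma>(v := [])) j)"
    by (rule Suc.IH) (use Suc.prems in \<open>auto dest: spec[of _ "Suc _"]\<close>)
  show ?case unfolding clear_range.simps run.simps(4) 1 2 by (auto simp: fun_eq_iff)
qed


definition num_entries :: "nat \<Rightarrow> nat list \<Rightarrow> nat" where
  "num_entries d ds = d ^ length ds * d ^ length ds"

definition next_record :: "nat list \<Rightarrow> nat list" where
  "next_record vs = snd (read_field (snd (read_field (tl vs))))"

text \<open>The certificate serves twice: its records are searched for the digits of the qudits, and
  the name field of the i-th record is the number for the i-th term.\<close>

definition cert_number :: "nat list \<Rightarrow> nat" where
  "cert_number vs = num (fst (read_field (tl vs)))"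

text \<open>From stack 13 on lie the variables of the formula, three for each entry and then, on
  stack \<open>a\<close>, the number from the certificate; the verdict goes to stack
  \<open>r\<close>. Clearing all of them restores the frame for the next term.\<close>

definition leaf :: "nat \<Rightarrow> nat \<Rightarrow> (nat list \<Rightarrow> form) \<Rightarrow> nat list \<Rightarrow> prog" where
  "leaf d f \<phi> ds =
     (let N = num_entries d ds; a = 13 + 3 * N; r = Suc a
      in entries_prog N 13 ;; Pop 2 ;; Pop 3 ;; read 3 1 a ;; read 3 1 12 ;; clear 1 12 ;;
         form_prog f 13 (\<phi> ds) r ;; Case r Skip (raise 10) Skip Skip ;;
         clear_range (3 * N + 2) 13)"

lemma wf_leaf [simp]: "wf_prog (leaf d f \<phi> ds)"
  by (simp add: leaf_def Let_def)

text \<open>The variables: three for every entry, and the number of the certificate as the last one.\<close>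
definition term_env :: "(rat \<times> rat) list \<Rightarrow> nat \<Rightarrow> nat \<Rightarrow> nat" where
  "term_env zs \<alpha> j = (if j < 3 * length zs then num (entry_var zs j) else \<alpha>)"

lemma bounded_read_field:
  "bounded L xs \<Longrightarrow> bounded L (fst (read_field xs)) \<and> bounded L (snd (read_field xs))"
  using symbols_read_field[of xs] length_read_field[of xs] by (auto simp: bounded_def)

lemma bounded_tl: "bounded L xs \<Longrightarrow> bounded L (tl xs)"
  by (auto simp: bounded_def symbols_tl)

lemma bounded_next_record: "bounded L vs \<Longrightarrow> bounded L (next_record vs)"
  unfolding next_record_def using bounded_read_field bounded_tl by blast

lemma run_read_bounded:
  assumes "i \<noteq> t" "i \<noteq> j" "t \<noteq> j" "bounded L (\<sigma> i)" "\<sigma> t = []" "\<sigma> j = []"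
  shows "run L (read i t j) \<sigma> = \<sigma>(i := snd (read_field (\<sigma> i)), j := fst (read_field (\<sigma> i)))"
  by (subst run_read) (use assms in \<open>auto simp: bounded_def\<close>)

lemma run_leaf:
  assumes "length es = num_entries d ds" "xs = bit_symbols (enc_list enc_entry es) @ rest"
    "bounded L xs" "bounded L vs" "1 \<le> L"
    "form_vars (\<phi> ds) \<le> Suc (3 * num_entries d ds)" "form_size (\<phi> ds) < f"
  shows "run L (leaf d f \<phi> ds) (frame zs xs vs fail) =
     frame zs rest (next_record vs) (fail \<or> \<not> eval_form (term_env es (cert_number vs)) (\<phi> ds))"
    and "bounded L rest"
proof -
  define N where "N = length es"
  define a where "a = 13 + 3 * N"
  let ?r = "Suc a"
  let ?\<alpha> = "fst (read_field (tl vs))"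
  let ?V = "next_record vs"
  \<comment> \<open>The frame with the entries of the term loaded, as a function of the two stacks
    that are still being consumed.\<close>
  define F where "F = (\<lambda>xs vs. set_entries es 13 (frame zs xs vs fail))"
  have N: "num_entries d ds = N" using assms(1) by (simp add: N_def)
  have F_low: "F xs vs j = frame zs xs vs fail j" if "j < 13" for j xs vs
    using that by (simp add: F_def set_entries_other)
  have F_high: "F xs vs j = []" if "a \<le> j" for j xs vs
    using that by (simp add: F_def set_entries_other a_def N_def frame_def)
  have F_var: "F xs vs (13 + j) = entry_var es j" if "j < 3 * N" for j xs vs
    using that set_entries_var[of j es 13] by (simp add: F_def N_def)
  have upd2: "(F xs vs)(2 := ys) = F ys vs" for xs ys vs
    unfolding F_def by (subst set_entries_update, simp, rule arg_cong[of _ _ "set_entries es 13"])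
      (auto simp: frame_def fun_eq_iff)
  have upd3: "(F xs vs)(3 := ys) = F xs ys" for xs ys vs
    unfolding F_def by (subst set_entries_update, simp, rule arg_cong[of _ _ "set_entries es 13"])
      (auto simp: frame_def fun_eq_iff)
  let ?xs = "bit_symbols (concat (map (\<lambda>z. True # enc_entry z) es)) @ (1 # rest)"
  have xs: "xs = ?xs" using assms(2) by (simp add: enc_list_def)
  have "run L (entries_prog (length es) 13) (frame zs xs vs fail) =
     set_entries es 13 ((frame zs xs vs fail)(2 := 1 # rest)) \<and> bounded L (1 # rest) \<and>
     (\<forall>j < 3 * length es. bounded L (entry_var es j))"
    by (rule run_entries_prog) (use assms(3) xs in \<open>auto simp: frame_def\<close>)
  moreover have "(frame zs xs vs fail)(2 := 1 # rest) = frame zs (1 # rest) vs fail"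
    by (auto simp: frame_def fun_eq_iff)
  ultimately have 1: "run L (entries_prog N 13) (frame zs xs vs fail) = F (1 # rest) vs"
    and b: "bounded L (1 # rest)" and bv: "\<And>j. j < 3 * N \<Longrightarrow> bounded L (entry_var es j)"
    by (auto simp: F_def N_def)
  from b show "bounded L rest" by (auto simp: bounded_def)
  have 2: "run L (Pop 2) (F (1 # rest) vs) = F rest vs"
    unfolding run.simps(3) upd2 by (simp add: F_low frame_def)
  have 3: "run L (Pop 3) (F rest vs) = F rest (tl vs)"
    unfolding run.simps(3) upd3 by (simp add: F_low frame_def)
  let ?n = "read_field (tl vs)"
  have bn: "bounded L (tl vs)" "bounded L ?\<alpha>" "bounded L (snd ?n)"
    using bounded_tl[OF assms(4)] bounded_read_field by blast+
  have F3: "F rest vs 3 = vs" "F rest vs 1 = []" "F rest vs 12 = []" for vs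
    by (subst F_low, simp, simp add: frame_def)+
  have 4: "run L (read 3 1 a) (F rest (tl vs)) = (F rest (snd ?n))(a := ?\<alpha>)"
  proof -
    have "run L (read 3 1 a) (F rest (tl vs)) = (F rest (tl vs))(3 := snd ?n, a := ?\<alpha>)"
      using run_read_bounded[of 3 1 a L "F rest (tl vs)"] bn(1) F3 F_high[of a]
      by (simp add: a_def)
    then show ?thesis by (simp only: upd3)
  qed
  define G where "G = (\<lambda>vs. (F rest vs)(a := ?\<alpha>))"
  have read_a: "run L (read 3 1 a) (F rest (tl vs)) = G (snd ?n)"
    by (simp only: 4 G_def)
  have G3: "G vs 3 = vs" "G vs 1 = []" "G vs 12 = []" for vs
    by (simp_all add: F3 F3[unfolded One_nat_def] G_def a_def)
  have G_upd: "(G vs)(3 := ys) = G ys" for vs ys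
    unfolding G_def using upd3[of rest vs ys] by (simp add: a_def fun_upd_twist)
  have 5: "run L (read 3 1 12) (G (snd ?n)) = (G ?V)(12 := fst (read_field (snd ?n)))"
    using run_read_bounded[of 3 1 12 L "G (snd ?n)"] bn(3) G3 by (simp add: G_upd next_record_def)
  have 6: "run L (clear 1 12) ((G ?V)(12 := fst (read_field (snd ?n)))) = G ?V"
  proof -
    have "length (fst (read_field (snd ?n))) \<le> L"
      using bounded_read_field[OF bn(3)] by (simp add: bounded_def)
    then have "run L (clear 1 12) ((G ?V)(12 := fst (read_field (snd ?n)))) =
        (G ?V)(12 := fst (read_field (snd ?n)), 12 := [])" by (intro run_clear) simp
    also have "\<dots> = G ?V" using G3(3)[of ?V] by (metis fun_upd_triv fun_upd_upd)
    finally show ?thesis .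
  qed
  have G_var: "G ?V (13 + j) = (if j < 3 * N then entry_var es j else ?\<alpha>)" if "j < Suc (3 * N)" for j
    using that by (auto simp: G_def F_var a_def)
  have G_high: "G ?V j = []" if "?r \<le> j" for j using that by (simp add: G_def F_high)
  let ?t = "eval_form (term_env es (cert_number vs)) (\<phi> ds)"
  have 7: "run L (form_prog f 13 (\<phi> ds) ?r) (G ?V) = (G ?V)(?r := truth ?t)"
  proof -
    have "run L (form_prog f 13 (\<phi> ds) ?r) (G ?V) =
        (G ?V)(?r := truth (eval_form (\<lambda>j. num (G ?V (13 + j))) (\<phi> ds)))"
    proof (rule run_form_prog[where l = L])
      show "13 + form_vars (\<phi> ds) \<le> Suc a" using assms(6) N by (simp add: a_def)
      show "\<forall>j < form_vars (\<phi> ds). symbols (G ?V (13 + j)) \<and> length (G ?V (13 + j)) \<le> L"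
        using G_var bv bn(2) assms(6) N by (auto simp: bounded_def)
      show "form_size (\<phi> ds) * L < f * L" using assms(5,7) by simp
    qed (use G_high assms(5) in auto)
    also have "eval_form (\<lambda>j. num (G ?V (13 + j))) (\<phi> ds) = ?t"
      using assms(6) N by (intro eval_form_cong) (auto simp: G_var term_env_def cert_number_def N_def)
    finally show ?thesis .
  qed
  let ?fail = "fail \<or> \<not> ?t"
  define F' where "F' = set_entries es 13 (frame zs rest ?V ?fail)"
  have F': "(F rest ?V)(10 := (if ?fail then [1] else [])) = F'"
    unfolding F_def F'_def by (subst set_entries_update, simp, rule arg_cong[of _ _ "set_entries es 13"])
      (auto simp: frame_def fun_eq_iff)
  have 8: "run L (Case ?r Skip (raise 10) Skip Skip) ((G ?V)(?r := truth ?t)) =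
      F'(a := ?\<alpha>, ?r := truth ?t)"
  proof -
    have f10: "((G ?V)(?r := truth ?t)) 10 = (if fail then [1] else [])"
      by (simp add: G_def F_low frame_def a_def)
    have eq: "F'(a := ?\<alpha>, ?r := truth ?t) = ((G ?V)(?r := truth ?t))(10 := (if ?fail then [1] else []))"
      unfolding F'[symmetric] G_def by (auto simp: a_def fun_eq_iff)
    have "run L (Case ?r Skip (raise 10) Skip Skip) ((G ?V)(?r := truth ?t)) =
        (if ?t then (G ?V)(?r := truth ?t) else run L (raise 10) ((G ?V)(?r := truth ?t)))"
      by (simp add: truth_def)
    also have "run L (raise 10) ((G ?V)(?r := truth ?t)) =
       (if fail then (G ?V)(?r := truth ?t) else ((G ?V)(?r := truth ?t))(10 := [1]))"
      using f10 by (subst run_raise) auto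
    finally show ?thesis unfolding eq using f10 by (auto simp: fun_upd_idem simp del: fun_upd_apply)
  qed
  have 9: "run L (clear_range (3 * N + 2) 13) (F'(a := ?\<alpha>, ?r := truth ?t)) =
      frame zs rest ?V ?fail"
  proof -
    have F'_low: "F' j = frame zs rest ?V ?fail j" if "j < 13" for j
      using that by (simp add: F'_def set_entries_other)
    have F'_high: "F' j = []" if "a \<le> j" for j
      using that by (simp add: F'_def set_entries_other a_def N_def frame_def)
    have F'_var: "F' (13 + j) = entry_var es j" if "j < 3 * N" for j
      using that set_entries_var[of j es 13] by (simp add: F'_def N_def)
    have "length ((F'(a := ?\<alpha>, ?r := truth ?t)) (13 + j)) \<le> L" if "j < 3 * N + 2" for j
    proof -
      consider "j < 3 * N" | "13 + j = a" | "13 + j = ?r" using \<open>j < 3 * N + 2\<close> a_def by linarith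
      then show ?thesis
        using bv F'_var bn(2) assms(5) by cases (auto simp: bounded_def a_def)
    qed
    then have "run L (clear_range (3 * N + 2) 13) (F'(a := ?\<alpha>, ?r := truth ?t)) =
       (\<lambda>j. if 13 \<le> j \<and> j < 13 + (3 * N + 2) then [] else (F'(a := ?\<alpha>, ?r := truth ?t)) j)"
      by (intro run_clear_range) blast
    also have "\<dots> = frame zs rest ?V ?fail"
      using F'_low F'_high by (auto simp: fun_eq_iff a_def frame_def)
    finally show ?thesis .
  qed
  show "run L (leaf d f \<phi> ds) (frame zs xs vs fail) = frame zs rest ?V ?fail"
    unfolding leaf_def Let_def N a_def[symmetric] run.simps(4) 1 2 3 read_a 5 6 7 8 9 ..
qed


text \<open>One term is processed per round; after the last one the end marker 1 stays on top and
  the body idles.\<close>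

definition verify_terms :: "nat \<Rightarrow> nat \<Rightarrow> nat \<Rightarrow> (nat list \<Rightarrow> form) \<Rightarrow> prog" where
  "verify_terms d k f \<phi> = Case 2 Skip Skip (Pop 2 ;; names d (leaf d f \<phi>) k []) Skip"

text \<open>The first loop stops at the separator and leaves the certificate on stack 0; the
  instance, reversed on stack 1, regains its order on stack 2. Stack 3 receives a second copy of the
  certificate, whose records are consumed term by term.\<close>

definition verifier :: "nat \<Rightarrow> nat \<Rightarrow> nat \<Rightarrow> (nat list \<Rightarrow> form) \<Rightarrow> prog" where
  "verifier d k f \<phi> =
     Loop (Case 0 Skip (Pop 0 ;; Push 1 1) (Pop 0 ;; Push 1 2) Skip) ;; Pop 0 ;; move 1 1 2 ;;
     copy 1 0 3 1 ;; read 2 1 12 ;; clear 1 12 ;; Loop (verify_terms d k f \<phi>) ;;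
     Case 10 (Push 0 2) (Push 0 1) (Push 0 1) (Push 0 1)"

lemma wf_verifier: "wf_prog (verifier d k f \<phi>)"
  by (simp add: verifier_def verify_terms_def wf_names)

definition term_check :: "nat \<Rightarrow> nat \<Rightarrow> (nat list \<Rightarrow> form) \<Rightarrow> nat list \<Rightarrow> local_term \<Rightarrow> nat list \<Rightarrow> bool" where
  "term_check d L \<phi> zs T vs \<longleftrightarrow>
     eval_form (term_env (entries T) (cert_number vs)) (\<phi> (map (cert_digit d L zs) (acts_on T)))"

primrec terms_check :: "nat \<Rightarrow> nat \<Rightarrow> (nat list \<Rightarrow> form) \<Rightarrow> nat list \<Rightarrow> local_term list \<Rightarrow> nat list \<Rightarrow> bool" where
  "terms_check d L \<phi> zs [] vs \<longleftrightarrow> True"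
| "terms_check d L \<phi> zs (T # Ts) vs \<longleftrightarrow>
     term_check d L \<phi> zs T vs \<and> terms_check d L \<phi> zs Ts (next_record vs)"

lemma terms_check_iff:
  "terms_check d L \<phi> zs Ts vs \<longleftrightarrow>
     (\<forall>i < length Ts. term_check d L \<phi> zs (Ts ! i) ((next_record ^^ i) vs))"
proof (induction Ts arbitrary: vs)
  case (Cons T Ts)
  have "(\<forall>i < length (T # Ts). term_check d L \<phi> zs ((T # Ts) ! i) ((next_record ^^ i) vs)) \<longleftrightarrow>
     term_check d L \<phi> zs T vs \<and> (\<forall>i < length Ts. term_check d L \<phi> zs (Ts ! i) ((next_record ^^ Suc i) vs))"
    by (auto simp: less_Suc_eq_0_disj)
  then show ?case using Cons by (simp add: funpow_Suc_right del: funpow.simps)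
qed simp

lemma run_verify_terms:
  assumes "bounded L zs" "1 \<le> L"
    "\<And>T. T \<in> set Ts \<Longrightarrow> length (acts_on T) \<le> k \<and> length (entries T) = num_entries d (acts_on T)"
    "\<And>ds. length ds \<le> k \<Longrightarrow> set ds \<subseteq> {..<d} \<Longrightarrow>
      form_vars (\<phi> ds) \<le> Suc (3 * num_entries d ds) \<and> form_size (\<phi> ds) < f"
    "bounded L (bit_symbols (enc_list enc_term Ts))" "bounded L vs" "1 \<le> d"
  shows "\<exists>vs'. (run L (verify_terms d k f \<phi>) ^^ length Ts) (frame zs (bit_symbols (enc_list enc_term Ts)) vs fail) =
     frame zs [1] vs' (fail \<or> \<not> terms_check d L \<phi> zs Ts vs)"
  using assms(3,5,6)
proof (induction Ts arbitrary: vs fail)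
  case Nil
  then show ?case by (auto simp: enc_list_def)
next
  case (Cons T Ts)
  let ?rest = "bit_symbols (enc_list enc_term Ts)"
  let ?ds = "map (cert_digit d L zs) (acts_on T)"
  let ?xs = "bit_symbols (enc_list enc_entry (entries T)) @ ?rest"
  have T: "length (acts_on T) \<le> k" "length (entries T) = num_entries d (acts_on T)"
    using Cons.prems(1) by auto
  have ds: "length ?ds \<le> k" "set ?ds \<subseteq> {..<d}" "num_entries d ?ds = num_entries d (acts_on T)"
    using T assms(7) by (auto simp: cert_digit_def num_entries_def)
  have enc: "bit_symbols (enc_list enc_term (T # Ts)) = 2 # bit_symbols (enc_list enc_nat (acts_on T)) @ ?xs"
    by (simp add: enc_list_def enc_term_def)
  have b: "bounded L (bit_symbols (enc_list enc_nat (acts_on T)) @ ?xs)" "bounded L ?xs" "bounded L ?rest"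
    using Cons.prems(2) unfolding enc by (auto simp: bounded_def)
  have 0: "run L (verify_terms d k f \<phi>) (frame zs (bit_symbols (enc_list enc_term (T # Ts))) vs fail) =
     run L (names d (leaf d f \<phi>) k []) (frame zs (bit_symbols (enc_list enc_nat (acts_on T)) @ ?xs) vs fail)"
  proof -
    have "run L (Pop 2) (frame zs (2 # ys) vs fail) = frame zs ys vs fail" for ys
      by (auto simp: frame_def fun_eq_iff)
    moreover have "frame zs (2 # ys) vs fail 2 = 2 # ys" for ys by (simp add: frame_def)
    ultimately show ?thesis unfolding enc verify_terms_def by (simp del: run.simps(3))
  qed
  have 1: "run L (names d (leaf d f \<phi>) k []) (frame zs (bit_symbols (enc_list enc_nat (acts_on T)) @ ?xs) vs fail) =
     run L (leaf d f \<phi> ([] @ ?ds)) (frame zs ?xs vs fail)"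
    by (rule run_names) (use assms(1) T b in auto)
  have 2: "run L (leaf d f \<phi> ?ds) (frame zs ?xs vs fail) =
     frame zs ?rest (next_record vs) (fail \<or> \<not> term_check d L \<phi> zs T vs)"
    unfolding term_check_def
  proof (rule run_leaf)
    show "form_vars (\<phi> ?ds) \<le> Suc (3 * num_entries d ?ds)" "form_size (\<phi> ?ds) < f"
      using assms(4)[OF ds(1,2)] by auto
  qed (use T ds b Cons.prems(3) assms(2) in auto)
  obtain vs' where vs': "(run L (verify_terms d k f \<phi>) ^^ length Ts)
      (frame zs ?rest (next_record vs) (fail \<or> \<not> term_check d L \<phi> zs T vs)) =
     frame zs [1] vs' ((fail \<or> \<not> term_check d L \<phi> zs T vs) \<or> \<not> terms_check d L \<phi> zs Ts (next_record vs))"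
    using Cons.IH[of "next_record vs" "fail \<or> \<not> term_check d L \<phi> zs T vs"] Cons.prems b
      bounded_next_record by auto
  have "run L (verify_terms d k f \<phi>) (frame zs (bit_symbols (enc_list enc_term (T # Ts))) vs fail) =
      frame zs ?rest (next_record vs) (fail \<or> \<not> term_check d L \<phi> zs T vs)"
    unfolding 0 1 append_Nil 2 ..
  from loop_step[OF this vs'] show ?case by (auto simp del: funpow.simps)
qed

theorem run_verifier:
  fixes H :: hamiltonian and y :: "bool list"
  assumes "\<And>T. T \<in> set (local_terms H) \<Longrightarrow>
      length (acts_on T) \<le> k \<and> length (entries T) = num_entries d (acts_on T)"
    "\<And>ds. length ds \<le> k \<Longrightarrow> set ds \<subseteq> {..<d} \<Longrightarrow>
      form_vars (\<phi> ds) \<le> Suc (3 * num_entries d ds) \<and> form_size (\<phi> ds) < f"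
    "1 \<le> d"
  defines "w \<equiv> input_pair (enc_hamiltonian H) y"
  shows "top_of (run (length w) (verifier d k f \<phi>) (input_store w) 0) = 2 \<longleftrightarrow>
    terms_check d (length w) \<phi> (bit_symbols y) (local_terms H) (bit_symbols y)"
proof -
  let ?L = "length w"
  let ?x = "bit_symbols (enc_hamiltonian H)" and ?zs = "bit_symbols y"
  let ?Ts = "local_terms H"
  have w: "w = ?x @ 3 # ?zs" by (simp add: w_def input_pair_def bit_symbols_def)
  have len: "length ?x \<le> ?L" "length ?zs \<le> ?L" "1 \<le> ?L" by (simp_all add: w)
  let ?b = "Case 0 Skip (Pop 0 ;; Push 1 1) (Pop 0 ;; Push 1 2) Skip"
  let ?S = "\<lambda>xs ys. (\<lambda>_. [])(0 := xs, Suc 0 := ys)"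
  have split: "(run ?L ?b ^^ length bs) (?S (bit_symbols bs @ 3 # ?zs) ys) = ?S (3 # ?zs) (rev (bit_symbols bs) @ ys)" for bs ys
  proof (induction bs arbitrary: ys)
    case (Cons b bs)
    have "run ?L ?b (?S (bit_symbols (b # bs) @ 3 # ?zs) ys) = ?S (bit_symbols bs @ 3 # ?zs) (bit_symbol b # ys)"
      by (auto simp: bit_symbols_Cons bit_symbol_def fun_eq_iff)
    from loop_step[OF this Cons.IH] show ?case
      by (simp only: length_Cons bit_symbols_Cons rev.simps append_assoc append_Cons append_Nil)
  qed simp
  have 1: "(run ?L ?b ^^ ?L) (input_store w) = ?S (3 # ?zs) (rev ?x)"
  proof (rule loop_fixed)
    have "input_store w = ?S (?x @ 3 # ?zs) []" by (auto simp: input_store_def w fun_eq_iff)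
    then show "(run ?L ?b ^^ length (enc_hamiltonian H)) (input_store w) = ?S (3 # ?zs) (rev ?x)"
      using split[of "enc_hamiltonian H" "[]"] by (simp only: append_Nil2)
  qed (use len in auto)
  have 2: "run ?L (Pop 0) (?S (3 # ?zs) (rev ?x)) = ?S ?zs (rev ?x)"
    by (auto simp: fun_eq_iff)
  have 3: "run ?L (move 1 1 2) (?S ?zs (rev ?x)) = (\<lambda>_. [])(0 := ?zs, 2 := ?x)"
    by (subst run_move) (use len in \<open>auto simp: fun_eq_iff\<close>)
  have 4: "run ?L (copy 1 0 3 1) ((\<lambda>_. [])(0 := ?zs, 2 := ?x)) = frame ?zs ?x ?zs False"
    by (subst run_copy) (use len in \<open>auto simp: fun_eq_iff frame_def\<close>)
  let ?rest = "bit_symbols (enc_list enc_term ?Ts)"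
  have x: "?x = bit_symbols (enc_nat (num_qudits H)) @ ?rest" by (simp add: enc_hamiltonian_def)
  have bx: "bounded ?L ?x" "bounded ?L ?zs" using len by (simp_all add: bounded_def)
  have read: "run ?L (read 2 1 12) (frame ?zs ?x ?zs False) =
      (frame ?zs ?x ?zs False)(2 := ?rest, 12 := nat_field (num_qudits H))"
    and b: "bounded ?L ?rest" "bounded ?L (nat_field (num_qudits H))"
    using run_read_nat[of "frame ?zs ?x ?zs False" 2 "num_qudits H" ?rest ?L 1 12] x bx
    by (auto simp: frame_def)
  have 5: "run ?L (read 2 1 12) (frame ?zs ?x ?zs False) =
      (frame ?zs ?rest ?zs False)(12 := nat_field (num_qudits H))"
    unfolding read by (auto simp: frame_def fun_eq_iff)
  have 6: "run ?L (clear 1 12) ((frame ?zs ?rest ?zs False)(12 := nat_field (num_qudits H))) =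
      frame ?zs ?rest ?zs False"
    by (subst run_clear) (use b in \<open>auto simp: bounded_def frame_def fun_eq_iff\<close>)
  obtain vs where vs: "(run ?L (verify_terms d k f \<phi>) ^^ length ?Ts) (frame ?zs ?rest ?zs False) =
      frame ?zs [1] vs (False \<or> \<not> terms_check d ?L \<phi> ?zs ?Ts ?zs)"
    using run_verify_terms[OF bx(2) len(3) assms(1,2) b(1) bx(2) assms(3)] by blast
  let ?ok = "terms_check d ?L \<phi> ?zs ?Ts ?zs"
  have 7: "(run ?L (verify_terms d k f \<phi>) ^^ ?L) (frame ?zs ?rest ?zs False) =
      frame ?zs [1] vs (False \<or> \<not> ?ok)"
  proof (rule loop_fixed[OF vs])
    show "run ?L (verify_terms d k f \<phi>) (frame ?zs [1] vs (False \<or> \<not> ?ok)) = frame ?zs [1] vs (False \<or> \<not> ?ok)"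
      by (simp add: verify_terms_def frame_def)
    have "length Ts \<le> length (enc_list enc_term Ts)" for Ts
      by (induction Ts) (auto simp: enc_list_def)
    then show "length ?Ts \<le> ?L" using b(1) by (auto simp: bounded_def intro: le_trans)
  qed
  have "run ?L (verifier d k f \<phi>) (input_store w) =
      run ?L (Case 10 (Push 0 2) (Push 0 1) (Push 0 1) (Push 0 1)) (frame ?zs [1] vs (False \<or> \<not> ?ok))"
    unfolding verifier_def run.simps(4,6) 1 2 3 4 5 6 7 ..
  then show ?thesis by (simp add: frame_def)
qed

section \<open>Hermitian matrices, their ground projectors, and common ground vectors\<close>

section \<open>The spectral theorem\<close>

definition hermitian :: "nat \<Rightarrow> complex mat \<Rightarrow> bool" where
  "hermitian n A \<longleftrightarrow> A \<in> carrier_mat n n \<and> (\<forall>x < n. \<forall>y < n. A $$ (x, y) = cnj (A $$ (y, x)))"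

lemma hermitianD: "hermitian n A \<Longrightarrow> x < n \<Longrightarrow> y < n \<Longrightarrow> cnj (A $$ (x, y)) = A $$ (y, x)"
  unfolding hermitian_def by (metis complex_cnj_cnj)

lemma hermitian_mat_iff:
  assumes "A \<in> carrier_mat n n"
  shows "hermitian_mat A \<longleftrightarrow> hermitian n A"
proof -
  have dims: "dim_row A = n" "dim_col A = n" using assms by auto
  have adj: "mat_adjoint A = mat n n (\<lambda>(x, y). cnj (A $$ (y, x)))"
  proof (rule eq_matI)
    fix x y assume "x < dim_row (mat n n (\<lambda>(x, y). cnj (A $$ (y, x))))"
      "y < dim_col (mat n n (\<lambda>(x, y). cnj (A $$ (y, x))))"
    then have xy: "x < n" "y < n" by simp_all
    then show "mat_adjoint A $$ (x, y) = mat n n (\<lambda>(x, y). cnj (A $$ (y, x))) $$ (x, y)"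
      by (simp add: mat_adjoint_def mat_of_rows_def dims)
  qed (simp_all add: mat_adjoint_def dims)
  show ?thesis
  proof
    assume "hermitian_mat A"
    then have "mat n n (\<lambda>(x, y). cnj (A $$ (y, x))) = A" by (simp add: hermitian_mat_def adj)
    then have "A $$ (x, y) = mat n n (\<lambda>(x, y). cnj (A $$ (y, x))) $$ (x, y)" for x y by simp
    then show "hermitian n A" using assms unfolding hermitian_def
      by (metis (no_types, lifting) case_prod_conv index_mat(1))
  next
    assume H: "hermitian n A"
    have "mat n n (\<lambda>(x, y). cnj (A $$ (y, x))) = A"
    proof (rule eq_matI)
      fix x y assume "x < dim_row A" "y < dim_col A"
      then have "x < n" "y < n" by (simp_all add: dims)
      moreover from this have "A $$ (x, y) = cnj (A $$ (y, x))" using H unfolding hermitian_def by blast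
      ultimately show "mat n n (\<lambda>(x, y). cnj (A $$ (y, x))) $$ (x, y) = A $$ (x, y)" by simp
    qed (simp_all add: dims)
    then show "hermitian_mat A" by (simp add: hermitian_mat_def adj dims)
  qed
qed

lemma mult_mat_vec_index:
  "A \<in> carrier_mat n n \<Longrightarrow> v \<in> carrier_vec n \<Longrightarrow> x < n \<Longrightarrow> (A *\<^sub>v v) $ x = (\<Sum>y<n. A $$ (x, y) * v $ y)"
  by (auto simp: scalar_prod_def lessThan_atLeast0 intro!: sum.cong)

lemma mult_mat_index:
  "A \<in> carrier_mat n n \<Longrightarrow> B \<in> carrier_mat n n \<Longrightarrow> x < n \<Longrightarrow> y < n \<Longrightarrow>
    (A * B) $$ (x, y) = (\<Sum>z<n. A $$ (x, z) * B $$ (z, y))"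
  by (auto simp: scalar_prod_def lessThan_atLeast0 intro!: sum.cong)

text \<open>Vectors are functions of which only the values below \<open>n\<close> matter; sums and
  multiples then need no carrier conditions.\<close>

definition inprod :: "nat \<Rightarrow> (nat \<Rightarrow> complex) \<Rightarrow> (nat \<Rightarrow> complex) \<Rightarrow> complex" where
  "inprod n v w = (\<Sum>x<n. v x * cnj (w x))"

definition apply_mat :: "nat \<Rightarrow> complex mat \<Rightarrow> (nat \<Rightarrow> complex) \<Rightarrow> nat \<Rightarrow> complex" where
  "apply_mat n A v x = (\<Sum>y<n. A $$ (x, y) * v y)"

lemma inprod_hermitian:
  assumes "hermitian n A"
  shows "inprod n (apply_mat n A v) w = inprod n v (apply_mat n A w)"
proof -
  have "inprod n (apply_mat n A v) w = (\<Sum>x<n. \<Sum>y<n. A $$ (x, y) * v y * cnj (w x))"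
    by (simp add: inprod_def apply_mat_def sum_distrib_right)
  also have "\<dots> = (\<Sum>y<n. \<Sum>x<n. A $$ (x, y) * v y * cnj (w x))" by (rule sum.swap)
  also have "\<dots> = (\<Sum>y<n. \<Sum>x<n. v y * cnj (A $$ (y, x) * w x))"
    by (intro sum.cong refl) (simp add: hermitianD[OF assms])
  also have "\<dots> = inprod n v (apply_mat n A w)"
    by (simp add: inprod_def apply_mat_def sum_distrib_left)
  finally show ?thesis .
qed

lemma apply_mat_smult: "apply_mat n A (\<lambda>x. c * v x) x = c * apply_mat n A v x"
  by (simp add: apply_mat_def sum_distrib_left algebra_simps)

lemma inprod_smult_left: "inprod n (\<lambda>x. c * v x) w = c * inprod n v w"
  by (simp add: inprod_def sum_distrib_left algebra_simps)

lemma inprod_smult_right: "inprod n v (\<lambda>x. c * w x) = cnj c * inprod n v w"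
  by (simp add: inprod_def sum_distrib_left algebra_simps)

lemma inprod_cong: "(\<And>x. x < n \<Longrightarrow> v x = v' x) \<Longrightarrow> (\<And>x. x < n \<Longrightarrow> w x = w' x) \<Longrightarrow> inprod n v w = inprod n v' w'"
  by (simp add: inprod_def)

lemma inprod_self: "inprod n v v = of_real (\<Sum>x<n. (cmod (v x))\<^sup>2)"
  by (simp add: inprod_def complex_norm_square of_real_sum del: of_real_power)

lemma inprod_self_eq_0: "inprod n v v = 0 \<longleftrightarrow> (\<forall>x<n. v x = 0)"
proof -
  have "(\<Sum>x<n. (cmod (v x))\<^sup>2) = 0 \<longleftrightarrow> (\<forall>x\<in>{..<n}. (cmod (v x))\<^sup>2 = 0)"
    by (rule sum_nonneg_eq_0_iff) auto
  then show ?thesis unfolding inprod_self of_real_eq_0_iff by auto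
qed

definition eigen :: "nat \<Rightarrow> complex mat \<Rightarrow> (nat \<Rightarrow> complex) \<Rightarrow> complex \<Rightarrow> bool" where
  "eigen n A v e \<longleftrightarrow> (\<forall>x<n. apply_mat n A v x = e * v x)"

lemma eigenvalue_eigen:
  assumes "A \<in> carrier_mat n n"
  shows "eigenvalue A e \<longleftrightarrow> (\<exists>v. eigen n A v e \<and> (\<exists>x<n. v x \<noteq> 0))"
proof
  assume "eigenvalue A e"
  then obtain v where v: "v \<in> carrier_vec n" "v \<noteq> 0\<^sub>v n" "A *\<^sub>v v = e \<cdot>\<^sub>v v"
    using assms by (auto simp: eigenvalue_def eigenvector_def)
  have "apply_mat n A (\<lambda>x. v $ x) x = e * v $ x" if "x < n" for x
    using mult_mat_vec_index[OF assms v(1) that] v that by (simp add: apply_mat_def)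
  moreover have "\<exists>x<n. v $ x \<noteq> 0" using v(1,2) by (auto simp: vec_eq_iff)
  ultimately show "\<exists>v. eigen n A v e \<and> (\<exists>x<n. v x \<noteq> 0)"
    by (intro exI[of _ "\<lambda>x. v $ x"]) (simp add: eigen_def)
next
  assume "\<exists>v. eigen n A v e \<and> (\<exists>x<n. v x \<noteq> 0)"
  then obtain v where v: "eigen n A v e" "\<exists>x<n. v x \<noteq> 0" by blast
  have "A *\<^sub>v vec n v = e \<cdot>\<^sub>v vec n v"
    using assms v(1) by (intro eq_vecI) (auto simp: mult_mat_vec_index eigen_def apply_mat_def simp del: index_mult_mat_vec)
  moreover have "vec n v \<noteq> 0\<^sub>v n" using v(2) by (auto simp: vec_eq_iff)
  ultimately show "eigenvalue A e" unfolding eigenvalue_def eigenvector_def using assms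
    by (intro exI[of _ "vec n v"]) auto
qed

lemma eigen_real:
  assumes "hermitian n A" "eigen n A v e" "\<exists>x<n. v x \<noteq> 0"
  shows "e \<in> \<real>"
proof -
  have "e * inprod n v v = inprod n (apply_mat n A v) v"
    unfolding inprod_smult_left[symmetric] using assms(2) by (intro inprod_cong) (auto simp: eigen_def)
  also have "\<dots> = inprod n v (apply_mat n A v)" by (rule inprod_hermitian[OF assms(1)])
  also have "\<dots> = cnj e * inprod n v v"
    unfolding inprod_smult_right[symmetric] using assms(2) by (intro inprod_cong) (auto simp: eigen_def)
  finally show ?thesis using inprod_self_eq_0[of n v] assms(3) by (auto simp: Reals_cnj_iff)
qed

lemma eigen_orthogonal:
  assumes "hermitian n A" "eigen n A v e" "eigen n A w (of_real c)" "e \<noteq> of_real c"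
  shows "inprod n v w = 0"
proof -
  have "e * inprod n v w = inprod n (apply_mat n A v) w"
    unfolding inprod_smult_left[symmetric] using assms(2) by (intro inprod_cong) (auto simp: eigen_def)
  also have "\<dots> = inprod n v (apply_mat n A w)" by (rule inprod_hermitian[OF assms(1)])
  also have "\<dots> = cnj (of_real c) * inprod n v w"
    unfolding inprod_smult_right[symmetric] using assms(3) by (intro inprod_cong) (auto simp: eigen_def)
  finally show ?thesis using assms(4) by auto
qed

definition trace :: "complex mat \<Rightarrow> complex" where
  "trace A = (\<Sum>x<dim_row A. A $$ (x, x))"

lemma trace_comm:
  assumes "A \<in> carrier_mat n n" "B \<in> carrier_mat n n"
  shows "trace (A * B) = trace (B * A)"
proof -
  have "trace (A * B) = (\<Sum>x<n. \<Sum>z<n. A $$ (x, z) * B $$ (z, x))"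
    using assms by (simp add: trace_def mult_mat_index del: index_mult_mat(1))
  also have "\<dots> = (\<Sum>z<n. \<Sum>x<n. B $$ (z, x) * A $$ (x, z))"
    by (subst sum.swap) (simp add: mult.commute)
  also have "\<dots> = trace (B * A)"
    using assms by (simp add: trace_def mult_mat_index del: index_mult_mat(1))
  finally show ?thesis .
qed

text \<open>By Schur's triangularization the trace is the sum of the eigenvalues with multiplicity;
  if all of them were \<open>c\<close> it would be \<open>n * c\<close>.\<close>

lemma exists_other_eigenvalue:
  assumes M: "M \<in> carrier_mat n n" and tr: "trace M \<noteq> of_nat n * c"
  shows "\<exists>e. eigenvalue M e \<and> e \<noteq> c"
proof (rule ccontr)
  assume *: "\<not> ?thesis"
  obtain es where es: "char_poly M = (\<Prod>a\<leftarrow>es. [:- a, 1:])" "length es = n"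
    using char_poly_factorized[OF M] by blast
  have "e = c" if "e \<in> set es" for e
  proof -
    have "poly (char_poly M) e = 0" unfolding es(1) poly_prod_list
      using that by (auto simp: prod_list_zero_iff)
    then show ?thesis using * eigenvalue_root_char_poly[OF M] by blast
  qed
  then have c: "es ! i = c" if "i < n" for i using that es(2) by simp
  obtain B P Q where B: "schur_decomposition M es = (B, P, Q)" by (metis surj_pair)
  have s: "similar_mat_wit M B P Q" "diag_mat B = es" using schur_decomposition[OF M es(1) B] by auto
  note w = similar_mat_witD2[OF M s(1)]
  have "trace M = trace (P * (B * Q))" using w by simp
  also have "\<dots> = trace ((B * Q) * P)" using w by (intro trace_comm) auto
  also have "(B * Q) * P = B" using w by (simp add: assoc_mult_mat[of B n n Q n P n])
  also have "trace B = (\<Sum>i<n. es ! i)"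
    using w s(2) by (auto simp: trace_def diag_mat_def intro!: sum.cong)
  also have "\<dots> = of_nat n * c" using c by simp
  finally show False using tr by simp
qed

definition orthonormal :: "nat \<Rightarrow> nat \<Rightarrow> (nat \<Rightarrow> nat \<Rightarrow> complex) \<Rightarrow> bool" where
  "orthonormal n k u \<longleftrightarrow> (\<forall>i<k. \<forall>j<k. inprod n (u i) (u j) = (if i = j then 1 else 0))"

text \<open>
  Moving the eigenvalues already found to a common real value \<open>c\<close> keeps the matrix Hermitian.  For all
  but one \<open>c\<close> the trace forces a further eigenvalue, whose eigenvector is orthogonal to the old ones.
\<close>
lemma extend_eigenvectors:
  assumes A: "hermitian n A" and u: "orthonormal n k u" "\<And>i. i < k \<Longrightarrow> eigen n A (u i) (of_real (l i))"
    and k: "k < n"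
  shows "\<exists>v e. inprod n v v = 1 \<and> (\<forall>i<k. inprod n v (u i) = 0) \<and> eigen n A v (of_real e)"
proof -
  have Ac: "A \<in> carrier_mat n n" using A by (simp add: hermitian_def)
  define t where "t = (\<Sum>x<n. Re (A $$ (x, x))) - (\<Sum>i<k. l i)"
  \<comment> \<open>The modified matrix has trace \<open>t + k * c\<close>, which equals
    \<open>n * c\<close> for \<open>c = t / (n - k)\<close> only; adding 1 avoids this
    value.\<close>
  define c where "c = t / (real n - real k) + 1"
  define M where "M = mat n n (\<lambda>(x, y). A $$ (x, y) + (\<Sum>i<k. of_real (c - l i) * u i x * cnj (u i y)))"
  have M: "M \<in> carrier_mat n n" by (simp add: M_def)
  have MH: "hermitian n M"
    unfolding hermitian_def
  proof (intro conjI allI impI M)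
    fix x y assume "x < n" "y < n"
    then show "M $$ (x, y) = cnj (M $$ (y, x))"
      by (simp add: M_def hermitianD[OF A] mult.commute mult.left_commute)
  qed
  have M_apply: "apply_mat n M v x = apply_mat n A v x + (\<Sum>i<k. of_real (c - l i) * u i x * inprod n v (u i))"
    if "x < n" for v x
  proof -
    have "apply_mat n M v x = apply_mat n A v x + (\<Sum>y<n. \<Sum>i<k. of_real (c - l i) * u i x * (v y * cnj (u i y)))"
      using that by (simp add: apply_mat_def M_def sum.distrib distrib_right sum_distrib_right)
        (simp add: mult.commute mult.left_commute)
    also have "(\<Sum>y<n. \<Sum>i<k. of_real (c - l i) * u i x * (v y * cnj (u i y))) =
        (\<Sum>i<k. of_real (c - l i) * u i x * inprod n v (u i))"
      by (subst sum.swap) (simp add: inprod_def sum_distrib_left)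
    finally show ?thesis .
  qed
  have Mu: "eigen n M (u j) (of_real c)" if "j < k" for j
    unfolding eigen_def
  proof (intro allI impI)
    fix x assume x: "x < n"
    have "(\<Sum>i<k. of_real (c - l i) * u i x * inprod n (u j) (u i)) =
        (\<Sum>i<k. if i = j then of_real (c - l j) * u j x else 0)"
      using u(1) that by (intro sum.cong) (auto simp: orthonormal_def)
    also have "\<dots> = of_real (c - l j) * u j x" using that by simp
    finally show "apply_mat n M (u j) x = of_real c * u j x"
      using u(2)[OF that] x by (simp add: M_apply eigen_def algebra_simps)
  qed
  have "trace M = (\<Sum>x<n. A $$ (x, x)) + (\<Sum>x<n. \<Sum>i<k. of_real (c - l i) * u i x * cnj (u i x))"
    by (simp add: trace_def M_def sum.distrib)
  also have "(\<Sum>x<n. A $$ (x, x)) = of_real (\<Sum>x<n. Re (A $$ (x, x)))"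
  proof -
    have "A $$ (x, x) = of_real (Re (A $$ (x, x)))" if "x < n" for x
      using hermitianD[OF A that that] by (metis Reals_cnj_iff of_real_Re)
    then show ?thesis by simp
  qed
  also have "(\<Sum>x<n. \<Sum>i<k. of_real (c - l i) * u i x * cnj (u i x)) = (\<Sum>i<k. of_real (c - l i) * inprod n (u i) (u i))"
    by (subst sum.swap) (simp add: inprod_def sum_distrib_left mult.assoc)
  also have "\<dots> = (\<Sum>i<k. of_real (c - l i))"
    using u(1) by (intro sum.cong) (auto simp: orthonormal_def)
  finally have "trace M = of_real (t + real k * c)"
    by (simp add: t_def sum_subtractf)
  moreover have "t + real k * c \<noteq> real n * c"
  proof -
    have "(real n - real k) * c = t + (real n - real k)" using k by (simp add: c_def field_simps)
    then show ?thesis using k by (auto simp: algebra_simps)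
  qed
  ultimately have "trace M \<noteq> of_nat n * of_real c"
    by (metis of_real_eq_iff of_real_mult of_real_of_nat_eq)
  then obtain e where e: "eigenvalue M e" "e \<noteq> of_real c" using exists_other_eigenvalue[OF M] by blast
  then obtain v where v: "eigen n M v e" "\<exists>x<n. v x \<noteq> 0" using eigenvalue_eigen[OF M] by blast
  \<comment> \<open>An eigenvector for an eigenvalue other than \<open>c\<close> is orthogonal to
    all \<open>u i\<close>. The terms added to \<open>A\<close> vanish on it, so it is an
    eigenvector of \<open>A\<close> as well.\<close>
  have orth: "inprod n v (u i) = 0" if "i < k" for i
    using eigen_orthogonal[OF MH v(1) Mu[OF that] e(2)] .
  have Av: "eigen n A v e" using v(1) orth by (simp add: eigen_def M_apply)
  obtain r where r: "e = of_real r" using eigen_real[OF A Av v(2)] by (auto elim: Reals_cases)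
  define s where "s = (\<Sum>x<n. (cmod (v x))\<^sup>2)"
  have s: "inprod n v v = of_real s" by (simp add: s_def inprod_self)
  have "s \<noteq> 0" using inprod_self_eq_0[of n v] v(2) s by auto
  moreover have "s \<ge> 0" by (simp add: s_def sum_nonneg)
  ultimately have s0: "s > 0" by simp
  define w where "w = (\<lambda>x. of_real (1 / sqrt s) * v x)"
  have "inprod n w w = of_real (1 / sqrt s) * (of_real (1 / sqrt s) * of_real s)"
    unfolding w_def inprod_smult_left inprod_smult_right s by simp
  also have "\<dots> = 1" using s0 by (simp add: field_simps flip: of_real_mult)
  finally have "inprod n w w = 1" .
  moreover have "inprod n w (u i) = 0" if "i < k" for i
    unfolding w_def inprod_smult_left using orth[OF that] by simp
  moreover have "eigen n A w (of_real r)"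
    using Av unfolding eigen_def w_def apply_mat_smult r by simp
  ultimately show ?thesis by blast
qed

definition spectral :: "nat \<Rightarrow> complex mat \<Rightarrow> (nat \<Rightarrow> nat \<Rightarrow> complex) \<Rightarrow> (nat \<Rightarrow> real) \<Rightarrow> bool" where
  "spectral n A u l \<longleftrightarrow> A \<in> carrier_mat n n \<and> orthonormal n n u \<and>
     (\<forall>x<n. \<forall>y<n. (\<Sum>i<n. u i x * cnj (u i y)) = (if x = y then 1 else 0)) \<and>
     (\<forall>i<n. eigen n A (u i) (of_real (l i)))"

theorem spectral_theorem:
  assumes "hermitian n A"
  shows "\<exists>u l. spectral n A u l"
proof -
  have "\<exists>u l. orthonormal n k u \<and> (\<forall>i<k. eigen n A (u i) (of_real (l i)))" if "k \<le> n" for k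
    using that
  proof (induction k)
    case 0
    then show ?case by (simp add: orthonormal_def)
  next
    case (Suc k)
    then obtain u l where u: "orthonormal n k u" "\<forall>i<k. eigen n A (u i) (of_real (l i :: real))" by auto
    obtain v e where v: "inprod n v v = 1" "\<forall>i<k. inprod n v (u i) = 0" "eigen n A v (of_real e)"
      using extend_eigenvectors[OF assms u(1), of l] u(2) Suc.prems by auto
    have v': "inprod n (u i) v = 0" if "i < k" for i
    proof -
      have "inprod n (u i) v = cnj (inprod n v (u i))" by (simp add: inprod_def mult.commute)
      with v(2) that show ?thesis by simp
    qed
    have "orthonormal n (Suc k) (u(k := v))"
      using u(1) v v' by (auto simp: orthonormal_def less_Suc_eq)
    moreover have "\<forall>i<Suc k. eigen n A ((u(k := v)) i) (of_real ((l(k := e)) i))"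
      using u(2) v(3) by (auto simp: less_Suc_eq)
    ultimately show ?case by blast
  qed
  then obtain u l where u: "orthonormal n n u" "\<forall>i<n. eigen n A (u i) (of_real (l i :: real))" by blast
  define U where "U = mat n n (\<lambda>(i, x). u i x)"
  define V where "V = mat n n (\<lambda>(x, i). cnj (u i x))"
  have "U * V = 1\<^sub>m n"
    using u(1) by (auto intro!: eq_matI simp: U_def V_def orthonormal_def inprod_def scalar_prod_def lessThan_atLeast0)
  \<comment> \<open>For square matrices a right inverse is a left inverse: orthonormality of
    \<open>n\<close> vectors yields their completeness.\<close>
  then have VU: "V * U = 1\<^sub>m n"
    by (rule mat_mult_left_right_inverse[rotated 2]) (auto simp: U_def V_def)
  have "(\<Sum>i<n. u i x * cnj (u i y)) = (if x = y then 1 else 0)" if "x < n" "y < n" for x y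
  proof -
    have "(V * U) $$ (y, x) = (\<Sum>i<n. u i x * cnj (u i y))"
      using that by (auto simp: U_def V_def scalar_prod_def lessThan_atLeast0 mult.commute intro!: sum.cong)
    with VU that show ?thesis by auto
  qed
  with u assms show ?thesis unfolding spectral_def hermitian_def by blast
qed

lemma spectral_expand:
  assumes "spectral n A u l" "x < n"
  shows "v x = (\<Sum>i<n. inprod n v (u i) * u i x)"
proof -
  have "(\<Sum>i<n. inprod n v (u i) * u i x) = (\<Sum>i<n. \<Sum>y<n. v y * (u i x * cnj (u i y)))"
    by (simp add: inprod_def sum_distrib_right mult.assoc) (simp add: mult.commute mult.left_commute)
  also have "\<dots> = (\<Sum>y<n. v y * (\<Sum>i<n. u i x * cnj (u i y)))"
    by (subst sum.swap) (simp add: sum_distrib_left)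
  also have "\<dots> = (\<Sum>y<n. if y = x then v x else 0)"
    using assms unfolding spectral_def by (intro sum.cong refl) auto
  also have "\<dots> = v x" using assms(2) by simp
  finally show ?thesis by simp
qed

lemma spectral_inprod:
  assumes "spectral n A u l"
  shows "inprod n v w = (\<Sum>i<n. inprod n v (u i) * cnj (inprod n w (u i)))"
proof -
  have "inprod n v w = (\<Sum>x<n. (\<Sum>i<n. inprod n v (u i) * u i x) * cnj (w x))"
    unfolding inprod_def[of n v w] by (intro sum.cong refl) (simp add: spectral_expand[OF assms, of _ v])
  also have "\<dots> = (\<Sum>i<n. \<Sum>x<n. inprod n v (u i) * (u i x * cnj (w x)))"
    by (subst sum.swap) (simp add: sum_distrib_right mult.assoc)
  also have "\<dots> = (\<Sum>i<n. inprod n v (u i) * cnj (inprod n w (u i)))"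
    by (simp add: inprod_def sum_distrib_left mult.commute)
  finally show ?thesis .
qed

lemma apply_mat_mult:
  assumes "X \<in> carrier_mat n n" "Y \<in> carrier_mat n n" "x < n"
  shows "apply_mat n (X * Y) v x = apply_mat n X (apply_mat n Y v) x"
proof -
  have "apply_mat n (X * Y) v x = (\<Sum>y<n. \<Sum>z<n. X $$ (x, z) * Y $$ (z, y) * v y)"
    using assms by (simp add: apply_mat_def mult_mat_index sum_distrib_right del: index_mult_mat(1))
  also have "\<dots> = apply_mat n X (apply_mat n Y v) x"
    by (subst sum.swap) (simp add: apply_mat_def sum_distrib_left mult.assoc)
  finally show ?thesis .
qed

lemma apply_mat_cong: "(\<And>y. y < n \<Longrightarrow> v y = w y) \<Longrightarrow> apply_mat n A v x = apply_mat n A w x"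
  by (simp add: apply_mat_def)

lemma spectral_mat_eqI:
  assumes "spectral n A u l" "X \<in> carrier_mat n n" "Y \<in> carrier_mat n n"
    "\<And>j x. j < n \<Longrightarrow> x < n \<Longrightarrow> apply_mat n X (u j) x = apply_mat n Y (u j) x"
  shows "X = Y"
proof -
  have "Z $$ (x, y) = (\<Sum>j<n. apply_mat n Z (u j) x * cnj (u j y))" if "x < n" "y < n" for x y and Z :: "complex mat"
  proof -
    have "(\<Sum>j<n. apply_mat n Z (u j) x * cnj (u j y)) = (\<Sum>z<n. Z $$ (x, z) * (\<Sum>j<n. u j z * cnj (u j y)))"
      by (simp add: apply_mat_def sum_distrib_left sum_distrib_right mult.assoc) (rule sum.swap)
    also have "\<dots> = (\<Sum>z<n. if z = y then Z $$ (x, y) else 0)"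
      using assms(1) that unfolding spectral_def by (intro sum.cong refl) auto
    finally show ?thesis using that by simp
  qed
  with assms show ?thesis by (intro eq_matI) auto
qed

text \<open>The functional calculus: the matrix with eigenvectors \<open>u\<close> and with
  eigenvalues \<open>f i\<close> in place of those of the given matrix.\<close>

definition fun_mat :: "nat \<Rightarrow> (nat \<Rightarrow> nat \<Rightarrow> complex) \<Rightarrow> (nat \<Rightarrow> complex) \<Rightarrow> complex mat" where
  "fun_mat n u f = mat n n (\<lambda>(x, y). \<Sum>i<n. f i * u i x * cnj (u i y))"

lemma fun_mat_carrier [simp]: "fun_mat n u f \<in> carrier_mat n n"
  by (simp add: fun_mat_def)

lemma apply_fun_mat: "x < n \<Longrightarrow> apply_mat n (fun_mat n u f) v x = (\<Sum>i<n. f i * inprod n v (u i) * u i x)"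
proof -
  assume "x < n"
  then have "apply_mat n (fun_mat n u f) v x = (\<Sum>y<n. \<Sum>i<n. f i * (v y * cnj (u i y)) * u i x)"
    by (simp add: apply_mat_def fun_mat_def sum_distrib_right mult.assoc)
      (simp add: mult.commute mult.left_commute)
  also have "\<dots> = (\<Sum>i<n. f i * inprod n v (u i) * u i x)"
    by (subst sum.swap) (simp add: inprod_def sum_distrib_left sum_distrib_right)
  finally show ?thesis .
qed

lemma apply_fun_mat_basis:
  assumes "spectral n A u l" "j < n" "x < n"
  shows "apply_mat n (fun_mat n u f) (u j) x = f j * u j x"
proof -
  have "apply_mat n (fun_mat n u f) (u j) x = (\<Sum>i<n. if i = j then f j * u j x else 0)"
    unfolding apply_fun_mat[OF assms(3)]
    using assms unfolding spectral_def orthonormal_def by (intro sum.cong refl) auto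
  then show ?thesis using assms(2) by simp
qed

lemma spectral_hermitian: 
  assumes "spectral n A u l"
  shows "A = fun_mat n u (\<lambda>i. of_real (l i))" "hermitian n A"
proof -
  show eq: "A = fun_mat n u (\<lambda>i. of_real (l i))"
    by (rule spectral_mat_eqI[OF assms])
      (use assms in \<open>auto simp: spectral_def apply_fun_mat_basis[OF assms] eigen_def\<close>)
  show "hermitian n A"
    unfolding hermitian_def
  proof (intro conjI allI impI)
    show "A \<in> carrier_mat n n" using assms by (simp add: spectral_def)
    fix x y assume "x < n" "y < n"
    then show "A $$ (x, y) = cnj (A $$ (y, x))"
      unfolding eq by (simp add: fun_mat_def mult.commute mult.left_commute)
  qed
qed

text \<open>A matrix that commutes with \<open>A\<close> maps eigenspaces to themselves: the
  component of the image of \<open>u j\<close> along \<open>u i\<close> vanishes unless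
  \<open>l i = l j\<close>, and in that case \<open>f i = f j\<close>.\<close>

lemma fun_mat_commute:
  assumes sp: "spectral n A u l" and M: "M \<in> carrier_mat n n" "A * M = M * A"
    and f: "\<And>i j. i < n \<Longrightarrow> j < n \<Longrightarrow> l i = l j \<Longrightarrow> f i = f j"
  shows "fun_mat n u f * M = M * fun_mat n u f"
proof (rule spectral_mat_eqI[OF sp])
  have A: "A \<in> carrier_mat n n" and ev: "\<And>i. i < n \<Longrightarrow> eigen n A (u i) (of_real (l i))"
    using sp by (auto simp: spectral_def)
  fix j x assume j: "j < n" and x: "x < n"
  let ?w = "apply_mat n M (u j)"
  have coeff: "inprod n ?w (u i) = 0 \<or> l i = l j" if i: "i < n" for i
  proof -
    have "inprod n (apply_mat n A ?w) (u i) = of_real (l j) * inprod n ?w (u i)"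
    proof -
      have "apply_mat n A ?w x = of_real (l j) * ?w x" if "x < n" for x
      proof -
        have "apply_mat n A ?w x = apply_mat n M (apply_mat n A (u j)) x"
          using A M that by (simp flip: apply_mat_mult)
        also have "\<dots> = apply_mat n M (\<lambda>x. of_real (l j) * u j x) x"
          using ev[OF j] by (intro apply_mat_cong) (simp add: eigen_def)
        finally show ?thesis by (simp add: apply_mat_smult)
      qed
      then show ?thesis unfolding inprod_smult_left[symmetric] by (intro inprod_cong) auto
    qed
    moreover have "inprod n (apply_mat n A ?w) (u i) = of_real (l i) * inprod n ?w (u i)"
    proof -
      have "inprod n (apply_mat n A ?w) (u i) = inprod n ?w (apply_mat n A (u i))"
        by (rule inprod_hermitian[OF spectral_hermitian(2)[OF sp]])
      also have "\<dots> = inprod n ?w (\<lambda>x. of_real (l i) * u i x)"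
        using ev[OF i] by (intro inprod_cong) (auto simp: eigen_def)
      finally show ?thesis by (simp add: inprod_smult_right)
    qed
    ultimately show ?thesis by (metis mult_right_cancel of_real_eq_iff)
  qed
  have "apply_mat n (fun_mat n u f * M) (u j) x = (\<Sum>i<n. f i * inprod n ?w (u i) * u i x)"
    using M x by (simp add: apply_mat_mult apply_fun_mat)
  also have "\<dots> = (\<Sum>i<n. f j * (inprod n ?w (u i) * u i x))"
    using coeff f[OF _ j] by (intro sum.cong refl) (metis lessThan_iff mult.assoc mult_not_zero)
  also have "\<dots> = f j * ?w x"
    using spectral_expand[OF sp x, of ?w] by (simp flip: sum_distrib_left)
  also have "\<dots> = apply_mat n M (\<lambda>x. f j * u j x) x" by (simp add: apply_mat_smult)
  also have "\<dots> = apply_mat n M (apply_mat n (fun_mat n u f) (u j)) x"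
    by (intro apply_mat_cong) (simp add: apply_fun_mat_basis[OF sp j])
  also have "\<dots> = apply_mat n (M * fun_mat n u f) (u j) x"
    using M x by (simp add: apply_mat_mult)
  finally show "apply_mat n (fun_mat n u f * M) (u j) x = apply_mat n (M * fun_mat n u f) (u j) x" .
qed (use M in \<open>auto intro: mult_carrier_mat[of _ n n]\<close>)


section \<open>Ground spaces of commuting stoquastic matrices\<close>

lemma complex_nonneg_iff: "(0 :: complex) \<le> z \<longleftrightarrow> 0 \<le> Re z \<and> Im z = 0"
  by (auto simp: less_eq_complex_def)

lemma complex_mult_nonneg: "0 \<le> z \<Longrightarrow> 0 \<le> w \<Longrightarrow> 0 \<le> z * (w :: complex)"
  by (simp add: complex_nonneg_iff)

lemma complex_sum_nonneg: "(\<And>i. i \<in> I \<Longrightarrow> 0 \<le> f i) \<Longrightarrow> 0 \<le> (\<Sum>i\<in>I. f i :: complex)"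
  by (induction I rule: infinite_finite_induct) (auto simp: complex_nonneg_iff)

text \<open>The sum is an entry of the j-th power of \<open>c I - A\<close>, a matrix whose entries
  are non-negative as soon as \<open>c\<close> is at least every diagonal entry of
  \<open>A\<close>.\<close>

lemma spectral_powers_nonneg:
  assumes sp: "spectral n A u l"
    and c: "\<And>x. x < n \<Longrightarrow> Re (A $$ (x, x)) \<le> c"
    and off: "\<And>x y. x < n \<Longrightarrow> y < n \<Longrightarrow> x \<noteq> y \<Longrightarrow> A $$ (x, y) \<le> 0"
    and "x < n" "y < n"
  shows "0 \<le> (\<Sum>i<n. of_real ((c - l i) ^ j) * u i x * cnj (u i y))"
  using assms(4)
proof (induction j arbitrary: x)
  case 0
  then have "(\<Sum>i<n. of_real ((c - l i) ^ 0) * u i x * cnj (u i y)) = (if x = y then 1 else 0)"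
    using sp \<open>y < n\<close> by (simp add: spectral_def)
  then show ?case by (simp only:) (simp add: complex_nonneg_iff)
next
  case (Suc j)
  let ?S = "\<lambda>z. \<Sum>i<n. of_real ((c - l i) ^ j) * u i z * cnj (u i y)"
  let ?B = "\<lambda>z. (if x = z then of_real c else 0) - A $$ (x, z)"
  have Bu: "(\<Sum>z<n. ?B z * u i z) = of_real (c - l i) * u i x" if "i < n" for i
  proof -
    have "(\<Sum>z<n. ?B z * u i z) = (\<Sum>z<n. if x = z then of_real c * u i x else 0) - apply_mat n A (u i) x"
      unfolding apply_mat_def sum_subtractf[symmetric] by (intro sum.cong refl) (auto simp: algebra_simps)
    also have "apply_mat n A (u i) x = of_real (l i) * u i x"
      using sp Suc.prems that by (simp add: spectral_def eigen_def)
    finally show ?thesis using Suc.prems by (simp add: algebra_simps)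
  qed
  have "(\<Sum>i<n. of_real ((c - l i) ^ Suc j) * u i x * cnj (u i y)) =
      (\<Sum>i<n. (\<Sum>z<n. ?B z * u i z) * (of_real ((c - l i) ^ j) * cnj (u i y)))"
  proof (intro sum.cong refl)
    fix i assume "i \<in> {..<n}"
    then have "i < n" by simp
    show "of_real ((c - l i) ^ Suc j) * u i x * cnj (u i y) =
        (\<Sum>z<n. ?B z * u i z) * (of_real ((c - l i) ^ j) * cnj (u i y))"
      unfolding Bu[OF \<open>i < n\<close>] by simp
  qed
  also have "\<dots> = (\<Sum>z<n. ?B z * ?S z)"
    by (simp add: sum_distrib_left sum_distrib_right mult.assoc mult.left_commute) (rule sum.swap)
  also have "0 \<le> \<dots>"
  proof (rule complex_sum_nonneg, rule complex_mult_nonneg)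
    fix z assume z: "z \<in> {..<n}"
    then show "0 \<le> ?S z" by (intro Suc.IH) simp
    show "0 \<le> ?B z"
    proof (cases "x = z")
      case True
      have "Im (A $$ (x, x)) = 0"
        using hermitianD[OF spectral_hermitian(2)[OF sp] Suc.prems Suc.prems] by (metis Reals_cnj_iff complex_is_Real_iff)
      then show ?thesis using True c[OF Suc.prems] by (simp add: complex_nonneg_iff)
    next
      case False
      then show ?thesis using off[of x z] Suc.prems z by (simp add: complex_nonneg_iff less_eq_complex_def)
    qed
  qed
  finally show ?case .
qed

lemma ground_projector_nonneg:
  assumes sp: "spectral n A u l"
    and off: "\<And>x y. x < n \<Longrightarrow> y < n \<Longrightarrow> x \<noteq> y \<Longrightarrow> A $$ (x, y) \<le> 0"
    and m: "\<And>i. i < n \<Longrightarrow> m \<le> l i" and xy: "x < n" "y < n"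
  shows "0 \<le> fun_mat n u (\<lambda>i. if l i = m then 1 else 0) $$ (x, y)"
proof -
  \<comment> \<open>This \<open>c\<close> exceeds \<open>m\<close>, all eigenvalues and all diagonal
    entries. The ratios \<open>(c - l i) / (c - m)\<close> are then 1 on the ground space and lie in
    [0, 1) elsewhere, so that their powers tend to the ground projector.\<close>
  define c where "c = 1 + \<bar>m\<bar> + (\<Sum>i<n. \<bar>l i\<bar>) + (\<Sum>x<n. \<bar>Re (A $$ (x, x))\<bar>)"
  have pos: "0 \<le> (\<Sum>i<n. \<bar>l i\<bar>)" "0 \<le> (\<Sum>x<n. \<bar>Re (A $$ (x, x))\<bar>)" by (auto intro: sum_nonneg)
  have cl: "l i < c" if "i < n" for i
  proof -
    have "\<bar>l i\<bar> \<le> (\<Sum>i<n. \<bar>l i\<bar>)" by (rule member_le_sum) (use that in auto)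
    with pos show ?thesis unfolding c_def by linarith
  qed
  have cd: "Re (A $$ (x, x)) \<le> c" if "x < n" for x
  proof -
    have "\<bar>Re (A $$ (x, x))\<bar> \<le> (\<Sum>x<n. \<bar>Re (A $$ (x, x))\<bar>)"
      by (rule member_le_sum[where f = "\<lambda>x. \<bar>Re (A $$ (x, x))\<bar>"]) (use that in auto)
    with pos show ?thesis unfolding c_def by linarith
  qed
  have cm: "m < c" using pos unfolding c_def by linarith
  let ?t = "\<lambda>j. \<Sum>i<n. of_real (((c - l i) / (c - m)) ^ j) * u i x * cnj (u i y)"
  have "0 \<le> ?t j" for j
  proof -
    have "?t j = of_real (1 / (c - m) ^ j) * (\<Sum>i<n. of_real ((c - l i) ^ j) * u i x * cnj (u i y))"
      unfolding sum_distrib_left by (intro sum.cong refl) (simp add: power_divide)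
    also have "0 \<le> \<dots>"
      by (rule complex_mult_nonneg[OF _ spectral_powers_nonneg[OF sp cd off xy]])
        (use cm in \<open>auto simp: complex_nonneg_iff\<close>)
    finally show ?thesis .
  qed
  then have t: "0 \<le> Re (?t j)" "Im (?t j) = 0" for j by (simp_all add: complex_nonneg_iff)
  have "?t \<longlonglongrightarrow> (\<Sum>i<n. of_real (if l i = m then 1 else 0) * u i x * cnj (u i y))"
  proof (intro tendsto_intros)
    fix i assume i: "i \<in> {..<n}"
    show "(\<lambda>j. ((c - l i) / (c - m)) ^ j) \<longlonglongrightarrow> (if l i = m then 1 else 0)"
    proof (cases "l i = m")
      case True
      then show ?thesis using cm by simp
    next
      case False
      then have "m < l i" using m[of i] i by simp
      then have "0 \<le> (c - l i) / (c - m)" "(c - l i) / (c - m) < 1"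
        using cl[of i] i cm by (auto simp: field_simps)
      from LIMSEQ_realpow_zero[OF this] show ?thesis using False by simp
    qed
  qed
  also have "(\<Sum>i<n. of_real (if l i = m then 1 else 0) * u i x * cnj (u i y)) =
      fun_mat n u (\<lambda>i. if l i = m then 1 else 0) $$ (x, y)"
    using xy by (simp add: fun_mat_def) (intro sum.cong refl, simp)
  finally have lim: "?t \<longlonglongrightarrow> fun_mat n u (\<lambda>i. if l i = m then 1 else 0) $$ (x, y)" .
  have "0 \<le> Re (fun_mat n u (\<lambda>i. if l i = m then 1 else 0) $$ (x, y))"
    by (rule LIMSEQ_le_const[OF tendsto_Re[OF lim]]) (use t in auto)
  moreover have "Im (fun_mat n u (\<lambda>i. if l i = m then 1 else 0) $$ (x, y)) = 0"
    using tendsto_Im[OF lim] unfolding t(2) by (metis LIMSEQ_unique tendsto_const)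
  ultimately show ?thesis by (simp add: complex_nonneg_iff)
qed

text \<open>Relational form of \<open>ground_energy\<close>, which spares the minimum over a set of
  real parts.\<close>

definition min_eigen :: "nat \<Rightarrow> complex mat \<Rightarrow> real \<Rightarrow> bool" where
  "min_eigen n A m \<longleftrightarrow> eigenvalue A (of_real m) \<and> (\<forall>e. eigenvalue A e \<longrightarrow> m \<le> Re e)"

lemma spectral_eigenvalue:
  assumes "spectral n A u l" "i < n"
  shows "eigenvalue A (of_real (l i))"
proof -
  have "inprod n (u i) (u i) \<noteq> 0" using assms by (simp add: spectral_def orthonormal_def)
  then have "\<exists>x<n. u i x \<noteq> 0" using inprod_self_eq_0 by blast
  moreover have "A \<in> carrier_mat n n" "eigen n A (u i) (of_real (l i))"
    using assms by (simp_all add: spectral_def)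
  ultimately show ?thesis using eigenvalue_eigen by metis
qed

text \<open>The ground projector without reference to a basis. Its diagonal entry at
  \<open>x\<close> is the sum of the squared moduli at \<open>x\<close> over an orthonormal basis of
  the ground space, hence positive once a single ground vector does not vanish at
  \<open>x\<close>.\<close>

lemma ground_projector:
  assumes A: "hermitian n A" and m: "min_eigen n A m"
    and off: "\<And>x y. x < n \<Longrightarrow> y < n \<Longrightarrow> x \<noteq> y \<Longrightarrow> A $$ (x, y) \<le> 0"
  shows "\<exists>P. P \<in> carrier_mat n n \<and> (\<forall>x<n. \<forall>y<n. 0 \<le> P $$ (x, y)) \<and> A * P = of_real m \<cdot>\<^sub>m P \<and>
     (\<forall>M \<in> carrier_mat n n. A * M = M * A \<longrightarrow> P * M = M * P) \<and>
     (\<forall>v x. eigen n A v (of_real m) \<longrightarrow> x < n \<longrightarrow> v x \<noteq> 0 \<longrightarrow> 0 < Re (P $$ (x, x)))"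
proof -
  obtain u l where sp: "spectral n A u l" using spectral_theorem[OF A] by blast
  have Ac: "A \<in> carrier_mat n n" using A by (simp add: hermitian_def)
  have ml: "m \<le> l i" if "i < n" for i
    using spectral_eigenvalue[OF sp that] m unfolding min_eigen_def by (metis Re_complex_of_real)
  let ?f = "\<lambda>i. if l i = m then 1 else (0 :: complex)"
  let ?P = "fun_mat n u ?f"
  have "A * ?P = of_real m \<cdot>\<^sub>m ?P"
  proof (rule spectral_mat_eqI[OF sp])
    fix j x assume j: "j < n" and x: "x < n"
    have "apply_mat n (A * ?P) (u j) x = apply_mat n A (apply_mat n ?P (u j)) x"
      using Ac x by (simp add: apply_mat_mult)
    also have "\<dots> = apply_mat n A (\<lambda>x. ?f j * u j x) x"
      by (intro apply_mat_cong) (simp add: apply_fun_mat_basis[OF sp j])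
    also have "\<dots> = ?f j * (of_real (l j) * u j x)"
      using sp j x by (simp add: apply_mat_smult spectral_def eigen_def)
    also have "\<dots> = of_real m * apply_mat n ?P (u j) x"
      by (simp add: apply_fun_mat_basis[OF sp j x])
    also have "\<dots> = apply_mat n (of_real m \<cdot>\<^sub>m ?P) (u j) x"
    proof -
      have "(of_real m \<cdot>\<^sub>m ?P) $$ (x, y) = of_real m * ?P $$ (x, y)" if "y < n" for y
        by (rule index_smult_mat) (use x that carrier_matD[OF fun_mat_carrier[of n u ?f]] in auto)
      then show ?thesis by (simp add: apply_mat_def sum_distrib_left mult.assoc)
    qed
    finally show "apply_mat n (A * ?P) (u j) x = apply_mat n (of_real m \<cdot>\<^sub>m ?P) (u j) x" .
  qed (use Ac in \<open>auto intro: mult_carrier_mat[of _ n n]\<close>)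
  moreover have "\<forall>M \<in> carrier_mat n n. A * M = M * A \<longrightarrow> ?P * M = M * ?P"
    using fun_mat_commute[OF sp, of _ ?f] by auto
  moreover have "0 < Re (?P $$ (x, x))" if v: "eigen n A v (of_real m)" and x: "x < n" "v x \<noteq> 0" for v x
  proof -
    have coeff: "inprod n v (u i) = 0 \<or> l i = m" if "i < n" for i
    proof (cases "l i = m")
      case False
      then have "inprod n v (u i) = 0"
        using eigen_orthogonal[OF A v, of "u i" "l i"] sp that by (auto simp: spectral_def)
      then show ?thesis by simp
    qed simp
    have "\<exists>i<n. l i = m \<and> u i x \<noteq> 0"
    proof (rule ccontr)
      assume *: "\<not> ?thesis"
      have "v x = (\<Sum>i<n. 0)"
        unfolding spectral_expand[OF sp x(1), of v] using * coeff
        by (intro sum.cong refl) (metis lessThan_iff mult_not_zero)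
      with x(2) show False by simp
    qed
    then obtain i where i: "i < n" "l i = m" "u i x \<noteq> 0" by blast
    have "Re (?P $$ (x, x)) = (\<Sum>i<n. Re (?f i * u i x * cnj (u i x)))"
      using x(1) by (simp only: fun_mat_def index_mat(1) case_prod_conv Re_sum)
    also have "\<dots> = (\<Sum>i<n. if l i = m then (cmod (u i x))\<^sup>2 else 0)"
      by (intro sum.cong refl) (auto simp: cmod_power2, simp add: power2_eq_square)
    finally have eq: "Re (?P $$ (x, x)) = (\<Sum>i<n. if l i = m then (cmod (u i x))\<^sup>2 else 0)" .
    have "(if l i = m then (cmod (u i x))\<^sup>2 else 0) \<le> (\<Sum>i<n. if l i = m then (cmod (u i x))\<^sup>2 else 0)"
      by (rule member_le_sum) (use i(1) in auto)
    moreover have "0 < (if l i = m then (cmod (u i x))\<^sup>2 else 0)" using i(2,3) by simp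
    ultimately show ?thesis unfolding eq by linarith
  qed
  ultimately show ?thesis using ground_projector_nonneg[OF sp off ml] fun_mat_carrier
    by (intro exI[of _ ?P] conjI allI impI) blast+
qed

text \<open>
  The product of the ground projectors has non-negative entries, and its diagonal entry at \<open>x\<close> is at
  least the product of their diagonal entries at \<open>x\<close>.
\<close>
theorem common_ground_state:
  assumes "\<And>A. A \<in> set As \<Longrightarrow> hermitian n A \<and> min_eigen n A (m A)"
    and "\<And>A x y. A \<in> set As \<Longrightarrow> x < n \<Longrightarrow> y < n \<Longrightarrow> x \<noteq> y \<Longrightarrow> A $$ (x, y) \<le> 0"
    and "\<And>A B. A \<in> set As \<Longrightarrow> B \<in> set As \<Longrightarrow> A * B = B * A"
    and x: "x < n" and "\<And>A. A \<in> set As \<Longrightarrow> \<exists>v. eigen n A v (of_real (m A)) \<and> v x \<noteq> 0"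
  shows "\<exists>v. v x \<noteq> 0 \<and> (\<forall>A \<in> set As. eigen n A v (of_real (m A)))"
proof -
  \<comment> \<open>\<open>Q\<close> is the product of the ground projectors. That each matrix of
    the list acts on it as multiplication by its least eigenvalue says that every column of
    \<open>Q\<close> is a common ground vector; the one at \<open>x\<close> is non-zero at
    \<open>x\<close>.\<close>
  have "\<exists>Q. Q \<in> carrier_mat n n \<and> (\<forall>y<n. \<forall>z<n. 0 \<le> Q $$ (y, z)) \<and> 0 < Re (Q $$ (x, x)) \<and>
     (\<forall>A \<in> set As. A * Q = of_real (m A) \<cdot>\<^sub>m Q)"
    using assms(1,2,3,5)
  proof (induction As)
    case Nil
    show ?case using x by (intro exI[of _ "1\<^sub>m n"]) (auto simp: complex_nonneg_iff)
  next
    case (Cons A As)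
    have "\<exists>Q. Q \<in> carrier_mat n n \<and> (\<forall>y<n. \<forall>z<n. 0 \<le> Q $$ (y, z)) \<and> 0 < Re (Q $$ (x, x)) \<and>
     (\<forall>A \<in> set As. A * Q = of_real (m A) \<cdot>\<^sub>m Q)"
      by (rule Cons.IH) (use Cons.prems in auto)
    then obtain Q where Q: "Q \<in> carrier_mat n n" "\<And>y z. y < n \<Longrightarrow> z < n \<Longrightarrow> 0 \<le> Q $$ (y, z)"
      "0 < Re (Q $$ (x, x))" "\<And>B. B \<in> set As \<Longrightarrow> B * Q = of_real (m B) \<cdot>\<^sub>m Q" by blast
    have A: "hermitian n A" "min_eigen n A (m A)" using Cons.prems(1) by auto
    obtain P where P: "P \<in> carrier_mat n n" "\<And>y z. y < n \<Longrightarrow> z < n \<Longrightarrow> 0 \<le> P $$ (y, z)"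
      "A * P = of_real (m A) \<cdot>\<^sub>m P" "\<And>M. M \<in> carrier_mat n n \<Longrightarrow> A * M = M * A \<Longrightarrow> P * M = M * P"
      "\<And>v x. eigen n A v (of_real (m A)) \<Longrightarrow> x < n \<Longrightarrow> v x \<noteq> 0 \<Longrightarrow> 0 < Re (P $$ (x, x))"
      using ground_projector[OF A Cons.prems(2)[of A]] by auto
    have Ac: "A \<in> carrier_mat n n" using A by (simp add: hermitian_def)
    have Pxx: "0 < Re (P $$ (x, x))" using P(5) Cons.prems(4)[of A] x by auto
    have "A * (P * Q) = of_real (m A) \<cdot>\<^sub>m (P * Q)"
      using Ac P(1,3) Q(1) by (metis assoc_mult_mat mult_smult_assoc_mat)
    moreover have "B * (P * Q) = of_real (m B) \<cdot>\<^sub>m (P * Q)" if B: "B \<in> set As" for B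
    proof -
      have Bc: "B \<in> carrier_mat n n" using Cons.prems(1)[of B] B by (simp add: hermitian_def)
      have "P * B = B * P" using P(4)[OF Bc] Cons.prems(3)[of A B] B by simp
      then have "B * (P * Q) = P * (B * Q)"
        using assoc_mult_mat[OF Bc P(1) Q(1)] assoc_mult_mat[OF P(1) Bc Q(1)] by simp
      also have "\<dots> = of_real (m B) \<cdot>\<^sub>m (P * Q)"
        unfolding Q(4)[OF B] using P(1) Q(1) by (rule mult_smult_distrib)
      finally show ?thesis .
    qed
    moreover have PQ: "0 \<le> (P * Q) $$ (y, z)" if "y < n" "z < n" for y z
      unfolding mult_mat_index[OF P(1) Q(1) that]
      using P(2) Q(2) that by (intro complex_sum_nonneg complex_mult_nonneg) auto
    moreover have "0 < Re ((P * Q) $$ (x, x))"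
    proof -
      have nonneg: "0 \<le> Re (P $$ (x, z) * Q $$ (z, x))" if "z \<in> {..<n}" for z
        using complex_mult_nonneg[OF P(2) Q(2)] x that by (auto simp: complex_nonneg_iff)
      have "Im (P $$ (x, x)) = 0" using P(2)[OF x x] by (simp add: complex_nonneg_iff)
      then have "0 < Re (P $$ (x, x) * Q $$ (x, x))" using Pxx Q(3) by simp
      also have "\<dots> \<le> (\<Sum>z<n. Re (P $$ (x, z) * Q $$ (z, x)))"
        by (rule member_le_sum[where f = "\<lambda>z. Re (P $$ (x, z) * Q $$ (z, x))"]) (use x nonneg in auto)
      also have "\<dots> = Re ((P * Q) $$ (x, x))"
        unfolding mult_mat_index[OF P(1) Q(1) x x] by simp
      finally show ?thesis .
    qed
    ultimately show ?case using P(1) Q(1) by (intro exI[of _ "P * Q"]) auto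
  qed
  then obtain Q where Q: "Q \<in> carrier_mat n n" "0 < Re (Q $$ (x, x))"
     "\<And>A. A \<in> set As \<Longrightarrow> A * Q = of_real (m A) \<cdot>\<^sub>m Q" by blast
  have "eigen n A (\<lambda>y. Q $$ (y, x)) (of_real (m A))" if "A \<in> set As" for A
    unfolding eigen_def
  proof (intro allI impI)
    fix y assume y: "y < n"
    have "A \<in> carrier_mat n n" using assms(1)[OF that] by (simp add: hermitian_def)
    then have "apply_mat n A (\<lambda>y. Q $$ (y, x)) y = (A * Q) $$ (y, x)"
      using Q(1) x y by (simp add: apply_mat_def mult_mat_index del: index_mult_mat(1))
    then show "apply_mat n A (\<lambda>y. Q $$ (y, x)) y = of_real (m A) * Q $$ (y, x)"
      using Q(1) x y by (simp add: Q(3)[OF that])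
  qed
  moreover have "Q $$ (x, x) \<noteq> 0" using Q(2) by auto
  ultimately show ?thesis by (intro exI[of _ "\<lambda>y. Q $$ (y, x)"]) auto
qed

section \<open>Eigenvalue gaps of integer matrices and the test of ground vectors by signs\<close>

section \<open>Separation of eigenvalues of integer matrices\<close>

text \<open>With the root 0 split off, the constant coefficient of the remaining factor is the
  product of the negated non-zero roots.\<close>

lemma prod_linear_factors_zero:
  fixes as :: "complex list"
  shows "(\<Prod>a\<leftarrow>as. [:- a, 1:]) =
    monom 1 (length (filter (\<lambda>a. a = 0) as)) * (\<Prod>a\<leftarrow>filter (\<lambda>a. a \<noteq> 0) as. [:- a, 1:])"
proof (induction as)
  case (Cons a as)
  let ?k = "length (filter (\<lambda>a. a = 0) as)" and ?q = "\<Prod>a\<leftarrow>filter (\<lambda>a. a \<noteq> 0) as. [:- a, 1:]"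
  show ?case
  proof (cases "a = 0")
    case True
    have "[:0, 1:] * (monom 1 ?k * ?q) = monom 1 (Suc ?k) * ?q"
      by (simp add: monom_Suc)
    then show ?thesis using Cons True by simp
  next
    case False
    have "[:- a, 1:] * (monom 1 ?k * ?q) = monom 1 ?k * ([:- a, 1:] * ?q)"
      by (rule mult.left_commute)
    then show ?thesis using Cons False by (simp del: mult_pCons_left mult_pCons_right)
  qed
qed simp

lemma prod_list_le_power:
  fixes Z :: real
  assumes "1 \<le> Z" "\<And>b. b \<in> set bs \<Longrightarrow> cmod b \<le> Z"
  shows "prod_list (map cmod bs) \<le> Z ^ length bs"
  using assms(2)
proof (induction bs)
  case (Cons b bs)
  have "prod_list (map cmod bs) \<le> Z ^ length bs" using Cons by simp
  moreover have "0 \<le> prod_list (map cmod bs)" by (induction bs) auto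
  ultimately show ?case using Cons.prems[of b] assms(1) by (simp add: mult_mono)
qed simp

lemma prod_list_member_le_power:
  fixes Z :: real
  assumes "1 \<le> Z" "\<And>b. b \<in> set bs \<Longrightarrow> cmod b \<le> Z" "e \<in> set bs"
  shows "prod_list (map cmod bs) \<le> cmod e * Z ^ length bs"
  using assms(2,3)
proof (induction bs)
  case (Cons b bs)
  have nonneg: "0 \<le> prod_list (map cmod bs)" by (induction bs) auto
  show ?case
  proof (cases "e = b")
    case True
    have "prod_list (map cmod bs) \<le> Z ^ length bs"
      using Cons.prems by (intro prod_list_le_power[OF assms(1)]) auto
    also have "\<dots> \<le> Z ^ Suc (length bs)" using assms(1) by (intro power_increasing) auto
    finally show ?thesis using True by (simp add: mult_left_mono)
  next
    case False
    then have "prod_list (map cmod bs) \<le> cmod e * Z ^ length bs" using Cons by auto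
    then have "cmod b * prod_list (map cmod bs) \<le> Z * (cmod e * Z ^ length bs)"
      using Cons.prems(1)[of b] nonneg assms(1) by (intro mult_mono) auto
    then show ?thesis by (simp add: mult.left_commute)
  qed
qed simp

text \<open>The product of the non-zero roots is, up to sign, the lowest non-zero coefficient.\<close>
lemma nonzero_root_lower_bound:
  fixes p :: "int poly"
  assumes p: "map_poly of_int p = (\<Prod>a\<leftarrow>as. [:- a, 1:])" and Z: "1 \<le> Z" "\<And>a. a \<in> set as \<Longrightarrow> cmod a \<le> Z"
    and e: "e \<in> set as" "e \<noteq> 0"
  shows "1 \<le> cmod e * Z ^ length as"
proof -
  let ?bs = "filter (\<lambda>a. a \<noteq> 0) as" and ?k = "length (filter (\<lambda>a. a = 0) as)"
  let ?q = "\<Prod>a\<leftarrow>?bs. [:- a, 1:]"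
  have "(of_int (coeff p ?k) :: complex) = coeff (map_poly of_int p) ?k"
    by (simp add: coeff_map_poly)
  also have "\<dots> = coeff ?q 0"
    unfolding p prod_linear_factors_zero[of as] by (simp add: coeff_monom_mult)
  also have "\<dots> = poly ?q 0" by (simp add: poly_0_coeff_0)
  also have "\<dots> = (\<Prod>a\<leftarrow>?bs. - a)" by (induction as) auto
  finally have eq: "of_int (coeff p ?k) = (\<Prod>a\<leftarrow>?bs. - a)" .
  have "(\<Prod>a\<leftarrow>?bs. - a) \<noteq> 0" by (auto simp: prod_list_zero_iff)
  then have "coeff p ?k \<noteq> 0" using eq by auto
  \<comment> \<open>Integrality enters here: the product of the non-zero roots is bounded from
    below, and all factors other than \<open>e\<close> are bounded from above by
    \<open>Z\<close>.\<close>
  then have "1 \<le> \<bar>coeff p ?k\<bar>" by linarith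
  then have "1 \<le> cmod (of_int (coeff p ?k))" by (simp add: norm_of_int del: of_int_abs flip: of_int_abs)
  also have "\<dots> = prod_list (map cmod ?bs)" unfolding eq by (induction as) (auto simp: norm_mult)
  also have "\<dots> \<le> cmod e * Z ^ length ?bs"
    using Z e by (intro prod_list_member_le_power) auto
  also have "\<dots> \<le> cmod e * Z ^ length as"
    using Z(1) by (intro mult_left_mono power_increasing) auto
  finally show ?thesis .
qed

text \<open>The eigenvalue equation is read at a component of the eigenvector of largest
  modulus.\<close>

lemma eigenvalue_row_bound:
  assumes "A \<in> carrier_mat n n" "eigenvalue A e" "\<And>x. x < n \<Longrightarrow> (\<Sum>y<n. cmod (A $$ (x, y))) \<le> Z"
  shows "cmod e \<le> Z"
proof -
  obtain v where v: "eigen n A v e" "\<exists>x<n. v x \<noteq> 0" using assms eigenvalue_eigen by blast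
  have fin: "finite ((\<lambda>x. cmod (v x)) ` {..<n})" "(\<lambda>x. cmod (v x)) ` {..<n} \<noteq> {}" using v(2) by auto
  obtain x where x: "x < n" "cmod (v x) = Max ((\<lambda>x. cmod (v x)) ` {..<n})"
    using Max_in[OF fin] by auto
  have le: "cmod (v y) \<le> cmod (v x)" if "y < n" for y
    using Max_ge[OF fin(1)] that x(2) by simp
  obtain y where "y < n" "v y \<noteq> 0" using v(2) by blast
  then have pos: "0 < cmod (v x)" using le[of y] by (smt (verit) zero_less_norm_iff)
  have "cmod e * cmod (v x) = cmod (apply_mat n A v x)"
    using v(1) x(1) by (simp add: eigen_def norm_mult)
  also have "\<dots> \<le> (\<Sum>y<n. cmod (A $$ (x, y)) * cmod (v x))"
    unfolding apply_mat_def by (rule order_trans[OF norm_sum]) (auto intro!: sum_mono mult_left_mono le simp: norm_mult)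
  also have "\<dots> \<le> Z * cmod (v x)"
    using assms(3)[OF x(1)] pos by (simp flip: sum_distrib_right)
  finally show ?thesis using pos by simp
qed

lemma sum_div_mod:
  fixes f :: "nat \<Rightarrow> nat \<Rightarrow> 'a :: comm_monoid_add"
  shows "(\<Sum>r<N * N. f (r div N) (r mod N)) = (\<Sum>i<N. \<Sum>j<N. f i j)"
proof -
  have lt: "i * N + j < N * N" if "i < N" "j < N" for i j
  proof -
    have "i * N + j < Suc i * N" using that by simp
    also have "\<dots> \<le> N * N" using that by (intro mult_le_mono1) simp
    finally show ?thesis .
  qed
  have mod_lt: "r mod N < N" if "r < N * N" for r using that by (cases "N = 0") auto
  have "(\<Sum>r<N * N. f (r div N) (r mod N)) = (\<Sum>(i, j)\<in>{..<N} \<times> {..<N}. f i j)"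
    by (rule sum.reindex_bij_witness[of _ "\<lambda>(i, j). i * N + j" "\<lambda>r. (r div N, r mod N)"])
      (auto simp: lt less_mult_imp_div_less mod_lt)
  then show ?thesis by (simp add: sum.cartesian_product)
qed

abbreviation cmat :: "int mat \<Rightarrow> complex mat" where
  "cmat X \<equiv> map_mat of_int X"

text \<open>The matrix \<open>X \<otimes> I - I \<otimes> Y\<close>, whose eigenvalues are the differences of those of \<open>X\<close> and \<open>Y\<close>.\<close>
definition diff_mat :: "nat \<Rightarrow> int mat \<Rightarrow> int mat \<Rightarrow> int mat" where
  "diff_mat N X Y = mat (N * N) (N * N) (\<lambda>(r, s).
     (if r mod N = s mod N then X $$ (r div N, s div N) else 0) -
     (if r div N = s div N then Y $$ (r mod N, s mod N) else 0))"

text \<open>The eigenvector is the tensor product of the two given ones, with \<open>r div N\<close>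
  and \<open>r mod N\<close> as its two indices.\<close>

lemma diff_mat_eigenvalue:
  assumes X: "X \<in> carrier_mat N N" and Y: "Y \<in> carrier_mat N N"
    and "eigenvalue (cmat X) e" "eigenvalue (cmat Y) f"
  shows "eigenvalue (cmat (diff_mat N X Y)) (e - f)"
proof -
  obtain v x0 where v: "eigen N (cmat X) v e" "x0 < N" "v x0 \<noteq> 0"
    using assms(3) eigenvalue_eigen[of "cmat X" N] X by auto
  obtain w y0 where w: "eigen N (cmat Y) w f" "y0 < N" "w y0 \<noteq> 0"
    using assms(4) eigenvalue_eigen[of "cmat Y" N] Y by auto
  have N: "0 < N" using v(2) by simp
  let ?u = "\<lambda>r. v (r div N) * w (r mod N)"
  have "eigen (N * N) (cmat (diff_mat N X Y)) ?u (e - f)"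
    unfolding eigen_def
  proof (intro allI impI)
    fix r assume r: "r < N * N"
    define i j where "i = r div N" and "j = r mod N"
    have ij: "i < N" "j < N" using r N by (auto simp: i_def j_def less_mult_imp_div_less)
    have "apply_mat (N * N) (cmat (diff_mat N X Y)) ?u r =
        (\<Sum>s<N * N. ((if j = s mod N then of_int (X $$ (i, s div N)) else 0) -
           (if i = s div N then of_int (Y $$ (j, s mod N)) else 0)) * ?u s)"
      unfolding apply_mat_def using r by (intro sum.cong refl) (auto simp: diff_mat_def i_def j_def)
    also have "\<dots> = (\<Sum>i'<N. \<Sum>j'<N. ((if j = j' then of_int (X $$ (i, i')) else 0) -
           (if i = i' then of_int (Y $$ (j, j')) else 0)) * (v i' * w j'))"
      by (rule sum_div_mod)
    also have "\<dots> = (\<Sum>i'<N. \<Sum>j'<N. if j = j' then of_int (X $$ (i, i')) * v i' * w j' else 0) -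
       (\<Sum>i'<N. \<Sum>j'<N. if i = i' then of_int (Y $$ (j, j')) * w j' * v i' else 0)"
      unfolding sum_subtractf[symmetric] by (intro sum.cong refl) (auto simp: algebra_simps)
    also have "(\<Sum>i'<N. \<Sum>j'<N. if j = j' then of_int (X $$ (i, i')) * v i' * w j' else 0) =
        apply_mat N (cmat X) v i * w j"
      using ij X by (simp add: apply_mat_def sum_distrib_right)
    also have "(\<Sum>i'<N. \<Sum>j'<N. if i = i' then of_int (Y $$ (j, j')) * w j' * v i' else 0) =
        apply_mat N (cmat Y) w j * v i"
      using ij Y by (subst sum.swap) (simp add: apply_mat_def sum_distrib_right)
    finally show "apply_mat (N * N) (cmat (diff_mat N X Y)) ?u r = (e - f) * ?u r"
      using v(1) w(1) ij by (simp add: eigen_def i_def j_def algebra_simps)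
  qed
  moreover have "\<exists>r < N * N. ?u r \<noteq> 0"
  proof (intro exI conjI)
    have "x0 * N + y0 < Suc x0 * N" using w(2) by simp
    also have "\<dots> \<le> N * N" using v(2) by (intro mult_le_mono1) simp
    finally show "x0 * N + y0 < N * N" .
    show "?u (x0 * N + y0) \<noteq> 0" using v w by simp
  qed
  moreover have "cmat (diff_mat N X Y) \<in> carrier_mat (N * N) (N * N)" by (simp add: diff_mat_def)
  ultimately show ?thesis using eigenvalue_eigen by blast
qed

lemma diff_mat_row_sum:
  assumes r: "r < N * N"
    and "\<And>i. i < N \<Longrightarrow> (\<Sum>j<N. \<bar>X $$ (i, j)\<bar>) \<le> a" "\<And>i. i < N \<Longrightarrow> (\<Sum>j<N. \<bar>Y $$ (i, j)\<bar>) \<le> b"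
  shows "(\<Sum>s<N * N. \<bar>diff_mat N X Y $$ (r, s)\<bar>) \<le> a + b"
proof -
  define i j where "i = r div N" and "j = r mod N"
  have N: "0 < N" using r by (auto intro: gr0I)
  have ij: "i < N" "j < N" using r N by (auto simp: i_def j_def less_mult_imp_div_less)
  have "(\<Sum>s<N * N. \<bar>diff_mat N X Y $$ (r, s)\<bar>) \<le>
      (\<Sum>s<N * N. (if j = s mod N then \<bar>X $$ (i, s div N)\<bar> else 0) +
           (if i = s div N then \<bar>Y $$ (j, s mod N)\<bar> else 0))"
    using r by (intro sum_mono) (auto simp: diff_mat_def i_def j_def)
  also have "\<dots> = (\<Sum>i'<N. \<Sum>j'<N. (if j = j' then \<bar>X $$ (i, i')\<bar> else 0) + (if i = i' then \<bar>Y $$ (j, j')\<bar> else 0))"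
    by (rule sum_div_mod)
  also have "\<dots> = (\<Sum>i'<N. \<bar>X $$ (i, i')\<bar>) + (\<Sum>j'<N. \<bar>Y $$ (j, j')\<bar>)"
  proof -
    have "(\<Sum>i'<N. \<Sum>j'<N. (if i = i' then \<bar>Y $$ (j, j')\<bar> else 0)) = (\<Sum>j'<N. \<bar>Y $$ (j, j')\<bar>)"
      using ij by (subst sum.swap) simp
    then show ?thesis using ij by (simp add: sum.distrib)
  qed
  also have "\<dots> \<le> a + b" using assms ij by (intro add_mono) auto
  finally show ?thesis .
qed

text \<open>\<open>e - f\<close> is a non-zero eigenvalue of the integer matrix
  \<open>diff_mat N X Y\<close>. By its row sums all eigenvalues of that matrix have modulus at most
  \<open>Z\<close>, and its characteristic polynomial is a monic integer polynomial of degree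
  \<open>N * N\<close>.\<close>

theorem eigenvalue_separation:
  assumes X: "X \<in> carrier_mat N N" "\<And>i. i < N \<Longrightarrow> (\<Sum>j<N. \<bar>X $$ (i, j)\<bar>) \<le> a"
    and Y: "Y \<in> carrier_mat N N" "\<And>i. i < N \<Longrightarrow> (\<Sum>j<N. \<bar>Y $$ (i, j)\<bar>) \<le> b"
    and e: "eigenvalue (cmat X) e" and f: "eigenvalue (cmat Y) f" and "e \<noteq> f" and Z: "1 \<le> Z" "a + b \<le> Z"
  shows "1 \<le> cmod (e - f) * of_int Z ^ (N * N)"
proof -
  let ?K = "diff_mat N X Y"
  have K: "?K \<in> carrier_mat (N * N) (N * N)" by (simp add: diff_mat_def)
  then have cK: "cmat ?K \<in> carrier_mat (N * N) (N * N)" by simp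
  obtain as where as: "char_poly (cmat ?K) = (\<Prod>a\<leftarrow>as. [:- a, 1:])" "length as = N * N"
    using char_poly_factorized[OF cK] by blast
  have root: "eigenvalue (cmat ?K) c \<longleftrightarrow> c \<in> set as" for c
    unfolding eigenvalue_root_char_poly[OF cK] as(1) poly_prod_list
    by (auto simp: prod_list_zero_iff)
  have "map_poly of_int (char_poly ?K) = (\<Prod>a\<leftarrow>as. [:- a, 1:])"
    using of_int_hom.char_poly_hom[OF K, where ?'a = complex] as(1) by simp
  moreover have "cmod c \<le> of_int Z" if "c \<in> set as" for c
  proof (rule eigenvalue_row_bound[OF cK])
    show "eigenvalue (cmat ?K) c" using that root by simp
    fix r assume r: "r < N * N"
    have "(\<Sum>s<N * N. cmod (cmat ?K $$ (r, s))) = of_int (\<Sum>s<N * N. \<bar>?K $$ (r, s)\<bar>)"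
      using r K by (simp add: norm_of_int flip: of_int_abs)
    also have "\<dots> \<le> of_int Z"
      unfolding of_int_le_iff by (rule order_trans[OF diff_mat_row_sum[OF r] Z(2)]) (use X(2) Y(2) in auto)
    finally show "(\<Sum>s<N * N. cmod (cmat ?K $$ (r, s))) \<le> of_int Z" .
  qed
  moreover have "e - f \<in> set as" using root diff_mat_eigenvalue[OF X(1) Y(1) e f] by simp
  ultimately show ?thesis
    using nonzero_root_lower_bound[of "char_poly ?K" as "of_int Z" "e - f"] assms(7) Z(1) as(2) by simp
qed


section \<open>Ground spaces and rank-one perturbations\<close>

text \<open>
  For large \<open>S\<close>, subtracting the projector on the basis vector \<open>a\<close> from \<open>S * A\<close> lowers the least
  eigenvalue if and only if some ground vector of \<open>A\<close> does not vanish at \<open>a\<close>.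
\<close>
definition lower_at :: "nat \<Rightarrow> nat \<Rightarrow> real \<Rightarrow> complex mat \<Rightarrow> complex mat" where
  "lower_at n a S A = mat n n (\<lambda>(x, y). of_real S * A $$ (x, y) - (if x = a \<and> y = a then 1 else 0))"

lemma hermitian_lower_at: "hermitian n A \<Longrightarrow> hermitian n (lower_at n a S A)"
  unfolding hermitian_def[of n "lower_at n a S A"]
  by (auto simp: lower_at_def hermitianD)

lemma inprod_lower_at:
  assumes "a < n"
  shows "inprod n (apply_mat n (lower_at n a S A) v) v =
     of_real S * inprod n (apply_mat n A v) v - of_real ((cmod (v a))\<^sup>2)"
proof -
  have eq: "apply_mat n (lower_at n a S A) v x = of_real S * apply_mat n A v x - (if x = a then v a else 0)"
    if "x < n" for x
  proof -
    have "apply_mat n (lower_at n a S A) v x =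
        (\<Sum>y<n. of_real S * (A $$ (x, y) * v y) - (if y = a then (if x = a then v a else 0) else 0))"
      unfolding apply_mat_def using that by (intro sum.cong refl) (auto simp: lower_at_def algebra_simps)
    also have "\<dots> = of_real S * apply_mat n A v x - (if x = a then v a else 0)"
      using assms by (simp add: sum_subtractf apply_mat_def sum_distrib_left)
    finally show ?thesis .
  qed
  have "inprod n (apply_mat n (lower_at n a S A) v) v =
      (\<Sum>x<n. of_real S * (apply_mat n A v x * cnj (v x)) - (if x = a then v a * cnj (v a) else 0))"
    unfolding inprod_def by (intro sum.cong refl) (auto simp: eq left_diff_distrib)
  also have "\<dots> = of_real S * inprod n (apply_mat n A v) v - v a * cnj (v a)"
    using assms by (simp add: sum_subtractf inprod_def sum_distrib_left)
  finally show ?thesis by (simp only: complex_norm_square)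
qed

lemma spectral_norm:
  assumes "spectral n A u l"
  shows "inprod n v v = of_real (\<Sum>i<n. (cmod (inprod n v (u i)))\<^sup>2)"
  unfolding spectral_inprod[OF assms, of v v] of_real_sum
  by (intro sum.cong refl) (simp only: complex_norm_square)

lemma spectral_quadratic:
  assumes sp: "spectral n A u l"
  shows "inprod n (apply_mat n A v) v = of_real (\<Sum>i<n. l i * (cmod (inprod n v (u i)))\<^sup>2)"
proof -
  have "inprod n (apply_mat n A v) (u i) = of_real (l i) * inprod n v (u i)" if "i < n" for i
  proof -
    have "inprod n (apply_mat n A v) (u i) = inprod n v (apply_mat n A (u i))"
      by (rule inprod_hermitian[OF spectral_hermitian(2)[OF sp]])
    also have "\<dots> = inprod n v (\<lambda>x. of_real (l i) * u i x)"
      using sp that by (intro inprod_cong) (auto simp: spectral_def eigen_def)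
    finally show ?thesis by (simp add: inprod_smult_right)
  qed
  then show ?thesis
    unfolding spectral_inprod[OF sp, of "apply_mat n A v" v] of_real_sum
    by (intro sum.cong refl) (simp add: complex_norm_square mult.assoc del: of_real_power)
qed

lemma inprod_self_pos:
  fixes v :: "nat \<Rightarrow> complex" and n :: nat
  shows "\<exists>x<n. v x \<noteq> 0 \<Longrightarrow> 0 < (\<Sum>x<n. (cmod (v x))\<^sup>2)"
proof -
  assume "\<exists>x<n. v x \<noteq> 0"
  then have "(\<Sum>x<n. (cmod (v x))\<^sup>2) \<noteq> 0"
    using inprod_self_eq_0[of n v] unfolding inprod_self of_real_eq_0_iff by blast
  moreover have "0 \<le> (\<Sum>x<n. (cmod (v x))\<^sup>2)" by (rule sum_nonneg) simp
  ultimately show ?thesis by linarith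
qed

text \<open>The value \<open>v a\<close> pulls the Rayleigh quotient of the vector \<open>v\<close>
  for the lowered matrix below \<open>S * m\<close>, and some eigenvalue is at most that
  quotient.\<close>

lemma lower_at_eigenvalue_lt:
  assumes A: "hermitian n A" and a: "a < n" and v: "eigen n A v (of_real m)" "v a \<noteq> 0"
  shows "\<exists>\<mu> < S * m. eigenvalue (lower_at n a S A) (of_real \<mu>)"
proof -
  let ?Y = "lower_at n a S A"
  obtain u l where sp: "spectral n ?Y u l"
    using spectral_theorem[OF hermitian_lower_at[OF A]] by blast
  let ?s = "\<Sum>x<n. (cmod (v x))\<^sup>2"
  let ?c = "\<lambda>i. (cmod (inprod n v (u i)))\<^sup>2"
  have norm: "?s = (\<Sum>i<n. ?c i)"
    using spectral_norm[OF sp, of v] unfolding inprod_self of_real_eq_iff .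
  have "inprod n (apply_mat n A v) v = of_real (m * ?s)"
  proof -
    have "inprod n (apply_mat n A v) v = inprod n (\<lambda>x. of_real m * v x) v"
      using v(1) by (intro inprod_cong) (auto simp: eigen_def)
    then show ?thesis by (simp add: inprod_smult_left inprod_self)
  qed
  then have "of_real (\<Sum>i<n. l i * ?c i) = (of_real (S * (m * ?s) - (cmod (v a))\<^sup>2) :: complex)"
    unfolding spectral_quadratic[OF sp, symmetric] inprod_lower_at[OF a] by simp
  then have "(\<Sum>i<n. l i * ?c i) = S * (m * ?s) - (cmod (v a))\<^sup>2" unfolding of_real_eq_iff .
  also have "\<dots> < S * m * ?s" using v(2) by simp
  also have "\<dots> = (\<Sum>i<n. S * m * ?c i)" unfolding norm by (simp add: sum_distrib_left)
  finally have "\<exists>i<n. l i * ?c i < S * m * ?c i"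
    by (metis (no_types, lifting) lessThan_iff not_less sum_mono)
  then obtain i where i: "i < n" "l i * ?c i < S * m * ?c i" by blast
  then have "l i < S * m" by (metis mult_right_mono not_less zero_le_power2)
  with spectral_eigenvalue[OF sp i(1)] show ?thesis by blast
qed

text \<open>Only the part of a vector orthogonal to the ground space contributes to its value at
  \<open>a\<close>. On that part \<open>S * A\<close> exceeds \<open>S * m\<close> by at least 1,
  which outweighs the projector that is subtracted.\<close>

lemma lower_at_eigenvalue_ge:
  assumes A: "hermitian n A" and a: "a < n" and m: "min_eigen n A m" and S: "0 \<le> S"
    and gap: "\<And>e. eigenvalue A (of_real e) \<Longrightarrow> e \<noteq> m \<Longrightarrow> 1 \<le> S * (e - m)"
    and vanish: "\<And>v. eigen n A v (of_real m) \<Longrightarrow> v a = 0"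
    and \<mu>: "eigenvalue (lower_at n a S A) (of_real \<mu>)"
  shows "S * m \<le> \<mu>"
proof -
  let ?Y = "lower_at n a S A"
  have Yc: "?Y \<in> carrier_mat n n" by (simp add: lower_at_def)
  obtain v where v: "eigen n ?Y v (of_real \<mu>)" "\<exists>x<n. v x \<noteq> 0"
    using \<mu> eigenvalue_eigen[OF Yc] by blast
  obtain u l where sp: "spectral n A u l" using spectral_theorem[OF A] by blast
  let ?s = "\<Sum>x<n. (cmod (v x))\<^sup>2"
  let ?c = "\<lambda>i. (cmod (inprod n v (u i)))\<^sup>2"
  have norm: "?s = (\<Sum>i<n. ?c i)"
    using spectral_norm[OF sp, of v] unfolding inprod_self of_real_eq_iff .
  \<comment> \<open>These are the coefficients of \<open>w\<close>, the component of
    \<open>v\<close> orthogonal to the ground space.\<close>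
  define d where "d = (\<lambda>i. if l i = m then 0 else inprod n v (u i))"
  define w where "w = (\<lambda>x. \<Sum>i<n. d i * u i x)"
  have wu: "inprod n w (u j) = d j" if "j < n" for j
  proof -
    have "inprod n w (u j) = (\<Sum>i<n. d i * inprod n (u i) (u j))"
      unfolding inprod_def w_def sum_distrib_right sum_distrib_left
      by (subst sum.swap) (simp add: mult.assoc)
    also have "\<dots> = (\<Sum>i<n. if i = j then d j else 0)"
      using sp that by (intro sum.cong refl) (auto simp: spectral_def orthonormal_def)
    finally show ?thesis using that by simp
  qed
  have "u i a = 0" if "i < n" "l i = m" for i
  proof -
    have "eigen n A (u i) (of_real (l i))" using sp that(1) by (simp add: spectral_def)
    with that(2) show ?thesis using vanish by simp
  qed
  then have va: "v a = w a"
    unfolding spectral_expand[OF sp a, of v] w_def d_def by (intro sum.cong refl) auto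
  have "(cmod (w a))\<^sup>2 \<le> (\<Sum>x<n. (cmod (w x))\<^sup>2)"
    by (rule member_le_sum[where f = "\<lambda>x. (cmod (w x))\<^sup>2"]) (use a in auto)
  also have "\<dots> = (\<Sum>i<n. (cmod (inprod n w (u i)))\<^sup>2)"
    using spectral_norm[OF sp, of w] unfolding inprod_self of_real_eq_iff .
  also have "\<dots> = (\<Sum>i<n. if l i = m then 0 else ?c i)"
    by (intro sum.cong refl) (auto simp: wu d_def)
  finally have wa: "(cmod (v a))\<^sup>2 \<le> (\<Sum>i<n. if l i = m then 0 else ?c i)" unfolding va .
  have "S * m * ?s + (cmod (v a))\<^sup>2 \<le> (\<Sum>i<n. S * m * ?c i + (if l i = m then 0 else ?c i))"
    using wa unfolding norm by (simp add: sum.distrib sum_distrib_left)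
  also have "\<dots> \<le> (\<Sum>i<n. S * (l i * ?c i))"
  proof (rule sum_mono)
    fix i assume "i \<in> {..<n}"
    then have "1 \<le> S * (l i - m)" if "l i \<noteq> m"
      using gap[OF spectral_eigenvalue[OF sp] that] by simp
    then have "l i \<noteq> m \<Longrightarrow> 1 * ?c i \<le> S * (l i - m) * ?c i" by (intro mult_right_mono) auto
    then show "S * m * ?c i + (if l i = m then 0 else ?c i) \<le> S * (l i * ?c i)"
      by (auto simp: algebra_simps)
  qed
  finally have lower: "S * m * ?s \<le> S * (\<Sum>i<n. l i * ?c i) - (cmod (v a))\<^sup>2"
    by (simp add: sum_distrib_left)
  have "inprod n (apply_mat n ?Y v) v = of_real (\<mu> * ?s)"
  proof -
    have "inprod n (apply_mat n ?Y v) v = inprod n (\<lambda>x. of_real \<mu> * v x) v"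
      using v(1) by (intro inprod_cong) (auto simp: eigen_def)
    then show ?thesis by (simp add: inprod_smult_left inprod_self)
  qed
  then have "of_real (\<mu> * ?s) = (of_real (S * (\<Sum>i<n. l i * ?c i) - (cmod (v a))\<^sup>2) :: complex)"
    unfolding inprod_lower_at[OF a] spectral_quadratic[OF sp] by simp
  then have "\<mu> * ?s = S * (\<Sum>i<n. l i * ?c i) - (cmod (v a))\<^sup>2" unfolding of_real_eq_iff .
  with lower have "S * m * ?s \<le> \<mu> * ?s" by simp
  then show ?thesis using inprod_self_pos[OF v(2)] by simp
qed

text \<open>\<open>S * A\<close> is at least the identity and the projector is at most the identity.
  This is needed because the certificate can hold only a natural number as the separating
  numerator.\<close>

lemma lower_at_eigenvalue_nonneg:
  assumes A: "hermitian n A" and a: "a < n" and m: "min_eigen n A m" "1 \<le> m" and S: "1 \<le> S"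
    and \<mu>: "eigenvalue (lower_at n a S A) (of_real \<mu>)"
  shows "0 \<le> \<mu>"
proof -
  let ?Y = "lower_at n a S A"
  have Yc: "?Y \<in> carrier_mat n n" by (simp add: lower_at_def)
  obtain v where v: "eigen n ?Y v (of_real \<mu>)" "\<exists>x<n. v x \<noteq> 0"
    using \<mu> eigenvalue_eigen[OF Yc] by blast
  obtain u l where sp: "spectral n A u l" using spectral_theorem[OF A] by blast
  let ?s = "\<Sum>x<n. (cmod (v x))\<^sup>2"
  let ?c = "\<lambda>i. (cmod (inprod n v (u i)))\<^sup>2"
  have norm: "?s = (\<Sum>i<n. ?c i)"
    using spectral_norm[OF sp, of v] unfolding inprod_self of_real_eq_iff .
  have "(cmod (v a))\<^sup>2 \<le> ?s"
    by (rule member_le_sum[where f = "\<lambda>x. (cmod (v x))\<^sup>2"]) (use a in auto)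
  also have "?s \<le> (\<Sum>i<n. S * (l i * ?c i))"
    unfolding norm
  proof (rule sum_mono)
    fix i assume "i \<in> {..<n}"
    then have "1 \<le> l i"
      using spectral_eigenvalue[OF sp] m unfolding min_eigen_def by (metis Re_complex_of_real lessThan_iff order_trans)
    then have "1 * 1 \<le> S * l i" using S by (intro mult_mono) auto
    then have "1 * ?c i \<le> S * l i * ?c i" by (intro mult_right_mono) auto
    then show "?c i \<le> S * (l i * ?c i)" by (simp add: mult.assoc)
  qed
  finally have lower: "0 \<le> S * (\<Sum>i<n. l i * ?c i) - (cmod (v a))\<^sup>2" by (simp add: sum_distrib_left)
  have "inprod n (apply_mat n ?Y v) v = of_real (\<mu> * ?s)"
  proof -
    have "inprod n (apply_mat n ?Y v) v = inprod n (\<lambda>x. of_real \<mu> * v x) v"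
      using v(1) by (intro inprod_cong) (auto simp: eigen_def)
    then show ?thesis by (simp add: inprod_smult_left inprod_self)
  qed
  then have "of_real (\<mu> * ?s) = (of_real (S * (\<Sum>i<n. l i * ?c i) - (cmod (v a))\<^sup>2) :: complex)"
    unfolding inprod_lower_at[OF a] spectral_quadratic[OF sp] by simp
  then have "\<mu> * ?s = S * (\<Sum>i<n. l i * ?c i) - (cmod (v a))\<^sup>2" unfolding of_real_eq_iff .
  with lower have "0 \<le> \<mu> * ?s" by simp
  then show ?thesis using inprod_self_pos[OF v(2)] by (simp add: zero_le_mult_iff)
qed



section \<open>The local criterion\<close>

text \<open>Every factor \<open>X - r\<close> with \<open>r < 0\<close> has positive coefficients,
  and positivity up to the degree is inherited by products.\<close>

lemma coeff_prod_negative_roots: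
  assumes "\<And>r. r \<in> set rs \<Longrightarrow> r < (0 :: real)" "l \<le> length rs"
  shows "\<exists>c > 0. coeff (\<Prod>r\<leftarrow>rs. [:- complex_of_real r, 1:]) l = of_real c"
  using assms
proof (induction rs arbitrary: l)
  case Nil
  then show ?case by (intro exI[of _ 1]) simp
next
  case (Cons r rs)
  let ?p = "\<Prod>r\<leftarrow>rs. [:- complex_of_real r, 1:]"
  have r: "r < 0" using Cons.prems(1) by simp
  have eq: "coeff (\<Prod>r\<leftarrow>r # rs. [:- complex_of_real r, 1:]) l =
      of_real (- r) * coeff ?p l + (case l of 0 \<Rightarrow> 0 | Suc k \<Rightarrow> coeff ?p k)"
    by (simp add: coeff_pCons split: nat.split)
  have IH: "\<exists>c > 0. coeff ?p k = of_real c" if "k \<le> length rs" for k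
    by (rule Cons.IH) (use Cons.prems that in auto)
  have deg: "degree ?p = length rs" by (rule degree_linear_factors[where f = "\<lambda>x. - of_real x"])
  show ?case
  proof (cases l)
    case 0
    obtain c where "c > 0" "coeff ?p 0 = of_real c" using IH[of 0] by auto
    then show ?thesis using r 0 unfolding eq by (intro exI[of _ "- r * c"]) (simp add: mult_neg_pos)
  next
    case (Suc k)
    then obtain c where c: "c > 0" "coeff ?p k = of_real c" using IH[of k] Cons.prems(2) by auto
    show ?thesis
    proof (cases "l \<le> length rs")
      case True
      then obtain c' where c': "c' > 0" "coeff ?p l = of_real c'" using IH by blast
      have "0 < - r * c'" using r c'(1) by (intro mult_pos_pos) auto
      then have "0 < - r * c' + c" using c(1) by linarith
      moreover have "(case l of 0 \<Rightarrow> 0 | Suc k \<Rightarrow> coeff ?p k) = of_real c" using Suc c(2) by simp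
      ultimately show ?thesis unfolding eq c'(2)
        by (intro exI[of _ "- r * c' + c"] conjI) simp_all
    next
      case False
      then have "coeff ?p l = 0" using deg by (intro coeff_eq_0) simp
      then show ?thesis using c Suc unfolding eq by auto
    qed
  qed
qed

lemma coeff_prod_nonpositive_roots:
  assumes "\<And>r. r \<in> set rs \<Longrightarrow> r \<le> (0 :: real)"
  shows "\<exists>c \<ge> 0. coeff (\<Prod>r\<leftarrow>rs. [:- complex_of_real r, 1:]) l = of_real c"
  using assms
proof (induction rs arbitrary: l)
  case Nil
  then show ?case by (cases l) (auto intro: exI[of _ 1])
next
  case (Cons r rs)
  let ?p = "\<Prod>r\<leftarrow>rs. [:- complex_of_real r, 1:]"
  have r: "r \<le> 0" using Cons.prems by simp
  have eq: "coeff (\<Prod>r\<leftarrow>r # rs. [:- complex_of_real r, 1:]) l =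
      of_real (- r) * coeff ?p l + (case l of 0 \<Rightarrow> 0 | Suc k \<Rightarrow> coeff ?p k)"
    by (simp add: coeff_pCons split: nat.split)
  have IH: "\<exists>c \<ge> 0. coeff ?p k = of_real c" for k
    by (rule Cons.IH) (use Cons.prems in auto)
  obtain c where c: "c \<ge> 0" "coeff ?p l = of_real c" using IH by blast
  obtain c' where c': "c' \<ge> 0" "(case l of 0 \<Rightarrow> 0 | Suc k \<Rightarrow> coeff ?p k) = complex_of_real c'"
    using IH by (cases l) (auto intro: exI[of _ 0])
  have "0 \<le> - r * c" using r c(1) by (intro mult_nonneg_nonneg) auto
  then have "0 \<le> - r * c + c'" using c'(1) by linarith
  then show ?case unfolding eq c(2) c'(2) by (intro exI[of _ "- r * c + c'"] conjI) simp_all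
qed

definition real_rooted :: "nat \<Rightarrow> int mat \<Rightarrow> bool" where
  "real_rooted N M \<longleftrightarrow> M \<in> carrier_mat N N \<and> (\<forall>e. eigenvalue (cmat M) e \<longrightarrow> e \<in> \<real>)"

lemma real_rooted_factorization:
  assumes "real_rooted N M"
  obtains rs where "map_poly of_int (char_poly M) = (\<Prod>r\<leftarrow>rs. [:- complex_of_real r, 1:])" "length rs = N"
    "\<And>r. eigenvalue (cmat M) (of_real r) \<longleftrightarrow> r \<in> set rs"
proof -
  have M: "M \<in> carrier_mat N N" "cmat M \<in> carrier_mat N N" using assms by (auto simp: real_rooted_def)
  obtain as where as: "char_poly (cmat M) = (\<Prod>a\<leftarrow>as. [:- a, 1:])" "length as = N"
    using char_poly_factorized[OF M(2)] by blast
  have root: "eigenvalue (cmat M) c \<longleftrightarrow> c \<in> set as" for c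
    unfolding eigenvalue_root_char_poly[OF M(2)] as(1) poly_prod_list
    by (auto simp: prod_list_zero_iff)
  have real: "of_real (Re a) = a" if "a \<in> set as" for a
    using that root assms unfolding real_rooted_def by simp
  have "map (\<lambda>a. complex_of_real (Re a)) as = as" using real by (intro map_idI) auto
  then have eq: "(\<Prod>r\<leftarrow>map Re as. [:- complex_of_real r, 1:]) = (\<Prod>a\<leftarrow>as. [:- a, 1:])"
    by (metis (mono_tags, lifting) comp_apply list.map_comp map_eq_conv real)
  have "r \<in> set (map Re as) \<longleftrightarrow> of_real r \<in> set as" for r
    using real by (auto simp: image_iff) (metis Re_complex_of_real)+
  with eq show thesis
    using that[of "map Re as"] root as of_int_hom.char_poly_hom[OF M(1), where ?'a = complex] by simp
qed

lemma char_poly_root_sum: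
  assumes "real_rooted N M" "eigenvalue (cmat M) (of_real r)"
  shows "(\<Sum>l\<le>N. of_int (coeff (char_poly M) l) * r ^ l) = 0"
proof -
  have M: "M \<in> carrier_mat N N" "cmat M \<in> carrier_mat N N" using assms by (auto simp: real_rooted_def)
  have deg: "degree (char_poly (cmat M)) = N" using degree_monic_char_poly[OF M(2)] by simp
  have "poly (char_poly (cmat M)) (of_real r) = 0"
    using assms(2) eigenvalue_root_char_poly[OF M(2)] by blast
  then have "(\<Sum>l\<le>N. coeff (char_poly (cmat M)) l * of_real r ^ l) = 0"
    unfolding poly_altdef deg .
  moreover have "coeff (char_poly (cmat M)) l = of_int (coeff (char_poly M) l)" for l
    unfolding of_int_hom.char_poly_hom[OF M(1)] by (simp add: coeff_map_poly)
  ultimately have "complex_of_real (\<Sum>l\<le>N. of_int (coeff (char_poly M) l) * r ^ l) = 0" by simp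
  then show ?thesis unfolding of_real_eq_0_iff .
qed

text \<open>A polynomial with positive coefficients has no root at or above 0. For the other
  direction all roots must be real: then the characteristic polynomial is a product of factors
  \<open>X - r\<close> with \<open>r < 0\<close>.\<close>

lemma all_eigenvalues_negative_iff:
  assumes "real_rooted N M"
  shows "(\<forall>r. eigenvalue (cmat M) (of_real r) \<longrightarrow> r < 0) \<longleftrightarrow> (\<forall>l\<le>N. 0 < coeff (char_poly M) l)"
proof
  assume neg: "\<forall>r. eigenvalue (cmat M) (of_real r) \<longrightarrow> r < 0"
  obtain rs where rs: "map_poly of_int (char_poly M) = (\<Prod>r\<leftarrow>rs. [:- complex_of_real r, 1:])" "length rs = N"
    "\<And>r. eigenvalue (cmat M) (of_real r) \<longleftrightarrow> r \<in> set rs"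
    using real_rooted_factorization[OF assms] by metis
  show "\<forall>l\<le>N. 0 < coeff (char_poly M) l"
  proof (intro allI impI)
    fix l assume "l \<le> N"
    then obtain c where c: "c > 0" "coeff (\<Prod>r\<leftarrow>rs. [:- complex_of_real r, 1:]) l = of_real c"
      using coeff_prod_negative_roots[of rs l] neg rs(2,3) by auto
    have "complex_of_int (coeff (char_poly M) l) = of_real c"
      using c(2) unfolding rs(1)[symmetric] by (simp add: coeff_map_poly)
    then have "of_int (coeff (char_poly M) l) = c" by (metis of_real_eq_iff of_real_of_int_eq)
    with c(1) show "0 < coeff (char_poly M) l" by simp
  qed
next
  assume pos: "\<forall>l\<le>N. 0 < coeff (char_poly M) l"
  show "\<forall>r. eigenvalue (cmat M) (of_real r) \<longrightarrow> r < 0"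
  proof (intro allI impI, rule ccontr)
    fix r assume ev: "eigenvalue (cmat M) (of_real r)" and "\<not> r < 0"
    then have r: "0 \<le> r" by simp
    have "of_int (coeff (char_poly M) 0) * r ^ 0 \<le> (\<Sum>l\<le>N. of_int (coeff (char_poly M) l) * r ^ l)"
      by (rule member_le_sum[where f = "\<lambda>l. of_int (coeff (char_poly M) l) * r ^ l"])
        (use pos r in \<open>auto intro!: mult_nonneg_nonneg simp: less_imp_le\<close>)
    moreover have "0 < coeff (char_poly M) 0" using pos by simp
    ultimately show False using char_poly_root_sum[OF assms ev] by simp
  qed
qed

text \<open>If no root is positive, the factors \<open>X - r\<close> have non-negative coefficients,
  and so has their product. If no coefficient is negative, the leading coefficient 1 makes the
  polynomial positive at every \<open>r > 0\<close>.\<close>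

lemma some_eigenvalue_positive_iff:
  assumes "real_rooted N M"
  shows "(\<exists>r > 0. eigenvalue (cmat M) (of_real r)) \<longleftrightarrow> (\<exists>l\<le>N. coeff (char_poly M) l < 0)"
proof
  assume "\<exists>l\<le>N. coeff (char_poly M) l < 0"
  then obtain l where l: "coeff (char_poly M) l < 0" by blast
  show "\<exists>r > 0. eigenvalue (cmat M) (of_real r)"
  proof (rule ccontr)
    assume *: "\<not> ?thesis"
    obtain rs where rs: "map_poly of_int (char_poly M) = (\<Prod>r\<leftarrow>rs. [:- complex_of_real r, 1:])"
      "\<And>r. eigenvalue (cmat M) (of_real r) \<longleftrightarrow> r \<in> set rs"
      using real_rooted_factorization[OF assms] by metis
    then have "\<And>r. r \<in> set rs \<Longrightarrow> r \<le> 0" using * not_less by blast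
    then obtain c where c: "c \<ge> 0" "coeff (\<Prod>r\<leftarrow>rs. [:- complex_of_real r, 1:]) l = of_real c"
      using coeff_prod_nonpositive_roots[of rs l] by auto
    have "complex_of_int (coeff (char_poly M) l) = of_real c"
      using c(2) unfolding rs(1)[symmetric] by (simp add: coeff_map_poly)
    then have "of_int (coeff (char_poly M) l) = c" by (metis of_real_eq_iff of_real_of_int_eq)
    with c(1) l show False by simp
  qed
next
  assume "\<exists>r > 0. eigenvalue (cmat M) (of_real r)"
  then obtain r where r: "0 < r" "eigenvalue (cmat M) (of_real r)" by blast
  have M: "M \<in> carrier_mat N N" using assms by (auto simp: real_rooted_def)
  show "\<exists>l\<le>N. coeff (char_poly M) l < 0"
  proof (rule ccontr)
    assume "\<not> ?thesis"
    then have nonneg: "0 \<le> coeff (char_poly M) l" if "l \<le> N" for l using that not_less by blast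
    have "of_int (coeff (char_poly M) N) * r ^ N \<le> (\<Sum>l\<le>N. of_int (coeff (char_poly M) l) * r ^ l)"
      by (rule member_le_sum[where f = "\<lambda>l. of_int (coeff (char_poly M) l) * r ^ l"])
        (use nonneg r in \<open>auto intro!: mult_nonneg_nonneg\<close>)
    moreover have "coeff (char_poly M) N = 1" using degree_monic_char_poly[OF M] by simp
    moreover have "0 < r ^ N" using r(1) by simp
    ultimately show False using char_poly_root_sum[OF assms r(2)] by simp
  qed
qed

text \<open>Its eigenvalues are \<open>\<alpha> - \<beta> * e\<close>: for positive \<beta> their
  signs compare the eigenvalues \<open>e\<close> of \<open>X\<close> with the rational number
  \<open>\<alpha> / \<beta>\<close>.\<close>

definition shift_mat :: "nat \<Rightarrow> int \<Rightarrow> int \<Rightarrow> int mat \<Rightarrow> int mat" where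
  "shift_mat N \<alpha> \<beta> X = mat N N (\<lambda>(i, j). (if i = j then \<alpha> else 0) - \<beta> * X $$ (i, j))"

lemma eigen_shift_mat:
  assumes "X \<in> carrier_mat N N"
  shows "x < N \<Longrightarrow> apply_mat N (cmat (shift_mat N \<alpha> \<beta> X)) v x = of_int \<alpha> * v x - of_int \<beta> * apply_mat N (cmat X) v x"
proof -
  assume x: "x < N"
  have "apply_mat N (cmat (shift_mat N \<alpha> \<beta> X)) v x =
      (\<Sum>y<N. (if y = x then of_int \<alpha> * v x else 0) - of_int \<beta> * (cmat X $$ (x, y) * v y))"
    unfolding apply_mat_def using x assms
    by (intro sum.cong refl) (auto simp: shift_mat_def algebra_simps)
  then show ?thesis using x by (simp add: sum_subtractf apply_mat_def sum_distrib_left)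
qed

lemma eigenvalue_shift_mat:
  assumes X: "X \<in> carrier_mat N N" and \<beta>: "\<beta> \<noteq> 0"
  shows "eigenvalue (cmat (shift_mat N \<alpha> \<beta> X)) f \<longleftrightarrow> eigenvalue (cmat X) ((of_int \<alpha> - f) / of_int \<beta>)"
proof -
  have "eigen N (cmat (shift_mat N \<alpha> \<beta> X)) v f \<longleftrightarrow> eigen N (cmat X) v ((of_int \<alpha> - f) / of_int \<beta>)" for v
  proof -
    have b: "of_int \<beta> \<noteq> (0 :: complex)" using \<beta> by simp
    have "of_int \<alpha> * v x - of_int \<beta> * z = f * v x \<longleftrightarrow> z = (of_int \<alpha> - f) / of_int \<beta> * v x" for x and z :: complex
      using b by (auto simp: field_simps)
    then show ?thesis unfolding eigen_def by (simp add: eigen_shift_mat[OF X])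
  qed
  moreover have "cmat (shift_mat N \<alpha> \<beta> X) \<in> carrier_mat N N" "cmat X \<in> carrier_mat N N"
    using X by (auto simp: shift_mat_def)
  ultimately show ?thesis by (simp add: eigenvalue_eigen)
qed

definition symmetric_int :: "nat \<Rightarrow> int mat \<Rightarrow> bool" where
  "symmetric_int N X \<longleftrightarrow> X \<in> carrier_mat N N \<and> (\<forall>i<N. \<forall>j<N. X $$ (i, j) = X $$ (j, i))"

lemma hermitian_cmat: "symmetric_int N X \<Longrightarrow> hermitian N (cmat X)"
  unfolding hermitian_def symmetric_int_def by (auto simp: complex_cnj_of_int)

lemma hermitian_eigenvalue_real: "hermitian n A \<Longrightarrow> eigenvalue A e \<Longrightarrow> e \<in> \<real>"
  using eigen_real eigenvalue_eigen unfolding hermitian_def by metis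

lemma real_rooted_shift_mat:
  assumes "symmetric_int N X"
  shows "real_rooted N (shift_mat N \<alpha> \<beta> X)"
proof -
  have "symmetric_int N (shift_mat N \<alpha> \<beta> X)"
    using assms unfolding symmetric_int_def shift_mat_def by auto
  then show ?thesis
    using hermitian_eigenvalue_real[OF hermitian_cmat] unfolding real_rooted_def symmetric_int_def by blast
qed

text \<open>Squares instead of absolute values: for integers they are no smaller, and they are
  polynomials in the entries, as a formula for the verifier requires.\<close>

definition entry_bound :: "nat \<Rightarrow> int mat \<Rightarrow> int" where
  "entry_bound N A = 1 + (\<Sum>i<N. \<Sum>j<N. A $$ (i, j) * A $$ (i, j))"

text \<open>The separation bound for two eigenvalues of \<open>A\<close>, both row sums being at
  most \<open>entry_bound N A\<close>: after scaling, distinct eigenvalues are at least 1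
  apart.\<close>

definition scale :: "nat \<Rightarrow> int mat \<Rightarrow> int" where
  "scale N A = (2 * entry_bound N A) ^ (N * N)"

definition scaled_mat :: "nat \<Rightarrow> int mat \<Rightarrow> int mat" where
  "scaled_mat N A = mat N N (\<lambda>(i, j). scale N A * A $$ (i, j))"

definition lowered_mat :: "nat \<Rightarrow> nat \<Rightarrow> int mat \<Rightarrow> int mat" where
  "lowered_mat N a A = mat N N (\<lambda>(i, j). scale N A * A $$ (i, j) - (if i = a \<and> j = a then 1 else 0))"

text \<open>The row sums of the scaled and of the lowered matrix add up to at most
  \<open>2 * scale N A * entry_bound N A + 1\<close>, so the power separates their eigenvalues by 1.
  The factor 2 guarantees an integer strictly in between.\<close>

definition resolution :: "nat \<Rightarrow> int mat \<Rightarrow> int" where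
  "resolution N A = 2 * (2 * scale N A * entry_bound N A + 1) ^ (N * N)"

text \<open>Says that \<open>\<alpha> / resolution N A\<close> separates the least eigenvalues of the two matrices.\<close>
definition criterion :: "nat \<Rightarrow> nat \<Rightarrow> int mat \<Rightarrow> int \<Rightarrow> bool" where
  "criterion N a A \<alpha> \<longleftrightarrow>
     (\<forall>l\<le>N. 0 < coeff (char_poly (shift_mat N \<alpha> (resolution N A) (scaled_mat N A))) l) \<and>
     (\<exists>l\<le>N. coeff (char_poly (shift_mat N \<alpha> (resolution N A) (lowered_mat N a A))) l < 0)"

lemma entry_bound_ge: "1 \<le> entry_bound N A"
  by (auto simp: entry_bound_def intro!: sum_nonneg)

lemma row_sum_bound:
  assumes "i < N"
  shows "(\<Sum>j<N. \<bar>A $$ (i, j)\<bar>) \<le> entry_bound N A"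
proof -
  have "\<bar>z\<bar> \<le> z * z" for z :: int
  proof (cases "z = 0")
    case False
    then have "\<bar>z\<bar> * 1 \<le> \<bar>z\<bar> * \<bar>z\<bar>" by (intro mult_left_mono) auto
    then show ?thesis by (simp flip: abs_mult)
  qed simp
  then have "(\<Sum>j<N. \<bar>A $$ (i, j)\<bar>) \<le> (\<Sum>j<N. A $$ (i, j) * A $$ (i, j))" by (intro sum_mono) auto
  also have "\<dots> \<le> (\<Sum>i<N. \<Sum>j<N. A $$ (i, j) * A $$ (i, j))"
    by (rule member_le_sum[where f = "\<lambda>i. \<Sum>j<N. A $$ (i, j) * A $$ (i, j)"])
      (use assms in \<open>auto intro!: sum_nonneg\<close>)
  finally show ?thesis by (simp add: entry_bound_def)
qed

lemma scale_ge: "1 \<le> scale N A"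
  unfolding scale_def using entry_bound_ge[of N A] by (intro one_le_power) linarith

lemma resolution_pos: "0 < resolution N A"
  unfolding resolution_def using entry_bound_ge[of N A] scale_ge[of N A] by (simp add: add_nonneg_pos)

context
  fixes N a :: nat and A :: "int mat" and m :: real
  assumes sym_A: "symmetric_int N A" and a: "a < N" and min_m: "min_eigen N (cmat A) m" and m_ge: "1 \<le> m"
begin

private lemma A_carrier: "A \<in> carrier_mat N N"
  using sym_A by (simp add: symmetric_int_def)

private lemma scaled_eigenvalue:
  "eigenvalue (cmat (scaled_mat N A)) (of_int (scale N A) * e) \<longleftrightarrow> eigenvalue (cmat A) e"
proof -
  have "apply_mat N (cmat (scaled_mat N A)) v x = of_int (scale N A) * apply_mat N (cmat A) v x" if "x < N" for v x
    unfolding apply_mat_def sum_distrib_left using that A_carrier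
    by (intro sum.cong refl) (auto simp: scaled_mat_def)
  then have "eigen N (cmat (scaled_mat N A)) v (of_int (scale N A) * e) \<longleftrightarrow> eigen N (cmat A) v e" for v
    using scale_ge[of N A] unfolding eigen_def by simp
  moreover have "cmat (scaled_mat N A) \<in> carrier_mat N N" "cmat A \<in> carrier_mat N N"
    using A_carrier by (auto simp: scaled_mat_def)
  ultimately show ?thesis by (simp add: eigenvalue_eigen)
qed

private lemma cmat_lowered: "cmat (lowered_mat N a A) = lower_at N a (of_int (scale N A)) (cmat A)"
  using A_carrier by (intro eq_matI) (auto simp: lowered_mat_def lower_at_def)

private lemma symmetric_scaled: "symmetric_int N (scaled_mat N A)"
  using sym_A by (auto simp: symmetric_int_def scaled_mat_def)

private lemma symmetric_lowered: "symmetric_int N (lowered_mat N a A)"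
  using sym_A by (auto simp: symmetric_int_def lowered_mat_def)

private lemma gap:
  assumes "eigenvalue (cmat A) (of_real e)" "e \<noteq> m"
  shows "1 \<le> of_int (scale N A) * (e - m)"
proof -
  have "m \<le> e" using min_m assms(1) unfolding min_eigen_def by fastforce
  moreover have "1 \<le> cmod (of_real e - of_real m) * of_int (2 * entry_bound N A) ^ (N * N)"
    by (rule eigenvalue_separation[OF A_carrier row_sum_bound A_carrier row_sum_bound assms(1)])
      (use min_m assms(2) entry_bound_ge[of N A] in \<open>auto simp: min_eigen_def\<close>)
  ultimately show ?thesis by (simp add: scale_def mult.commute norm_of_real flip: of_real_diff)
qed

text \<open>The first half of the criterion puts \<open>\<alpha> / resolution N A\<close> below the
  least eigenvalue of the scaled matrix, the second half puts an eigenvalue of the lowered matrix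
  below that quotient; this cannot be if all ground vectors vanish at \<open>a\<close>. The number
  \<alpha> is arbitrary, as it comes from an untrusted certificate.\<close>

lemma criterion_sound:
  assumes "criterion N a A \<alpha>"
  shows "\<exists>v. eigen N (cmat A) v (of_real m) \<and> v a \<noteq> 0"
proof (rule ccontr)
  assume "\<not> ?thesis"
  then have vanish: "v a = 0" if "eigen N (cmat A) v (of_real m)" for v using that by blast
  let ?\<beta> = "resolution N A"
  have \<beta>: "0 < (of_int ?\<beta> :: real)" "?\<beta> \<noteq> 0" using resolution_pos[of N A] by simp_all
  have X: "scaled_mat N A \<in> carrier_mat N N" and Y: "lowered_mat N a A \<in> carrier_mat N N"
    by (auto simp: scaled_mat_def lowered_mat_def)
  have "eigenvalue (cmat (shift_mat N \<alpha> ?\<beta> (scaled_mat N A))) (of_real (of_int \<alpha> - of_int ?\<beta> * (of_int (scale N A) * m)))"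
    unfolding eigenvalue_shift_mat[OF X \<beta>(2)]
    using scaled_eigenvalue[of "of_real m"] min_m \<beta> by (simp add: min_eigen_def)
  then have 1: "of_int \<alpha> - of_int ?\<beta> * (of_int (scale N A) * m) < 0"
    using assms all_eigenvalues_negative_iff[OF real_rooted_shift_mat[OF symmetric_scaled]]
    unfolding criterion_def by blast
  obtain r where r: "0 < r" "eigenvalue (cmat (shift_mat N \<alpha> ?\<beta> (lowered_mat N a A))) (of_real r)"
    using assms some_eigenvalue_positive_iff[OF real_rooted_shift_mat[OF symmetric_lowered]]
    unfolding criterion_def by blast
  have "eigenvalue (cmat (lowered_mat N a A)) (of_real ((of_int \<alpha> - r) / of_int ?\<beta>))"
    using r(2) unfolding eigenvalue_shift_mat[OF Y \<beta>(2)] by simp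
  then have "of_int (scale N A) * m \<le> (of_int \<alpha> - r) / of_int ?\<beta>"
    unfolding cmat_lowered
  proof (rule lower_at_eigenvalue_ge[OF hermitian_cmat[OF sym_A] a min_m, rotated 3])
    show "0 \<le> (of_int (scale N A) :: real)" using scale_ge[of N A] by simp
  qed (rule gap vanish; assumption)+
  then have "of_int ?\<beta> * (of_int (scale N A) * m) \<le> of_int \<alpha> - r"
    using \<beta>(1) by (simp add: le_divide_eq mult.commute)
  with 1 r(1) show False by simp
qed

text \<open>The upper bound is what keeps the certificate short: it is a polynomial in the entries
  of \<open>A\<close>.\<close>

lemma criterion_complete:
  assumes v: "eigen N (cmat A) v (of_real m)" "v a \<noteq> 0"
  shows "\<exists>\<alpha> :: nat. criterion N a A (int \<alpha>) \<and>
    int \<alpha> \<le> resolution N A * scale N A * entry_bound N A"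
proof -
  let ?\<beta> = "resolution N A" and ?S = "scale N A" and ?\<rho> = "entry_bound N A"
  have \<beta>: "0 < (of_int ?\<beta> :: real)" "?\<beta> \<noteq> 0" using resolution_pos[of N A] by simp_all
  have S: "1 \<le> (of_int ?S :: real)" using scale_ge[of N A] by simp
  have X: "scaled_mat N A \<in> carrier_mat N N" and Y: "lowered_mat N a A \<in> carrier_mat N N"
    by (auto simp: scaled_mat_def lowered_mat_def)
  have H: "hermitian N (cmat A)" by (rule hermitian_cmat[OF sym_A])
  obtain \<mu> where \<mu>: "\<mu> < of_int ?S * m" "eigenvalue (cmat (lowered_mat N a A)) (of_real \<mu>)"
    using lower_at_eigenvalue_lt[OF H a v, of "of_int ?S"] unfolding cmat_lowered by blast
  have \<mu>0: "0 \<le> \<mu>"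
    by (rule lower_at_eigenvalue_nonneg[OF H a min_m m_ge S]) (use \<mu>(2) cmat_lowered in simp)
  have ev: "eigenvalue (cmat (scaled_mat N A)) (of_real (of_int ?S * m))"
    using scaled_eigenvalue[of "of_real m"] min_m by (simp add: min_eigen_def)
  have row: "(\<Sum>j<N. \<bar>scaled_mat N A $$ (i, j)\<bar>) \<le> ?S * ?\<rho>" if "i < N" for i
  proof -
    have "(\<Sum>j<N. \<bar>scaled_mat N A $$ (i, j)\<bar>) = ?S * (\<Sum>j<N. \<bar>A $$ (i, j)\<bar>)"
      using that scale_ge[of N A] by (simp add: scaled_mat_def abs_mult sum_distrib_left)
    then show ?thesis using row_sum_bound[OF that, of A] scale_ge[of N A] by (simp add: mult_left_mono)
  qed
  have row': "(\<Sum>j<N. \<bar>lowered_mat N a A $$ (i, j)\<bar>) \<le> ?S * ?\<rho> + 1" if "i < N" for i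
  proof -
    have "(\<Sum>j<N. \<bar>lowered_mat N a A $$ (i, j)\<bar>) \<le> (\<Sum>j<N. \<bar>scaled_mat N A $$ (i, j)\<bar> + (if j = a then 1 else 0))"
      using that by (intro sum_mono) (auto simp: lowered_mat_def scaled_mat_def)
    also have "\<dots> = (\<Sum>j<N. \<bar>scaled_mat N A $$ (i, j)\<bar>) + 1" using a by (simp add: sum.distrib)
    finally show ?thesis using row[OF that] by simp
  qed
  have S\<rho>: "1 \<le> ?S * ?\<rho>" using scale_ge[of N A] entry_bound_ge[of N A] by (metis mult_mono mult_1 zero_le_one order_trans)
  have sep: "1 \<le> cmod (of_real (of_int ?S * m) - of_real \<mu>) * of_int (2 * ?S * ?\<rho> + 1) ^ (N * N)"
  proof (rule eigenvalue_separation[OF X row Y row' ev \<mu>(2)])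
    show "complex_of_real (of_int ?S * m) \<noteq> of_real \<mu>"
      unfolding of_real_eq_iff using \<mu>(1) by simp
  qed (use S\<rho> in \<open>simp_all add: mult.assoc\<close>)
  define P where "P = (of_int (2 * ?S * ?\<rho> + 1) ^ (N * N) :: real)"
  have "cmod (of_real (of_int ?S * m) - of_real \<mu>) = of_int ?S * m - \<mu>"
    unfolding of_real_diff[symmetric] norm_of_real using \<mu>(1) by simp
  then have "1 \<le> (of_int ?S * m - \<mu>) * P" using sep unfolding P_def by (simp only:)
  moreover have "of_int ?\<beta> = 2 * P" unfolding resolution_def P_def by (simp only: of_int_mult of_int_power of_int_numeral)
  ultimately have gap2: "of_int ?\<beta> * \<mu> + 2 \<le> of_int ?\<beta> * (of_int ?S * m)"
    by (simp add: algebra_simps)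
  \<comment> \<open>The least integer above \<open>?\<beta> * \<mu>\<close>. The two quantities to
    be separated are at least 2 apart, so it also lies strictly below the second one.\<close>
  define \<alpha> where "\<alpha> = \<lfloor>of_int ?\<beta> * \<mu>\<rfloor> + 1"
  have \<alpha>: "of_int ?\<beta> * \<mu> < of_int \<alpha>" "of_int \<alpha> \<le> of_int ?\<beta> * \<mu> + 1"
    unfolding \<alpha>_def by linarith+
  have "0 \<le> of_int ?\<beta> * \<mu>" using \<beta>(1) \<mu>0 by simp
  then have \<alpha>0: "0 \<le> \<alpha>" using \<alpha>(1) by linarith
  have "criterion N a A \<alpha>"
    unfolding criterion_def
  proof
    have "r < 0" if r: "eigenvalue (cmat (shift_mat N \<alpha> ?\<beta> (scaled_mat N A))) (of_real r)" for r
    proof -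
      let ?e = "(of_int \<alpha> - r) / of_int ?\<beta> / of_int ?S"
      have "eigenvalue (cmat (scaled_mat N A)) (of_int ?S * of_real ?e)"
        using r S unfolding eigenvalue_shift_mat[OF X \<beta>(2)] by simp
      then have "eigenvalue (cmat A) (of_real ?e)" using scaled_eigenvalue by blast
      then have "m \<le> ?e" using min_m unfolding min_eigen_def by fastforce
      then have "of_int ?\<beta> * (of_int ?S * m) \<le> of_int \<alpha> - r"
        using \<beta>(1) S by (simp add: le_divide_eq mult_ac)
      then show ?thesis using gap2 \<alpha>(2) by linarith
    qed
    then show "\<forall>l\<le>N. 0 < coeff (char_poly (shift_mat N \<alpha> ?\<beta> (scaled_mat N A))) l"
      using all_eigenvalues_negative_iff[OF real_rooted_shift_mat[OF symmetric_scaled]] by blast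
    have "eigenvalue (cmat (shift_mat N \<alpha> ?\<beta> (lowered_mat N a A))) (of_real (of_int \<alpha> - of_int ?\<beta> * \<mu>))"
      using \<mu>(2) \<beta> unfolding eigenvalue_shift_mat[OF Y \<beta>(2)] by simp
    moreover have "0 < of_int \<alpha> - of_int ?\<beta> * \<mu>" using \<alpha>(1) by simp
    ultimately show "\<exists>l\<le>N. coeff (char_poly (shift_mat N \<alpha> ?\<beta> (lowered_mat N a A))) l < 0"
      using some_eigenvalue_positive_iff[OF real_rooted_shift_mat[OF symmetric_lowered]] by blast
  qed
  moreover have "\<alpha> \<le> ?\<beta> * ?S * ?\<rho>"
  proof -
    \<comment> \<open>The numerator is at most the larger of the separated quantities, and that one
      is bounded because \<open>m\<close> is bounded by the row sums of \<open>A\<close>.\<close>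
    have "cmod (of_real m) \<le> of_int ?\<rho>"
    proof (rule eigenvalue_row_bound[of "cmat A" N])
      fix i assume i: "i < N"
      have "(\<Sum>j<N. cmod (cmat A $$ (i, j))) = of_int (\<Sum>j<N. \<bar>A $$ (i, j)\<bar>)"
        using i A_carrier by (simp add: norm_of_int flip: of_int_abs)
      then show "(\<Sum>j<N. cmod (cmat A $$ (i, j))) \<le> of_int ?\<rho>"
        using row_sum_bound[OF i, of A] by (simp only: of_int_le_iff)
    qed (use A_carrier min_m in \<open>auto simp: min_eigen_def\<close>)
    then have "m \<le> of_int ?\<rho>" by simp
    then have "of_int ?\<beta> * (of_int ?S * m) \<le> of_int ?\<beta> * (of_int ?S * of_int ?\<rho>)"
      using \<beta>(1) S by (intro mult_left_mono) auto
    then have "of_int \<alpha> \<le> (of_int (?\<beta> * ?S * ?\<rho>) :: real)" using \<alpha>(2) gap2 by (simp add: mult.assoc)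
    then show ?thesis by (simp only: of_int_le_iff)
  qed
  ultimately show ?thesis using \<alpha>0 by (intro exI[of _ "nat \<alpha>"]) simp
qed

end

section \<open>The criterion as a formula\<close>

text \<open>Integer polynomials in the variables, as differences of two expressions with natural
  values. The pair is chosen before the environment, so a fixed program can evaluate it.\<close>

definition poly_fun :: "nat \<Rightarrow> ((nat \<Rightarrow> nat) \<Rightarrow> int) \<Rightarrow> bool" where
  "poly_fun n F \<longleftrightarrow> (\<exists>P Q. expr_vars P \<le> n \<and> expr_vars Q \<le> n \<and>
     (\<forall>\<rho>. F \<rho> = int (eval_expr \<rho> P) - int (eval_expr \<rho> Q)))"

lemma poly_funI:
  "expr_vars P \<le> n \<Longrightarrow> expr_vars Q \<le> n \<Longrightarrow> (\<And>\<rho>. F \<rho> = int (eval_expr \<rho> P) - int (eval_expr \<rho> Q)) \<Longrightarrow> poly_fun n F"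
  unfolding poly_fun_def by blast

lemma poly_fun_mono: "poly_fun n F \<Longrightarrow> n \<le> n' \<Longrightarrow> poly_fun n' F"
  unfolding poly_fun_def by (meson le_trans)

lemma poly_fun_var: "j < n \<Longrightarrow> poly_fun n (\<lambda>\<rho>. int (\<rho> j))"
  by (rule poly_funI[of "Var j" _ Zero]) auto

lemma poly_fun_add:
  assumes "poly_fun n F" "poly_fun n G"
  shows "poly_fun n (\<lambda>\<rho>. F \<rho> + G \<rho>)"
proof -
  obtain P Q P' Q' where "expr_vars P \<le> n" "expr_vars Q \<le> n" "expr_vars P' \<le> n" "expr_vars Q' \<le> n"
    "\<forall>\<rho>. F \<rho> = int (eval_expr \<rho> P) - int (eval_expr \<rho> Q)"
    "\<forall>\<rho>. G \<rho> = int (eval_expr \<rho> P') - int (eval_expr \<rho> Q')"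
    using assms unfolding poly_fun_def by metis
  then show ?thesis by (intro poly_funI[of "Add P P'" _ "Add Q Q'"]) auto
qed

lemma poly_fun_diff:
  assumes "poly_fun n F" "poly_fun n G"
  shows "poly_fun n (\<lambda>\<rho>. F \<rho> - G \<rho>)"
proof -
  obtain P Q P' Q' where "expr_vars P \<le> n" "expr_vars Q \<le> n" "expr_vars P' \<le> n" "expr_vars Q' \<le> n"
    "\<forall>\<rho>. F \<rho> = int (eval_expr \<rho> P) - int (eval_expr \<rho> Q)"
    "\<forall>\<rho>. G \<rho> = int (eval_expr \<rho> P') - int (eval_expr \<rho> Q')"
    using assms unfolding poly_fun_def by metis
  then show ?thesis by (intro poly_funI[of "Add P Q'" _ "Add Q P'"]) auto
qed

lemma poly_fun_mult:
  assumes "poly_fun n F" "poly_fun n G"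
  shows "poly_fun n (\<lambda>\<rho>. F \<rho> * G \<rho>)"
proof -
  obtain P Q P' Q' where "expr_vars P \<le> n" "expr_vars Q \<le> n" "expr_vars P' \<le> n" "expr_vars Q' \<le> n"
    and F: "\<And>\<rho>. F \<rho> = int (eval_expr \<rho> P) - int (eval_expr \<rho> Q)"
    and G: "\<And>\<rho>. G \<rho> = int (eval_expr \<rho> P') - int (eval_expr \<rho> Q')"
    using assms unfolding poly_fun_def by metis
  then show ?thesis
    by (intro poly_funI[of "Add (Mul P P') (Mul Q Q')" _ "Add (Mul P Q') (Mul Q P')"])
      (simp_all add: F G left_diff_distrib right_diff_distrib)
qed

lemma poly_fun_const: "poly_fun n (\<lambda>_. c)"
proof -
  have nat: "poly_fun n (\<lambda>_. int k)" for k
  proof (induction k)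
    case 0
    show ?case by (rule poly_funI[of Zero _ Zero]) auto
  next
    case (Suc k)
    have "poly_fun n (\<lambda>_. 1)" by (rule poly_funI[of One _ Zero]) auto
    from poly_fun_add[OF this Suc] show ?case by simp
  qed
  have "poly_fun n (\<lambda>_. int (nat c) - int (nat (- c)))" by (intro poly_fun_diff nat)
  then show ?thesis by (simp add: nat_0_le split: if_splits)
qed

lemma poly_fun_sum: "(\<And>i. i \<in> I \<Longrightarrow> poly_fun n (F i)) \<Longrightarrow> poly_fun n (\<lambda>\<rho>. \<Sum>i\<in>I. F i \<rho>)"
  by (induction I rule: infinite_finite_induct) (auto intro: poly_fun_const poly_fun_add)

lemma poly_fun_prod: "(\<And>i. i \<in> I \<Longrightarrow> poly_fun n (F i)) \<Longrightarrow> poly_fun n (\<lambda>\<rho>. \<Prod>i\<in>I. F i \<rho>)"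
  by (induction I rule: infinite_finite_induct) (auto intro: poly_fun_const poly_fun_mult)

lemma poly_fun_power: "poly_fun n F \<Longrightarrow> poly_fun n (\<lambda>\<rho>. F \<rho> ^ k)"
  by (induction k) (auto intro: poly_fun_const poly_fun_mult)

lemma poly_fun_if: "poly_fun n F \<Longrightarrow> poly_fun n G \<Longrightarrow> poly_fun n (\<lambda>\<rho>. if b then F \<rho> else G \<rho>)"
  by (cases b) auto

lemmas poly_fun_intros = poly_fun_add poly_fun_diff poly_fun_mult poly_fun_const poly_fun_sum poly_fun_power

definition poly_coeffs :: "nat \<Rightarrow> ((nat \<Rightarrow> nat) \<Rightarrow> int poly) \<Rightarrow> bool" where
  "poly_coeffs n F \<longleftrightarrow> (\<forall>l. poly_fun n (\<lambda>\<rho>. coeff (F \<rho>) l))"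

lemma poly_coeffs_const: "poly_coeffs n (\<lambda>_. c)"
  by (simp add: poly_coeffs_def poly_fun_const)

lemma poly_coeffs_add: "poly_coeffs n F \<Longrightarrow> poly_coeffs n G \<Longrightarrow> poly_coeffs n (\<lambda>\<rho>. F \<rho> + G \<rho>)"
  by (simp add: poly_coeffs_def poly_fun_add)

lemma poly_coeffs_mult: "poly_coeffs n F \<Longrightarrow> poly_coeffs n G \<Longrightarrow> poly_coeffs n (\<lambda>\<rho>. F \<rho> * G \<rho>)"
  unfolding poly_coeffs_def coeff_mult by (intro allI poly_fun_sum poly_fun_mult) auto

lemma poly_coeffs_sum: "(\<And>i. i \<in> I \<Longrightarrow> poly_coeffs n (F i)) \<Longrightarrow> poly_coeffs n (\<lambda>\<rho>. \<Sum>i\<in>I. F i \<rho>)"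
  by (induction I rule: infinite_finite_induct) (auto intro: poly_coeffs_const poly_coeffs_add)

lemma poly_coeffs_prod: "(\<And>i. i \<in> I \<Longrightarrow> poly_coeffs n (F i)) \<Longrightarrow> poly_coeffs n (\<lambda>\<rho>. \<Prod>i\<in>I. F i \<rho>)"
  by (induction I rule: infinite_finite_induct) (auto intro: poly_coeffs_const poly_coeffs_mult)

text \<open>By the Leibniz formula the coefficients are fixed polynomials in the entries. The number
  of its summands is a constant, since \<open>N\<close> is fixed, and no division occurs.\<close>

lemma poly_fun_char_poly:
  assumes M: "\<And>\<rho>. M \<rho> \<in> carrier_mat N N" and entries: "\<And>i j. i < N \<Longrightarrow> j < N \<Longrightarrow> poly_fun n (\<lambda>\<rho>. M \<rho> $$ (i, j))"
  shows "poly_fun n (\<lambda>\<rho>. coeff (char_poly (M \<rho>)) l)"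
proof -
  have entry: "poly_coeffs n (\<lambda>\<rho>. char_poly_matrix (M \<rho>) $$ (i, j))" if ij: "i < N" "j < N" for i j
  proof -
    have eq: "char_poly_matrix (M \<rho>) $$ (i, j) = (if i = j then [:0, 1:] else 0) + [:- (M \<rho> $$ (i, j)):]" for \<rho>
      using M[of \<rho>] ij by (auto simp: char_poly_matrix_def)
    have "poly_coeffs n (\<lambda>\<rho>. [:- (M \<rho> $$ (i, j)):])"
      unfolding poly_coeffs_def
    proof
      fix l
      have "poly_fun n (\<lambda>\<rho>. 0 - M \<rho> $$ (i, j))" by (intro poly_fun_intros entries ij)
      then show "poly_fun n (\<lambda>\<rho>. coeff [:- (M \<rho> $$ (i, j)):] l)"
        by (cases l) (simp_all add: poly_fun_const)
    qed
    then show ?thesis unfolding eq by (intro poly_coeffs_add poly_coeffs_const)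
  qed
  have "dim_row (char_poly_matrix (M \<rho>)) = N" "dim_col (char_poly_matrix (M \<rho>)) = N" for \<rho>
    using char_poly_matrix_closed[OF M[of \<rho>]] by auto
  then have det: "char_poly (M \<rho>) = (\<Sum>p\<in>{p. p permutes {0..<N}}. signof p *
      (\<Prod>i = 0..<N. char_poly_matrix (M \<rho>) $$ (i, p i)))" for \<rho>
    by (simp add: char_poly_def det_def)
  have "poly_coeffs n (\<lambda>\<rho>. char_poly (M \<rho>))"
    unfolding det
  proof (intro poly_coeffs_sum poly_coeffs_mult poly_coeffs_const poly_coeffs_prod)
    fix p i assume "p \<in> {p. p permutes {0..<N}}" "i \<in> {0..<N}"
    then have "i < N" "p i < N" using permutes_in_image[of p "{0..<N}" i] by auto
    then show "poly_coeffs n (\<lambda>\<rho>. char_poly_matrix (M \<rho>) $$ (i, p i))" by (rule entry)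
  qed
  then show ?thesis by (simp add: poly_coeffs_def)
qed

definition form_fun :: "nat \<Rightarrow> ((nat \<Rightarrow> nat) \<Rightarrow> bool) \<Rightarrow> bool" where
  "form_fun n \<Phi> \<longleftrightarrow> (\<exists>p. form_vars p \<le> n \<and> (\<forall>\<rho>. eval_form \<rho> p \<longleftrightarrow> \<Phi> \<rho>))"

lemma form_fun_positive:
  assumes "poly_fun n F"
  shows "form_fun n (\<lambda>\<rho>. 0 < F \<rho>)"
proof -
  obtain P Q where "expr_vars P \<le> n" "expr_vars Q \<le> n" "\<forall>\<rho>. F \<rho> = int (eval_expr \<rho> P) - int (eval_expr \<rho> Q)"
    using assms unfolding poly_fun_def by blast
  then show ?thesis unfolding form_fun_def by (intro exI[of _ "Less Q P"]) auto
qed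

lemma form_fun_negative:
  assumes "poly_fun n F"
  shows "form_fun n (\<lambda>\<rho>. F \<rho> < 0)"
proof -
  have "poly_fun n (\<lambda>\<rho>. 0 - F \<rho>)" by (intro poly_fun_intros assms)
  from form_fun_positive[OF this] show ?thesis by simp
qed

lemma form_fun_conj: "form_fun n \<Phi> \<Longrightarrow> form_fun n \<Psi> \<Longrightarrow> form_fun n (\<lambda>\<rho>. \<Phi> \<rho> \<and> \<Psi> \<rho>)"
  unfolding form_fun_def by (metis eval_form.simps(2) form_vars.simps(2) max.bounded_iff)

lemma form_fun_disj: "form_fun n \<Phi> \<Longrightarrow> form_fun n \<Psi> \<Longrightarrow> form_fun n (\<lambda>\<rho>. \<Phi> \<rho> \<or> \<Psi> \<rho>)"
  unfolding form_fun_def by (metis eval_form.simps(3) form_vars.simps(3) max.bounded_iff)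

lemma form_fun_all:
  fixes k :: nat
  shows "(\<And>l. l \<le> k \<Longrightarrow> form_fun n (\<Phi> l)) \<Longrightarrow> form_fun n (\<lambda>\<rho>. \<forall>l\<le>k. \<Phi> l \<rho>)"
proof (induction k)
  case (Suc k)
  have "form_fun n (\<lambda>\<rho>. (\<forall>l\<le>k. \<Phi> l \<rho>) \<and> \<Phi> (Suc k) \<rho>)" using Suc by (intro form_fun_conj) auto
  moreover have "((\<forall>l\<le>k. \<Phi> l \<rho>) \<and> \<Phi> (Suc k) \<rho>) \<longleftrightarrow> (\<forall>l\<le>Suc k. \<Phi> l \<rho>)" for \<rho>
    by (auto simp: le_Suc_eq)
  ultimately show ?case by simp
qed auto

lemma form_fun_ex:
  fixes k :: nat
  shows "(\<And>l. l \<le> k \<Longrightarrow> form_fun n (\<Phi> l)) \<Longrightarrow> form_fun n (\<lambda>\<rho>. \<exists>l\<le>k. \<Phi> l \<rho>)"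
proof (induction k)
  case (Suc k)
  have "form_fun n (\<lambda>\<rho>. (\<exists>l\<le>k. \<Phi> l \<rho>) \<or> \<Phi> (Suc k) \<rho>)" using Suc by (intro form_fun_disj) auto
  moreover have "((\<exists>l\<le>k. \<Phi> l \<rho>) \<or> \<Phi> (Suc k) \<rho>) \<longleftrightarrow> (\<exists>l\<le>Suc k. \<Phi> l \<rho>)" for \<rho>
    by (auto simp: le_Suc_eq)
  ultimately show ?case by simp
qed auto

text \<open>
  The matrix of a term, multiplied with the product of all denominators, plus the identity; by the
  addition its least eigenvalue becomes at least 1.
\<close>
definition env_mat :: "nat \<Rightarrow> (nat \<Rightarrow> nat) \<Rightarrow> int mat" where
  "env_mat N \<rho> = mat N N (\<lambda>(i, j).
     (int (\<rho> (3 * (i * N + j))) - int (\<rho> (3 * (i * N + j) + 1))) *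
       (\<Prod>e\<in>{..<N * N} - {i * N + j}. int (\<rho> (3 * e + 2))) +
     (if i = j then 1 else 0))"

lemma env_mat_carrier: "env_mat N \<rho> \<in> carrier_mat N N"
  by (simp add: env_mat_def)

lemma index_pair_less: "i < N \<Longrightarrow> j < N \<Longrightarrow> i * N + j < N * (N :: nat)"
proof -
  assume "i < N" "j < N"
  then have "i * N + j < Suc i * N" by simp
  also have "\<dots> \<le> N * N" using \<open>i < N\<close> by (intro mult_le_mono1) simp
  finally show ?thesis .
qed

lemma poly_fun_env_mat:
  assumes "i < N" "j < N"
  shows "poly_fun (3 * (N * N)) (\<lambda>\<rho>. env_mat N \<rho> $$ (i, j))"
proof -
  have "i * N + j < N * N" using assms by (rule index_pair_less)
  then have "poly_fun (3 * (N * N)) (\<lambda>\<rho>. (int (\<rho> (3 * (i * N + j))) - int (\<rho> (3 * (i * N + j) + 1))) *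
       (\<Prod>e\<in>{..<N * N} - {i * N + j}. int (\<rho> (3 * e + 2))) + (if i = j then 1 else 0))"
    by (intro poly_fun_add poly_fun_mult poly_fun_diff poly_fun_prod poly_fun_var poly_fun_const) auto
  then show ?thesis using assms by (simp add: env_mat_def)
qed

lemma poly_fun_entry_bound: "poly_fun (3 * (N * N)) (\<lambda>\<rho>. entry_bound N (env_mat N \<rho>))"
  unfolding entry_bound_def by (intro poly_fun_intros poly_fun_env_mat) auto

lemma poly_fun_scale: "poly_fun (3 * (N * N)) (\<lambda>\<rho>. scale N (env_mat N \<rho>))"
  unfolding scale_def by (intro poly_fun_intros poly_fun_entry_bound)

lemma poly_fun_resolution: "poly_fun (3 * (N * N)) (\<lambda>\<rho>. resolution N (env_mat N \<rho>))"
  unfolding resolution_def by (intro poly_fun_intros poly_fun_entry_bound poly_fun_scale)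

lemma criterion_form:
  "\<exists>p. form_vars p \<le> Suc (3 * (N * N)) \<and>
     (\<forall>\<rho>. eval_form \<rho> p \<longleftrightarrow> criterion N a (env_mat N \<rho>) (int (\<rho> (3 * (N * N)))))"
proof -
  let ?n = "Suc (3 * (N * N))"
  have up: "poly_fun ?n F" if "poly_fun (3 * (N * N)) F" for F using poly_fun_mono[OF that] by simp
  have 1: "poly_fun ?n (\<lambda>\<rho>. coeff (char_poly (shift_mat N (int (\<rho> (3 * (N * N))))
      (resolution N (env_mat N \<rho>)) (scaled_mat N (env_mat N \<rho>)))) l)" for l
  proof (rule poly_fun_char_poly)
    fix i j assume ij: "i < N" "j < N"
    have "poly_fun ?n (\<lambda>\<rho>. (if i = j then int (\<rho> (3 * (N * N))) else 0) -
        resolution N (env_mat N \<rho>) * (scale N (env_mat N \<rho>) * env_mat N \<rho> $$ (i, j)))"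
      by (intro poly_fun_diff poly_fun_mult poly_fun_if poly_fun_var poly_fun_const
          up[OF poly_fun_resolution] up[OF poly_fun_scale] up[OF poly_fun_env_mat] ij) simp
    then show "poly_fun ?n (\<lambda>\<rho>. shift_mat N (int (\<rho> (3 * (N * N))))
      (resolution N (env_mat N \<rho>)) (scaled_mat N (env_mat N \<rho>)) $$ (i, j))"
      using ij by (simp add: shift_mat_def scaled_mat_def)
  qed (simp add: shift_mat_def)
  have 2: "poly_fun ?n (\<lambda>\<rho>. coeff (char_poly (shift_mat N (int (\<rho> (3 * (N * N))))
      (resolution N (env_mat N \<rho>)) (lowered_mat N a (env_mat N \<rho>)))) l)" for l
  proof (rule poly_fun_char_poly)
    fix i j assume ij: "i < N" "j < N"
    have "poly_fun ?n (\<lambda>\<rho>. (if i = j then int (\<rho> (3 * (N * N))) else 0) -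
        resolution N (env_mat N \<rho>) * (scale N (env_mat N \<rho>) * env_mat N \<rho> $$ (i, j) - (if i = a \<and> j = a then 1 else 0)))"
      by (intro poly_fun_diff poly_fun_mult poly_fun_if poly_fun_var poly_fun_const
          up[OF poly_fun_resolution] up[OF poly_fun_scale] up[OF poly_fun_env_mat] ij) simp
    then show "poly_fun ?n (\<lambda>\<rho>. shift_mat N (int (\<rho> (3 * (N * N))))
      (resolution N (env_mat N \<rho>)) (lowered_mat N a (env_mat N \<rho>)) $$ (i, j))"
      using ij by (simp add: shift_mat_def lowered_mat_def)
  qed (simp add: shift_mat_def)
  have "form_fun ?n (\<lambda>\<rho>. criterion N a (env_mat N \<rho>) (int (\<rho> (3 * (N * N)))))"
    unfolding criterion_def
    by (intro form_fun_conj form_fun_all form_fun_ex form_fun_positive form_fun_negative 1 2)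
  then show ?thesis unfolding form_fun_def .
qed

text \<open>Dropping the subtracted part of the polynomial turns the bound on the separating number
  into an expression; the size of that expression then bounds the length of the certified
  number.\<close>

lemma certificate_bound:
  "\<exists>e. expr_vars e \<le> 3 * (N * N) \<and> (\<forall>\<rho>. resolution N (env_mat N \<rho>) * scale N (env_mat N \<rho>) *
     entry_bound N (env_mat N \<rho>) \<le> int (eval_expr \<rho> e))"
proof -
  have "poly_fun (3 * (N * N)) (\<lambda>\<rho>. resolution N (env_mat N \<rho>) * scale N (env_mat N \<rho>) *
     entry_bound N (env_mat N \<rho>))"
    by (intro poly_fun_mult poly_fun_resolution poly_fun_scale poly_fun_entry_bound)
  then obtain P Q where "expr_vars P \<le> 3 * (N * N)"
    "\<forall>\<rho>. resolution N (env_mat N \<rho>) * scale N (env_mat N \<rho>) * entry_bound N (env_mat N \<rho>) =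
      int (eval_expr \<rho> P) - int (eval_expr \<rho> Q)"
    unfolding poly_fun_def by blast
  then show ?thesis by (intro exI[of _ P]) simp
qed


section \<open>From local terms to operators on all qudits\<close>

section \<open>Digits\<close>

definition from_digits :: "nat \<Rightarrow> nat \<Rightarrow> (nat \<Rightarrow> nat) \<Rightarrow> nat" where
  "from_digits d n c = (\<Sum>j<n. c j * d ^ j)"

lemma from_digits_less:
  assumes "\<And>j. j < n \<Longrightarrow> c j < d"
  shows "from_digits d n c < d ^ n"
  using assms
proof (induction n)
  case (Suc n)
  then have "from_digits d n c < d ^ n" "c n < d" by auto
  then have "from_digits d n c + c n * d ^ n < d ^ n + c n * d ^ n" by simp
  also have "\<dots> = Suc (c n) * d ^ n" by simp
  also have "\<dots> \<le> d * d ^ n" using \<open>c n < d\<close> by (intro mult_le_mono1) simp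
  finally show ?case by (simp add: from_digits_def)
qed (simp add: from_digits_def)

lemma digit_from_digits:
  assumes "\<And>j. j < n \<Longrightarrow> c j < d" "j < n"
  shows "digit d (from_digits d n c) j = c j"
  using assms
proof (induction n)
  case (Suc n)
  have d: "0 < d" using Suc.prems(1)[of 0] by simp
  have lt: "from_digits d n c < d ^ n" using Suc.prems by (intro from_digits_less) auto
  have eq: "from_digits d (Suc n) c = from_digits d n c + c n * d ^ n" by (simp add: from_digits_def)
  show ?case
  proof (cases "j = n")
    case True
    have "(from_digits d n c + c n * d ^ n) div d ^ n = c n" using lt d by simp
    then show ?thesis using Suc.prems(1)[of n] unfolding digit_def eq True by simp
  next
    case False
    then have j: "j < n" using Suc.prems(2) by simp
    have "d ^ n = d ^ j * (d * d ^ (n - Suc j))"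
      using j by (metis Suc_diff_Suc power_Suc power_add le_add_diff_inverse less_imp_le)
    then have "from_digits d (Suc n) c = from_digits d n c + d ^ j * (d * (c n * d ^ (n - Suc j)))"
      unfolding eq by simp
    then have "from_digits d (Suc n) c div d ^ j = from_digits d n c div d ^ j + d * (c n * d ^ (n - Suc j))"
      using d by simp
    then have "digit d (from_digits d (Suc n) c) j = digit d (from_digits d n c) j"
      unfolding digit_def by simp
    with Suc.IH[OF _ j] Suc.prems show ?thesis by simp
  qed
qed simp

lemma from_digits_digit:
  assumes "x < d ^ n"
  shows "from_digits d n (digit d x) = x"
proof -
  have "from_digits d n (digit d x) = x mod d ^ n"
  proof (induction n)
    case (Suc n)
    then show ?case
      by (simp add: from_digits_def digit_def mod_mult2_eq mult.commute[of d])
  qed (simp add: from_digits_def)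
  with assms show ?thesis by simp
qed

lemma from_digits_cong: "(\<And>j. j < n \<Longrightarrow> c j = c' j) \<Longrightarrow> from_digits d n c = from_digits d n c'"
  by (simp add: from_digits_def)

lemma digits_eqI:
  assumes "x < d ^ n" "y < d ^ n" "\<And>j. j < n \<Longrightarrow> digit d x j = digit d y j"
  shows "x = y"
  using from_digits_cong[of n "digit d x" "digit d y" d] assms from_digits_digit by metis

lemma restrict_index_from_digits: "restrict_index d S x = from_digits d (length S) (\<lambda>t. digit d x (S ! t))"
  by (simp add: restrict_index_def from_digits_def)

text \<open>The string that agrees with \<open>a\<close> on the positions \<open>S\<close> and with \<open>x\<close> elsewhere.\<close>
definition put_index :: "nat \<Rightarrow> nat \<Rightarrow> nat list \<Rightarrow> nat \<Rightarrow> nat \<Rightarrow> nat" where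
  "put_index d n S x a = from_digits d n (\<lambda>j. if j \<in> set S
     then digit d a (SOME t. t < length S \<and> S ! t = j) else digit d x j)"

context
  fixes d n :: nat and S :: "nat list"
  assumes d: "1 \<le> d" and S: "distinct S" "set S \<subseteq> {..<n}"
begin

lemma digit_less: "digit d x j < d"
  using d by (simp add: digit_def)

lemma put_index_less: "put_index d n S x a < d ^ n"
  unfolding put_index_def by (rule from_digits_less) (simp add: digit_less)

lemma digit_put_index:
  assumes "j < n"
  shows "digit d (put_index d n S x a) j =
    (if j \<in> set S then digit d a (SOME t. t < length S \<and> S ! t = j) else digit d x j)"
  unfolding put_index_def by (rule digit_from_digits[OF _ assms]) (simp add: digit_less)

lemma digit_put_index_in:
  assumes "t < length S"
  shows "digit d (put_index d n S x a) (S ! t) = digit d a t"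
proof -
  have "(SOME s. s < length S \<and> S ! s = S ! t) = t"
    by (rule some_equality) (use assms S(1) nth_eq_iff_index_eq in auto)
  moreover have "S ! t \<in> set S" "S ! t < n" using assms S(2) nth_mem by auto
  ultimately show ?thesis by (simp add: digit_put_index)
qed

lemma digit_put_index_out: "j < n \<Longrightarrow> j \<notin> set S \<Longrightarrow> digit d (put_index d n S x a) j = digit d x j"
  by (simp add: digit_put_index)

lemma restrict_index_less: "restrict_index d S x < d ^ length S"
  unfolding restrict_index_from_digits by (rule from_digits_less) (rule digit_less)

lemma digit_restrict_index: "t < length S \<Longrightarrow> digit d (restrict_index d S x) t = digit d x (S ! t)"
  unfolding restrict_index_from_digits by (rule digit_from_digits) (rule digit_less)

lemma restrict_put_index:
  assumes "a < d ^ length S"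
  shows "restrict_index d S (put_index d n S x a) = a"
  by (rule digits_eqI[OF restrict_index_less assms]) (simp add: digit_restrict_index digit_put_index_in)

lemma put_restrict_index:
  assumes "y < d ^ n" "\<forall>j<n. j \<notin> set S \<longrightarrow> digit d x j = digit d y j"
  shows "put_index d n S x (restrict_index d S y) = y"
proof (rule digits_eqI[OF put_index_less assms(1)])
  fix j assume j: "j < n"
  show "digit d (put_index d n S x (restrict_index d S y)) j = digit d y j"
  proof (cases "j \<in> set S")
    case True
    then obtain t where "t < length S" "S ! t = j" by (auto simp: in_set_conv_nth)
    then show ?thesis using digit_put_index_in[of t] digit_restrict_index[of t y] by simp
  next
    case False
    then show ?thesis using assms(2) j by (simp add: digit_put_index_out)
  qed
qed

lemma put_put_index: "put_index d n S (put_index d n S x a) b = put_index d n S x b"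
proof (rule digits_eqI[OF put_index_less put_index_less])
  fix j assume "j < n"
  then show "digit d (put_index d n S (put_index d n S x a) b) j = digit d (put_index d n S x b) j"
    by (simp add: digit_put_index)
qed

end

section \<open>Local and global ground vectors\<close>

lemma local_matrix_carrier: "local_matrix d T \<in> carrier_mat (local_dim d T) (local_dim d T)"
  by (simp add: local_matrix_def)

lemma global_matrix_carrier: "global_matrix d n T \<in> carrier_mat (d ^ n) (d ^ n)"
  by (simp add: global_matrix_def)

lemma min_eigen_exists:
  assumes "hermitian n A" "0 < n"
  shows "\<exists>m. min_eigen n A m"
proof -
  have A: "A \<in> carrier_mat n n" using assms(1) by (simp add: hermitian_def)
  have fin: "finite (Re ` spectrum A)" using card_finite_spectrum[OF A] by simp
  have ne: "Re ` spectrum A \<noteq> {}" using spectrum_non_empty[OF A] assms(2) by simp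
  obtain e where e: "e \<in> spectrum A" "Min (Re ` spectrum A) = Re e" using Min_in[OF fin ne] by auto
  have "e \<in> \<real>" using hermitian_eigenvalue_real[OF assms(1)] e(1) by (simp add: spectrum_def)
  then have "complex_of_real (Re e) = e" by simp
  moreover have "Re e \<le> Re f" if "eigenvalue A f" for f
    using Min_le[OF fin, of "Re f"] that e(2) by (simp add: spectrum_def)
  ultimately show ?thesis using e(1) unfolding min_eigen_def spectrum_def
    by (intro exI[of _ "Re e"]) simp
qed

lemma ground_energy_eq:
  assumes A: "A \<in> carrier_mat n n" and m: "min_eigen n A m"
  shows "ground_energy A = m"
  unfolding ground_energy_def
proof (rule Min_eqI)
  show "finite (Re ` spectrum A)" using card_finite_spectrum[OF A] by simp
  show "m \<le> y" if "y \<in> Re ` spectrum A" for y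
    using that m by (auto simp: min_eigen_def spectrum_def)
  have "m = Re (complex_of_real m)" by simp
  moreover have "complex_of_real m \<in> spectrum A" using m by (simp add: min_eigen_def spectrum_def)
  ultimately show "m \<in> Re ` spectrum A" by (rule image_eqI)
qed

lemma groundspace_iff:
  assumes A: "A \<in> carrier_mat n n" and m: "min_eigen n A m" and v: "v \<in> carrier_vec n"
  shows "v \<in> groundspace A \<longleftrightarrow> eigen n A (\<lambda>x. v $ x) (of_real m)"
proof -
  have "A *\<^sub>v v = complex_of_real m \<cdot>\<^sub>v v \<longleftrightarrow> (\<forall>x<n. (A *\<^sub>v v) $ x = (complex_of_real m \<cdot>\<^sub>v v) $ x)"
    using A v by (auto simp: vec_eq_iff simp del: index_mult_mat_vec)
  also have "\<dots> \<longleftrightarrow> eigen n A (\<lambda>x. v $ x) (of_real m)"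
    using v unfolding eigen_def apply_mat_def by (auto simp: mult_mat_vec_index[OF A v] simp del: index_mult_mat_vec)
  finally show ?thesis using A v by (simp add: groundspace_def ground_energy_eq[OF A m])
qed

definition agree_off :: "nat \<Rightarrow> nat \<Rightarrow> nat list \<Rightarrow> nat \<Rightarrow> nat \<Rightarrow> bool" where
  "agree_off d n S x y \<longleftrightarrow> (\<forall>j<n. j \<notin> set S \<longrightarrow> digit d x j = digit d y j)"

lemma global_matrix_entry:
  assumes "x < d ^ n" "y < d ^ n"
  shows "global_matrix d n T $$ (x, y) = (if agree_off d n (acts_on T) x y
    then local_matrix d T $$ (restrict_index d (acts_on T) x, restrict_index d (acts_on T) y) else 0)"
  using assms by (simp only: global_matrix_def agree_off_def index_mat prod.case)

context
  fixes d n :: nat and T :: local_term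
  assumes d: "1 \<le> d" and S: "distinct (acts_on T)" "set (acts_on T) \<subseteq> {..<n}"
begin

private abbreviation "SS \<equiv> acts_on T"
private abbreviation "agree \<equiv> agree_off d n (acts_on T)"
private abbreviation "rs \<equiv> restrict_index d (acts_on T)"
private abbreviation "put \<equiv> put_index d n (acts_on T)"

private lemma agree_put: "agree x (put x a)"
  unfolding agree_off_def using digit_put_index_out[OF d S] by simp

private lemma agree_trans: "agree y z \<Longrightarrow> agree x y \<longleftrightarrow> agree x z"
  by (simp add: agree_off_def)

private lemma put_rs: "y < d ^ n \<Longrightarrow> agree x y \<Longrightarrow> put x (rs y) = y"
  using put_restrict_index[OF d S] by (simp add: agree_off_def)

text \<open>In row \<open>x\<close> only the columns that agree with \<open>x\<close> off the term
  can be non-zero; they are the strings \<open>put x a\<close>, one for each local string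
  \<open>a\<close>.\<close>

lemma apply_global_matrix:
  assumes x: "x < d ^ n"
  shows "apply_mat (d ^ n) (global_matrix d n T) \<psi> x =
    (\<Sum>a<local_dim d T. local_matrix d T $$ (rs x, a) * \<psi> (put x a))"
proof -
  have "apply_mat (d ^ n) (global_matrix d n T) \<psi> x =
      (\<Sum>y<d ^ n. if agree x y then local_matrix d T $$ (rs x, rs y) * \<psi> y else 0)"
    unfolding apply_mat_def using x by (intro sum.cong refl) (simp add: global_matrix_entry)
  also have "\<dots> = (\<Sum>y\<in>{y \<in> {..<d ^ n}. agree x y}. local_matrix d T $$ (rs x, rs y) * \<psi> y)"
    by (rule sum.inter_filter[symmetric]) simp
  also have "\<dots> = (\<Sum>a<local_dim d T. local_matrix d T $$ (rs x, a) * \<psi> (put x a))"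
  proof (rule sum.reindex_bij_witness[of _ "put x" rs])
    fix a assume "a \<in> {..<local_dim d T}"
    then have a: "a < d ^ length SS" by (simp add: local_dim_def)
    show "rs (put x a) = a" by (rule restrict_put_index[OF d S a])
    show "put x a \<in> {y \<in> {..<d ^ n}. agree x y}"
      using put_index_less[OF d S] agree_put by simp
  next
    fix y assume "y \<in> {y \<in> {..<d ^ n}. agree x y}"
    then have y: "y < d ^ n" "agree x y" by simp_all
    show put: "put x (rs y) = y" by (rule put_rs[OF y])
    show "rs y \<in> {..<local_dim d T}"
      using restrict_index_less[OF d S] by (simp add: local_dim_def)
    show "local_matrix d T $$ (rs x, rs y) * \<psi> (put x (rs y)) = local_matrix d T $$ (rs x, rs y) * \<psi> y"
      by (simp only: put)
  qed
  finally show ?thesis .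
qed

text \<open>The tensor product of \<open>\<phi>\<close> with the basis state given by
  \<open>x0\<close> on the other qudits.\<close>

lemma eigen_local_to_global:
  assumes "eigen (local_dim d T) (local_matrix d T) \<phi> e"
  shows "eigen (d ^ n) (global_matrix d n T) (\<lambda>y. if agree x0 y then \<phi> (rs y) else 0) e"
  unfolding eigen_def
proof (intro allI impI)
  fix x assume x: "x < d ^ n"
  have ag: "agree x0 (put x a) \<longleftrightarrow> agree x0 x" for a
    using agree_trans[OF agree_put] by blast
  have "apply_mat (d ^ n) (global_matrix d n T) (\<lambda>y. if agree x0 y then \<phi> (rs y) else 0) x =
      (\<Sum>a<local_dim d T. local_matrix d T $$ (rs x, a) * (if agree x0 x then \<phi> a else 0))"
    unfolding apply_global_matrix[OF x] ag
    by (intro sum.cong refl) (simp add: restrict_put_index[OF d S] local_dim_def)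
  also have "\<dots> = (if agree x0 x then apply_mat (local_dim d T) (local_matrix d T) \<phi> (rs x) else 0)"
    by (cases "agree x0 x") (simp_all only: if_True if_False mult_zero_right sum.neutral_const apply_mat_def)
  also have "\<dots> = e * (if agree x0 x then \<phi> (rs x) else 0)"
    using assms restrict_index_less[OF d S, of x] by (simp add: eigen_def local_dim_def)
  finally show "apply_mat (d ^ n) (global_matrix d n T) (\<lambda>y. if agree x0 y then \<phi> (rs y) else 0) x =
      e * (if agree x0 x then \<phi> (rs x) else 0)" .
qed

text \<open>The slice of \<open>\<psi>\<close> through \<open>x0\<close> along the qudits of the
  term.\<close>

lemma eigen_global_to_local:
  assumes "eigen (d ^ n) (global_matrix d n T) \<psi> e"
  shows "eigen (local_dim d T) (local_matrix d T) (\<lambda>a. \<psi> (put x0 a)) e"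
  unfolding eigen_def
proof (intro allI impI)
  fix a assume "a < local_dim d T"
  then have a: "a < d ^ length SS" by (simp add: local_dim_def)
  have "apply_mat (d ^ n) (global_matrix d n T) \<psi> (put x0 a) =
     apply_mat (local_dim d T) (local_matrix d T) (\<lambda>a. \<psi> (put x0 a)) a"
    unfolding apply_global_matrix[OF put_index_less[OF d S]] apply_mat_def[of _ "local_matrix d T"]
    by (intro sum.cong refl) (simp add:  restrict_put_index[OF d S a] put_put_index[OF d S])
  then show "apply_mat (local_dim d T) (local_matrix d T) (\<lambda>a. \<psi> (put x0 a)) a = e * \<psi> (put x0 a)"
    using assms put_index_less[OF d S] by (simp add: eigen_def)
qed

text \<open>This makes the condition on a string local: whether some eigenvector is non-zero at
  \<open>x0\<close> depends only on the restriction of \<open>x0\<close> to the qudits of the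
  term.\<close>

lemma eigen_global_iff_local:
  assumes x0: "x0 < d ^ n"
  shows "(\<exists>\<psi>. eigen (d ^ n) (global_matrix d n T) \<psi> e \<and> \<psi> x0 \<noteq> 0) \<longleftrightarrow>
    (\<exists>\<phi>. eigen (local_dim d T) (local_matrix d T) \<phi> e \<and> \<phi> (rs x0) \<noteq> 0)"
proof
  assume "\<exists>\<psi>. eigen (d ^ n) (global_matrix d n T) \<psi> e \<and> \<psi> x0 \<noteq> 0"
  then obtain \<psi> where \<psi>: "eigen (d ^ n) (global_matrix d n T) \<psi> e" "\<psi> x0 \<noteq> 0" by blast
  have "put x0 (rs x0) = x0" by (rule put_rs[OF x0]) (simp add: agree_off_def)
  with eigen_global_to_local[OF \<psi>(1), of x0] \<psi>(2)
  show "\<exists>\<phi>. eigen (local_dim d T) (local_matrix d T) \<phi> e \<and> \<phi> (rs x0) \<noteq> 0"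
    by (intro exI[of _ "\<lambda>a. \<psi> (put x0 a)"]) simp
next
  assume "\<exists>\<phi>. eigen (local_dim d T) (local_matrix d T) \<phi> e \<and> \<phi> (rs x0) \<noteq> 0"
  then obtain \<phi> where \<phi>: "eigen (local_dim d T) (local_matrix d T) \<phi> e" "\<phi> (rs x0) \<noteq> 0" by blast
  from eigen_local_to_global[OF \<phi>(1), of x0] \<phi>(2)
  show "\<exists>\<psi>. eigen (d ^ n) (global_matrix d n T) \<psi> e \<and> \<psi> x0 \<noteq> 0"
    by (intro exI[of _ "\<lambda>y. if agree x0 y then \<phi> (rs y) else 0"]) (simp add: agree_off_def)
qed

lemma eigenvalue_global_iff_local:
  "eigenvalue (global_matrix d n T) e \<longleftrightarrow> eigenvalue (local_matrix d T) e"
proof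
  assume "eigenvalue (global_matrix d n T) e"
  then obtain \<psi> x where "eigen (d ^ n) (global_matrix d n T) \<psi> e" "x < d ^ n" "\<psi> x \<noteq> 0"
    using eigenvalue_eigen[OF global_matrix_carrier] by blast
  then obtain \<phi> where "eigen (local_dim d T) (local_matrix d T) \<phi> e" "\<phi> (rs x) \<noteq> 0"
    using eigen_global_iff_local by blast
  moreover have "rs x < local_dim d T"
    using restrict_index_less[OF d S] by (simp add: local_dim_def)
  ultimately show "eigenvalue (local_matrix d T) e"
    using eigenvalue_eigen[OF local_matrix_carrier] by blast
next
  assume "eigenvalue (local_matrix d T) e"
  then obtain \<phi> a where \<phi>: "eigen (local_dim d T) (local_matrix d T) \<phi> e" "a < local_dim d T" "\<phi> a \<noteq> 0"
    using eigenvalue_eigen[OF local_matrix_carrier] by blast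
  have x: "put 0 a < d ^ n" by (rule put_index_less[OF d S])
  have "rs (put 0 a) = a" using \<phi>(2) by (intro restrict_put_index[OF d S]) (simp add: local_dim_def)
  then obtain \<psi> where "eigen (d ^ n) (global_matrix d n T) \<psi> e" "\<psi> (put 0 a) \<noteq> 0"
    using eigen_global_iff_local[OF x] \<phi> by metis
  then show "eigenvalue (global_matrix d n T) e"
    using eigenvalue_eigen[OF global_matrix_carrier] x by blast
qed

lemma min_eigen_global:
  assumes "min_eigen (local_dim d T) (local_matrix d T) m"
  shows "min_eigen (d ^ n) (global_matrix d n T) m"
  using assms unfolding min_eigen_def eigenvalue_global_iff_local .

lemma hermitian_global:
  assumes "hermitian (local_dim d T) (local_matrix d T)"
  shows "hermitian (d ^ n) (global_matrix d n T)"
  unfolding hermitian_def[of "d ^ n"]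
proof (intro conjI allI impI global_matrix_carrier)
  fix x y assume xy: "x < d ^ n" "y < d ^ n"
  have "cnj (local_matrix d T $$ (rs y, rs x)) = local_matrix d T $$ (rs x, rs y)"
    using hermitianD[OF assms] restrict_index_less[OF d S] by (simp add: local_dim_def)
  moreover have "agree x y \<longleftrightarrow> agree y x" by (auto simp: agree_off_def)
  ultimately show "global_matrix d n T $$ (x, y) = cnj (global_matrix d n T $$ (y, x))"
    using xy by (simp add: global_matrix_entry)
qed

lemma stoquastic_global:
  assumes "stoquastic_mat (local_matrix d T)" "x < d ^ n" "y < d ^ n" "x \<noteq> y"
  shows "global_matrix d n T $$ (x, y) \<le> 0"
proof (cases "agree x y")
  case True
  \<comment> \<open>Different strings that agree off the term must differ on it, so an off-diagonal
    entry comes from an off-diagonal entry.\<close>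
  have "rs x \<noteq> rs y"
  proof
    assume "rs x = rs y"
    moreover have "put x (rs y) = y" by (rule put_rs[OF assms(3) True])
    moreover have "put x (rs x) = x" by (rule put_rs[OF assms(2)]) (simp add: agree_off_def)
    ultimately show False using assms(4) by simp
  qed
  moreover have "rs x < local_dim d T" "rs y < local_dim d T"
    using restrict_index_less[OF d S] by (simp_all add: local_dim_def)
  ultimately have "local_matrix d T $$ (rs x, rs y) \<le> 0"
    using assms(1) carrier_matD[OF local_matrix_carrier[of d T]] unfolding stoquastic_mat_def by simp
  then show ?thesis using True assms(2,3) by (simp add: global_matrix_entry)
next
  case False
  then have "global_matrix d n T $$ (x, y) = 0" using assms(2,3) by (simp add: global_matrix_entry)
  then show ?thesis by simp
qed

end

definition ground_at :: "nat \<Rightarrow> local_term \<Rightarrow> nat \<Rightarrow> bool" where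
  "ground_at d T a \<longleftrightarrow> (\<exists>m \<phi>. min_eigen (local_dim d T) (local_matrix d T) m \<and>
     eigen (local_dim d T) (local_matrix d T) \<phi> (of_real m) \<and> \<phi> a \<noteq> 0)"

lemma valid_term_hermitian:
  assumes "valid_term d k n T"
  shows "hermitian (local_dim d T) (local_matrix d T)"
  using assms hermitian_mat_iff[OF local_matrix_carrier]
  by (simp add: valid_term_def positive_semidefinite_def)

lemma min_eigen_unique: "min_eigen n A m \<Longrightarrow> min_eigen n A m' \<Longrightarrow> m = m'"
  unfolding min_eigen_def by (metis Re_complex_of_real order_antisym)

text \<open>Any string in the support of a common ground state serves for one direction. Conversely,
  \<open>common_ground_state\<close> replaces the local ground vectors, which need not be related to
  each other, by one vector that is non-zero at \<open>x\<close>.\<close>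

theorem frustration_free_iff:
  assumes d: "1 \<le> d" and H: "\<And>T. T \<in> set (local_terms H) \<Longrightarrow> valid_term d k (num_qudits H) T"
    and comm: "commuting d H" and stoq: "stoquastic d H"
  shows "frustration_free d H \<longleftrightarrow>
    (\<exists>x < d ^ num_qudits H. \<forall>T \<in> set (local_terms H). ground_at d T (restrict_index d (acts_on T) x))"
proof -
  let ?n = "num_qudits H"
  let ?M = "d ^ ?n"
  let ?G = "\<lambda>T. global_matrix d ?n T"
  have S: "distinct (acts_on T)" "set (acts_on T) \<subseteq> {..<?n}" if "T \<in> set (local_terms H)" for T
    using H[OF that] by (simp_all add: valid_term_def)
  have herm: "hermitian ?M (?G T)" if "T \<in> set (local_terms H)" for T
    by (rule hermitian_global[OF d S[OF that] valid_term_hermitian[OF H[OF that]]])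
  have pos: "0 < local_dim d T" for T using d by (simp add: local_dim_def)
  have "\<exists>m. min_eigen (local_dim d T) (local_matrix d T) m" if "T \<in> set (local_terms H)" for T
    by (rule min_eigen_exists[OF valid_term_hermitian[OF H[OF that]] pos])
  then obtain m where m: "min_eigen (local_dim d T) (local_matrix d T) (m T)" if "T \<in> set (local_terms H)" for T
    by metis
  have mG: "min_eigen ?M (?G T) (m T)" if "T \<in> set (local_terms H)" for T
    by (rule min_eigen_global[OF d S[OF that] m[OF that]])
  have good: "ground_at d T (restrict_index d (acts_on T) x) \<longleftrightarrow>
      (\<exists>\<psi>. eigen ?M (?G T) \<psi> (of_real (m T)) \<and> \<psi> x \<noteq> 0)"
    if T: "T \<in> set (local_terms H)" and x: "x < ?M" for T x
    unfolding eigen_global_iff_local[OF d S[OF T] x] ground_at_def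
    using m[OF T] min_eigen_unique by metis
  show ?thesis
  proof
    assume "frustration_free d H"
    then obtain \<psi> where \<psi>: "\<psi> \<in> carrier_vec ?M" "\<psi> \<bullet>c \<psi> = 1"
      "\<And>T. T \<in> set (local_terms H) \<Longrightarrow> \<psi> \<in> groundspace (?G T)" unfolding frustration_free_def by blast
    have "\<psi> \<noteq> 0\<^sub>v ?M" using \<psi>(1,2) conjugate_square_eq_0_vec[OF \<psi>(1)] by auto
    then obtain x where x: "x < ?M" "\<psi> $ x \<noteq> 0" using \<psi>(1) by (auto simp: vec_eq_iff)
    have "ground_at d T (restrict_index d (acts_on T) x)" if T: "T \<in> set (local_terms H)" for T
      unfolding good[OF T x(1)]
      using groundspace_iff[OF global_matrix_carrier mG[OF T] \<psi>(1)] \<psi>(3)[OF T] x(2)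
      by (intro exI[of _ "\<lambda>x. \<psi> $ x"]) simp
    with x(1) show "\<exists>x < ?M. \<forall>T \<in> set (local_terms H). ground_at d T (restrict_index d (acts_on T) x)"
      by blast
  next
    assume "\<exists>x < ?M. \<forall>T \<in> set (local_terms H). ground_at d T (restrict_index d (acts_on T) x)"
    then obtain x where x: "x < ?M"
      "\<And>T. T \<in> set (local_terms H) \<Longrightarrow> \<exists>\<psi>. eigen ?M (?G T) \<psi> (of_real (m T)) \<and> \<psi> x \<noteq> 0"
      using good by blast
    \<comment> \<open>\<open>common_ground_state\<close> takes the eigenvalue as a function of the
      matrix, whereas \<open>m\<close> is a function of the term; \<open>ground_energy\<close>
      translates between them.\<close>
    have ge: "ground_energy (?G T) = m T" if "T \<in> set (local_terms H)" for T
      by (rule ground_energy_eq[OF global_matrix_carrier mG[OF that]])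
    have "\<exists>v. v x \<noteq> 0 \<and> (\<forall>A \<in> set (map ?G (local_terms H)). eigen ?M A v (of_real (ground_energy A)))"
    proof (rule common_ground_state)
      show "x < ?M" by (rule x(1))
      fix A assume "A \<in> set (map ?G (local_terms H))"
      then obtain T where T: "T \<in> set (local_terms H)" "A = ?G T" by auto
      show "hermitian ?M A \<and> min_eigen ?M A (ground_energy A)"
        using herm mG ge T by simp
      show "\<exists>v. eigen ?M A v (of_real (ground_energy A)) \<and> v x \<noteq> 0" using x(2) ge T by simp
      show "A $$ (y, z) \<le> 0" if "y < ?M" "z < ?M" "y \<noteq> z" for y z
        using stoquastic_global[OF d S[OF T(1)] _ that] stoq T by (simp add: stoquastic_def)
      show "A * B = B * A" if "B \<in> set (map ?G (local_terms H))" for B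
        using comm that T by (auto simp: commuting_def)
    qed
    then obtain v where v: "v x \<noteq> 0" "\<And>T. T \<in> set (local_terms H) \<Longrightarrow> eigen ?M (?G T) v (of_real (m T))"
      using ge by auto
    define s where "s = (\<Sum>x<?M. (cmod (v x))\<^sup>2)"
    have s: "0 < s" unfolding s_def by (rule inprod_self_pos) (use v(1) x(1) in blast)
    define w where "w = (\<lambda>x. of_real (1 / sqrt s) * v x)"
    define \<psi> where "\<psi> = vec ?M w"
    have \<psi>: "\<psi> \<in> carrier_vec ?M" by (simp add: \<psi>_def)
    have "\<psi> \<bullet>c \<psi> = inprod ?M w w"
      by (simp add: \<psi>_def inprod_def scalar_prod_def lessThan_atLeast0)
    also have "\<dots> = of_real (1 / sqrt s) * (of_real (1 / sqrt s) * of_real s)"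
      unfolding w_def inprod_smult_left inprod_smult_right inprod_self s_def[symmetric] by simp
    also have "\<dots> = 1" using s by (simp add: field_simps flip: of_real_mult)
    finally have "\<psi> \<bullet>c \<psi> = 1" .
    moreover have "\<psi> \<in> groundspace (?G T)" if T: "T \<in> set (local_terms H)" for T
      unfolding groundspace_iff[OF global_matrix_carrier mG[OF T] \<psi>] eigen_def
    proof (intro allI impI)
      fix y assume y: "y < ?M"
      have "apply_mat ?M (?G T) (\<lambda>x. \<psi> $ x) y = apply_mat ?M (?G T) w y"
        by (intro apply_mat_cong) (simp add: \<psi>_def)
      also have "\<dots> = of_real (m T) * w y"
        using v(2)[OF T] y unfolding w_def apply_mat_smult eigen_def by simp
      finally show "apply_mat ?M (?G T) (\<lambda>x. \<psi> $ x) y = of_real (m T) * \<psi> $ y"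
        using y by (simp add: \<psi>_def)
    qed
    ultimately show "frustration_free d H" using \<psi> unfolding frustration_free_def by blast
  qed
qed


section \<open>The criterion for a term\<close>

lemma entry_fields_num:
  assumes "quotient_of (fst z) = (p, q)"
  shows "num (fst (entry_fields z)) = nat p" "num (fst (snd (entry_fields z))) = nat (- p)"
    "num (snd (snd (entry_fields z))) = nat q"
  using assms by (simp_all add: entry_fields_def num_nat_field)

lemma term_env_entry:
  assumes e: "e < length es" and pq: "quotient_of (fst (es ! e)) = (p, q)"
  shows "term_env es \<alpha> (3 * e) = nat p" "term_env es \<alpha> (3 * e + 1) = nat (- p)"
    "term_env es \<alpha> (3 * e + 2) = nat q"
proof -
  have "(3 * e + 1) div 3 = e" "(3 * e + 1) mod 3 = 1" "(3 * e + 2) div 3 = e" "(3 * e + 2) mod 3 = 2"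
    by presburger+
  then have "entry_var es (3 * e) = fst (entry_fields (es ! e))"
    "entry_var es (3 * e + 1) = fst (snd (entry_fields (es ! e)))"
    "entry_var es (3 * e + 2) = snd (snd (entry_fields (es ! e)))"
    unfolding entry_var_def by (simp_all split: prod.splits)
  then show "term_env es \<alpha> (3 * e) = nat p" "term_env es \<alpha> (3 * e + 1) = nat (- p)"
    "term_env es \<alpha> (3 * e + 2) = nat q"
    using e entry_fields_num[OF pq] by (simp_all add: term_env_def)
qed

context
  fixes d k n :: nat and T :: local_term
  assumes d: "1 \<le> d" and T: "valid_term d k n T" and stoq: "stoquastic_mat (local_matrix d T)"
begin

private abbreviation "N \<equiv> local_dim d T"
private abbreviation "h \<equiv> local_matrix d T"
private abbreviation "es \<equiv> entries T"

private lemma len: "length es = N * N"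
  using T by (simp add: valid_term_def)

private definition den :: "nat \<Rightarrow> int" where
  "den e = snd (quotient_of (fst (es ! e)))"

private definition D :: real where
  "D = (\<Prod>e<N * N. of_int (den e))"

private lemma den_pos: "0 < den e"
  using quotient_of_denom_pos'[of "fst (es ! e)"] by (simp add: den_def)

private lemma D_pos: "0 < D"
  unfolding D_def using den_pos by (intro prod_pos) simp

text \<open>Off the diagonal the order on the complex numbers makes stoquastic entries real; on the
  diagonal hermiticity does.\<close>

private lemma h_entry:
  assumes "i < N" "j < N"
  shows "h $$ (i, j) = of_real (of_rat (fst (es ! (i * N + j))))"
proof -
  obtain re im where z: "es ! (i * N + j) = (re, im)" by fastforce
  have h: "h $$ (i, j) = Complex (of_rat re) (of_rat im)" using assms z by (simp add: local_matrix_def)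
  have "Im (h $$ (i, j)) = 0"
  proof (cases "i = j")
    case True
    then show ?thesis using hermitianD[OF valid_term_hermitian[OF T] assms]
      by (metis Reals_cnj_iff complex_is_Real_iff)
  next
    case False
    then have "h $$ (i, j) \<le> 0"
      using stoq assms carrier_matD[OF local_matrix_carrier[of d T]] unfolding stoquastic_mat_def by simp
    then show ?thesis by (simp add: less_eq_complex_def)
  qed
  then show ?thesis using h z by (simp add: complex_eq_iff)
qed

text \<open>Multiplying a numerator with the denominators of all other entries amounts to
  multiplying the fraction with \<open>D\<close>, so the same factor appears at every entry.\<close>

private lemma env_mat_entry:
  assumes ij: "i < N" "j < N"
  shows "complex_of_int (env_mat N (term_env es \<alpha>) $$ (i, j)) = of_real D * h $$ (i, j) + (if i = j then 1 else 0)"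
proof -
  let ?e = "i * N + j"
  have e: "?e < N * N" by (rule index_pair_less[OF ij])
  obtain p q where pq: "quotient_of (fst (es ! ?e)) = (p, q)" by fastforce
  have q: "den ?e = q" using pq by (simp add: den_def)
  have "int (term_env es \<alpha> (3 * e + 2)) = den e" if "e < N * N" for e
    using term_env_entry(3)[of e es] that len den_pos[of e] by (cases "quotient_of (fst (es ! e))") (simp add: den_def)
  then have prod: "(\<Prod>e\<in>{..<N * N} - {?e}. int (term_env es \<alpha> (3 * e + 2))) = (\<Prod>e\<in>{..<N * N} - {?e}. den e)"
    by (intro prod.cong) auto
  have "int (term_env es \<alpha> (3 * ?e)) - int (term_env es \<alpha> (3 * ?e + 1)) = p"
    using term_env_entry(1,2)[OF _ pq] e len by (simp add: nat_0_le split: if_splits)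
  then have A: "env_mat N (term_env es \<alpha>) $$ (i, j) =
      p * (\<Prod>e\<in>{..<N * N} - {?e}. den e) + (if i = j then 1 else 0)"
    using ij prod by (simp add: env_mat_def)
  have "D = of_int q * of_int (\<Prod>e\<in>{..<N * N} - {?e}. den e)"
    unfolding D_def using e q by (subst prod.remove[of _ ?e]) auto
  moreover have "of_rat (fst (es ! ?e)) = (of_int p / of_int q :: real)"
    using quotient_of_div[OF pq] by (simp add: of_rat_divide)
  moreover have "q \<noteq> 0" using den_pos[of ?e] q by simp
  ultimately have "D * of_rat (fst (es ! ?e)) = of_int (p * (\<Prod>e\<in>{..<N * N} - {?e}. den e))"
    by (simp add: field_simps)
  then have "complex_of_real (D * of_rat (fst (es ! ?e))) = complex_of_int (p * (\<Prod>e\<in>{..<N * N} - {?e}. den e))"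
    by (simp only: of_real_of_int_eq)
  then show ?thesis unfolding A h_entry[OF ij] by simp
qed

private lemma eigen_env_mat:
  "eigen N (cmat (env_mat N (term_env es \<alpha>))) v (of_real D * e + 1) \<longleftrightarrow> eigen N h v e"
proof -
  have "apply_mat N (cmat (env_mat N (term_env es \<alpha>))) v x = of_real D * apply_mat N h v x + v x" if x: "x < N" for x
  proof -
    have "apply_mat N (cmat (env_mat N (term_env es \<alpha>))) v x =
        (\<Sum>y<N. of_real D * (h $$ (x, y) * v y) + (if y = x then v x else 0))"
      unfolding apply_mat_def using x
      by (intro sum.cong refl) (auto simp: index_map_mat carrier_matD[OF env_mat_carrier] env_mat_entry distrib_right)
    then show ?thesis using x by (simp add: sum.distrib apply_mat_def sum_distrib_left)
  qed
  then show ?thesis using D_pos unfolding eigen_def by (simp add: algebra_simps)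
qed

private lemma eigenvalue_env_mat:
  "eigenvalue (cmat (env_mat N (term_env es \<alpha>))) f \<longleftrightarrow> eigenvalue h ((f - 1) / of_real D)"
proof -
  have "f = of_real D * ((f - 1) / of_real D) + 1" using D_pos by simp
  then have "eigen N (cmat (env_mat N (term_env es \<alpha>))) v f \<longleftrightarrow> eigen N h v ((f - 1) / of_real D)" for v
    using eigen_env_mat by metis
  moreover have "cmat (env_mat N (term_env es \<alpha>)) \<in> carrier_mat N N" using env_mat_carrier by simp
  ultimately show ?thesis using eigenvalue_eigen local_matrix_carrier by metis
qed

private lemma symmetric_env_mat: "symmetric_int N (env_mat N (term_env es \<alpha>))"
  unfolding symmetric_int_def
proof (intro conjI allI impI env_mat_carrier)
  fix i j assume ij: "i < N" "j < N"
  have "h $$ (i, j) = h $$ (j, i)"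
    using hermitianD[OF valid_term_hermitian[OF T] ij] unfolding h_entry[OF ij] by simp
  then have "complex_of_int (env_mat N (term_env es \<alpha>) $$ (i, j)) = complex_of_int (env_mat N (term_env es \<alpha>) $$ (j, i))"
    unfolding env_mat_entry[OF ij] env_mat_entry[OF ij(2,1)] by simp
  then show "env_mat N (term_env es \<alpha>) $$ (i, j) = env_mat N (term_env es \<alpha>) $$ (j, i)" by simp
qed

private lemma min_eigen_env_mat:
  assumes "min_eigen N h m"
  shows "min_eigen N (cmat (env_mat N (term_env es \<alpha>))) (D * m + 1)"
  unfolding min_eigen_def eigenvalue_env_mat
proof (intro conjI allI impI)
  show "eigenvalue h ((complex_of_real (D * m + 1) - 1) / of_real D)"
    using assms D_pos by (simp add: min_eigen_def)
  fix f assume f: "eigenvalue h ((f - 1) / of_real D)"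
  then have "m \<le> Re ((f - 1) / of_real D)" using assms unfolding min_eigen_def by blast
  then show "D * m + 1 \<le> Re f" using D_pos unfolding Re_divide_of_real by (simp add: field_simps)
qed

text \<open>Together with the identity added in \<open>env_mat\<close>, this gives the least
  eigenvalue of at least 1 that the criterion presupposes.\<close>

private lemma min_eigen_nonneg:
  assumes "min_eigen N h m"
  shows "0 \<le> m"
proof -
  obtain v x where v: "eigen N h v (of_real m)" "x < N" "v x \<noteq> 0"
    using assms eigenvalue_eigen[OF local_matrix_carrier] unfolding min_eigen_def by blast
  have psd: "positive_semidefinite h" using T by (simp add: valid_term_def)
  have "0 \<le> (h *\<^sub>v vec N v) \<bullet>c vec N v"
    using psd carrier_matD[OF local_matrix_carrier[of d T]] unfolding positive_semidefinite_def by simp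
  also have "(h *\<^sub>v vec N v) \<bullet>c vec N v = inprod N (\<lambda>x. of_real m * v x) v"
  proof -
    have "(h *\<^sub>v vec N v) $ x = of_real m * v x" if "x < N" for x
      using mult_mat_vec_index[OF local_matrix_carrier _ that, of "vec N v"] v(1) that
      by (simp add: eigen_def apply_mat_def del: index_mult_mat_vec)
    then show ?thesis
      by (simp add: inprod_def scalar_prod_def lessThan_atLeast0 del: index_mult_mat_vec)
  qed
  also have "\<dots> = of_real (m * (\<Sum>x<N. (cmod (v x))\<^sup>2))"
    by (simp add: inprod_smult_left inprod_self)
  finally have "0 \<le> m * (\<Sum>x<N. (cmod (v x))\<^sup>2)" by (simp add: complex_nonneg_iff)
  moreover have "0 < (\<Sum>x<N. (cmod (v x))\<^sup>2)" by (rule inprod_self_pos) (use v in blast)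
  ultimately show ?thesis by (simp add: zero_le_mult_iff)
qed

text \<open>The tested number \<open>\<alpha>'\<close> is kept apart from the number \<alpha> in the
  environment, because completeness finds it only when the matrix is given.\<close>

lemma criterion_ground_at:
  assumes a: "a < N"
  shows "criterion N a (env_mat N (term_env es \<alpha>)) (int \<alpha>') \<Longrightarrow> ground_at d T a"
    and "ground_at d T a \<Longrightarrow> \<exists>\<alpha>' :: nat. criterion N a (env_mat N (term_env es \<alpha>)) (int \<alpha>') \<and>
      int \<alpha>' \<le> resolution N (env_mat N (term_env es \<alpha>)) * scale N (env_mat N (term_env es \<alpha>)) *
        entry_bound N (env_mat N (term_env es \<alpha>))"
proof -
  obtain m where m: "min_eigen N h m"
    using min_eigen_exists[OF valid_term_hermitian[OF T]] a by auto
  have ge: "1 \<le> D * m + 1" using min_eigen_nonneg[OF m] D_pos by simp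
  have eq: "complex_of_real (D * m + 1) = of_real D * of_real m + 1" by simp
  have ga: "ground_at d T a \<longleftrightarrow> (\<exists>v. eigen N h v (of_real m) \<and> v a \<noteq> 0)"
    unfolding ground_at_def using m min_eigen_unique by metis
  show "ground_at d T a" if "criterion N a (env_mat N (term_env es \<alpha>)) (int \<alpha>')"
    using criterion_sound[OF symmetric_env_mat a min_eigen_env_mat[OF m] ge that]
    unfolding ga eq eigen_env_mat .
  show "\<exists>\<alpha>' :: nat. criterion N a (env_mat N (term_env es \<alpha>)) (int \<alpha>') \<and>
      int \<alpha>' \<le> resolution N (env_mat N (term_env es \<alpha>)) * scale N (env_mat N (term_env es \<alpha>)) *
        entry_bound N (env_mat N (term_env es \<alpha>))" if g: "ground_at d T a"
  proof -
    obtain v where "eigen N h v (of_real m)" "v a \<noteq> 0" using g ga by blast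
    then show ?thesis
      using criterion_complete[OF symmetric_env_mat a min_eigen_env_mat[OF m] ge]
      unfolding eq eigen_env_mat by blast
  qed
qed

end

section \<open>Soundness of arbitrary certificates and construction of short ones\<close>

section \<open>Certificates\<close>

text \<open>The digit is written in unary, each unit being a marked bit 1, because the verifier
  turns it into control flow by popping. The leading bit announces a record.\<close>

definition cert_record :: "nat \<times> nat \<Rightarrow> bool list" where
  "cert_record r = True # enc_nat (fst r) @ concat (replicate (snd r) [True, True]) @ [False]"

lemma read_field_unary:
  "read_field (bit_symbols (concat (replicate c [True, True]) @ [False]) @ rest) = (replicate c 2, rest)"
proof (induction c)
  case 0
  show ?case by (cases rest) simp_all
qed simp

lemma length_enc_nat: "length (enc_nat n) = 2 * length (nat_field n) + 1"
proof (induction n rule: nat_field.induct)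
  case (1 n)
  show ?case
  proof (cases "n = 0")
    case True
    then show ?thesis by (simp add: enc_nat.simps[of 0] nat_field.simps[of 0])
  next
    case False
    then show ?thesis using 1 by (simp add: enc_nat.simps[of n] nat_field.simps[of n])
  qed
qed

lemma length_nat_field_le: "n < 2 ^ l \<Longrightarrow> length (nat_field n) \<le> l"
proof (induction n arbitrary: l rule: nat_field.induct)
  case (1 n)
  show ?case
  proof (cases "n = 0")
    case False
    with 1(2) obtain l' where l: "l = Suc l'" by (cases l) auto
    have "n div 2 < 2 ^ l'" using 1(2) by (simp add: l less_mult_imp_div_less mult.commute)
    then show ?thesis using 1(1)[OF False] False by (simp add: nat_field.simps[of n] l)
  qed (simp add: nat_field.simps)
qed

lemma num_less: "num xs < 2 ^ length xs"
proof (induction xs)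
  case (Cons s xs)
  then show ?case using bit_value_le[of s] by simp
qed simp

lemma length_cert_record: "length (cert_record r) = length (enc_nat (fst r)) + 2 * snd r + 2"
proof -
  have "length (concat (replicate c [True, True])) = 2 * c" for c by (induction c) simp_all
  then show ?thesis by (simp add: cert_record_def)
qed

lemma read_cert_record:
  "read_field (tl (bit_symbols (cert_record r) @ rest)) =
     (nat_field (fst r), bit_symbols (concat (replicate (snd r) [True, True]) @ [False]) @ rest)"
  unfolding cert_record_def by (simp add: read_field_enc_nat)

lemma next_cert_record: "next_record (bit_symbols (cert_record r) @ rest) = rest"
  unfolding next_record_def read_cert_record snd_conv read_field_unary ..

lemma cert_number_record: "cert_number (bit_symbols (cert_record r) @ rest) = fst r"
  unfolding cert_number_def read_cert_record by (simp add: num_nat_field)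

abbreviation certificate :: "(nat \<times> nat) list \<Rightarrow> bool list" where
  "certificate rs \<equiv> concat (map cert_record rs)"

lemma next_certificate:
  "i \<le> length rs \<Longrightarrow> (next_record ^^ i) (bit_symbols (certificate rs)) = bit_symbols (certificate (drop i rs))"
proof (induction i)
  case (Suc i)
  then have "drop i rs = rs ! i # drop (Suc i) rs" by (simp add: Cons_nth_drop_Suc)
  then show ?case using Suc by (simp add: next_cert_record)
qed simp

lemma cert_number_certificate:
  assumes "i < length rs"
  shows "cert_number ((next_record ^^ i) (bit_symbols (certificate rs))) = fst (rs ! i)"
proof -
  have "drop i rs = rs ! i # drop (Suc i) rs" using assms by (simp add: Cons_nth_drop_Suc)
  then show ?thesis using next_certificate[of i rs] assms by (simp add: cert_number_record)
qed

lemma lookup_step_record: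
  "lookup_step (nat_field j) (bit_symbols (cert_record r) @ rest, v) =
     (rest, if fst r = j then replicate (snd r) 2 else v)"
proof -
  have "top_of (bit_symbols (cert_record r) @ rest) = 2" by (simp add: cert_record_def)
  then show ?thesis
    unfolding lookup_step_def Let_def fst_conv read_cert_record snd_conv read_field_unary
    by (simp add: nat_field_inject)
qed

abbreviation assign :: "nat \<Rightarrow> nat \<times> nat \<Rightarrow> nat list \<Rightarrow> nat list" where
  "assign j r v \<equiv> if fst r = j then replicate (snd r) 2 else v"

lemma lookup_certificate:
  assumes "length rs \<le> L"
  shows "(lookup_step (nat_field j) ^^ L) (bit_symbols (certificate rs), v) = ([], fold (assign j) rs v)"
  using assms
proof (induction rs arbitrary: L v)
  case Nil
  have "lookup_step (nat_field j) ([], v) = ([], v)" by (simp add: lookup_step_def)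
  then show ?case by (induction L) simp_all
next
  case (Cons r rs)
  then obtain L' where L: "L = Suc L'" "length rs \<le> L'" by (cases L) auto
  show ?case
    unfolding L(1) funpow_Suc_right o_def using Cons.IH[OF L(2)] by (simp add: lookup_step_record)
qed

lemma fold_assign: "fold (assign j) (map (\<lambda>i. (i, g i)) ns) v = (if j \<in> set ns then replicate (g j) 2 else v)"
  by (induction ns arbitrary: v) auto

text \<open>The name of a record in \<open>ps\<close> is a number for a term and may coincide with
  the name of a qudit. As the last match wins, the digits listed after \<open>ps\<close>
  decide.\<close>

lemma cert_digit_certificate:
  assumes "length ps + length ns \<le> L" "j \<in> set ns" "g j < d"
  shows "cert_digit d L (bit_symbols (certificate (ps @ map (\<lambda>i. (i, g i)) ns))) j = g j"
  unfolding cert_digit_def lookup_list_def using assms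
  by (subst lookup_certificate) (simp_all add: fold_assign)

lemma length_le_enc_list: "length xs \<le> length (enc_list f xs)"
  by (induction xs) (simp_all add: enc_list_def)

lemma length_element_le: "x \<in> set xs \<Longrightarrow> length (f x) \<le> length (enc_list f xs)"
  by (induction xs) (auto simp: enc_list_def)

lemma length_concat_le:
  "(\<And>x. x \<in> set xs \<Longrightarrow> length (g x) \<le> length (f x)) \<Longrightarrow> length (concat (map g xs)) \<le> length (enc_list f xs)"
proof (induction xs)
  case (Cons x xs)
  then have "length (g x) \<le> length (f x)" "length (concat (map g xs)) \<le> length (enc_list f xs)" by simp_all
  then show ?case by (simp add: enc_list_def)
qed (simp add: enc_list_def)

lemma length_concat_bound:
  "(\<And>x. x \<in> set xs \<Longrightarrow> length (f x) \<le> c) \<Longrightarrow> length (concat (map f xs)) \<le> length xs * c"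
  by (induction xs) (simp_all add: add_mono)

lemma length_entry_var:
  assumes "j < 3 * length es"
  shows "length (entry_var es j) \<le> length (enc_list enc_entry es)"
proof -
  let ?z = "es ! (j div 3)"
  have "?z \<in> set es" using assms by (intro nth_mem) auto
  then have "length (enc_entry ?z) \<le> length (enc_list enc_entry es)" by (rule length_element_le)
  moreover have "length (entry_var es j) \<le> length (enc_entry ?z)"
  proof -
    obtain p q where pq: "quotient_of (fst ?z) = (p, q)" by fastforce
    have "length (nat_field (nat p)) \<le> length (nat_field (nat \<bar>p\<bar>))"
      "length (nat_field (nat (- p))) \<le> length (nat_field (nat \<bar>p\<bar>))"
      by (cases "0 \<le> p"; simp)+
    then show ?thesis
      by (auto simp: entry_var_def entry_fields_def pq enc_entry_def enc_rat_def length_enc_nat)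
  qed
  ultimately show ?thesis by simp
qed

section \<open>The formulas of the verifier\<close>

text \<open>A choice is enough: the program is fixed together with \<open>d\<close> and
  \<open>k\<close>, so the formula only has to exist.\<close>

definition criterion_formula :: "nat \<Rightarrow> nat list \<Rightarrow> form" where
  "criterion_formula d ds = (SOME p. form_vars p \<le> Suc (3 * num_entries d ds) \<and>
     (\<forall>\<rho>. eval_form \<rho> p \<longleftrightarrow> criterion (d ^ length ds) (from_digits d (length ds) ((!) ds))
        (env_mat (d ^ length ds) \<rho>) (int (\<rho> (3 * num_entries d ds)))))"

lemma criterion_formula:
  "form_vars (criterion_formula d ds) \<le> Suc (3 * num_entries d ds)"
  "eval_form \<rho> (criterion_formula d ds) \<longleftrightarrow> criterion (d ^ length ds) (from_digits d (length ds) ((!) ds))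
     (env_mat (d ^ length ds) \<rho>) (int (\<rho> (3 * num_entries d ds)))"
  using someI_ex[OF criterion_form[of "d ^ length ds" "from_digits d (length ds) ((!) ds)"]]
  unfolding criterion_formula_def num_entries_def by blast+

definition certificate_expr :: "nat \<Rightarrow> expr" where
  "certificate_expr N = (SOME e. expr_vars e \<le> 3 * (N * N) \<and>
     (\<forall>\<rho>. resolution N (env_mat N \<rho>) * scale N (env_mat N \<rho>) *
        entry_bound N (env_mat N \<rho>) \<le> int (eval_expr \<rho> e)))"

lemma certificate_expr:
  "expr_vars (certificate_expr N) \<le> 3 * (N * N)"
  "resolution N (env_mat N \<rho>) * scale N (env_mat N \<rho>) * entry_bound N (env_mat N \<rho>)
     \<le> int (eval_expr \<rho> (certificate_expr N))"
  using someI_ex[OF certificate_bound[of N]] unfolding certificate_expr_def by blast+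

lemma term_check_criterion:
  assumes T: "valid_term d k n T"
    and x: "\<forall>j \<in> set (acts_on T). cert_digit d L zs j = digit d x j"
  shows "term_check d L (criterion_formula d) zs T vs \<longleftrightarrow>
    criterion (local_dim d T) (restrict_index d (acts_on T) x)
      (env_mat (local_dim d T) (term_env (entries T) (cert_number vs))) (int (cert_number vs))"
proof -
  let ?ds = "map (cert_digit d L zs) (acts_on T)"
  have N: "num_entries d ?ds = length (entries T)"
    using T by (simp add: valid_term_def num_entries_def local_dim_def)
  have "from_digits d (length ?ds) ((!) ?ds) = restrict_index d (acts_on T) x"
    unfolding restrict_index_from_digits length_map by (rule from_digits_cong) (simp add: x)
  moreover have "term_env (entries T) (cert_number vs) (3 * num_entries d ?ds) = cert_number vs"
    unfolding N by (simp add: term_env_def)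
  ultimately show ?thesis
    unfolding term_check_def criterion_formula(2) by (simp add: local_dim_def)
qed

context
  fixes d k :: nat and b :: "nat poly" and H :: hamiltonian
  assumes d: "1 \<le> d" and H: "local_hamiltonian d k b H" "commuting d H" "stoquastic d H"
begin

private abbreviation "n \<equiv> num_qudits H"
private abbreviation "Ts \<equiv> local_terms H"
private abbreviation "enc_length \<equiv> length (enc_hamiltonian H)"

private lemma valid: "T \<in> set Ts \<Longrightarrow> valid_term d k n T"
  using H(1) by (simp add: local_hamiltonian_def)

private lemma stoq: "T \<in> set Ts \<Longrightarrow> stoquastic_mat (local_matrix d T)"
  using H(3) by (simp add: stoquastic_def)

private lemma digit_less': "digit d x j < d"
  using d by (simp add: digit_def)

private lemma restrict_less: "restrict_index d (acts_on T) x < local_dim d T"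
  unfolding restrict_index_from_digits local_dim_def by (rule from_digits_less) (rule digit_less')

private lemmas ff_iff = frustration_free_iff[OF d valid H(2,3)]

lemma verifier_sound:
  assumes "terms_check d L (criterion_formula d) zs Ts zs"
  shows "frustration_free d H"
proof -
  \<comment> \<open>The digit found depends on the qudit alone, so all terms are checked against
    restrictions of one global string, also where they overlap.\<close>
  define x where "x = from_digits d n (cert_digit d L zs)"
  have lt: "cert_digit d L zs j < d" for j using d by (simp add: cert_digit_def)
  then have x: "x < d ^ n" unfolding x_def by (rule from_digits_less)
  have "ground_at d T (restrict_index d (acts_on T) x)" if T: "T \<in> set Ts" for T
  proof -
    have "\<forall>j \<in> set (acts_on T). cert_digit d L zs j = digit d x j"
      unfolding x_def using valid[OF T] lt by (intro ballI digit_from_digits[symmetric]) (auto simp: valid_term_def)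
    note check = term_check_criterion[OF valid[OF T] this]
    obtain i where i: "i < length Ts" "Ts ! i = T" using T by (auto simp: in_set_conv_nth)
    have "term_check d L (criterion_formula d) zs T ((next_record ^^ i) zs)"
      using assms i unfolding terms_check_iff by blast
    then show ?thesis
      unfolding check by (rule criterion_ground_at(1)[OF d valid[OF T] stoq[OF T] restrict_less])
  qed
  then show ?thesis using x ff_iff by blast
qed

private lemma enc_term_le: "T \<in> set Ts \<Longrightarrow> length (enc_term T) \<le> enc_length"
  using length_element_le[of T Ts enc_term] by (simp add: enc_hamiltonian_def)

private lemma enc_length_pos: "1 \<le> enc_length"
  by (simp add: enc_hamiltonian_def length_enc_nat)

private lemma certificate_number:
  assumes T: "T \<in> set Ts" and g: "ground_at d T (restrict_index d (acts_on T) x)"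
  obtains \<alpha> where "criterion (local_dim d T) (restrict_index d (acts_on T) x)
      (env_mat (local_dim d T) (term_env (entries T) \<alpha>)) (int \<alpha>)"
    and "length (nat_field \<alpha>) \<le> (\<Sum>t\<le>k. expr_size (certificate_expr (d ^ t))) * enc_length"
proof -
  let ?N = "local_dim d T" and ?es = "entries T"
  let ?e = "certificate_expr ?N"
  have es: "length ?es = ?N * ?N" and k: "length (acts_on T) \<le> k"
    using valid[OF T] by (simp_all add: valid_term_def)
  have vars: "j < 3 * length ?es" if "j < expr_vars ?e" for j
    using that certificate_expr(1)[of ?N] es by simp
  \<comment> \<open>The matrix reads only the variables of the entries, so the certified number can
    be put into the environment after it has been chosen for that matrix.\<close>
  have env: "env_mat ?N (term_env ?es \<alpha>) = env_mat ?N (term_env ?es 0)" for \<alpha>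
  proof -
    have eq: "term_env ?es \<alpha> (3 * e + c) = term_env ?es 0 (3 * e + c)" if "e < ?N * ?N" "c < 3" for e c
      using that by (simp add: term_env_def es)
    show ?thesis
      unfolding env_mat_def
    proof (rule cong_mat[OF refl refl])
      fix i j assume ij: "i < ?N" "j < ?N"
      let ?i = "i * ?N + j"
      have i: "?i < ?N * ?N" by (rule index_pair_less[OF ij])
      have "term_env ?es \<alpha> (3 * ?i) = term_env ?es 0 (3 * ?i)"
        "term_env ?es \<alpha> (3 * ?i + 1) = term_env ?es 0 (3 * ?i + 1)"
        using eq[OF i, of 0] eq[OF i, of 1] by simp_all
      moreover have "(\<Prod>e\<in>{..<?N * ?N} - {?i}. int (term_env ?es \<alpha> (3 * e + 2))) =
          (\<Prod>e\<in>{..<?N * ?N} - {?i}. int (term_env ?es 0 (3 * e + 2)))"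
        by (intro prod.cong refl arg_cong[where f = int] eq) auto
      ultimately show "(case (i, j) of (i, j) \<Rightarrow>
          (int (term_env ?es \<alpha> (3 * (i * ?N + j))) - int (term_env ?es \<alpha> (3 * (i * ?N + j) + 1))) *
          (\<Prod>e\<in>{..<?N * ?N} - {i * ?N + j}. int (term_env ?es \<alpha> (3 * e + 2))) + (if i = j then 1 else 0)) =
        (case (i, j) of (i, j) \<Rightarrow>
          (int (term_env ?es 0 (3 * (i * ?N + j))) - int (term_env ?es 0 (3 * (i * ?N + j) + 1))) *
          (\<Prod>e\<in>{..<?N * ?N} - {i * ?N + j}. int (term_env ?es 0 (3 * e + 2))) + (if i = j then 1 else 0))"
        by (simp only: prod.case)
    qed
  qed
  obtain \<alpha> where c: "criterion ?N (restrict_index d (acts_on T) x)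
      (env_mat ?N (term_env ?es 0)) (int \<alpha>)"
    and le: "int \<alpha> \<le> resolution ?N (env_mat ?N (term_env ?es 0)) * scale ?N (env_mat ?N (term_env ?es 0)) *
        entry_bound ?N (env_mat ?N (term_env ?es 0))"
    using criterion_ground_at(2)[OF d valid[OF T] stoq[OF T] restrict_less g] by blast
  have "int \<alpha> \<le> int (eval_expr (term_env ?es 0) ?e)"
    using le certificate_expr(2) by (rule order_trans)
  also have "eval_expr (term_env ?es 0) ?e = num (expr_list (entry_var ?es) ?e)"
    unfolding num_expr_list by (rule eval_expr_cong) (simp add: term_env_def vars)
  finally have "\<alpha> < 2 ^ length (expr_list (entry_var ?es) ?e)"
    using num_less[of "expr_list (entry_var ?es) ?e"] by simp
  then have "length (nat_field \<alpha>) \<le> length (expr_list (entry_var ?es) ?e)" by (rule length_nat_field_le)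
  also have "\<dots> \<le> expr_size ?e * enc_length"
  proof (rule length_expr_list[OF enc_length_pos])
    fix j assume "j < expr_vars ?e"
    then have "length (entry_var ?es j) \<le> length (enc_list enc_entry ?es)" by (intro length_entry_var vars)
    also have "\<dots> \<le> length (enc_term T)" by (simp add: enc_term_def)
    finally show "length (entry_var ?es j) \<le> enc_length" using enc_term_le[OF T] by simp
  qed
  \<comment> \<open>The sum over all \<open>t \<le> k\<close> stands in for a maximum and makes the
    bound independent of the term.\<close>
  also have "\<dots> \<le> (\<Sum>t\<le>k. expr_size (certificate_expr (d ^ t))) * enc_length"
    unfolding local_dim_def using k by (intro mult_le_mono1 member_le_sum) auto
  finally have len: "length (nat_field \<alpha>) \<le> (\<Sum>t\<le>k. expr_size (certificate_expr (d ^ t))) * enc_length" .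
  show thesis by (rule that[OF _ len]) (use c in \<open>simp only: env[of \<alpha>]\<close>)
qed

text \<open>All sufficiently large loop lengths are covered because \<open>L\<close> is the length
  of the whole input, of which the certificate is a part.\<close>

lemma verifier_complete:
  assumes "frustration_free d H"
  shows "\<exists>y. length y \<le> poly [:0, 2 * d + 5, 2 * (\<Sum>t\<le>k. expr_size (certificate_expr (d ^ t))) + 1:] enc_length \<and>
    (\<forall>L \<ge> length y. terms_check d L (criterion_formula d) (bit_symbols y) Ts (bit_symbols y))"
proof -
  let ?s = "\<Sum>t\<le>k. expr_size (certificate_expr (d ^ t))"
  obtain x where x: "\<And>T. T \<in> set Ts \<Longrightarrow> ground_at d T (restrict_index d (acts_on T) x)"
    using assms ff_iff by blast
  have "\<exists>\<alpha>. criterion (local_dim d T) (restrict_index d (acts_on T) x)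
      (env_mat (local_dim d T) (term_env (entries T) \<alpha>)) (int \<alpha>) \<and>
      length (nat_field \<alpha>) \<le> ?s * enc_length" if "T \<in> set Ts" for T
    using certificate_number[OF that x[OF that]] by blast
  then obtain \<alpha> where \<alpha>: "\<And>T. T \<in> set Ts \<Longrightarrow> criterion (local_dim d T) (restrict_index d (acts_on T) x)
      (env_mat (local_dim d T) (term_env (entries T) (\<alpha> T))) (int (\<alpha> T))"
    "\<And>T. T \<in> set Ts \<Longrightarrow> length (nat_field (\<alpha> T)) \<le> ?s * enc_length"
    by metis
  define ps where "ps = map (\<lambda>T. (\<alpha> T, 0 :: nat)) Ts"
  \<comment> \<open>Digits are listed only for the qudits on which some term acts. The number of
    qudits is given in binary, so a list of all digits could be exponentially long.\<close>
  define ns where "ns = concat (map acts_on Ts)"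
  define rs where "rs = ps @ map (\<lambda>j. (j, digit d x j)) ns"
  have len_ns: "length ns \<le> enc_length"
  proof -
    have "length (acts_on T) \<le> length (enc_term T)" for T
      using length_le_enc_list[of "acts_on T" enc_nat] by (simp add: enc_term_def)
    then have "length ns \<le> length (enc_list enc_term Ts)" unfolding ns_def by (intro length_concat_le)
    then show ?thesis by (simp add: enc_hamiltonian_def)
  qed
  have len_ps: "length ps \<le> enc_length"
    using length_le_enc_list[of Ts enc_term] by (simp add: ps_def enc_hamiltonian_def)
  have "length (certificate ps) \<le> length ps * (2 * ?s * enc_length + 3)"
    using \<alpha>(2) by (intro length_concat_bound) (auto simp: ps_def length_cert_record length_enc_nat)
  also have "\<dots> \<le> enc_length * (2 * ?s * enc_length + 3)" using len_ps by (rule mult_le_mono1)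
  finally have 1: "length (certificate ps) \<le> enc_length * (2 * ?s * enc_length + 3)" .
  have rec: "length (cert_record (j, digit d x j)) \<le> enc_length + 2 * d + 2" if j: "j \<in> set ns" for j
  proof -
    obtain T where T: "T \<in> set Ts" "j \<in> set (acts_on T)" using j by (auto simp: ns_def)
    have "length (enc_nat j) \<le> length (enc_term T)"
      using length_element_le[OF T(2), of enc_nat] by (simp add: enc_term_def)
    then show ?thesis using enc_term_le[OF T(1)] digit_less'[of x j] by (simp add: length_cert_record)
  qed
  have "length (certificate (map (\<lambda>j. (j, digit d x j)) ns)) \<le> length ns * (enc_length + 2 * d + 2)"
    unfolding map_map o_def using rec by (rule length_concat_bound)
  also have "\<dots> \<le> enc_length * (enc_length + 2 * d + 2)" using len_ns by (rule mult_le_mono1)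
  finally have "length (certificate rs) \<le>
      enc_length * (2 * ?s * enc_length + 3) + enc_length * (enc_length + 2 * d + 2)"
    using 1 by (simp add: rs_def)
  also have "\<dots> = poly [:0, 2 * d + 5, 2 * ?s + 1:] enc_length" by (simp add: algebra_simps)
  finally have size: "length (certificate rs) \<le> poly [:0, 2 * d + 5, 2 * ?s + 1:] enc_length" .
  have "length rs \<le> length (certificate rs)"
    by (induction rs) (simp_all add: length_cert_record)
  then have "terms_check d L (criterion_formula d) (bit_symbols (certificate rs)) Ts (bit_symbols (certificate rs))"
    if L: "length (certificate rs) \<le> L" for L
    unfolding terms_check_iff
  proof (intro allI impI)
    fix i assume i: "i < length Ts"
    then have T: "Ts ! i \<in> set Ts" by simp
    have "\<forall>j \<in> set (acts_on (Ts ! i)). cert_digit d L (bit_symbols (certificate rs)) j = digit d x j"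
      unfolding rs_def
    proof (intro ballI)
      fix j assume j: "j \<in> set (acts_on (Ts ! i))"
      show "cert_digit d L (bit_symbols (certificate (ps @ map (\<lambda>j. (j, digit d x j)) ns))) j = digit d x j"
      proof (rule cert_digit_certificate[where g = "digit d x"])
        show "digit d x j < d" by (rule digit_less')
        show "length ps + length ns \<le> L" using \<open>length rs \<le> length (certificate rs)\<close> L by (simp add: rs_def)
        show "j \<in> set ns" using j T by (auto simp: ns_def)
      qed
    qed
    note check = term_check_criterion[OF valid[OF T] this]
    have "cert_number ((next_record ^^ i) (bit_symbols (certificate rs))) = \<alpha> (Ts ! i)"
      using cert_number_certificate[of i rs] i by (simp add: rs_def ps_def nth_append)
    then show "term_check d L (criterion_formula d) (bit_symbols (certificate rs)) (Ts ! i)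
        ((next_record ^^ i) (bit_symbols (certificate rs)))"
      unfolding check using \<alpha>(1)[OF T] by simp
  qed
  then show ?thesis using size by blast
qed

end

theorem theorem1p4:
  fixes d k :: nat and b :: "nat poly"
  assumes "d \<ge> 1"
  shows "in_NP (commuting_stoquastic_frustration_free d k b)"
proof -
  let ?F = "{ds. set ds \<subseteq> {..<d} \<and> length ds \<le> k}"
  let ?\<phi> = "criterion_formula d"
  \<comment> \<open>There are finitely many digit lists of length at most \<open>k\<close>, so one
    constant covers the sizes of all formulas and fixes the number of copies of each loop.\<close>
  define f where "f = Suc (Max ((\<lambda>ds. form_size (?\<phi> ds)) ` ?F))"
  have formulas: "form_vars (?\<phi> ds) \<le> Suc (3 * num_entries d ds) \<and> form_size (?\<phi> ds) < f"
    if "length ds \<le> k" "set ds \<subseteq> {..<d}" for ds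
  proof -
    have "form_size (?\<phi> ds) \<le> Max ((\<lambda>ds. form_size (?\<phi> ds)) ` ?F)"
      using that by (intro Max_ge finite_imageI finite_lists_length_le) auto
    then show ?thesis by (intro conjI criterion_formula(1)) (simp only: f_def less_Suc_eq_le)
  qed
  have accept: "top_of (run (length (input_pair (enc_hamiltonian H) y)) (verifier d k f ?\<phi>)
        (input_store (input_pair (enc_hamiltonian H) y)) 0) = 2 \<longleftrightarrow>
      terms_check d (length (input_pair (enc_hamiltonian H) y)) ?\<phi> (bit_symbols y) (local_terms H) (bit_symbols y)"
    if "local_hamiltonian d k b H" for H y
    using that assms formulas
    by (intro run_verifier) (auto simp: local_hamiltonian_def valid_term_def num_entries_def local_dim_def)
  show ?thesis
  proof (rule in_NP_progI[OF wf_verifier])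
    fix w assume "w \<in> fst (commuting_stoquastic_frustration_free d k b)"
    then obtain H where w: "w = enc_hamiltonian H" and H: "local_hamiltonian d k b H" "commuting d H"
      "stoquastic d H" "frustration_free d H"
      by (auto simp: commuting_stoquastic_frustration_free_def)
    show "\<exists>y. length y \<le> poly [:0, 2 * d + 5, 2 * (\<Sum>t\<le>k. expr_size (certificate_expr (d ^ t))) + 1:] (length w) \<and>
        top_of (run (length (input_pair w y)) (verifier d k f ?\<phi>) (input_store (input_pair w y)) 0) = 2"
      using verifier_complete[OF assms H] unfolding w accept[OF H(1)] by (fastforce simp: input_pair_def)
  next
    fix w y assume "w \<in> snd (commuting_stoquastic_frustration_free d k b)"
    then obtain H where w: "w = enc_hamiltonian H" and H: "local_hamiltonian d k b H" "commuting d H"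
      "stoquastic d H" "\<not> frustration_free d H"
      by (auto simp: commuting_stoquastic_frustration_free_def)
    show "top_of (run (length (input_pair w y)) (verifier d k f ?\<phi>) (input_store (input_pair w y)) 0) \<noteq> 2"
      unfolding w accept[OF H(1)] using verifier_sound[OF assms H(1-3)] H(4) by blast
  qed
qed

end
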